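(* Let $p,q$ be nonnegative integers. The decomposition of $\mathbf V^{\otimes(p,q)}$ into indecomposable $\mathfrak{gl}_\infty$-modules is given by the isomorphism $$\mathbf V^{\otimes(p,q)}\;\cong\;\bigoplus_{|\lambda|=p}\ \bigoplus_{|\mu|=q}\big(\dim H_\lambda\,\dim H_\mu\big)\ \boldsymbol\Gamma_{\lambda;0}\otimes\boldsymbol\Gamma_{0;\mu},$$ i.e. there is such an isomorphism of $\mathfrak{gl}_\infty$-modules (the coefficients in parentheses being multiplicities), and each $\boldsymbol\Gamma_{\lambda;0}\otimes\boldsymbol\Gamma_{0;\mu}$ is an indecomposable $\mathfrak{gl}_\infty$-module.
   Context: $\Bbbk$ is a field of characteristic zero; everything is over $\Bbbk$. Let $\mathbf V,\mathbf V_*$ be countably infinite-dimensional vector spaces with a non-degenerate pairing $\langle\cdot,\cdot\rangle:\mathbf V\otimes\mathbf V_*\to\Bbbk$ (we also write $\langle u^*,v\rangle=\langle v,u^*\rangle$). $\mathfrak{gl}_\infty$ is the space $\mathbf V\otimes\mathbf V_*$ with Lie bracket $[u\otimes u^*,v\otimes v^*]=\langle u^*,v\rangle\,u\otimes v^*-\langle v^*,u\rangle\,v\otimes u^*$. It acts on $\mathbf V$ by $(u\otimes u^* )v=\langle u^*,v\rangle u$, on $\mathbf V_*$ by $(u\otimes u^* )v^*=-\langle v^*,u\rangle u^*$, and on $\mathbf V^{\otimes(p,q)}=\mathbf V^{\otimes p}\otimes\mathbf V_*^{\otimes q}$ by the Leibniz rule. A partition is a finite nonincreasing sequence of positive integers;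 $|\lambda|$ is the sum of its parts; $0$ is the empty partition. For $|\lambda|=d$, $c_\lambda\in\Bbbk[\mathfrak S_d]$ is the Young symmetrizer of the standard tableau of shape $\lambda$ (numbered consecutively along rows), $H_\lambda=\Bbbk[\mathfrak S_d]c_\lambda$ is the corresponding irreducible $\mathfrak S_d$-module, and $\mathbb S_\lambda V=\operatorname{im}(c_\lambda:V^{\otimes d}\to V^{\otimes d})$. The $\mathfrak{gl}_\infty$-modules appearing are $\boldsymbol\Gamma_{\lambda;0}=\mathbb S_\lambda\mathbf V$ and $\boldsymbol\Gamma_{0;\mu}=\mathbb S_\mu\mathbf V_*$. *)

theory Defs
  imports
    "HOL-Algebra.AbelCoset"
    "Jordan_Normal_Form.VS_Connect"
    "HOL-Combinatorics.Permutations"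
    "HOL-Library.Countable_Set"
begin

text \<open>
  Vector spaces over a type \<open>'k\<close> of class \<^class>\<open>field\<close> are \<open>module\<close> records \<open>M\<close> with
  \<open>vectorspace class_ring M\<close>; the fields \<open>mult\<close> and \<open>one\<close> of such a record are ignored,
  except in the group algebra.
\<close>

section \<open>Linear algebra\<close>

subsection \<open>Free vector spaces and quotients\<close>

definition single :: "'s \<Rightarrow> 's \<Rightarrow> 'k::field" where
  "single s = (\<lambda>t. if t = s then 1 else 0)"

definition free_space :: "'s set \<Rightarrow> ('k::field, 's \<Rightarrow> 'k) module" where
  "free_space S = \<lparr>
     carrier = {x. finite {s. x s \<noteq> 0} \<and> {s. x s \<noteq> 0} \<subseteq> S},
     mult = undefined, one = undefined,
     zero = (\<lambda>s. 0), add = (\<lambda>x y s. x s + y s),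
     smult = (\<lambda>c x s. c * x s) \<rparr>"

definition quot_space :: "('k, 'm, 'z) module_scheme \<Rightarrow> 'm set \<Rightarrow> ('k, 'm set) module" where
  "quot_space M N = \<lparr>
     carrier = a_rcosets\<^bsub>M\<^esub> N,
     mult = undefined, one = undefined,
     zero = N, add = (<+>\<^bsub>M\<^esub>),
     smult = (\<lambda>c X. \<Union>x\<in>X. N +>\<^bsub>M\<^esub> (c \<odot>\<^bsub>M\<^esub> x)) \<rparr>"

definition relspan :: "'s set \<Rightarrow> ('s \<Rightarrow> 'k::field) set \<Rightarrow> ('s \<Rightarrow> 'k) set" where
  "relspan S R = LinearCombinations.module.span class_ring (free_space S) R"

definition presented :: "'s set \<Rightarrow> ('s \<Rightarrow> 'k::field) set \<Rightarrow> ('k, ('s \<Rightarrow> 'k) set) module" where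
  "presented S R = quot_space (free_space S) (relspan S R)"

definition gen :: "'s set \<Rightarrow> ('s \<Rightarrow> 'k::field) set \<Rightarrow> 's \<Rightarrow> ('s \<Rightarrow> 'k) set" where
  "gen S R s = relspan S R +>\<^bsub>free_space S\<^esub> single s"

text \<open>
  \<open>lift N f\<close> is the linear map to \<open>N\<close> sending the class of each generator \<open>s\<close> to \<open>f s\<close>. It is
  meaningful when \<open>f\<close> respects the relations, so that all representatives of a class have the same
  value (see \<open>lift_gen\<close> and \<open>lift_hom\<close> below).
\<close>

definition lin_ext :: "('k::field, 'n, 'z) module_scheme \<Rightarrow> ('s \<Rightarrow> 'n) \<Rightarrow> ('s \<Rightarrow> 'k) \<Rightarrow> 'n" where
  "lin_ext N f x = (\<Oplus>\<^bsub>N\<^esub>s\<in>{s. x s \<noteq> 0}. x s \<odot>\<^bsub>N\<^esub> f s)"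

definition lift :: "('k::field, 'n, 'z) module_scheme \<Rightarrow> ('s \<Rightarrow> 'n) \<Rightarrow> ('s \<Rightarrow> 'k) set \<Rightarrow> 'n" where
  "lift N f X = the_elem (lin_ext N f ` X)"


subsection \<open>Tensor products and tensor powers\<close>

definition tensor_rels ::
  "('k::field, 'a, 'y) module_scheme \<Rightarrow> ('k, 'b, 'z) module_scheme \<Rightarrow> ('a \<times> 'b \<Rightarrow> 'k) set" where
  "tensor_rels A B =
     {(\<lambda>z. single (a \<oplus>\<^bsub>A\<^esub> a', b) z - single (a, b) z - single (a', b) z) | a a' b.
        a \<in> carrier A \<and> a' \<in> carrier A \<and> b \<in> carrier B} \<union>
     {(\<lambda>z. single (a, b \<oplus>\<^bsub>B\<^esub> b') z - single (a, b) z - single (a, b') z) | a b b'.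
        a \<in> carrier A \<and> b \<in> carrier B \<and> b' \<in> carrier B} \<union>
     {(\<lambda>z. single (c \<odot>\<^bsub>A\<^esub> a, b) z - c * single (a, b) z) | c a b.
        a \<in> carrier A \<and> b \<in> carrier B} \<union>
     {(\<lambda>z. single (a, c \<odot>\<^bsub>B\<^esub> b) z - c * single (a, b) z) | c a b.
        a \<in> carrier A \<and> b \<in> carrier B}"

definition tensor_prod ::
  "('k::field, 'a, 'y) module_scheme \<Rightarrow> ('k, 'b, 'z) module_scheme \<Rightarrow>
   ('k, ('a \<times> 'b \<Rightarrow> 'k) set) module" where
  "tensor_prod A B = presented (carrier A \<times> carrier B) (tensor_rels A B)"

definition tens ::
  "('k::field, 'a, 'y) module_scheme \<Rightarrow> ('k, 'b, 'z) module_scheme \<Rightarrow>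
   'a \<Rightarrow> 'b \<Rightarrow> ('a \<times> 'b \<Rightarrow> 'k) set" where
  "tens A B a b = gen (carrier A \<times> carrier B) (tensor_rels A B) (a, b)"

text \<open>The list \<open>[v\<^sub>0, \<dots>, v\<^sub>d\<^sub>-\<^sub>1]\<close> stands for the decomposable tensor
  \<open>v\<^sub>0 \<otimes> \<dots> \<otimes> v\<^sub>d\<^sub>-\<^sub>1\<close>; in particular the zeroth tensor power is the ground field.\<close>

definition tuples :: "nat \<Rightarrow> ('k, 'v, 'z) module_scheme \<Rightarrow> 'v list set" where
  "tuples d V = {vs. length vs = d \<and> set vs \<subseteq> carrier V}"

definition tpow_rels :: "nat \<Rightarrow> ('k::field, 'v, 'z) module_scheme \<Rightarrow> ('v list \<Rightarrow> 'k) set" where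
  "tpow_rels d V =
     {(\<lambda>z. single (vs[i := x \<oplus>\<^bsub>V\<^esub> y]) z - single (vs[i := x]) z - single (vs[i := y]) z) | vs i x y.
        vs \<in> tuples d V \<and> i < d \<and> x \<in> carrier V \<and> y \<in> carrier V} \<union>
     {(\<lambda>z. single (vs[i := c \<odot>\<^bsub>V\<^esub> x]) z - c * single (vs[i := x]) z) | c vs i x.
        vs \<in> tuples d V \<and> i < d \<and> x \<in> carrier V}"

definition tensor_pow ::
  "nat \<Rightarrow> ('k::field, 'v, 'z) module_scheme \<Rightarrow> ('k, ('v list \<Rightarrow> 'k) set) module" where
  "tensor_pow d V = presented (tuples d V) (tpow_rels d V)"

definition tpure ::
  "nat \<Rightarrow> ('k::field, 'v, 'z) module_scheme \<Rightarrow> 'v list \<Rightarrow> ('v list \<Rightarrow> 'k) set" where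
  "tpure d V vs = gen (tuples d V) (tpow_rels d V) vs"


subsection \<open>Pairings\<close>

definition countably_infinite_dim :: "('k::field, 'v, 'z) module_scheme \<Rightarrow> bool" where
  "countably_infinite_dim V \<longleftrightarrow>
     vectorspace class_ring V \<and>
     (\<exists>B. vectorspace.basis class_ring V B \<and> countable B \<and> infinite B)"

definition nondegenerate_pairing ::
  "('k::field, 'v, 'y) module_scheme \<Rightarrow> ('k, 'w, 'z) module_scheme \<Rightarrow> ('v \<Rightarrow> 'w \<Rightarrow> 'k) \<Rightarrow> bool" where
  "nondegenerate_pairing V W pair \<longleftrightarrow>
     (\<forall>v\<in>carrier V. \<forall>v'\<in>carrier V. \<forall>w\<in>carrier W. pair (v \<oplus>\<^bsub>V\<^esub> v') w = pair v w + pair v' w) \<and>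
     (\<forall>v\<in>carrier V. \<forall>w\<in>carrier W. \<forall>w'\<in>carrier W. pair v (w \<oplus>\<^bsub>W\<^esub> w') = pair v w + pair v w') \<and>
     (\<forall>c. \<forall>v\<in>carrier V. \<forall>w\<in>carrier W. pair (c \<odot>\<^bsub>V\<^esub> v) w = c * pair v w) \<and>
     (\<forall>c. \<forall>v\<in>carrier V. \<forall>w\<in>carrier W. pair v (c \<odot>\<^bsub>W\<^esub> w) = c * pair v w) \<and>
     (\<forall>v\<in>carrier V. (\<forall>w\<in>carrier W. pair v w = 0) \<longrightarrow> v = \<zero>\<^bsub>V\<^esub>) \<and>
     (\<forall>w\<in>carrier W. (\<forall>v\<in>carrier V. pair v w = 0) \<longrightarrow> w = \<zero>\<^bsub>W\<^esub>)"


section \<open>Lie algebras and their modules\<close>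

record ('k, 'g) lie_alg = "('k, 'g) module" +
  bracket :: "'g \<Rightarrow> 'g \<Rightarrow> 'g"

record ('k, 'm, 'g) lie_mod = "('k, 'm) module" +
  act :: "'g \<Rightarrow> 'm \<Rightarrow> 'm"

locale lie_algebra =
  L: vectorspace "class_ring :: 'k::field ring" L for L :: "('k::field, 'g, 'z) lie_alg_scheme" +
  assumes bracket_closed:
      "\<lbrakk>x \<in> carrier L; y \<in> carrier L\<rbrakk> \<Longrightarrow> bracket L x y \<in> carrier L"
    and bracket_add_left:
      "\<lbrakk>x \<in> carrier L; x' \<in> carrier L; y \<in> carrier L\<rbrakk> \<Longrightarrow>
         bracket L (x \<oplus>\<^bsub>L\<^esub> x') y = bracket L x y \<oplus>\<^bsub>L\<^esub> bracket L x' y"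
    and bracket_add_right:
      "\<lbrakk>x \<in> carrier L; y \<in> carrier L; y' \<in> carrier L\<rbrakk> \<Longrightarrow>
         bracket L x (y \<oplus>\<^bsub>L\<^esub> y') = bracket L x y \<oplus>\<^bsub>L\<^esub> bracket L x y'"
    and bracket_smult_left:
      "\<lbrakk>x \<in> carrier L; y \<in> carrier L\<rbrakk> \<Longrightarrow> bracket L (c \<odot>\<^bsub>L\<^esub> x) y = c \<odot>\<^bsub>L\<^esub> bracket L x y"
    and bracket_smult_right:
      "\<lbrakk>x \<in> carrier L; y \<in> carrier L\<rbrakk> \<Longrightarrow> bracket L x (c \<odot>\<^bsub>L\<^esub> y) = c \<odot>\<^bsub>L\<^esub> bracket L x y"
    and bracket_self:
      "x \<in> carrier L \<Longrightarrow> bracket L x x = \<zero>\<^bsub>L\<^esub>"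
    and jacobi:
      "\<lbrakk>x \<in> carrier L; y \<in> carrier L; z \<in> carrier L\<rbrakk> \<Longrightarrow>
         bracket L x (bracket L y z) \<oplus>\<^bsub>L\<^esub> bracket L y (bracket L z x)
           \<oplus>\<^bsub>L\<^esub> bracket L z (bracket L x y) = \<zero>\<^bsub>L\<^esub>"

locale lie_module =
  L: lie_algebra L + M: vectorspace "class_ring :: 'k::field ring" M
  for L :: "('k::field, 'g, 'y) lie_alg_scheme" and M :: "('k::field, 'm, 'g, 'z) lie_mod_scheme" +
  assumes act_closed:
      "\<lbrakk>x \<in> carrier L; m \<in> carrier M\<rbrakk> \<Longrightarrow> act M x m \<in> carrier M"
    and act_add_left:
      "\<lbrakk>x \<in> carrier L; x' \<in> carrier L; m \<in> carrier M\<rbrakk> \<Longrightarrow>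
         act M (x \<oplus>\<^bsub>L\<^esub> x') m = act M x m \<oplus>\<^bsub>M\<^esub> act M x' m"
    and act_add_right:
      "\<lbrakk>x \<in> carrier L; m \<in> carrier M; m' \<in> carrier M\<rbrakk> \<Longrightarrow>
         act M x (m \<oplus>\<^bsub>M\<^esub> m') = act M x m \<oplus>\<^bsub>M\<^esub> act M x m'"
    and act_smult_left:
      "\<lbrakk>x \<in> carrier L; m \<in> carrier M\<rbrakk> \<Longrightarrow> act M (c \<odot>\<^bsub>L\<^esub> x) m = c \<odot>\<^bsub>M\<^esub> act M x m"
    and act_smult_right:
      "\<lbrakk>x \<in> carrier L; m \<in> carrier M\<rbrakk> \<Longrightarrow> act M x (c \<odot>\<^bsub>M\<^esub> m) = c \<odot>\<^bsub>M\<^esub> act M x m"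
    and act_bracket:
      "\<lbrakk>x \<in> carrier L; y \<in> carrier L; m \<in> carrier M\<rbrakk> \<Longrightarrow>
         act M (bracket L x y) m = act M x (act M y m) \<ominus>\<^bsub>M\<^esub> act M y (act M x m)"

definition lie_isomorphic ::
  "('k::field, 'g, 'x) lie_alg_scheme \<Rightarrow> ('k, 'm, 'g, 'y) lie_mod_scheme \<Rightarrow>
   ('k, 'n, 'g, 'z) lie_mod_scheme \<Rightarrow> bool" where
  "lie_isomorphic L M N \<longleftrightarrow>
     lie_module L M \<and> lie_module L N \<and>
     (\<exists>f \<in> LinearCombinations.module_hom class_ring M N.
        bij_betw f (carrier M) (carrier N) \<and>
        (\<forall>x\<in>carrier L. \<forall>m\<in>carrier M. f (act M x m) = act N x (f m)))"

definition lie_submodule ::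
  "('k::field, 'g, 'y) lie_alg_scheme \<Rightarrow> 'm set \<Rightarrow> ('k, 'm, 'g, 'z) lie_mod_scheme \<Rightarrow> bool" where
  "lie_submodule L N M \<longleftrightarrow>
     VectorSpace.subspace class_ring N M \<and> (\<forall>x\<in>carrier L. \<forall>n\<in>N. act M x n \<in> N)"

definition indecomposable ::
  "('k::field, 'g, 'y) lie_alg_scheme \<Rightarrow> ('k, 'm, 'g, 'z) lie_mod_scheme \<Rightarrow> bool" where
  "indecomposable L M \<longleftrightarrow>
     lie_module L M \<and> carrier M \<noteq> {\<zero>\<^bsub>M\<^esub>} \<and>
     (\<forall>A B. lie_submodule L A M \<longrightarrow> lie_submodule L B M \<longrightarrow>
        A \<inter> B = {\<zero>\<^bsub>M\<^esub>} \<longrightarrow> A <+>\<^bsub>M\<^esub> B = carrier M \<longrightarrow>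
        A = {\<zero>\<^bsub>M\<^esub>} \<or> B = {\<zero>\<^bsub>M\<^esub>})"

definition with_act :: "('k, 'm) module \<Rightarrow> ('g \<Rightarrow> 'm \<Rightarrow> 'm) \<Rightarrow> ('k, 'm, 'g) lie_mod" where
  "with_act M a = module.extend M (lie_mod.fields a)"

definition lie_direct_sum ::
  "'i set \<Rightarrow> ('i \<Rightarrow> ('k::field, 'm, 'g, 'z) lie_mod_scheme) \<Rightarrow> ('k, 'i \<Rightarrow> 'm, 'g) lie_mod" where
  "lie_direct_sum I M = \<lparr>
     carrier = {f \<in> (\<Pi>\<^sub>E i\<in>I. carrier (M i)). finite {i\<in>I. f i \<noteq> \<zero>\<^bsub>M i\<^esub>}},
     mult = undefined, one = undefined,
     zero = (\<lambda>i\<in>I. \<zero>\<^bsub>M i\<^esub>), add = (\<lambda>f g. \<lambda>i\<in>I. f i \<oplus>\<^bsub>M i\<^esub> g i),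
     smult = (\<lambda>c f. \<lambda>i\<in>I. c \<odot>\<^bsub>M i\<^esub> f i),
     act = (\<lambda>x f. \<lambda>i\<in>I. act (M i) x (f i)) \<rparr>"

definition lie_tensor ::
  "('k::field, 'm, 'g, 'y) lie_mod_scheme \<Rightarrow> ('k, 'n, 'g, 'z) lie_mod_scheme \<Rightarrow>
   ('k, ('m \<times> 'n \<Rightarrow> 'k) set, 'g) lie_mod" where
  "lie_tensor M N = with_act (tensor_prod M N)
     (\<lambda>x. lift (tensor_prod M N)
        (\<lambda>(m, n). tens M N (act M x m) n \<oplus>\<^bsub>tensor_prod M N\<^esub> tens M N m (act N x n)))"

definition lie_pow ::
  "nat \<Rightarrow> ('k::field, 'm, 'g, 'z) lie_mod_scheme \<Rightarrow> ('k, ('m list \<Rightarrow> 'k) set, 'g) lie_mod" where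
  "lie_pow d M = with_act (tensor_pow d M)
     (\<lambda>x. lift (tensor_pow d M)
        (\<lambda>ms. \<Oplus>\<^bsub>tensor_pow d M\<^esub>i\<in>{..<d}. tpure d M (ms[i := act M x (ms ! i)])))"


section \<open>The Lie algebra \<open>gl\<^sub>\<infinity>\<close> and its tensor modules\<close>

definition gl_inf ::
  "('k::field, 'v, 'y) module_scheme \<Rightarrow> ('k, 'w, 'z) module_scheme \<Rightarrow> ('v \<Rightarrow> 'w \<Rightarrow> 'k) \<Rightarrow>
   ('k, ('v \<times> 'w \<Rightarrow> 'k) set) lie_alg" where
  "gl_inf V W pair = (let T = tensor_prod V W in
     module.extend T (lie_alg.fields
       (\<lambda>X Y. lift T (\<lambda>(u, u'). lift T (\<lambda>(v, v').
          pair v u' \<odot>\<^bsub>T\<^esub> tens V W u v' \<ominus>\<^bsub>T\<^esub> pair u v' \<odot>\<^bsub>T\<^esub> tens V W v u') Y) X)))"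

definition natural_module ::
  "('k::field, 'v) module \<Rightarrow> ('v \<Rightarrow> 'w \<Rightarrow> 'k) \<Rightarrow> ('k, 'v, ('v \<times> 'w \<Rightarrow> 'k) set) lie_mod" where
  "natural_module V pair = with_act V
     (\<lambda>X v. lift V (\<lambda>(u, u'). pair v u' \<odot>\<^bsub>V\<^esub> u) X)"

definition conatural_module ::
  "('k::field, 'w) module \<Rightarrow> ('v \<Rightarrow> 'w \<Rightarrow> 'k) \<Rightarrow> ('k, 'w, ('v \<times> 'w \<Rightarrow> 'k) set) lie_mod" where
  "conatural_module W pair = with_act W
     (\<lambda>X w. lift W (\<lambda>(u, u'). \<ominus>\<^bsub>W\<^esub> (pair u w \<odot>\<^bsub>W\<^esub> u')) X)"

definition mixed_tensor ::
  "('k::field, 'v) module \<Rightarrow> ('k, 'w) module \<Rightarrow> ('v \<Rightarrow> 'w \<Rightarrow> 'k) \<Rightarrow> nat \<Rightarrow> nat \<Rightarrow>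
   ('k, (('v list \<Rightarrow> 'k) set \<times> ('w list \<Rightarrow> 'k) set \<Rightarrow> 'k) set, ('v \<times> 'w \<Rightarrow> 'k) set) lie_mod" where
  "mixed_tensor V W pair p q =
     lie_tensor (lie_pow p (natural_module V pair)) (lie_pow q (conatural_module W pair))"


section \<open>Partitions, Young symmetrizers and Schur functors\<close>

definition partitions :: "nat \<Rightarrow> nat list set" where
  "partitions d = {lam. sorted_wrt (\<ge>) lam \<and> (\<forall>n\<in>set lam. n > 0) \<and> sum_list lam = d}"

text \<open>
  The symmetric group on \<open>d\<close> letters is \<open>{\<sigma>. \<sigma> permutes {..<d}}\<close>, with \<open>\<sigma>\<tau> = \<sigma> \<circ> \<tau>\<close>.
\<close>

definition group_algebra :: "nat \<Rightarrow> ('k::field, (nat \<Rightarrow> nat) \<Rightarrow> 'k) module" where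
  "group_algebra d = (free_space {\<sigma>. \<sigma> permutes {..<d}}) \<lparr>
     mult := (\<lambda>a b \<pi>. \<Sum>(\<sigma>, \<tau>) | \<sigma> permutes {..<d} \<and> \<tau> permutes {..<d} \<and> \<sigma> \<circ> \<tau> = \<pi>. a \<sigma> * b \<tau>),
     one := single id \<rparr>"

text \<open>
  Row and column of the entry \<open>k\<close> (rows, columns and entries counted from 0) in the standard tableau
  of shape \<open>\<lambda>\<close> numbered consecutively along the rows.
\<close>

definition tab_row :: "nat list \<Rightarrow> nat \<Rightarrow> nat" where
  "tab_row lam k = (LEAST i. k < sum_list (take (Suc i) lam))"

definition tab_col :: "nat list \<Rightarrow> nat \<Rightarrow> nat" where
  "tab_col lam k = k - sum_list (take (tab_row lam k) lam)"

definition row_stabilizer :: "nat list \<Rightarrow> (nat \<Rightarrow> nat) set" where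
  "row_stabilizer lam =
     {\<sigma>. \<sigma> permutes {..<sum_list lam} \<and> (\<forall>k<sum_list lam. tab_row lam (\<sigma> k) = tab_row lam k)}"

definition col_stabilizer :: "nat list \<Rightarrow> (nat \<Rightarrow> nat) set" where
  "col_stabilizer lam =
     {\<sigma>. \<sigma> permutes {..<sum_list lam} \<and> (\<forall>k<sum_list lam. tab_col lam (\<sigma> k) = tab_col lam k)}"

definition young_symmetrizer :: "nat list \<Rightarrow> (nat \<Rightarrow> nat) \<Rightarrow> 'k::field" where
  "young_symmetrizer lam =
     (\<lambda>\<sigma>. if \<sigma> \<in> row_stabilizer lam then 1 else 0)
       \<otimes>\<^bsub>group_algebra (sum_list lam)\<^esub>
     (\<lambda>\<sigma>. if \<sigma> \<in> col_stabilizer lam then of_int (sign \<sigma>) else 0)"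

definition specht_module :: "nat list \<Rightarrow> ('k::field, (nat \<Rightarrow> nat) \<Rightarrow> 'k) module" where
  "specht_module lam = (let A = group_algebra (sum_list lam) in
     A \<lparr> carrier := {a \<otimes>\<^bsub>A\<^esub> young_symmetrizer lam | a. a \<in> carrier A} \<rparr>)"

text \<open>
  The group algebra acts on the tensor power on the right by permuting factors,
  \<open>(v\<^sub>0 \<otimes> \<dots> \<otimes> v\<^sub>d\<^sub>-\<^sub>1) \<sigma> = v\<^bsub>\<sigma>(0)\<^esub> \<otimes> \<dots> \<otimes> v\<^bsub>\<sigma>(d-1)\<^esub>\<close>;
  this is a right action because \<open>permute_list \<tau> (permute_list \<sigma> vs) = permute_list (\<sigma> \<circ> \<tau>) vs\<close>.
\<close>

definition place_perm ::
  "nat \<Rightarrow> ('k::field, 'v, 'z) module_scheme \<Rightarrow> ((nat \<Rightarrow> nat) \<Rightarrow> 'k) \<Rightarrow>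
   ('v list \<Rightarrow> 'k) set \<Rightarrow> ('v list \<Rightarrow> 'k) set" where
  "place_perm d V a = lift (tensor_pow d V)
     (\<lambda>vs. \<Oplus>\<^bsub>tensor_pow d V\<^esub>\<sigma>\<in>{\<sigma>. \<sigma> permutes {..<d}}.
        a \<sigma> \<odot>\<^bsub>tensor_pow d V\<^esub> tpure d V (permute_list \<sigma> vs))"

definition schur ::
  "nat list \<Rightarrow> ('k::field, 'm, 'g, 'z) lie_mod_scheme \<Rightarrow> ('k, ('m list \<Rightarrow> 'k) set, 'g) lie_mod" where
  "schur lam M = (let d = sum_list lam in
     (lie_pow d M) \<lparr> carrier := place_perm d M (young_symmetrizer lam) ` carrier (tensor_pow d M) \<rparr>)"

section \<open>The tensor product and \<open>gl\<^sub>\<infinity>\<close> behave as intended\<close>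

text \<open>
  \<open>tensor_lift_hom\<close>, \<open>tensor_lift_tens\<close> and \<open>tens_bilin\<close> are the universal property of \<open>tensor_prod\<close>;
  \<open>natural_act\<close> evaluates the two actions and the bracket on decomposable tensors.
\<close>

lemma free_space_simps [simp]:
  "x \<in> carrier (free_space S) \<longleftrightarrow> finite {s. x s \<noteq> 0} \<and> {s. x s \<noteq> 0} \<subseteq> S"
  "\<zero>\<^bsub>free_space S\<^esub> = (\<lambda>s. 0)"
  "x \<oplus>\<^bsub>free_space S\<^esub> y = (\<lambda>s. x s + y s)"
  "c \<odot>\<^bsub>free_space S\<^esub> x = (\<lambda>s. c * x s)"
  by (simp_all add: free_space_def)

lemma free_space_add_closed:
  assumes "x \<in> carrier (free_space S)" "y \<in> carrier (free_space S)"
  shows "(\<lambda>s. x s + y s) \<in> carrier (free_space S)"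
proof -
  have "{s. x s + y s \<noteq> 0} \<subseteq> {s. x s \<noteq> 0} \<union> {s. y s \<noteq> 0}" by auto
  then show ?thesis using assms
    by (auto intro: finite_subset)
qed

lemma free_space_smult_closed:
  assumes "x \<in> carrier (free_space S)"
  shows "(\<lambda>s. c * x s) \<in> carrier (free_space S)"
proof -
  have "{s. c * x s \<noteq> 0} \<subseteq> {s. x s \<noteq> 0}" by auto
  then show ?thesis using assms by (auto intro: finite_subset)
qed

lemma single_closed: "s \<in> S \<Longrightarrow> single s \<in> carrier (free_space S)"
  by (auto simp: single_def)

lemma free_space_vs: "vectorspace class_ring (free_space S :: ('k::field, _) module)"
proof -
  have "abelian_group (free_space S :: ('k, _) module)"
  proof (rule abelian_groupI)
    fix x :: "_ \<Rightarrow> 'k" assume "x \<in> carrier (free_space S)"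
    then show "\<exists>y\<in>carrier (free_space S). y \<oplus>\<^bsub>free_space S\<^esub> x = \<zero>\<^bsub>free_space S\<^esub>"
      by (intro bexI[of _ "\<lambda>s. - x s"]) auto
  qed (use free_space_add_closed in \<open>auto simp: add_ac fun_eq_iff\<close>)
  then have "Module.module class_ring (free_space S :: ('k, _) module)"
    by (intro moduleI class_cring.is_cring)
       (use free_space_smult_closed in \<open>auto simp: algebra_simps fun_eq_iff\<close>)
  then show ?thesis by (intro vectorspace.intro class_field)
qed

lemma quot_space_vs:
  fixes M :: "('k::field, 'm, 'z) module_scheme"
  assumes "VectorSpace.subspace class_ring N M"
  shows "vectorspace class_ring (quot_space M N)"
    and "(\<lambda>x. N +>\<^bsub>M\<^esub> x) \<in> LinearCombinations.module_hom class_ring M (quot_space M N)"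
    and "carrier (quot_space M N) = (\<lambda>x. N +>\<^bsub>M\<^esub> x) ` carrier M"
proof -
  interpret M: vectorspace class_ring M using assms by (simp add: subspace_def)
  interpret N: submodule class_ring N M using assms by (simp add: subspace_def)
  let ?Q = "quot_space M N" and ?q = "\<lambda>x. N +>\<^bsub>M\<^esub> x"
  have sub: "additive_subgroup N M"
  proof (rule additive_subgroupI)
    show "subgroup N (add_monoid M)"
    proof
      fix x assume "x \<in> N"
      moreover from this have "\<ominus>\<^bsub>M\<^esub> x = (- 1) \<odot>\<^bsub>M\<^esub> x"
        using M.smult_minus_1 N.subset by (auto simp: class_ring_simps)
      ultimately show "inv\<^bsub>add_monoid M\<^esub> x \<in> N"
        using N.smult_closed[of "-1" x] by (simp add: a_inv_def)
    qed (use N.subset in auto)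
  qed
  interpret N: abelian_subgroup N M
    by (rule abelian_subgroupI3[OF sub]) (rule M.abelian_group_axioms)
  show car: "carrier ?Q = ?q ` carrier M"
    by (auto simp: quot_space_def A_RCOSETS_def RCOSETS_def a_r_coset_def)
  have add: "?q x \<oplus>\<^bsub>?Q\<^esub> ?q y = ?q (x \<oplus>\<^bsub>M\<^esub> y)" if "x \<in> carrier M" "y \<in> carrier M" for x y
    using that by (simp add: quot_space_def N.a_rcos_sum)
  have smult: "c \<odot>\<^bsub>?Q\<^esub> ?q x = ?q (c \<odot>\<^bsub>M\<^esub> x)" if x: "x \<in> carrier M" for c x
  proof -
    have "?q (c \<odot>\<^bsub>M\<^esub> y) = ?q (c \<odot>\<^bsub>M\<^esub> x)" if "y \<in> ?q x" for y
    proof -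
      from that obtain n where n: "n \<in> N" "y = n \<oplus>\<^bsub>M\<^esub> x"
        by (auto simp: a_r_coset_def r_coset_def)
      have "c \<odot>\<^bsub>M\<^esub> y = c \<odot>\<^bsub>M\<^esub> n \<oplus>\<^bsub>M\<^esub> c \<odot>\<^bsub>M\<^esub> x"
        using n x N.subset by (auto simp: M.smult_r_distr)
      moreover have "c \<odot>\<^bsub>M\<^esub> n \<in> N" using n by simp
      ultimately have "c \<odot>\<^bsub>M\<^esub> y \<in> ?q (c \<odot>\<^bsub>M\<^esub> x)"
        by (auto simp: a_r_coset_def r_coset_def)
      then show ?thesis using x N.a_repr_independence' by simp
    qed
    moreover have "x \<in> ?q x" using x N.a_rcos_self by blast
    ultimately have "(\<Union>y\<in>?q x. ?q (c \<odot>\<^bsub>M\<^esub> y)) = ?q (c \<odot>\<^bsub>M\<^esub> x)"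
      by (intro SUP_eq_const) blast+
    then show ?thesis by (simp add: quot_space_def)
  qed
  have zero: "\<zero>\<^bsub>?Q\<^esub> = ?q \<zero>\<^bsub>M\<^esub>"
    by (simp add: quot_space_def N.subset M.a_coset_add_zero)
  have ab: "abelian_group ?Q"
  proof (rule abelian_groupI)
    fix X assume "X \<in> carrier ?Q"
    then obtain x where x: "x \<in> carrier M" "X = ?q x" by (auto simp: car)
    then show "\<exists>Y\<in>carrier ?Q. Y \<oplus>\<^bsub>?Q\<^esub> X = \<zero>\<^bsub>?Q\<^esub>"
      by (intro bexI[of _ "?q (\<ominus>\<^bsub>M\<^esub> x)"]) (auto simp: add zero car M.l_neg)
  qed (auto simp: car add zero M.a_ac)
  have "Module.module class_ring ?Q"
    by (intro moduleI class_cring.is_cring ab)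
       (auto simp: car add smult M.smult_l_distr[simplified] M.smult_r_distr M.smult_assoc1[simplified] M.smult_one[simplified])
  then show "vectorspace class_ring ?Q" by (intro vectorspace.intro class_field)
  show "?q \<in> LinearCombinations.module_hom class_ring M ?Q"
    by (auto simp: LinearCombinations.module_hom_def car add smult)
qed


lemma lin_ext_superset:
  fixes N :: "('k::field, 'n, 'z) module_scheme"
  assumes "vectorspace class_ring N" "finite T" "T \<subseteq> S" "{s. x s \<noteq> 0} \<subseteq> T" "f \<in> S \<rightarrow> carrier N"
  shows "lin_ext N f x = (\<Oplus>\<^bsub>N\<^esub>s\<in>T. x s \<odot>\<^bsub>N\<^esub> f s)"
proof -
  interpret N: vectorspace class_ring N by fact
  have *: "c \<odot>\<^bsub>N\<^esub> f s \<in> carrier N" if "s \<in> T" for c s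
    using that assms by (intro N.smult_closed) auto
  have "0 \<odot>\<^bsub>N\<^esub> f s = \<zero>\<^bsub>N\<^esub>" if "s \<in> T" for s
    using N.smult_l_null[of "f s"] that assms by auto
  then show ?thesis unfolding lin_ext_def
    using assms * by (intro N.add.finprod_mono_neutral_cong_left) auto
qed

lemma lin_ext_hom:
  fixes N :: "('k::field, 'n, 'z) module_scheme"
  assumes N: "vectorspace class_ring N" and f: "f \<in> S \<rightarrow> carrier N"
  shows "lin_ext N f \<in> LinearCombinations.module_hom class_ring (free_space S) N"
proof -
  interpret N: vectorspace class_ring N by fact
  have *: "c \<odot>\<^bsub>N\<^esub> f s \<in> carrier N" if "s \<in> S" for c s
    using that f by (intro N.smult_closed) auto
  have fs: "f s \<in> carrier N" if "s \<in> S" for s using that f by auto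
  have d: "(c + c') \<odot>\<^bsub>N\<^esub> f s = c \<odot>\<^bsub>N\<^esub> f s \<oplus>\<^bsub>N\<^esub> c' \<odot>\<^bsub>N\<^esub> f s" if "s \<in> S" for c c' s
    using N.smult_l_distr[of c c' "f s"] fs[OF that] by simp
  have e: "(c * c') \<odot>\<^bsub>N\<^esub> f s = c \<odot>\<^bsub>N\<^esub> (c' \<odot>\<^bsub>N\<^esub> f s)" if "s \<in> S" for c c' s
    using N.smult_assoc1[of c c' "f s"] fs[OF that] by simp
  have "lin_ext N f x \<in> carrier N" if "x \<in> carrier (free_space S)" for x
    using that unfolding lin_ext_def by (intro N.finsum_closed) (auto intro!: *)
  moreover have "lin_ext N f (\<lambda>s. x s + y s) = lin_ext N f x \<oplus>\<^bsub>N\<^esub> lin_ext N f y"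
    if "x \<in> carrier (free_space S)" "y \<in> carrier (free_space S)" for x y
  proof -
    let ?T = "{s. x s \<noteq> 0} \<union> {s. y s \<noteq> 0}"
    have T: "finite ?T" "?T \<subseteq> S" using that by auto
    have "lin_ext N f (\<lambda>s. x s + y s) = (\<Oplus>\<^bsub>N\<^esub>s\<in>?T. (x s + y s) \<odot>\<^bsub>N\<^esub> f s)"
      by (rule lin_ext_superset[OF N T _ f]) auto
    also have "\<dots> = (\<Oplus>\<^bsub>N\<^esub>s\<in>?T. x s \<odot>\<^bsub>N\<^esub> f s \<oplus>\<^bsub>N\<^esub> y s \<odot>\<^bsub>N\<^esub> f s)"
      by (rule N.finsum_cong') (use T(2) in \<open>auto intro!: d N.a_closed *\<close>)
    also have "\<dots> = (\<Oplus>\<^bsub>N\<^esub>s\<in>?T. x s \<odot>\<^bsub>N\<^esub> f s) \<oplus>\<^bsub>N\<^esub> (\<Oplus>\<^bsub>N\<^esub>s\<in>?T. y s \<odot>\<^bsub>N\<^esub> f s)"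
      using T * by (intro N.finsum_addf) auto
    also have "(\<Oplus>\<^bsub>N\<^esub>s\<in>?T. x s \<odot>\<^bsub>N\<^esub> f s) = lin_ext N f x"
      by (rule lin_ext_superset[OF N T _ f, symmetric]) auto
    also have "(\<Oplus>\<^bsub>N\<^esub>s\<in>?T. y s \<odot>\<^bsub>N\<^esub> f s) = lin_ext N f y"
      by (rule lin_ext_superset[OF N T _ f, symmetric]) auto
    finally show ?thesis .
  qed
  moreover have "lin_ext N f (\<lambda>s. c * x s) = c \<odot>\<^bsub>N\<^esub> lin_ext N f x"
    if "x \<in> carrier (free_space S)" for c x
  proof -
    let ?T = "{s. x s \<noteq> 0}"
    have T: "finite ?T" "?T \<subseteq> S" using that by auto
    have "lin_ext N f (\<lambda>s. c * x s) = (\<Oplus>\<^bsub>N\<^esub>s\<in>?T. (c * x s) \<odot>\<^bsub>N\<^esub> f s)"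
      by (rule lin_ext_superset[OF N T _ f]) auto
    also have "\<dots> = (\<Oplus>\<^bsub>N\<^esub>s\<in>?T. c \<odot>\<^bsub>N\<^esub> (x s \<odot>\<^bsub>N\<^esub> f s))"
      by (rule N.finsum_cong') (use T(2) in \<open>auto intro!: e * simp flip: e\<close>)
    also have "\<dots> = c \<odot>\<^bsub>N\<^esub> lin_ext N f x" unfolding lin_ext_def
      using T * by (intro N.finsum_smult[symmetric]) auto
    finally show ?thesis .
  qed
  ultimately show ?thesis
    unfolding LinearCombinations.module_hom_def free_space_simps(3,4) by blast
qed

lemma lin_ext_single:
  fixes N :: "('k::field, 'n, 'z) module_scheme"
  assumes "vectorspace class_ring N" "f s \<in> carrier N"
  shows "lin_ext N f (single s) = f s"
proof -
  interpret N: vectorspace class_ring N by fact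
  have "{t. single s t \<noteq> (0::'k)} = {s}" by (auto simp: single_def)
  then show ?thesis using assms N.smult_one[of "f s"] by (simp add: lin_ext_def single_def)
qed

lemma relspan_subspace:
  "R \<subseteq> carrier (free_space S) \<Longrightarrow> VectorSpace.subspace class_ring (relspan S R) (free_space S)"
proof -
  interpret F: vectorspace class_ring "free_space S" by (rule free_space_vs)
  show "R \<subseteq> carrier (free_space S) \<Longrightarrow> VectorSpace.subspace class_ring (relspan S R) (free_space S)"
    unfolding relspan_def by (rule F.span_is_subspace)
qed

lemma presented_vs:
  assumes "R \<subseteq> carrier (free_space S)"
  shows "vectorspace class_ring (presented S R)"
  unfolding presented_def by (intro quot_space_vs relspan_subspace assms)

lemma gen_closed:
  assumes "R \<subseteq> carrier (free_space S)" "s \<in> S"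
  shows "gen S R s \<in> carrier (presented S R)"
  unfolding presented_def gen_def
  using quot_space_vs(3)[OF relspan_subspace[OF assms(1)]] single_closed[OF assms(2)] by blast

lemma lift_class:
  fixes N :: "('k::field, 'n, 'z) module_scheme"
  assumes N: "vectorspace class_ring N" and R: "R \<subseteq> carrier (free_space S)"
    and f: "f \<in> S \<rightarrow> carrier N" and rel: "\<And>r. r \<in> R \<Longrightarrow> lin_ext N f r = \<zero>\<^bsub>N\<^esub>"
    and x: "x \<in> carrier (free_space S)"
  shows "lift N f (relspan S R +>\<^bsub>free_space S\<^esub> x) = lin_ext N f x"
proof -
  interpret N: vectorspace class_ring N by fact
  interpret F: vectorspace class_ring "free_space S :: ('k, _) module" by (rule free_space_vs)
  interpret h: linear_map class_ring "free_space S" N "lin_ext N f"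
    by (intro linear_map.intro mod_hom.intro mod_hom_axioms.intro N F.vectorspace_axioms
        lin_ext_hom f F.module_axioms N.module_axioms)
  have "VectorSpace.subspace class_ring h.ker (free_space S)" by (rule h.kerT_is_subspace)
  moreover have "R \<subseteq> h.ker" using R rel unfolding h.ker_def by blast
  ultimately have sub: "relspan S R \<subseteq> h.ker"
    unfolding relspan_def by (intro F.span_is_subset) (auto simp: subspace_def)
  have "lin_ext N f y = lin_ext N f x" if y: "y \<in> relspan S R +>\<^bsub>free_space S\<^esub> x" for y
  proof -
    obtain r where r: "r \<in> relspan S R" "y = r \<oplus>\<^bsub>free_space S\<^esub> x"
      using y by (auto simp: a_r_coset_def r_coset_def simp del: free_space_simps)
    have "r \<in> carrier (free_space S)" "lin_ext N f r = \<zero>\<^bsub>N\<^esub>"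
      using r sub by (auto simp: h.ker_def simp del: free_space_simps)
    then have "lin_ext N f y = \<zero>\<^bsub>N\<^esub> \<oplus>\<^bsub>N\<^esub> lin_ext N f x" using h.f_add[of r x] r(2) x by metis
    also have "\<dots> = lin_ext N f x" by (intro N.l_zero h.f_im x)
    finally show ?thesis .
  qed
  moreover have "x \<in> relspan S R +>\<^bsub>free_space S\<^esub> x"
  proof -
    have "(\<lambda>s. 0) \<in> relspan S R"
      using submodule.zero_closed[of class_ring "relspan S R" "free_space S"] relspan_subspace[OF R]
      by (simp add: subspace_def)
    then show ?thesis by (auto simp: a_r_coset_def r_coset_def intro!: bexI[of _ "\<lambda>s. 0"])
  qed
  ultimately show ?thesis unfolding lift_def by (intro the_elem_image_unique) blast+
qed


lemma lift_gen:
  fixes N :: "('k::field, 'n, 'z) module_scheme"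
  assumes "vectorspace class_ring N" "R \<subseteq> carrier (free_space S)" "f \<in> S \<rightarrow> carrier N"
    "\<And>r. r \<in> R \<Longrightarrow> lin_ext N f r = \<zero>\<^bsub>N\<^esub>" "s \<in> S"
  shows "lift N f (gen S R s) = f s"
proof -
  have "f s \<in> carrier N" using assms(3,5) by auto
  then show ?thesis
    unfolding gen_def
    by (intro trans[OF lift_class[OF assms(1-4) single_closed[OF assms(5)]] lin_ext_single[OF assms(1)]])
qed

lemma lift_hom:
  fixes N :: "('k::field, 'n, 'z) module_scheme"
  assumes N: "vectorspace class_ring N" and R: "R \<subseteq> carrier (free_space S)"
    and f: "f \<in> S \<rightarrow> carrier N" and rel: "\<And>r. r \<in> R \<Longrightarrow> lin_ext N f r = \<zero>\<^bsub>N\<^esub>"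
  shows "lift N f \<in> LinearCombinations.module_hom class_ring (presented S R) N"
proof -
  interpret F: vectorspace class_ring "free_space S :: ('k, _) module" by (rule free_space_vs)
  let ?q = "\<lambda>x. relspan S R +>\<^bsub>free_space S\<^esub> x"
  note Q = quot_space_vs(2,3)[OF relspan_subspace[OF R], folded presented_def]
  note h = lin_ext_hom[OF N f]
  have lc: "lift N f (?q x) = lin_ext N f x" if "x \<in> carrier (free_space S)" for x
    by (rule lift_class[OF N R f _ that]) (rule rel)
  note [simp del] = free_space_simps
  note mh = LinearCombinations.module_hom_def
  have a: "?q x \<oplus>\<^bsub>presented S R\<^esub> ?q y = ?q (x \<oplus>\<^bsub>free_space S\<^esub> y)"
    if "x \<in> carrier (free_space S)" "y \<in> carrier (free_space S)" for x y
    using Q(1) that by (simp add: mh)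
  have b: "c \<odot>\<^bsub>presented S R\<^esub> ?q x = ?q (c \<odot>\<^bsub>free_space S\<^esub> x)"
    if "x \<in> carrier (free_space S)" for c x
    using Q(1) that by (simp add: mh)
  have h1: "lin_ext N f x \<in> carrier N" if "x \<in> carrier (free_space S)" for x
    using h that unfolding mh by blast
  have h2: "lin_ext N f (x \<oplus>\<^bsub>free_space S\<^esub> y) = lin_ext N f x \<oplus>\<^bsub>N\<^esub> lin_ext N f y"
    if "x \<in> carrier (free_space S)" "y \<in> carrier (free_space S)" for x y
    using h that unfolding mh by blast
  have h3: "lin_ext N f (c \<odot>\<^bsub>free_space S\<^esub> x) = c \<odot>\<^bsub>N\<^esub> lin_ext N f x"
    if "x \<in> carrier (free_space S)" for c x
    using h that unfolding mh by simp
  have rep: "\<exists>x\<in>carrier (free_space S). X = ?q x" if "X \<in> carrier (presented S R)" for X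
    using that unfolding Q(2) image_iff .
  show ?thesis unfolding mh
  proof (intro CollectI conjI allI impI Pi_I)
    fix X assume X: "X \<in> carrier (presented S R)"
    obtain x where x: "x \<in> carrier (free_space S)" "X = ?q x" using rep[OF X] by (elim bexE)
    show "lift N f X \<in> carrier N" unfolding x(2) lc[OF x(1)] by (rule h1[OF x(1)])
  next
    fix X Y assume XY: "X \<in> carrier (presented S R) \<and> Y \<in> carrier (presented S R)"
    obtain x where x: "x \<in> carrier (free_space S)" "X = ?q x" 
      using rep[OF conjunct1[OF XY]] by (elim bexE)
    obtain y where y: "y \<in> carrier (free_space S)" "Y = ?q y" 
      using rep[OF conjunct2[OF XY]] by (elim bexE)
    show "lift N f (X \<oplus>\<^bsub>presented S R\<^esub> Y) = lift N f X \<oplus>\<^bsub>N\<^esub> lift N f Y"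
      unfolding x(2) y(2) a[OF x(1) y(1)] lc[OF F.a_closed[OF x(1) y(1)]] lc[OF x(1)] lc[OF y(1)]
      by (rule h2[OF x(1) y(1)])
  next
    fix c X assume X: "c \<in> carrier (class_ring :: 'k ring) \<and> X \<in> carrier (presented S R)"
    obtain x where x: "x \<in> carrier (free_space S)" "X = ?q x" 
      using rep[OF conjunct2[OF X]] by (elim bexE)
    have cx: "c \<odot>\<^bsub>free_space S\<^esub> x \<in> carrier (free_space S)"
      using X x(1) by (intro F.smult_closed) simp_all
    show "lift N f (c \<odot>\<^bsub>presented S R\<^esub> X) = c \<odot>\<^bsub>N\<^esub> lift N f X"
      unfolding x(2) b[OF x(1)] lc[OF cx] lc[OF x(1)] by (rule h3[OF x(1)])
  qed
qed

lemma comb_closed: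
  assumes "s \<in> S" "t \<in> S"
  shows "u \<in> S \<Longrightarrow> (\<lambda>z. single s z - single t z - single u z) \<in> carrier (free_space S)"
    and "(\<lambda>z. single s z - c * single t z) \<in> carrier (free_space S)"
proof -
  have 1: "{z. single s z - single t z - single u z \<noteq> 0} \<subseteq> {s, t, u}"
    and 2: "{z. single s z - c * single t z \<noteq> 0} \<subseteq> {s, t}"
    by (auto simp: single_def)
  show "(\<lambda>z. single s z - single t z - single u z) \<in> carrier (free_space S)" if "u \<in> S"
    using that unfolding free_space_simps using finite_subset[OF 1] subset_trans[OF 1] assms by auto
  show "(\<lambda>z. single s z - c * single t z) \<in> carrier (free_space S)"
    unfolding free_space_simps using finite_subset[OF 2] subset_trans[OF 2] assms by auto
qed

lemma tensor_rels_closed: 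
  fixes A :: "('k::field, 'a, 'y) module_scheme" and B :: "('k, 'b, 'z) module_scheme"
  assumes "vectorspace class_ring A" "vectorspace class_ring B"
  shows "tensor_rels A B \<subseteq> carrier (free_space (carrier A \<times> carrier B))"
proof -
  interpret A: vectorspace class_ring A by fact
  interpret B: vectorspace class_ring B by fact
  have sA: "c \<odot>\<^bsub>A\<^esub> a \<in> carrier A" if "a \<in> carrier A" for c a
    using that by (intro A.smult_closed) simp_all
  have sB: "c \<odot>\<^bsub>B\<^esub> a \<in> carrier B" if "a \<in> carrier B" for c a
    using that by (intro B.smult_closed) simp_all
  show ?thesis unfolding tensor_rels_def
    by (intro Un_least subsetI; elim CollectE exE conjE; hypsubst)
       (intro comb_closed SigmaI A.a_closed B.a_closed sA sB; assumption)+
qed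

lemma tensor_prod_vs:
  assumes "vectorspace class_ring A" "vectorspace class_ring B"
  shows "vectorspace class_ring (tensor_prod A B)"
  unfolding tensor_prod_def by (intro presented_vs tensor_rels_closed assms)

lemma lin_ext_comb:
  fixes N :: "('k::field, 'n, 'z) module_scheme"
  assumes N: "vectorspace class_ring N" and f: "f \<in> S \<rightarrow> carrier N" and s: "s \<in> S" and t: "t \<in> S"
  shows "u \<in> S \<Longrightarrow> lin_ext N f (\<lambda>z. single s z - single t z - single u z) = f s \<ominus>\<^bsub>N\<^esub> f t \<ominus>\<^bsub>N\<^esub> f u"
    and "lin_ext N f (\<lambda>z. single s z - c * single t z) = f s \<ominus>\<^bsub>N\<^esub> c \<odot>\<^bsub>N\<^esub> f t"
proof -
  interpret N: vectorspace class_ring N by fact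
  let ?F = "free_space S :: ('k, _) module"
  note h = lin_ext_hom[OF N f]
  note mh = LinearCombinations.module_hom_def
  have add: "lin_ext N f (\<lambda>z. x z + y z) = lin_ext N f x \<oplus>\<^bsub>N\<^esub> lin_ext N f y"
    if "x \<in> carrier ?F" "y \<in> carrier ?F" for x y using h that by (simp add: mh)
  have sm: "lin_ext N f (\<lambda>z. c * x z) = c \<odot>\<^bsub>N\<^esub> lin_ext N f x"
    if "x \<in> carrier ?F" for x c using h that by (simp add: mh)
  note [simp del] = free_space_simps
  have fc: "f s \<in> carrier N" if "s \<in> S" for s using f that by auto
  have m1: "(- c) \<odot>\<^bsub>N\<^esub> n = \<ominus>\<^bsub>N\<^esub> (c \<odot>\<^bsub>N\<^esub> n)" if "n \<in> carrier N" for c n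
    using N.smult_l_minus[of c n] that by (simp add: class_ring_simps)
  have one: "1 \<odot>\<^bsub>N\<^esub> n = n" if "n \<in> carrier N" for n using N.smult_one that by simp
  have sg: "lin_ext N f (single s) = f s" if "s \<in> S" for s
    by (rule lin_ext_single[where f=f, OF N fc[OF that]])
  have smg: "lin_ext N f (\<lambda>z. - c * single s z) = \<ominus>\<^bsub>N\<^esub> (c \<odot>\<^bsub>N\<^esub> f s)" if "s \<in> S" for c s
    using sm[OF single_closed[OF that], of "-c"] m1[OF fc[OF that]] sg[OF that] by simp
  note cl = free_space_add_closed free_space_smult_closed single_closed
  have b: "lin_ext N f (\<lambda>z. single s z + - c * single t z) = f s \<ominus>\<^bsub>N\<^esub> c \<odot>\<^bsub>N\<^esub> f t" for c
    by (subst add[of "single s" "\<lambda>z. - c * single t z", OF single_closed[OF s]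
          free_space_smult_closed[OF single_closed[OF t]]])
       (simp only: sg[OF s] smg[OF t] a_minus_def)
  show "lin_ext N f (\<lambda>z. single s z - c * single t z) = f s \<ominus>\<^bsub>N\<^esub> c \<odot>\<^bsub>N\<^esub> f t"
    using b[of c] by simp
  show "lin_ext N f (\<lambda>z. single s z - single t z - single u z) = f s \<ominus>\<^bsub>N\<^esub> f t \<ominus>\<^bsub>N\<^esub> f u" if u: "u \<in> S"
  proof -
    have "(\<lambda>z. single s z + - 1 * single t z) \<in> carrier ?F" "(\<lambda>z. - 1 * single u z) \<in> carrier ?F"
      by (intro cl s t u)+
    from add[OF this]
    have "lin_ext N f (\<lambda>z. single s z + - 1 * single t z + - 1 * single u z) = f s \<ominus>\<^bsub>N\<^esub> f t \<ominus>\<^bsub>N\<^esub> f u"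
      unfolding smg[OF u] b one[OF fc[OF t]] one[OF fc[OF u]] a_minus_def .
    then show ?thesis by simp
  qed
qed

definition bilin where
  "bilin A B N f \<longleftrightarrow>
     (\<forall>a\<in>carrier A. \<forall>b\<in>carrier B. f a b \<in> carrier N) \<and>
     (\<forall>a\<in>carrier A. \<forall>a'\<in>carrier A. \<forall>b\<in>carrier B. f (a \<oplus>\<^bsub>A\<^esub> a') b = f a b \<oplus>\<^bsub>N\<^esub> f a' b) \<and>
     (\<forall>a\<in>carrier A. \<forall>b\<in>carrier B. \<forall>b'\<in>carrier B. f a (b \<oplus>\<^bsub>B\<^esub> b') = f a b \<oplus>\<^bsub>N\<^esub> f a b') \<and>
     (\<forall>c. \<forall>a\<in>carrier A. \<forall>b\<in>carrier B. f (c \<odot>\<^bsub>A\<^esub> a) b = c \<odot>\<^bsub>N\<^esub> f a b) \<and>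
     (\<forall>c. \<forall>a\<in>carrier A. \<forall>b\<in>carrier B. f a (c \<odot>\<^bsub>B\<^esub> b) = c \<odot>\<^bsub>N\<^esub> f a b)"

lemma
  fixes A :: "('k::field, 'a, 'y) module_scheme" and B :: "('k, 'b, 'z) module_scheme"
    and N :: "('k, 'n, 'w) module_scheme"
  assumes A: "vectorspace class_ring A" and B: "vectorspace class_ring B" and N: "vectorspace class_ring N"
    and f: "bilin A B N f"
  shows tensor_lift_hom: "lift N (\<lambda>(a, b). f a b) \<in> LinearCombinations.module_hom class_ring (tensor_prod A B) N"
    and tensor_lift_tens: "\<lbrakk>a \<in> carrier A; b \<in> carrier B\<rbrakk> \<Longrightarrow> lift N (\<lambda>(a, b). f a b) (tens A B a b) = f a b"
proof -
  interpret A: vectorspace class_ring A by fact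
  interpret B: vectorspace class_ring B by fact
  interpret N: vectorspace class_ring N by fact
  let ?f = "\<lambda>(a, b). f a b"
  have fc: "?f \<in> carrier A \<times> carrier B \<rightarrow> carrier N" using f by (auto simp: bilin_def)
  have z: "n \<oplus>\<^bsub>N\<^esub> m \<ominus>\<^bsub>N\<^esub> n \<ominus>\<^bsub>N\<^esub> m = \<zero>\<^bsub>N\<^esub>" "n \<ominus>\<^bsub>N\<^esub> n = \<zero>\<^bsub>N\<^esub>"
    if "n \<in> carrier N" "m \<in> carrier N" for n m
    using that N.r_neg1[of n m] by (simp_all add: a_minus_def N.r_neg N.a_ac N.r_neg1 N.r_neg2)
  note lc = lin_ext_comb[OF N fc, unfolded case_prod_conv]
  have sA: "c \<odot>\<^bsub>A\<^esub> a \<in> carrier A" if "a \<in> carrier A" for c a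
    using that by (intro A.smult_closed) simp_all
  have sB: "c \<odot>\<^bsub>B\<^esub> a \<in> carrier B" if "a \<in> carrier B" for c a
    using that by (intro B.smult_closed) simp_all
  have sN: "c \<odot>\<^bsub>N\<^esub> a \<in> carrier N" if "a \<in> carrier N" for c a
    using that by (intro N.smult_closed) simp_all
  note fs = f[unfolded bilin_def]
  have fcl: "f a b \<in> carrier N" if "a \<in> carrier A" "b \<in> carrier B" for a b using fs that by blast
  have rel: "lin_ext N ?f r = \<zero>\<^bsub>N\<^esub>" if "r \<in> tensor_rels A B" for r
    using that unfolding tensor_rels_def
    apply (elim UnE CollectE exE conjE; hypsubst; subst lin_ext_comb[OF N fc])
    apply (simp_all add: sA sB fs fcl z sN)
    done
  show "lift N ?f \<in> LinearCombinations.module_hom class_ring (tensor_prod A B) N"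
    unfolding tensor_prod_def by (intro lift_hom N tensor_rels_closed A B fc rel)
  show "lift N ?f (tens A B a b) = f a b" if "a \<in> carrier A" "b \<in> carrier B"
    unfolding tens_def using that lift_gen[OF N tensor_rels_closed[OF A B] fc, of "(a, b)"] rel by simp
qed

lemma class_eqI:
  fixes R :: "('s \<Rightarrow> 'k::field) set"
  assumes R: "R \<subseteq> carrier (free_space S)" and x: "x \<in> carrier (free_space S)" and y: "y \<in> carrier (free_space S)"
    and r: "(\<lambda>s. x s - y s) \<in> R"
  shows "relspan S R +>\<^bsub>free_space S\<^esub> x = relspan S R +>\<^bsub>free_space S\<^esub> y"
proof -
  interpret F: vectorspace class_ring "free_space S :: ('k, _) module" by (rule free_space_vs)
  interpret s: submodule class_ring "relspan S R" "free_space S" 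
    using relspan_subspace[OF R] by (simp add: subspace_def)
  note [simp del] = free_space_simps
  have "subgroup (relspan S R) (add_monoid (free_space S))"
  proof
    fix x assume x: "x \<in> relspan S R"
    have "\<ominus>\<^bsub>free_space S\<^esub> x = (- 1) \<odot>\<^bsub>free_space S\<^esub> x"
      using F.smult_minus_1[of x] s.subset x by (auto simp: class_ring_simps)
    then show "inv\<^bsub>add_monoid (free_space S)\<^esub> x \<in> relspan S R"
      using s.smult_closed[of "-1" x] x by (simp add: a_inv_def)
  qed (use s.subset s.m_closed s.zero_closed in auto)
  moreover have "(\<lambda>s. x s - y s) \<in> relspan S R"
    unfolding relspan_def using F.in_own_span[OF R] r by blast
  then have "x \<in> relspan S R +>\<^bsub>free_space S\<^esub> y"
    unfolding a_r_coset_def r_coset_def by (auto simp: free_space_simps intro!: bexI[of _ "\<lambda>s. x s - y s"])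
  ultimately show ?thesis using F.a_repr_independence[OF _ y] by metis
qed

lemma gen_comb:
  fixes R :: "('s \<Rightarrow> 'k::field) set"
  assumes R: "R \<subseteq> carrier (free_space S)" and S: "s \<in> S" "t \<in> S"
  shows "\<lbrakk>(\<lambda>z. single s z - single t z - single u z) \<in> R; u \<in> S\<rbrakk> \<Longrightarrow>
      gen S R s = gen S R t \<oplus>\<^bsub>presented S R\<^esub> gen S R u"
    and "(\<lambda>z. single s z - c * single t z) \<in> R \<Longrightarrow> gen S R s = c \<odot>\<^bsub>presented S R\<^esub> gen S R t"
proof -
  note qh = quot_space_vs(2)[OF relspan_subspace[OF R], folded presented_def]
  note cl = free_space_add_closed free_space_smult_closed single_closed
  show "gen S R s = gen S R t \<oplus>\<^bsub>presented S R\<^esub> gen S R u"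
    if "(\<lambda>z. single s z - single t z - single u z) \<in> R" "u \<in> S"
  proof -
    have "gen S R t \<oplus>\<^bsub>presented S R\<^esub> gen S R u =
        relspan S R +>\<^bsub>free_space S\<^esub> (\<lambda>z. single t z + single u z)"
      using LinearCombinations.module_hom_add[OF qh single_closed[OF S(2)] single_closed[OF that(2)]]
      unfolding gen_def free_space_simps(3) by (rule sym)
    moreover have "\<dots> = gen S R s" unfolding gen_def
      by (rule class_eqI[symmetric, OF R]) (use S that in \<open>auto intro: cl simp: diff_diff_eq simp del: free_space_simps\<close>)
    ultimately show ?thesis by simp
  qed
  show "gen S R s = c \<odot>\<^bsub>presented S R\<^esub> gen S R t" if "(\<lambda>z. single s z - c * single t z) \<in> R"
  proof -
    have "c \<odot>\<^bsub>presented S R\<^esub> gen S R t =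
        relspan S R +>\<^bsub>free_space S\<^esub> (\<lambda>z. c * single t z)"
      using LinearCombinations.module_hom_smult[OF qh _ single_closed[OF S(2)], of c]
      unfolding gen_def free_space_simps(4) by simp
    moreover have "\<dots> = gen S R s" unfolding gen_def
      by (rule class_eqI[symmetric, OF R]) (use S that in \<open>auto intro: cl simp del: free_space_simps\<close>)
    ultimately show ?thesis by simp
  qed
qed

lemma tensor_relsI:
  fixes A :: "('k::field, 'a, 'y) module_scheme" and B :: "('k, 'b, 'z) module_scheme"
  assumes "a \<in> carrier A" "b \<in> carrier B"
  shows "a' \<in> carrier A \<Longrightarrow>
      (\<lambda>z. single (a \<oplus>\<^bsub>A\<^esub> a', b) z - single (a, b) z - single (a', b) z) \<in> tensor_rels A B"
    and "b' \<in> carrier B \<Longrightarrow>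
      (\<lambda>z. single (a, b \<oplus>\<^bsub>B\<^esub> b') z - single (a, b) z - single (a, b') z) \<in> tensor_rels A B"
    and "(\<lambda>z. single (c \<odot>\<^bsub>A\<^esub> a, b) z - c * single (a, b) z) \<in> tensor_rels A B"
    and "(\<lambda>z. single (a, c \<odot>\<^bsub>B\<^esub> b) z - c * single (a, b) z) \<in> tensor_rels A B"
  unfolding tensor_rels_def using assms
     apply -
  subgoal by (rule UnI1, rule UnI1, rule UnI1, intro CollectI exI conjI; (rule refl)?; assumption)
  subgoal by (rule UnI1, rule UnI1, rule UnI2, intro CollectI exI conjI; (rule refl)?; assumption)
  subgoal by (rule UnI1, rule UnI2, intro CollectI exI conjI; (rule refl)?; assumption)
  subgoal by (rule UnI2, intro CollectI exI conjI; (rule refl)?; assumption)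
  done

lemma tens_bilin:
  fixes A :: "('k::field, 'a, 'y) module_scheme" and B :: "('k, 'b, 'z) module_scheme"
  assumes A: "vectorspace class_ring A" and B: "vectorspace class_ring B"
  shows "bilin A B (tensor_prod A B) (tens A B)"
proof -
  interpret A: vectorspace class_ring A by fact
  interpret B: vectorspace class_ring B by fact
  note R = tensor_rels_closed[OF A B]
  have sA: "c \<odot>\<^bsub>A\<^esub> a \<in> carrier A" if "a \<in> carrier A" for c a
    using that by (intro A.smult_closed) simp_all
  have sB: "c \<odot>\<^bsub>B\<^esub> a \<in> carrier B" if "a \<in> carrier B" for c a
    using that by (intro B.smult_closed) simp_all
  show ?thesis unfolding bilin_def tens_def tensor_prod_def
    by (intro conjI ballI allI)
       (intro gen_closed gen_comb R SigmaI A.a_closed B.a_closed sA sB tensor_relsI; assumption)+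
qed

lemma natural_act:
  fixes V :: "('k::field, 'v) module" and W :: "('k, 'w) module"
  assumes V: "vectorspace class_ring V" and W: "vectorspace class_ring W" and p: "nondegenerate_pairing V W pair"
    and u: "u \<in> carrier V" "u' \<in> carrier W" and v: "v \<in> carrier V" and v': "v' \<in> carrier W"
  shows "act (natural_module V pair) (tens V W u u') v = pair v u' \<odot>\<^bsub>V\<^esub> u"
    and "act (conatural_module W pair) (tens V W u u') v' = \<ominus>\<^bsub>W\<^esub> (pair u v' \<odot>\<^bsub>W\<^esub> u')"
    and "bracket (gl_inf V W pair) (tens V W u u') (tens V W v v') =
      pair v u' \<odot>\<^bsub>tensor_prod V W\<^esub> tens V W u v' \<ominus>\<^bsub>tensor_prod V W\<^esub> pair u v' \<odot>\<^bsub>tensor_prod V W\<^esub> tens V W v u'"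
proof -
  interpret V: vectorspace class_ring V by fact
  interpret W: vectorspace class_ring W by fact
  note T = tensor_prod_vs[OF V W]
  interpret T: vectorspace class_ring "tensor_prod V W" by (rule T)
  note tb = tens_bilin[OF V W, unfolded bilin_def]
  note pp = p[unfolded nondegenerate_pairing_def]
  have V1: "c \<odot>\<^bsub>V\<^esub> a \<in> carrier V" "(c * d) \<odot>\<^bsub>V\<^esub> a = c \<odot>\<^bsub>V\<^esub> (d \<odot>\<^bsub>V\<^esub> a)"
    "(c + d) \<odot>\<^bsub>V\<^esub> a = c \<odot>\<^bsub>V\<^esub> a \<oplus>\<^bsub>V\<^esub> d \<odot>\<^bsub>V\<^esub> a" if "a \<in> carrier V" for c d a
    using that V.smult_closed[of c a] V.smult_assoc1[of c d a] V.smult_l_distr[of c d a] by simp_all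
  have W1: "c \<odot>\<^bsub>W\<^esub> a \<in> carrier W" "(c * d) \<odot>\<^bsub>W\<^esub> a = c \<odot>\<^bsub>W\<^esub> (d \<odot>\<^bsub>W\<^esub> a)"
    "(c + d) \<odot>\<^bsub>W\<^esub> a = c \<odot>\<^bsub>W\<^esub> a \<oplus>\<^bsub>W\<^esub> d \<odot>\<^bsub>W\<^esub> a" if "a \<in> carrier W" for c d a
    using that W.smult_closed[of c a] W.smult_assoc1[of c d a] W.smult_l_distr[of c d a] by simp_all
  have T1: "c \<odot>\<^bsub>tensor_prod V W\<^esub> a \<in> carrier (tensor_prod V W)"
    "(c * d) \<odot>\<^bsub>tensor_prod V W\<^esub> a = c \<odot>\<^bsub>tensor_prod V W\<^esub> (d \<odot>\<^bsub>tensor_prod V W\<^esub> a)"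
    "(c + d) \<odot>\<^bsub>tensor_prod V W\<^esub> a = c \<odot>\<^bsub>tensor_prod V W\<^esub> a \<oplus>\<^bsub>tensor_prod V W\<^esub> d \<odot>\<^bsub>tensor_prod V W\<^esub> a"
    if "a \<in> carrier (tensor_prod V W)" for c d a
    using that T.smult_closed[of c a] T.smult_assoc1[of c d a] T.smult_l_distr[of c d a] by simp_all
  have Vr: "c \<odot>\<^bsub>V\<^esub> (a \<oplus>\<^bsub>V\<^esub> b) = c \<odot>\<^bsub>V\<^esub> a \<oplus>\<^bsub>V\<^esub> c \<odot>\<^bsub>V\<^esub> b" if "a \<in> carrier V" "b \<in> carrier V" for c a b
    using V.smult_r_distr[of c a b] that by simp
  have Wr: "c \<odot>\<^bsub>W\<^esub> (a \<oplus>\<^bsub>W\<^esub> b) = c \<odot>\<^bsub>W\<^esub> a \<oplus>\<^bsub>W\<^esub> c \<odot>\<^bsub>W\<^esub> b" if "a \<in> carrier W" "b \<in> carrier W" for c a b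
    using W.smult_r_distr[of c a b] that by simp
  have Tr: "c \<odot>\<^bsub>tensor_prod V W\<^esub> (a \<oplus>\<^bsub>tensor_prod V W\<^esub> b) = c \<odot>\<^bsub>tensor_prod V W\<^esub> a \<oplus>\<^bsub>tensor_prod V W\<^esub> c \<odot>\<^bsub>tensor_prod V W\<^esub> b"
     if "a \<in> carrier (tensor_prod V W)" "b \<in> carrier (tensor_prod V W)" for c a b
    using T.smult_r_distr[of c a b] that by simp
  have Wm: "\<ominus>\<^bsub>W\<^esub> (c \<odot>\<^bsub>W\<^esub> a) = (-c) \<odot>\<^bsub>W\<^esub> a" if "a \<in> carrier W" for c a
    using W.smult_l_minus[of c a] that by (simp add: class_ring_simps)
  have Tn: "c \<odot>\<^bsub>tensor_prod V W\<^esub> (\<ominus>\<^bsub>tensor_prod V W\<^esub> a) = \<ominus>\<^bsub>tensor_prod V W\<^esub> (c \<odot>\<^bsub>tensor_prod V W\<^esub> a)"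
    if "a \<in> carrier (tensor_prod V W)" for c a
    using T.smult_r_minus[of c a] that by simp
  have [simp]: "with_act M a = \<lparr>carrier = carrier M, mult = mult M, one = one M, zero = zero M, add = add M, smult = smult M, act = a\<rparr>"
    for M :: "('x,'y) module" and a :: "'z \<Rightarrow> 'y \<Rightarrow> 'y" by (simp add: with_act_def module.defs lie_mod.defs)
  have "bilin V W V (\<lambda>u u'. pair v u' \<odot>\<^bsub>V\<^esub> u)" unfolding bilin_def
    using v pp by (simp add: V1 Vr mult.commute flip: V1(2))
  from tensor_lift_tens[OF V W V this u]
  show "act (natural_module V pair) (tens V W u u') v = pair v u' \<odot>\<^bsub>V\<^esub> u"
    by (simp add: natural_module_def)
  have "bilin V W W (\<lambda>u u'. \<ominus>\<^bsub>W\<^esub> (pair u v' \<odot>\<^bsub>W\<^esub> u'))" unfolding bilin_def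
    using v' pp by (simp add: W1 Wr Wm mult.commute W.minus_add flip: W1(2))
  from tensor_lift_tens[OF V W W this u]
  show "act (conatural_module W pair) (tens V W u u') v' = \<ominus>\<^bsub>W\<^esub> (pair u v' \<odot>\<^bsub>W\<^esub> u')"
    by (simp add: conatural_module_def)
  let ?T = "tensor_prod V W"
  let ?g = "\<lambda>u u' v v'. pair v u' \<odot>\<^bsub>?T\<^esub> tens V W u v' \<ominus>\<^bsub>?T\<^esub> pair u v' \<odot>\<^bsub>?T\<^esub> tens V W v u'"
  have tc: "tens V W a b \<in> carrier ?T" if "a \<in> carrier V" "b \<in> carrier W" for a b using tb that by blast
  have i: "bilin V W ?T (?g x x')" if x: "x \<in> carrier V" "x' \<in> carrier W" for x x'
    unfolding bilin_def using x pp tb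
    by (simp add: a_minus_def T.minus_add Tn T1 Tr tc T.a_ac V1 W1 mult.commute flip: T1(2))
  have o: "bilin V W ?T (\<lambda>x x'. ?g x x' v v')"
    unfolding bilin_def using v v' pp tb
    by (simp add: a_minus_def T.minus_add Tn T1 Tr tc T.a_ac V1 W1 mult.commute flip: T1(2))
  have il: "lift ?T (\<lambda>(v, v'). ?g x x' v v') (tens V W v v') = ?g x x' v v'"
    if x: "x \<in> carrier V" "x' \<in> carrier W" for x x' by (rule tensor_lift_tens[OF V W T i[OF x] v v'])
  let ?h = "\<lambda>x x'. lift ?T (\<lambda>(v, v'). ?g x x' v v') (tens V W v v')"
  have "bilin V W ?T ?h" using o unfolding bilin_def by (simp add: il V1 W1)
  from tensor_lift_tens[OF V W T this u]
  show "bracket (gl_inf V W pair) (tens V W u u') (tens V W v v') = ?g u u' v v'"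
    by (simp add: gl_inf_def Let_def module.defs lie_alg.defs il u)
qed

declare free_space_simps [simp del]

end

theory Submission
  imports Defs "HOL-Combinatorics.Cycles" "HOL-Library.Function_Algebras"
begin

text \<open>
  Let \<open>e\<close> be the Young symmetrizer of \<open>\<lambda>\<close>, scaled to an idempotent of \<open>A = k[S\<^sub>d]\<close>. Since \<open>e A e = k e\<close>,
  multiplication pairs \<open>e A\<close> with \<open>A e\<close>, non-degenerately because the coefficient of 1 in \<open>a b\<close> is a non-degenerate form.
  Dual bases \<open>x\<^sub>i\<close> of \<open>A e\<close> and \<open>y\<^sub>i\<close> of \<open>e A\<close> satisfy \<open>y\<^sub>i x\<^sub>j = \<delta>\<^sub>i\<^sub>j e\<close>, and \<open>\<Sum> x\<^sub>i y\<^sub>i\<close> is a central idempotent; comparing the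
  number of partitions with the number of conjugacy classes, these idempotents sum to 1. Hence the place
  permutations by \<open>x\<^sub>i\<close> and \<open>y\<^sub>i\<close> are the projections and inclusions of the decomposition of a tensor power, and
  the mixed case follows by tensoring.

  For indecomposability, \<open>V\<close> and \<open>V\<^sub>*\<close> have dual bases \<open>e\<^sub>i\<close>, \<open>f\<^sub>i\<close>. An endomorphism of the mixed tensor power is
  determined by its value on a single basis vector without repeated indices, as matrix units move the indices;
  by weight, this value is a combination of place permutations of the vector. So the place permutations span all
  endomorphisms, and \<open>e A e = k e\<close> leaves only the scalars on \<open>\<Gamma>\<close>.
\<close>

text \<open>Contractions also shape the coordinate argument. A basis vector without repeated indices
  is killed by every contraction, so it does not generate the tensor power. That it still determines
  an endomorphism is where infinite dimension enters: a difference of two endomorphisms that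
  vanishes on it might otherwise factor through a contraction and land in an invariant such as the
  sum of all e_i tensor f_i. This sum is infinite, whereas each image has finite support; that is
  assumption \<open>K_fin\<close>, which lemma \<open>support\<close> exploits. The field need not
  be algebraically closed. The relation e A e = k e, obtained from the combinatorics of tableaux,
  guarantees that no field extension or division algebra appears, so multiplicities are dimensions
  over k itself.\<close>

no_notation m_inv  (\<open>(\<open>open_block notation=\<open>prefix inv\<close>\<close>inv\<index> _)\<close> [81] 80)

section \<open>Combinatorics of the row-numbered tableau\<close>

lemma sum_list_take_mono: "m \<le> n \<Longrightarrow> sum_list (take m xs) \<le> sum_list (take n xs)" for xs :: "nat list"
proof -
  assume "m \<le> n"
  then obtain k where "n = m + k" using le_Suc_ex by blast
  then show ?thesis by (simp add: take_add)
qed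

lemma sum_list_take_le: "sum_list (take m xs) \<le> sum_list xs" for xs :: "nat list"
  by (metis append_take_drop_id le_add1 sum_list_append)

text \<open>The partial sums of the parts increase, so the \<open>LEAST\<close> in
  \<open>tab_row\<close> is governed by comparison with a single partial sum. Rows, columns and
  counts below are computed from this equivalence.\<close>

lemma tab_row_less_iff: "k < sum_list lam \<Longrightarrow> tab_row lam k < i \<longleftrightarrow> k < sum_list (take i lam)"
proof
  assume k: "k < sum_list lam" and i: "k < sum_list (take i lam)"
  then obtain i' where i': "i = Suc i'" by (cases i) auto
  have "tab_row lam k \<le> i'" unfolding tab_row_def using i i' by (intro Least_le) simp
  then show "tab_row lam k < i" using i' by simp
next
  assume k: "k < sum_list lam" and i: "tab_row lam k < i"
  have "k < sum_list (take (Suc (tab_row lam k)) lam)" unfolding tab_row_def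
    by (rule LeastI[of _ "length lam"]) (use k in simp)
  also have "\<dots> \<le> sum_list (take i lam)" by (rule sum_list_take_mono) (use i in simp)
  finally show "k < sum_list (take i lam)" .
qed

lemma tab_row_col:
  assumes k: "k < sum_list lam"
  shows "tab_row lam k < length lam" "tab_col lam k < lam ! tab_row lam k"
    "sum_list (take (tab_row lam k) lam) + tab_col lam k = k"
proof -
  show 1: "tab_row lam k < length lam" using tab_row_less_iff[OF k] k by simp
  have 2: "sum_list (take (tab_row lam k) lam) \<le> k"
    using tab_row_less_iff[OF k, of "tab_row lam k"] by simp
  have 3: "k < sum_list (take (Suc (tab_row lam k)) lam)"
    using tab_row_less_iff[OF k, of "Suc (tab_row lam k)"] by simp
  show "tab_col lam k < lam ! tab_row lam k" using 1 2 3
    by (auto simp: tab_col_def take_Suc_conv_app_nth)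
  show "sum_list (take (tab_row lam k) lam) + tab_col lam k = k" using 2 by (simp add: tab_col_def)
qed

text \<open>The entry of a cell is the number of entries in the rows above it plus its column index.
  Together with \<open>tab_inj\<close> this identifies the entries with the cells of the
  diagram.\<close>

lemma tab_cell:
  assumes "i < length lam" "j < lam ! i"
  obtains k where "k < sum_list lam" "tab_row lam k = i" "tab_col lam k = j"
proof -
  define k where "k = sum_list (take i lam) + j"
  have "k < sum_list (take (Suc i) lam)" using assms by (simp add: k_def take_Suc_conv_app_nth)
  then have k: "k < sum_list lam" using sum_list_take_le[of "Suc i" lam] by linarith
  have "tab_row lam k = i"
    using tab_row_less_iff[OF k, of i] tab_row_less_iff[OF k, of "Suc i"] \<open>k < sum_list (take (Suc i) lam)\<close>
    by (simp add: k_def)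
  moreover from this have "tab_col lam k = j" by (simp add: tab_col_def k_def)
  ultimately show ?thesis using that k by blast
qed

lemma tab_inj:
  assumes "k < sum_list lam" "k' < sum_list lam" "tab_row lam k = tab_row lam k'" "tab_col lam k = tab_col lam k'"
  shows "k = k'"
  using tab_row_col(3)[OF assms(1)] tab_row_col(3)[OF assms(2)] unfolding assms(3,4) by linarith

text \<open>Applied below to the set of rows that meet a given column.\<close>

lemma downset_eq_lessThan:
  fixes S :: "nat set"
  assumes "finite S" "\<And>x y. x \<in> S \<Longrightarrow> y < x \<Longrightarrow> y \<in> S"
  shows "S = {..<card S}"
proof -
  have "\<exists>n. S = {..<n}"
  proof (cases "S = {}")
    case True
    then have "S = {..<0}" by simp
    then show ?thesis ..
  next
    case False
    have "S = {..<Suc (Max S)}"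
    proof
      show "S \<subseteq> {..<Suc (Max S)}" using assms(1) by (auto simp: less_Suc_eq_le)
      show "{..<Suc (Max S)} \<subseteq> S" using assms(2)[OF Max_in[OF assms(1) False]] Max_in[OF assms(1) False]
        by (auto simp: less_Suc_eq)
    qed
    then show ?thesis by blast
  qed
  then show ?thesis by force
qed

lemma partitionsD:
  assumes "lam \<in> partitions d"
  shows "sum_list lam = d" "sorted_wrt (\<ge>) lam" "\<And>n. n \<in> set lam \<Longrightarrow> n > 0"
  using assms by (auto simp: partitions_def)

text \<open>Since the parts do not increase, the rows that meet column j form an initial segment,
  whose length is the column length L j. This translates partial sums of parts into sums of min i (L
  j) over the columns, the form needed for comparing shapes.\<close>

lemma tab_column:
  assumes lam: "lam \<in> partitions d"
  defines "L \<equiv> \<lambda>j. card {k. k < d \<and> tab_col lam k = j}"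
  shows "card {k. k < d \<and> tab_row lam k < i \<and> tab_col lam k = j} = min i (L j)"
    and "i < L j \<Longrightarrow> \<exists>k<d. tab_row lam k = i \<and> tab_col lam k = j"
proof -
  note d = partitionsD(1)[OF lam]
  let ?S = "\<lambda>j. {k. k < d \<and> tab_col lam k = j}"
  have inj: "inj_on (tab_row lam) (?S j)" for j
    by (rule inj_onI, rule tab_inj[of _ lam]) (simp_all add: d)
  have img: "tab_row lam ` ?S j = {i. i < length lam \<and> j < lam ! i}" for j
  proof
    show "tab_row lam ` ?S j \<subseteq> {i. i < length lam \<and> j < lam ! i}"
      using tab_row_col(1,2)[of _ lam] by (auto simp: d)
    show "{i. i < length lam \<and> j < lam ! i} \<subseteq> tab_row lam ` ?S j"
    proof
      fix i assume "i \<in> {i. i < length lam \<and> j < lam ! i}"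
      then obtain k where "k < d" "tab_row lam k = i" "tab_col lam k = j"
        using tab_cell[of i lam j] d by auto
      then show "i \<in> tab_row lam ` ?S j" by blast
    qed
  qed
  have S: "tab_row lam ` ?S j = {..<L j}" for j
  proof -
    have "tab_row lam ` ?S j = {..<card (tab_row lam ` ?S j)}"
    proof (rule downset_eq_lessThan)
      fix x y assume "x \<in> tab_row lam ` ?S j" "y < x"
      then show "y \<in> tab_row lam ` ?S j" unfolding img
        using sorted_wrt_nth_less[OF partitionsD(2)[OF lam], of y x] by auto
    qed simp
    then show ?thesis by (simp add: card_image[OF inj] L_def)
  qed
  have "tab_row lam ` {k. k < d \<and> tab_row lam k < i \<and> tab_col lam k = j} = {..<i} \<inter> tab_row lam ` ?S j"
    by auto
  also have "\<dots> = {..<min i (L j)}" unfolding S by auto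
  finally have *: "tab_row lam ` {k. k < d \<and> tab_row lam k < i \<and> tab_col lam k = j} = {..<min i (L j)}" .
  have "card (tab_row lam ` {k. k < d \<and> tab_row lam k < i \<and> tab_col lam k = j}) =
     card {k. k < d \<and> tab_row lam k < i \<and> tab_col lam k = j}"
    by (rule card_image) (rule inj_on_subset[OF inj[of j]], auto)
  then show "card {k. k < d \<and> tab_row lam k < i \<and> tab_col lam k = j} = min i (L j)"
    unfolding * by simp
  show "\<exists>k<d. tab_row lam k = i \<and> tab_col lam k = j" if "i < L j"
  proof -
    have "i \<in> tab_row lam ` ?S j" unfolding S using that by simp
    then show ?thesis by blast
  qed
qed

lemma card_tab_row_less:
  assumes "lam \<in> partitions d"
  shows "card {k. k < d \<and> tab_row lam k < i} = sum_list (take i lam)"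
proof -
  note d = partitionsD(1)[OF assms]
  have "{k. k < d \<and> tab_row lam k < i} = {..<sum_list (take i lam)}"
    using tab_row_less_iff[of _ lam i] sum_list_take_le[of i lam] by (auto simp: d)
  then show ?thesis by simp
qed

lemma card_fibres:
  fixes c :: "nat \<Rightarrow> nat"
  assumes "\<And>x. x < d \<Longrightarrow> c x < d"
  shows "(\<Sum>j<d. card {x. x < d \<and> P x \<and> c x = j}) = card {x. x < d \<and> P x}"
proof -
  have "(\<Sum>j<d. sum (\<lambda>_. 1::nat) {x \<in> {x. x < d \<and> P x}. c x = j}) = sum (\<lambda>_. 1) {x. x < d \<and> P x}"
    by (rule sum.group) (use assms in auto)
  then show ?thesis by (simp add: conj_assoc)
qed

lemma tab_col_less: "k < sum_list lam \<Longrightarrow> tab_col lam k < sum_list lam"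
  using tab_row_col(3)[of k lam] by linarith

text \<open>Read \<open>tab_col mu (inv \<sigma> x)\<close> as the column of x in the tableau of
  shape mu with entries renamed by \<sigma>. By hypothesis each row of lam meets such a column at
  most once, so at most min i (L j) entries of the first i rows lie in column j; summing over j
  gives dominance. For equal shapes all bounds are attained, and this rigidity allows each row to be
  rearranged so that every entry reaches its column.\<close>

lemma von_neumann:
  assumes lam: "lam \<in> partitions d" and mu: "mu \<in> partitions d" and s: "\<sigma> permutes {..<d}"
    and star: "\<And>x y. \<lbrakk>x < d; y < d; x \<noteq> y; tab_row lam x = tab_row lam y\<rbrakk> \<Longrightarrow>
        tab_col mu (inv \<sigma> x) \<noteq> tab_col mu (inv \<sigma> y)"
  shows "sum_list (take i lam) \<le> sum_list (take i mu)"
    and "lam = mu \<Longrightarrow> \<exists>\<rho>\<in>row_stabilizer lam. \<exists>\<gamma>\<in>col_stabilizer lam. \<sigma> = \<rho> \<circ> \<gamma>"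
proof -
  note d = partitionsD(1)[OF lam] and d' = partitionsD(1)[OF mu]
  define c where "c x = tab_col mu (inv \<sigma> x)" for x
  define N where "N i j = card {x. x < d \<and> tab_row lam x < i \<and> c x = j}" for i j
  define L where "L j = card {k. k < d \<and> tab_col mu k = j}" for j
  note s' = permutes_inv[OF s]
  have iss: "inv \<sigma> x < d \<longleftrightarrow> x < d" and ss: "\<sigma> x < d \<longleftrightarrow> x < d" for x
    using permutes_in_image[OF s'] permutes_in_image[OF s] by auto
  have c: "c x < d" if "x < d" for x
    using that tab_col_less[of "inv \<sigma> x" mu] iss d' by (simp add: c_def)
  have N1: "N i j \<le> i" for i j
  proof -
    have "card (tab_row lam ` {x. x < d \<and> tab_row lam x < i \<and> c x = j}) \<le> card {..<i}"
      by (rule card_mono) auto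
    moreover have "inj_on (tab_row lam) {x. x < d \<and> tab_row lam x < i \<and> c x = j}"
      by (rule inj_onI) (use star in \<open>auto simp: c_def\<close>)
    ultimately show ?thesis by (simp add: N_def card_image)
  qed
  have N2: "N i j \<le> L j" for i j
  proof -
    have "card (inv \<sigma> ` {x. x < d \<and> tab_row lam x < i \<and> c x = j}) \<le> L j" unfolding L_def
      by (rule card_mono) (auto simp: c_def iss)
    then show ?thesis using permutes_inj[OF s'] by (simp add: N_def card_image inj_on_subset)
  qed
  have N3: "N i j \<le> min i (L j)" for i j using N1 N2 by simp
  have SN: "(\<Sum>j<d. N i j) = sum_list (take i lam)" for i
    unfolding N_def card_tab_row_less[OF lam, symmetric] by (rule card_fibres) (rule c)
  have SL: "(\<Sum>j<d. min i (L j)) = sum_list (take i mu)" for i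
    unfolding card_tab_row_less[OF mu, symmetric] L_def tab_column(1)[OF mu, symmetric]
    by (rule card_fibres) (use tab_col_less d' in blast)
  show "sum_list (take i lam) \<le> sum_list (take i mu)"
    unfolding SN[symmetric] SL[symmetric] by (rule sum_mono) (rule N3)
  assume eq: "lam = mu"
  \<comment> \<open>For equal shapes the sums of both sides over j agree, so the termwise inequality
    is an equality.\<close>
  have N4: "N i j = min i (L j)" if "j < d" for i j
    using sum_mono_inv[of "N i" "{..<d}" "\<lambda>j. min i (L j)" j] SN[of i] SL[of i] N3 that
    unfolding eq by auto
  \<comment> \<open>When the row i of x is added to the rows above it, its column j gains the entry
    x. Hence min i (L j) grows, that is i < L j, and the diagram has a cell in row i and column
    j.\<close>
  have cell: "\<exists>k<d. tab_row lam k = tab_row lam x \<and> tab_col lam k = c x" if x: "x < d" for x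
  proof -
    let ?i = "tab_row lam x" and ?j = "c x"
    have "insert x {y. y < d \<and> tab_row lam y < ?i \<and> c y = ?j} \<subseteq> {y. y < d \<and> tab_row lam y < Suc ?i \<and> c y = ?j}"
      using x by auto
    from card_mono[OF _ this] have "Suc (N ?i ?j) \<le> N (Suc ?i) ?j" by (simp add: N_def)
    then have "?i < L ?j" using N4[OF c[OF x]] by simp
    then show ?thesis using tab_column(2)[OF mu] unfolding L_def eq by blast
  qed
  \<comment> \<open>\<open>D\<close> slides x inside its row to the column prescribed by \<sigma>.
    Then \<open>D \<circ> \<sigma>\<close> preserves columns, and \<open>inv D\<close> is the row
    factor of \<sigma>.\<close>
  define D where "D x = (if x < d then SOME k. k < d \<and> tab_row lam k = tab_row lam x \<and> tab_col lam k = c x else x)" for x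
  have D: "D x < d" "tab_row lam (D x) = tab_row lam x" "tab_col lam (D x) = c x" if "x < d" for x
    using someI_ex[OF cell[OF that]] that by (auto simp: D_def)
  have "D permutes {..<d}"
  proof (rule bij_imp_permutes)
    have "inj_on D {..<d}"
    proof (rule inj_onI)
      fix x y assume *: "x \<in> {..<d}" "y \<in> {..<d}" "D x = D y"
      then have "tab_row lam x = tab_row lam y" "c x = c y" using D by (metis lessThan_iff)+
      then show "x = y" using star * by (auto simp: c_def)
    qed
    moreover have "D ` {..<d} \<subseteq> {..<d}" using D by auto
    ultimately show "bij_betw D {..<d} {..<d}"
      by (simp add: bij_betw_def endo_inj_surj)
  qed (simp add: D_def)
  note D' = this permutes_inv[OF this]
  have iD: "inv D x < d \<longleftrightarrow> x < d" for x using permutes_in_image[OF D'(2)] by auto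
  have "inv D \<in> row_stabilizer lam" unfolding row_stabilizer_def d
  proof (intro CollectI conjI D'(2) allI impI)
    fix k assume "k < d"
    then show "tab_row lam (inv D k) = tab_row lam k"
      using D(2)[of "inv D k"] iD[of k] permutes_inverses(1)[OF D'(1)] by simp
  qed
  moreover have "D \<circ> \<sigma> \<in> col_stabilizer lam" unfolding col_stabilizer_def d
    using permutes_compose[OF s D'(1)] D(3) ss permutes_inverses(2)[OF s] by (simp add: c_def eq)
  moreover have "\<sigma> = inv D \<circ> (D \<circ> \<sigma>)"
    using permutes_inv_o(2)[OF D'(1)] by (simp add: o_assoc)
  ultimately show "\<exists>\<rho>\<in>row_stabilizer lam. \<exists>\<gamma>\<in>col_stabilizer lam. \<sigma> = \<rho> \<circ> \<gamma>" by blast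
qed

text \<open>Partial sums determine a sequence only up to trailing zeros; positivity of the parts
  excludes these.\<close>

lemma partition_eqI:
  fixes lam mu :: "nat list"
  assumes "\<And>i. sum_list (take i lam) = sum_list (take i mu)" "\<forall>n\<in>set lam. n > 0" "\<forall>n\<in>set mu. n > 0"
  shows "lam = mu"
  using assms
proof (induction lam arbitrary: mu)
  case Nil
  then show ?case using Nil.prems(1)[of 1] by (cases mu) auto
next
  case (Cons a lam)
  obtain b mu' where mu: "mu = b # mu'" using Cons.prems(1)[of 1] Cons.prems(2) by (cases mu) auto
  have "a = b" using Cons.prems(1)[of 1] mu by simp
  moreover have "lam = mu'"
    by (rule Cons.IH) (use Cons.prems(1)[of "Suc _"] Cons.prems(2,3) mu \<open>a = b\<close> in auto)
  ultimately show ?case using mu by simp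
qed

lemma finite_partitions: "finite (partitions d)"
proof (rule finite_subset)
  show "partitions d \<subseteq> {xs. set xs \<subseteq> {..d} \<and> length xs \<le> d}"
  proof
    fix lam assume "lam \<in> partitions d"
    note p = partitionsD[OF this]
    have "set lam \<subseteq> {..d}" using member_le_sum_list[of _ lam] p(1) by auto
    moreover have "length lam \<le> sum_list lam" if "\<forall>n\<in>set lam. n > 0" for lam :: "nat list"
      using that by (induction lam) auto
    ultimately show "lam \<in> {xs. set xs \<subseteq> {..d} \<and> length xs \<le> d}" using p by auto
  qed
qed (rule finite_lists_length_le, simp)

section \<open>Cycle types\<close>

text \<open>Fixed points are listed as cycles of length one, so that the lengths add up to the size
  of S and form a partition once sorted.\<close>

definition cycles_of :: "(nat \<Rightarrow> nat) \<Rightarrow> nat set \<Rightarrow> nat list list \<Rightarrow> bool" where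
  "cycles_of \<sigma> S css \<longleftrightarrow> distinct (concat css) \<and> set (concat css) = S \<and> [] \<notin> set css \<and>
     (\<forall>cs\<in>set css. \<forall>i<length cs. \<sigma> (cs ! i) = cs ! (Suc i mod length cs))"

lemma cycle_of_list_nth:
  assumes "distinct cs" "i < length cs"
  shows "cycle_of_list cs (cs ! i) = cs ! (Suc i mod length cs)"
proof -
  have "map (cycle_of_list cs) cs = rotate1 cs" using cyclic_rotation[OF assms(1), of 1] by simp
  then have "map (cycle_of_list cs) cs ! i = rotate1 cs ! i" by simp
  then show ?thesis using assms by (simp add: nth_rotate1)
qed

lemma cycle_decomp_permutes: "cycle_decomp S \<sigma> \<Longrightarrow> \<sigma> permutes S"
proof (induction rule: cycle_decomp.induct)
  case (comp I p cs)
  have "p permutes set cs \<union> I" "cycle_of_list cs permutes set cs \<union> I"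
    using comp.IH cycle_permutes[of cs] by (auto intro: permutes_subset)
  then show ?case by (rule permutes_compose)
qed (simp add: permutes_id flip: id_def)

lemma cycles_of_exists:
  assumes "cycle_decomp S \<sigma>"
  shows "\<exists>css. cycles_of \<sigma> S css"
  using assms
proof (induction rule: cycle_decomp.induct)
  case empty
  then show ?case by (intro exI[of _ "[]"]) (simp add: cycles_of_def)
next
  case (comp I p cs)
  then obtain css where css: "cycles_of p I css" by blast
  show ?case
  proof (cases "cs = []")
    case True
    then show ?thesis using css by auto
  next
    case False
    have pI: "p permutes I" using comp.hyps(1) by (rule cycle_decomp_permutes)
    have "cycles_of (cycle_of_list cs \<circ> p) (set cs \<union> I) (cs # css)"
      unfolding cycles_of_def
    proof (intro conjI ballI allI impI)
      fix c i assume c: "c \<in> set (cs # css)" and i: "i < length c"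
      show "(cycle_of_list cs \<circ> p) (c ! i) = c ! (Suc i mod length c)"
      proof (cases "c = cs")
        case True
        have "cs ! i \<notin> I" using comp.hyps(3) i True nth_mem[of i cs] by blast
        then have "p (cs ! i) = cs ! i" by (rule permutes_not_in[OF pI])
        then show ?thesis using True i comp.hyps(2) by (simp add: cycle_of_list_nth)
      next
        case False
        then have c': "c \<in> set css" using c by simp
        have "c ! (Suc i mod length c) \<in> set c" using i by (intro nth_mem) (auto intro: mod_less_divisor)
        then have "c ! (Suc i mod length c) \<notin> set cs" using c' css comp.hyps(3) by (auto simp: cycles_of_def)
        then show ?thesis using c' css i id_outside_supp[of "c ! (Suc i mod length c)"]
          by (auto simp: cycles_of_def)
      qed
    qed (use css comp.hyps False in \<open>auto simp: cycles_of_def\<close>)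
    then show ?thesis by blast
  qed
qed

lemma cycles_of_partition:
  assumes "\<sigma> permutes {..<d}"
  shows "\<exists>css. cycles_of \<sigma> {..<d} css \<and> map length css \<in> partitions d"
proof -
  have "cycle_decomp {..<d} \<sigma>" using assms by (intro cycle_decomposition) auto
  then obtain css where css: "cycles_of \<sigma> {..<d} css" using cycles_of_exists by blast
  define ds where "ds = rev (sort_key length css)"
  have m: "mset ds = mset css" by (simp add: ds_def)
  have set_eq: "set ds = set css" by (simp add: ds_def)
  have len: "length (concat xs) = sum_list (map length xs)" for xs :: "nat list list" 
    by (simp add: length_concat)
  have mc: "mset (concat ds) = mset (concat css)"
    using m by (metis mset_concat mset_map sum_mset_sum_list)
  then have dist: "distinct (concat ds)" using css mset_eq_imp_distinct_iff
    unfolding cycles_of_def by blast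
  moreover have "set (concat ds) = {..<d}" using mc css mset_eq_setD unfolding cycles_of_def by blast
  ultimately have "cycles_of \<sigma> {..<d} ds" using css unfolding cycles_of_def set_eq by blast
  moreover have "map length ds \<in> partitions d"
  proof -
    have "sorted (map length (sort_key length css))" by simp
    then have "sorted_wrt (\<ge>) (map length ds)" by (simp add: ds_def rev_map[symmetric] sorted_wrt_rev)
    moreover have "sum_list (map length ds) = d"
      using distinct_card[OF dist] \<open>set (concat ds) = {..<d}\<close> by (simp add: len)
    ultimately show ?thesis using css by (auto simp: partitions_def set_eq cycles_of_def)
  qed
  ultimately show ?thesis by blast
qed

text \<open>Write the cycles of \<tau> below those of \<sigma> and send each entry to the one below
  it. As matching cycles have equal length, this h carries the shift inside a cycle of \<sigma> to
  the shift inside a cycle of \<tau>.\<close>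

lemma conjugate_of_cycles:
  assumes s: "\<sigma> permutes {..<d}" and t: "\<tau> permutes {..<d}"
    and cs: "cycles_of \<sigma> {..<d} css" and ct: "cycles_of \<tau> {..<d} cts" and len: "map length css = map length cts"
  obtains h where "h permutes {..<d}" "\<tau> = h \<circ> \<sigma> \<circ> inv h"
proof -
  have l: "length css = length cts" using len by (metis length_map)
  have li: "length (css ! i) = length (cts ! i)" if "i < length css" for i
    using len that l by (metis nth_map)
  have lc: "length (concat css) = d" "length (concat cts) = d"
    using distinct_card[of "concat css"] distinct_card[of "concat cts"] cs ct
    by (simp_all add: cycles_of_def)
  define h where "h x = (if x < d then concat cts ! (THE k. k < d \<and> concat css ! k = x) else x)" for x
  have dc: "distinct (concat css)" "distinct (concat cts)" "set (concat css) = {..<d}" "set (concat cts) = {..<d}"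
    using cs ct by (simp_all add: cycles_of_def)
  have hk: "h (concat css ! k) = concat cts ! k" if "k < d" for k
  proof -
    have "concat css ! k < d" using dc(3) nth_mem[of k "concat css"] that lc by auto
    moreover have "(THE k'. k' < d \<and> concat css ! k' = concat css ! k) = k"
      using dc(1) that lc by (intro the_equality) (auto simp: nth_eq_iff_index_eq)
    ultimately show ?thesis by (simp add: h_def)
  qed
  have "h permutes {..<d}"
  proof (rule bij_imp_permutes)
    have sur: "h ` {..<d} = {..<d}"
    proof -
      have "{..<d} = (\<lambda>k. concat css ! k) ` {..<d}" using dc(3) lc unfolding set_conv_nth by auto
      then have "h ` {..<d} = h ` (\<lambda>k. concat css ! k) ` {..<d}" by simp
      also have "\<dots> = (\<lambda>k. concat cts ! k) ` {..<d}" unfolding image_image using hk by (intro image_cong) auto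
      also have "\<dots> = {..<d}" using dc(4) lc unfolding set_conv_nth by auto
      finally show ?thesis .
    qed
    then show "bij_betw h {..<d} {..<d}" by (simp add: bij_betw_def eq_card_imp_inj_on)
  qed (simp add: h_def)
  have hij: "h (css ! i ! j) = cts ! i ! j" if "i < length css" "j < length (css ! i)" for i j
  proof -
    \<comment> \<open>The position in the concatenation of entry j of cycle i. It is the same in
      both lists, because the preceding cycles have equal lengths.\<close>
    define k where "k = sum_list (map length (take i css)) + j"
    have len_t: "map length (take i css) = map length (take i cts)" using len by (metis take_map)
    have "concat css ! k = css ! i ! j" if "i < length css" "j < length (css ! i)" "k = sum_list (map length (take i css)) + j" for css :: "nat list list" and k
    proof -
      have "css = take i css @ css ! i # drop (Suc i) css" using that by (simp add: id_take_nth_drop)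
      then have "concat css = concat (take i css) @ css ! i @ concat (drop (Suc i) css)"
        by (metis concat.simps(2) concat_append)
      then show ?thesis using that by (simp add: nth_append length_concat)
    qed
    note kk = this
    have "k < d"
    proof -
      have "css = take i css @ css ! i # drop (Suc i) css" using that by (simp add: id_take_nth_drop)
      then have "concat css = concat (take i css) @ css ! i @ concat (drop (Suc i) css)"
        by (metis concat.simps(2) concat_append)
      then have "d = length (concat (take i css) @ css ! i @ concat (drop (Suc i) css))" using lc by simp
      then show ?thesis using that by (simp add: k_def length_concat)
    qed
    from hk[OF this] show ?thesis
      using kk[OF that k_def] kk[of cts k] that l li[of i] len_t by (simp add: k_def)
  qed
  have "\<tau> (h x) = h (\<sigma> x)" if x: "x < d" for x
  proof -
    have "x \<in> set (concat css)" using x dc(3) by simp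
    then obtain i j where ij: "i < length css" "j < length (css ! i)" "x = css ! i ! j"
      by (auto simp: in_set_conv_nth)
    have "Suc j mod length (css ! i) < length (css ! i)" using ij by (intro mod_less_divisor) auto
    moreover have "\<sigma> x = css ! i ! (Suc j mod length (css ! i))"
      using cs ij nth_mem[OF ij(1)] unfolding cycles_of_def by blast
    moreover have "\<tau> (cts ! i ! j) = cts ! i ! (Suc j mod length (cts ! i))"
      using ct ij l li[of i] nth_mem[of i cts] unfolding cycles_of_def by simp
    ultimately show ?thesis using hij ij li[of i] by simp
  qed
  then have "\<tau> \<circ> h = h \<circ> \<sigma>"
    using permutes_not_in[OF s] permutes_not_in[OF t] permutes_not_in[OF \<open>h permutes {..<d}\<close>] 
    by (intro ext) (metis comp_apply lessThan_iff)
  then have "\<tau> = h \<circ> \<sigma> \<circ> inv h"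
    using permutes_inv_o(1)[OF \<open>h permutes {..<d}\<close>] by (metis comp_assoc comp_id)
  with \<open>h permutes {..<d}\<close> show ?thesis by (rule that)
qed

section \<open>Linear maps\<close>

abbreviation lhom :: "('k::field, 'm, 'y) module_scheme \<Rightarrow> ('k, 'n, 'z) module_scheme \<Rightarrow> ('m \<Rightarrow> 'n) set" where
  "lhom M N \<equiv> LinearCombinations.module_hom class_ring M N"

text \<open>The scalars form \<open>class_ring\<close>, whose carrier is \<open>UNIV\<close>; the
  module axioms are restated here without membership conditions on scalars, in a form suited to
  rewriting.\<close>

locale kvs = vectorspace "class_ring :: 'k::field ring" M for M :: "('k::field, 'm, 'z) module_scheme" (structure)
begin

lemma scl [simp]: "x \<in> carrier M \<Longrightarrow> c \<odot> x \<in> carrier M"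
  by (rule smult_closed) simp_all
lemma sc_add: "x \<in> carrier M \<Longrightarrow> (c + d) \<odot> x = c \<odot> x \<oplus> d \<odot> x"
  using smult_l_distr[of c d x] by simp
lemma sc_sum_right: "x \<in> carrier M \<Longrightarrow> y \<in> carrier M \<Longrightarrow> c \<odot> (x \<oplus> y) = c \<odot> x \<oplus> c \<odot> y"
  using smult_r_distr[of c x y] by simp
lemma sc_sc: "x \<in> carrier M \<Longrightarrow> c \<odot> (d \<odot> x) = (c * d) \<odot> x"
  using smult_assoc1[of c d x] by simp
lemma sc_one [simp]: "x \<in> carrier M \<Longrightarrow> 1 \<odot> x = x"
  using smult_one by simp
lemma sc_zero [simp]: "x \<in> carrier M \<Longrightarrow> 0 \<odot> x = \<zero>"
  using smult_l_null[of x] by simp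
lemma sc_zero' [simp]: "c \<odot> \<zero> = \<zero>"
  using smult_r_null[of c] by simp
lemma sc_minus: "x \<in> carrier M \<Longrightarrow> (- c) \<odot> x = \<ominus> (c \<odot> x)"
  using smult_l_minus[of c x] by (simp add: class_ring_simps)
lemma sc_finsum: "finite I \<Longrightarrow> (\<And>i. i \<in> I \<Longrightarrow> g i \<in> carrier M) \<Longrightarrow>
    c \<odot> (\<Oplus>i\<in>I. g i) = (\<Oplus>i\<in>I. c \<odot> g i)"
  by (rule finsum_smult) auto
lemma finsum_sc: "finite I \<Longrightarrow> x \<in> carrier M \<Longrightarrow> (\<Oplus>i\<in>I. c i \<odot> x) = (\<Sum>i\<in>I. c i) \<odot> x"
  by (induction I rule: finite_induct) (auto simp: sc_add)
lemma finsum_add: "(\<And>i. i \<in> I \<Longrightarrow> f i \<in> carrier M) \<Longrightarrow> (\<And>i. i \<in> I \<Longrightarrow> g i \<in> carrier M) \<Longrightarrow>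
    (\<Oplus>i\<in>I. f i \<oplus> g i) = (\<Oplus>i\<in>I. f i) \<oplus> (\<Oplus>i\<in>I. g i)"
  by (rule finsum_addf) auto
lemma finsum_eq: "(\<And>i. i \<in> I \<Longrightarrow> f i = g i) \<Longrightarrow> (\<And>i. i \<in> I \<Longrightarrow> g i \<in> carrier M) \<Longrightarrow> 
    (\<Oplus>i\<in>I. f i) = (\<Oplus>i\<in>I. g i)"
  by (rule finsum_cong') auto
lemma finsum_cl: "(\<And>i. i \<in> I \<Longrightarrow> f i \<in> carrier M) \<Longrightarrow> (\<Oplus>i\<in>I. f i) \<in> carrier M"
  by (rule finsum_closed) auto
lemma finsum_swap:
  assumes "finite I" "finite J" "\<And>i j. i \<in> I \<Longrightarrow> j \<in> J \<Longrightarrow> f i j \<in> carrier M"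
  shows "(\<Oplus>i\<in>I. \<Oplus>j\<in>J. f i j) = (\<Oplus>j\<in>J. \<Oplus>i\<in>I. f i j)"
  using assms(1,3)
proof (induction I rule: finite_induct)
  case empty
  then show ?case by simp
next
  case (insert a I)
  have "(\<Oplus>j\<in>J. \<Oplus>i\<in>insert a I. f i j) = (\<Oplus>j\<in>J. f a j \<oplus> (\<Oplus>i\<in>I. f i j))"
    using insert by (intro finsum_eq finsum_insert) (auto intro: finsum_cl)
  also have "\<dots> = (\<Oplus>j\<in>J. f a j) \<oplus> (\<Oplus>j\<in>J. \<Oplus>i\<in>I. f i j)"
    using insert by (intro finsum_add) (auto intro: finsum_cl)
  finally show ?case using insert by (subst finsum_insert) (auto intro!: finsum_cl)
qed
lemma finsum_remove: "finite I \<Longrightarrow> i \<in> I \<Longrightarrow> (\<And>i. i \<in> I \<Longrightarrow> f i \<in> carrier M) \<Longrightarrow>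
   (\<Oplus>j\<in>I. f j) = f i \<oplus> (\<Oplus>j\<in>I - {i}. f j)"
  by (subst insert_Diff[symmetric, of i I], assumption, subst finsum_insert) auto
lemma finsum_delta: "finite I \<Longrightarrow> i \<in> I \<Longrightarrow> (\<And>j. j \<in> I \<Longrightarrow> f j \<in> carrier M) \<Longrightarrow>
   (\<And>j. j \<in> I \<Longrightarrow> j \<noteq> i \<Longrightarrow> f j = \<zero>) \<Longrightarrow> (\<Oplus>j\<in>I. f j) = f i"
proof -
  assume *: "finite I" "i \<in> I" "\<And>j. j \<in> I \<Longrightarrow> f j \<in> carrier M" "\<And>j. j \<in> I \<Longrightarrow> j \<noteq> i \<Longrightarrow> f j = \<zero>"
  have "(\<Oplus>j\<in>I - {i}. f j) = (\<Oplus>j\<in>I - {i}. \<zero>)" by (rule finsum_eq) (use * in auto)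
  then show ?thesis using finsum_remove[of I i f] * by (simp add: finsum_zero)
qed
lemma sub_zero_eq: "x \<in> carrier M \<Longrightarrow> y \<in> carrier M \<Longrightarrow> x \<ominus> y = \<zero> \<Longrightarrow> x = y"
  by simp
lemma minus_sc: "x \<in> carrier M \<Longrightarrow> \<ominus> x = (-1) \<odot> x"
  by (simp add: sc_minus)

end

lemma kvsI: "vectorspace class_ring M \<Longrightarrow> kvs M"
  by (simp add: kvs_def)

lemma vectorspaceI:
  fixes M :: "('k::field, 'm, 'z) module_scheme" (structure)
  assumes "\<And>x y. x \<in> carrier M \<Longrightarrow> y \<in> carrier M \<Longrightarrow> x \<oplus> y \<in> carrier M" "\<zero> \<in> carrier M"
    "\<And>x y z. x \<in> carrier M \<Longrightarrow> y \<in> carrier M \<Longrightarrow> z \<in> carrier M \<Longrightarrow> x \<oplus> y \<oplus> z = x \<oplus> (y \<oplus> z)"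
    "\<And>x y. x \<in> carrier M \<Longrightarrow> y \<in> carrier M \<Longrightarrow> x \<oplus> y = y \<oplus> x"
    "\<And>x. x \<in> carrier M \<Longrightarrow> \<zero> \<oplus> x = x"
    "\<And>x. x \<in> carrier M \<Longrightarrow> \<exists>y\<in>carrier M. y \<oplus> x = \<zero>"
    "\<And>c x. x \<in> carrier M \<Longrightarrow> c \<odot> x \<in> carrier M"
    "\<And>c d x. x \<in> carrier M \<Longrightarrow> (c + d) \<odot> x = c \<odot> x \<oplus> d \<odot> x"
    "\<And>c x y. x \<in> carrier M \<Longrightarrow> y \<in> carrier M \<Longrightarrow> c \<odot> (x \<oplus> y) = c \<odot> x \<oplus> c \<odot> y"
    "\<And>c d x. x \<in> carrier M \<Longrightarrow> (c * d) \<odot> x = c \<odot> (d \<odot> x)"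
    "\<And>x. x \<in> carrier M \<Longrightarrow> 1 \<odot> x = x"
  shows "vectorspace class_ring M"
proof -
  have "abelian_group M" by (rule abelian_groupI) (use assms in auto)
  then have "Module.module class_ring M"
    by (intro moduleI class_cring.is_cring) (use assms in auto)
  then show ?thesis by (intro vectorspace.intro class_field)
qed

lemma subspace_vs:
  fixes M :: "('k::field, 'm, 'z) module_scheme" and N :: "('k, 'm, 'y) module_scheme"
  assumes M: "vectorspace class_ring M" and sub: "carrier N \<subseteq> carrier M"
    and eq: "add N = add M" "zero N = zero M" "smult N = smult M"
    and cl: "zero M \<in> carrier N" "\<And>x y. x \<in> carrier N \<Longrightarrow> y \<in> carrier N \<Longrightarrow> x \<oplus>\<^bsub>M\<^esub> y \<in> carrier N"
      "\<And>c x. x \<in> carrier N \<Longrightarrow> c \<odot>\<^bsub>M\<^esub> x \<in> carrier N"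
  shows "vectorspace class_ring N"
proof -
  interpret kvs M using M by (rule kvsI)
  have "\<exists>y\<in>carrier N. y \<oplus>\<^bsub>M\<^esub> x = \<zero>\<^bsub>M\<^esub>" if "x \<in> carrier N" for x
    using cl(3)[OF that, of "-1"] that sub by (intro bexI[of _ "(-1) \<odot>\<^bsub>M\<^esub> x"]) (auto simp: sc_minus l_neg)
  then show ?thesis
    by (intro vectorspaceI) (use sub cl in \<open>auto simp: eq subset_eq a_ac sc_add sc_sum_right sc_sc\<close>)
qed

lemma lhomI:
  assumes "\<And>x. x \<in> carrier M \<Longrightarrow> f x \<in> carrier N"
    "\<And>x y. x \<in> carrier M \<Longrightarrow> y \<in> carrier M \<Longrightarrow> f (x \<oplus>\<^bsub>M\<^esub> y) = f x \<oplus>\<^bsub>N\<^esub> f y"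
    "\<And>c x. x \<in> carrier M \<Longrightarrow> f (c \<odot>\<^bsub>M\<^esub> x) = c \<odot>\<^bsub>N\<^esub> f x"
  shows "f \<in> lhom M N"
  using assms by (auto simp: LinearCombinations.module_hom_def)

lemma lhomD:
  assumes "f \<in> lhom M N"
  shows "x \<in> carrier M \<Longrightarrow> f x \<in> carrier N"
    "x \<in> carrier M \<Longrightarrow> y \<in> carrier M \<Longrightarrow> f (x \<oplus>\<^bsub>M\<^esub> y) = f x \<oplus>\<^bsub>N\<^esub> f y"
    "x \<in> carrier M \<Longrightarrow> f (c \<odot>\<^bsub>M\<^esub> x) = c \<odot>\<^bsub>N\<^esub> f x"
  using assms by (auto simp: LinearCombinations.module_hom_def)

locale khom = M: kvs M + N: kvs N 
  for M :: "('k::field, 'm, 'y) module_scheme" and N :: "('k, 'n, 'z) module_scheme" +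
  fixes f assumes f: "f \<in> lhom M N"
begin
lemmas cl = lhomD(1)[OF f] and add = lhomD(2)[OF f] and sc = lhomD(3)[OF f]
lemma zero: "f \<zero>\<^bsub>M\<^esub> = \<zero>\<^bsub>N\<^esub>"
  using sc[of "\<zero>\<^bsub>M\<^esub>" 0] cl[of "\<zero>\<^bsub>M\<^esub>"] by simp
lemma minus: "x \<in> carrier M \<Longrightarrow> f (\<ominus>\<^bsub>M\<^esub> x) = \<ominus>\<^bsub>N\<^esub> f x"
  using sc[of x "-1"] cl[of x] by (simp add: M.sc_minus N.sc_minus)
lemma diff: "x \<in> carrier M \<Longrightarrow> y \<in> carrier M \<Longrightarrow> f (x \<ominus>\<^bsub>M\<^esub> y) = f x \<ominus>\<^bsub>N\<^esub> f y"
  by (simp add: a_minus_def add minus)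
lemma finsum: "finite I \<Longrightarrow> (\<And>i. i \<in> I \<Longrightarrow> g i \<in> carrier M) \<Longrightarrow>
    f (\<Oplus>\<^bsub>M\<^esub>i\<in>I. g i) = (\<Oplus>\<^bsub>N\<^esub>i\<in>I. f (g i))"
proof (induction I rule: finite_induct)
  case empty
  then show ?case by (simp add: zero)
next
  case (insert x F)
  have "f (\<Oplus>\<^bsub>M\<^esub>i\<in>insert x F. g i) = f (g x \<oplus>\<^bsub>M\<^esub> (\<Oplus>\<^bsub>M\<^esub>i\<in>F. g i))"
    using insert by (subst M.finsum_insert) auto
  also have "\<dots> = f (g x) \<oplus>\<^bsub>N\<^esub> (\<Oplus>\<^bsub>N\<^esub>i\<in>F. f (g i))"
    using insert by (subst add) (auto intro: M.finsum_cl)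
  also have "\<dots> = (\<Oplus>\<^bsub>N\<^esub>i\<in>insert x F. f (g i))"
    using insert cl by (subst N.finsum_insert) auto
  finally show ?case .
qed
end

lemma khomI: "vectorspace class_ring M \<Longrightarrow> vectorspace class_ring N \<Longrightarrow> f \<in> lhom M N \<Longrightarrow> khom M N f"
  by (simp add: khom_def khom_axioms_def kvs_def)

lemma lhom_comp: "f \<in> lhom M N \<Longrightarrow> g \<in> lhom N P \<Longrightarrow> (\<lambda>x. g (f x)) \<in> lhom M P"
  by (auto simp: LinearCombinations.module_hom_def Pi_iff)

lemma lhom_id: "(\<lambda>x. x) \<in> lhom M M"
  by (auto simp: LinearCombinations.module_hom_def)

lemma lhom_finsum:
  assumes N: "vectorspace class_ring N" and fin: "finite I" and f: "\<And>i. i \<in> I \<Longrightarrow> f i \<in> lhom M N"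
  shows "(\<lambda>x. \<Oplus>\<^bsub>N\<^esub>i\<in>I. f i x) \<in> lhom M N"
proof -
  interpret N: kvs N using N by (rule kvsI)
  show ?thesis
  proof (rule lhomI)
    show "(\<Oplus>\<^bsub>N\<^esub>i\<in>I. f i x) \<in> carrier N" if "x \<in> carrier M" for x
      using lhomD(1)[OF f] that by (intro N.finsum_cl) auto
    show "(\<Oplus>\<^bsub>N\<^esub>i\<in>I. f i (x \<oplus>\<^bsub>M\<^esub> y)) = (\<Oplus>\<^bsub>N\<^esub>i\<in>I. f i x) \<oplus>\<^bsub>N\<^esub> (\<Oplus>\<^bsub>N\<^esub>i\<in>I. f i y)"
      if "x \<in> carrier M" "y \<in> carrier M" for x y
    proof -
      have "(\<Oplus>\<^bsub>N\<^esub>i\<in>I. f i (x \<oplus>\<^bsub>M\<^esub> y)) = (\<Oplus>\<^bsub>N\<^esub>i\<in>I. f i x \<oplus>\<^bsub>N\<^esub> f i y)"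
        using lhomD[OF f] that by (intro N.finsum_eq) auto
      also have "\<dots> = (\<Oplus>\<^bsub>N\<^esub>i\<in>I. f i x) \<oplus>\<^bsub>N\<^esub> (\<Oplus>\<^bsub>N\<^esub>i\<in>I. f i y)"
        using lhomD[OF f] that by (intro N.finsum_add) auto
      finally show ?thesis .
    qed
    show "(\<Oplus>\<^bsub>N\<^esub>i\<in>I. f i (c \<odot>\<^bsub>M\<^esub> x)) = c \<odot>\<^bsub>N\<^esub> (\<Oplus>\<^bsub>N\<^esub>i\<in>I. f i x)" if "x \<in> carrier M" for c x
      using lhomD[OF f] that fin by (subst N.sc_finsum) (auto intro!: N.finsum_eq)
  qed
qed

lemma lhom_smult:
  assumes N: "vectorspace class_ring N" and f: "f \<in> lhom M N"
  shows "(\<lambda>x. c \<odot>\<^bsub>N\<^esub> f x) \<in> lhom M N"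
proof -
  interpret N: kvs N using N by (rule kvsI)
  show ?thesis by (rule lhomI) (auto simp: lhomD[OF f] N.sc_sum_right N.sc_sc mult.commute)
qed

lemma lhom_add:
  assumes N: "vectorspace class_ring N" and f: "f \<in> lhom M N" and g: "g \<in> lhom M N"
  shows "(\<lambda>x. f x \<oplus>\<^bsub>N\<^esub> g x) \<in> lhom M N"
proof -
  interpret N: kvs N using N by (rule kvsI)
  show ?thesis by (rule lhomI) (auto simp: lhomD[OF f] lhomD[OF g] N.sc_sum_right N.a_ac)
qed

section \<open>Induction over generators\<close>

text \<open>Closure is only asked for elements of the carrier, so \<open>S\<close> may be an
  equaliser or a preimage of linear maps, whatever it contains outside the carrier.\<close>

definition lin_closed :: "('k::field, 'm, 'z) module_scheme \<Rightarrow> 'm set \<Rightarrow> bool" where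
  "lin_closed M S \<longleftrightarrow> \<zero>\<^bsub>M\<^esub> \<in> S \<and> (\<forall>x\<in>S \<inter> carrier M. \<forall>y\<in>S \<inter> carrier M. x \<oplus>\<^bsub>M\<^esub> y \<in> S) \<and> 
    (\<forall>c. \<forall>x\<in>S \<inter> carrier M. c \<odot>\<^bsub>M\<^esub> x \<in> S)"

lemma lin_closedD:
  assumes "lin_closed M S"
  shows "\<zero>\<^bsub>M\<^esub> \<in> S" "x \<in> carrier M \<Longrightarrow> y \<in> carrier M \<Longrightarrow> x \<in> S \<Longrightarrow> y \<in> S \<Longrightarrow> x \<oplus>\<^bsub>M\<^esub> y \<in> S"
    "x \<in> carrier M \<Longrightarrow> x \<in> S \<Longrightarrow> c \<odot>\<^bsub>M\<^esub> x \<in> S"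
  using assms by (auto simp: lin_closed_def)

lemma lin_closed_finsum:
  assumes M: "vectorspace class_ring M" and S: "lin_closed M S" and "finite I" 
    and "\<And>i. i \<in> I \<Longrightarrow> g i \<in> carrier M" "\<And>i. i \<in> I \<Longrightarrow> g i \<in> S"
  shows "(\<Oplus>\<^bsub>M\<^esub>i\<in>I. g i) \<in> S"
proof -
  interpret kvs M using M by (rule kvsI)
  show ?thesis using assms(3-)
  proof (induction I rule: finite_induct)
    case (insert x F)
    then show ?case by (subst finsum_insert) (auto intro!: lin_closedD[OF S] finsum_cl)
  qed (use lin_closedD(1)[OF S] in simp)
qed

lemma lin_closed_eq:
  assumes "vectorspace class_ring M" "vectorspace class_ring N" and f: "f \<in> lhom M N" and g: "g \<in> lhom M N"
  shows "lin_closed M {x. f x = g x}"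
proof -
  interpret f: khom M N f by (rule khomI) (use assms in auto)
  interpret g: khom M N g by (rule khomI) (use assms in auto)
  show ?thesis by (auto simp: lin_closed_def f.zero g.zero lhomD[OF f] lhomD[OF g])
qed

text \<open>A representative of a class has finite support and is the combination of functions
  \<open>single s\<close> with its own values as coefficients; the quotient map carries this to a
  combination of the classes \<open>gen S R s\<close>.\<close>

lemma presented_induct:
  fixes R :: "('s \<Rightarrow> 'k::field) set"
  assumes R: "R \<subseteq> carrier (free_space S)" and C: "lin_closed (presented S R) C"
    and g: "\<And>s. s \<in> S \<Longrightarrow> gen S R s \<in> C" and x: "x \<in> carrier (presented S R)"
  shows "x \<in> C"
proof -
  note Q = quot_space_vs[OF relspan_subspace[OF R], folded presented_def]
  interpret Q: kvs "presented S R" using Q(1) by (rule kvsI)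
  let ?F = "free_space S :: ('k, _) module"
  interpret q: khom ?F "presented S R" "\<lambda>x. relspan S R +>\<^bsub>free_space S\<^esub> x"
    by (rule khomI) (use Q free_space_vs in auto)
  obtain y where y: "y \<in> carrier ?F" "x = relspan S R +>\<^bsub>free_space S\<^esub> y" using x unfolding Q(3) by blast
  define T where "T = {s. y s \<noteq> 0}"
  have T: "finite T" "T \<subseteq> S" using y(1) by (auto simp: free_space_simps T_def)
  have "y = (\<lambda>t. \<Sum>s\<in>T. y s * single s t)"
    using T(1) by (auto simp: fun_eq_iff T_def single_def if_distrib sum.delta cong: if_cong)
  moreover have "(\<Oplus>\<^bsub>?F\<^esub>s\<in>T'. y s \<odot>\<^bsub>?F\<^esub> single s) = (\<lambda>t. \<Sum>s\<in>T'. y s * single s t)" if "T' \<subseteq> T" for T'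
    using finite_subset[OF that T(1)] that
  proof (induction T' rule: finite_induct)
    case (insert s T')
    have "y s \<odot>\<^bsub>?F\<^esub> single s \<in> carrier ?F" if "s \<in> T" for s
      using that T(2) by (intro q.M.scl single_closed) auto
    then show ?case using insert
      by (subst q.M.finsum_insert) (auto simp: free_space_simps)
  qed (simp add: free_space_simps)
  ultimately have y': "y = (\<Oplus>\<^bsub>?F\<^esub>s\<in>T. y s \<odot>\<^bsub>?F\<^esub> single s)" by simp
  have sc: "single s \<in> carrier ?F" if "s \<in> T" for s using T(2) that by (intro single_closed) auto
  have "x = (\<Oplus>\<^bsub>presented S R\<^esub>s\<in>T. y s \<odot>\<^bsub>presented S R\<^esub> gen S R s)"
    unfolding y(2) gen_def
    by (subst y', subst q.finsum[OF T(1)]) (auto simp: sc q.sc q.cl intro!: Q.finsum_eq Q.scl)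
  also have "\<dots> \<in> C"
    using T gen_closed[OF R] g by (intro lin_closed_finsum[OF Q(1) C]) (auto intro!: lin_closedD(3)[OF C])
  finally show ?thesis .
qed

lemma tensor_induct:
  assumes A: "vectorspace class_ring A" and B: "vectorspace class_ring B" and C: "lin_closed (tensor_prod A B) C"
    and g: "\<And>a b. a \<in> carrier A \<Longrightarrow> b \<in> carrier B \<Longrightarrow> tens A B a b \<in> C" and x: "x \<in> carrier (tensor_prod A B)"
  shows "x \<in> C"
  by (rule presented_induct[OF tensor_rels_closed[OF A B]])
    (use C g x in \<open>auto simp: tensor_prod_def tens_def\<close>)

section \<open>Dual systems\<close>

definition dual_system :: "('k::field, 'v, 'y) module_scheme \<Rightarrow> ('k, 'w, 'z) module_scheme \<Rightarrow> ('v \<Rightarrow> 'w \<Rightarrow> 'k) \<Rightarrow>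
    ('v \<times> 'w) set \<Rightarrow> bool" where
  "dual_system V W pair D \<longleftrightarrow> D \<subseteq> carrier V \<times> carrier W \<and>
     (\<forall>z\<in>D. \<forall>z'\<in>D. pair (fst z) (snd z') = (if z = z' then 1 else 0))"

text \<open>The projection onto the span of the first components along the common kernel of the
  second components. The equation \<open>dual_proj V pair D v = v\<close> thus says that v lies in
  this span.\<close>

definition dual_proj :: "('k::field, 'v, 'y) module_scheme \<Rightarrow> ('v \<Rightarrow> 'w \<Rightarrow> 'k) \<Rightarrow> ('v \<times> 'w) set \<Rightarrow> 'v \<Rightarrow> 'v" where
  "dual_proj V pair D v = (\<Oplus>\<^bsub>V\<^esub>z\<in>D. pair v (snd z) \<odot>\<^bsub>V\<^esub> fst z)"

lemma nondegenerate_pairing_swap: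
  "nondegenerate_pairing V W pair \<Longrightarrow> nondegenerate_pairing W V (\<lambda>w v. pair v w)"
  unfolding nondegenerate_pairing_def by blast

lemma dual_system_swap:
  "dual_system V W pair D \<Longrightarrow> dual_system W V (\<lambda>w v. pair v w) (prod.swap ` D)"
  unfolding dual_system_def by (auto simp: subset_iff)

locale paired = V: kvs V + W: kvs W
  for V :: "('k::field, 'v, 'y) module_scheme" and W :: "('k, 'w, 'z) module_scheme" +
  fixes pair :: "'v \<Rightarrow> 'w \<Rightarrow> 'k"
  assumes nd: "nondegenerate_pairing V W pair"
begin

lemma pair_simps:
  "\<lbrakk>v \<in> carrier V; v' \<in> carrier V; w \<in> carrier W\<rbrakk> \<Longrightarrow> pair (v \<oplus>\<^bsub>V\<^esub> v') w = pair v w + pair v' w"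
  "\<lbrakk>v \<in> carrier V; w \<in> carrier W; w' \<in> carrier W\<rbrakk> \<Longrightarrow> pair v (w \<oplus>\<^bsub>W\<^esub> w') = pair v w + pair v w'"
  "\<lbrakk>v \<in> carrier V; w \<in> carrier W\<rbrakk> \<Longrightarrow> pair (c \<odot>\<^bsub>V\<^esub> v) w = c * pair v w"
  "\<lbrakk>v \<in> carrier V; w \<in> carrier W\<rbrakk> \<Longrightarrow> pair v (c \<odot>\<^bsub>W\<^esub> w) = c * pair v w"
  using nd unfolding nondegenerate_pairing_def by auto

lemma pair_zero [simp]: "w \<in> carrier W \<Longrightarrow> pair \<zero>\<^bsub>V\<^esub> w = 0" "v \<in> carrier V \<Longrightarrow> pair v \<zero>\<^bsub>W\<^esub> = 0"
  using pair_simps(3)[of "\<zero>\<^bsub>V\<^esub>" w 0] pair_simps(4)[of v "\<zero>\<^bsub>W\<^esub>" 0] by auto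

lemma pair_minus: "\<lbrakk>v \<in> carrier V; w \<in> carrier W\<rbrakk> \<Longrightarrow> pair (\<ominus>\<^bsub>V\<^esub> v) w = - pair v w"
   "\<lbrakk>v \<in> carrier V; w \<in> carrier W\<rbrakk> \<Longrightarrow> pair v (\<ominus>\<^bsub>W\<^esub> w) = - pair v w"
  using pair_simps(3)[of v w "-1"] pair_simps(4)[of v w "-1"] by (auto simp: V.sc_minus W.sc_minus)

lemma pair_finsum:
  "finite I \<Longrightarrow> (\<And>i. i \<in> I \<Longrightarrow> g i \<in> carrier V) \<Longrightarrow> w \<in> carrier W \<Longrightarrow> pair (\<Oplus>\<^bsub>V\<^esub>i\<in>I. g i) w = (\<Sum>i\<in>I. pair (g i) w)"
  by (induction I rule: finite_induct) (auto simp: pair_simps V.finsum_cl)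

lemma dual_systemD:
  assumes "dual_system V W pair D" "z \<in> D"
  shows "fst z \<in> carrier V" "snd z \<in> carrier W" "z' \<in> D \<Longrightarrow> pair (fst z) (snd z') = (if z = z' then 1 else 0)"
proof -
  have "z \<in> carrier V \<times> carrier W" using assms unfolding dual_system_def by blast
  then show "fst z \<in> carrier V" "snd z \<in> carrier W" by (simp_all add: mem_Times_iff)
  show "z' \<in> D \<Longrightarrow> pair (fst z) (snd z') = (if z = z' then 1 else 0)"
    using assms unfolding dual_system_def by blast
qed

lemma dual_proj_closed: "dual_system V W pair D \<Longrightarrow> dual_proj V pair D v \<in> carrier V"
  unfolding dual_proj_def by (intro V.finsum_cl V.scl) (auto dest: dual_systemD)

lemma pair_dual_proj:
  assumes D: "dual_system V W pair D" "finite D" "D' \<subseteq> D" "z \<in> D"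
  shows "pair (dual_proj V pair D' v) (snd z) = (if z \<in> D' then pair v (snd z) else 0)"
proof -
  have "pair (dual_proj V pair D' v) (snd z) = (\<Sum>z'\<in>D'. pair (pair v (snd z') \<odot>\<^bsub>V\<^esub> fst z') (snd z))"
    unfolding dual_proj_def using D by (intro pair_finsum) (auto intro: finite_subset dest: dual_systemD)
  also have "\<dots> = (\<Sum>z'\<in>D'. if z = z' then pair v (snd z) else 0)"
  proof (intro sum.cong refl)
    fix z' assume "z' \<in> D'"
    then have "z' \<in> D" using D(3) by blast
    then show "pair (pair v (snd z') \<odot>\<^bsub>V\<^esub> fst z') (snd z) = (if z = z' then pair v (snd z) else 0)"
      using D(4) dual_systemD[OF D(1)] by (simp add: pair_simps)
  qed
  also have "\<dots> = (if z \<in> D' then pair v (snd z) else 0)"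
    using D finite_subset[of D' D] by (simp add: sum.delta)
  finally show ?thesis .
qed

text \<open>A vector fixed by the smaller projection lies in the span of the old first components,
  hence pairs to zero with every partner that is added.\<close>

lemma dual_proj_mono:
  assumes D: "dual_system V W pair D" "finite D" "D' \<subseteq> D" and v: "dual_proj V pair D' v = v"
  shows "dual_proj V pair D v = v"
proof -
  have "dual_proj V pair D v = dual_proj V pair D' v"
    unfolding dual_proj_def
  proof (rule V.add.finprod_mono_neutral_cong_right)
    fix z assume z: "z \<in> D - D'"
    then have "pair v (snd z) = 0" using pair_dual_proj[OF D, of z v] v by simp
    then show "pair v (snd z) \<odot>\<^bsub>V\<^esub> fst z = \<zero>\<^bsub>V\<^esub>" using z D dual_systemD(1)[OF D(1)] by auto
  qed (use D dual_systemD(1)[OF D(1)] in auto)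
  then show ?thesis using v by simp
qed

text \<open>Gram--Schmidt: subtracting from \<open>v\<close> and from a partner \<open>w\<close> their projections keeps the system dual.\<close>

lemma dual_system_extend:
  assumes D: "dual_system V W pair D" "finite D" and v: "v \<in> carrier V"
  shows "\<exists>D'. D \<subseteq> D' \<and> finite D' \<and> dual_system V W pair D' \<and> dual_proj V pair D' v = v"
proof (cases "dual_proj V pair D v = v")
  case True
  then show ?thesis using D by blast
next
  case False
  interpret S: paired W V "\<lambda>w v. pair v w" by unfold_locales (rule nondegenerate_pairing_swap[OF nd])
  let ?P = "dual_proj V pair D" and ?D = "prod.swap ` D"
  let ?Q = "dual_proj W (\<lambda>w v. pair v w) ?D"
  note DS = dual_system_swap[OF D(1)]
  note Pc = dual_proj_closed[OF D(1), of v]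
  note Qc = S.dual_proj_closed[OF DS]
  define v' where "v' = v \<ominus>\<^bsub>V\<^esub> ?P v"
  have v'c: "v' \<in> carrier V" using v Pc by (simp add: v'_def)
  have "v' \<noteq> \<zero>\<^bsub>V\<^esub>" using False v Pc by (auto simp: v'_def)
  then obtain w0 where w0: "w0 \<in> carrier W" "pair v' w0 \<noteq> 0"
    using nd v'c unfolding nondegenerate_pairing_def by blast
  define w1 where "w1 = inverse (pair v' w0) \<odot>\<^bsub>W\<^esub> w0"
  have w1: "w1 \<in> carrier W" "pair v' w1 = 1" using w0 v'c by (simp_all add: w1_def pair_simps)
  define w where "w = w1 \<ominus>\<^bsub>W\<^esub> ?Q w1"
  have wc: "w \<in> carrier W" using w1 Qc by (simp add: w_def)
  have vz: "pair v' (snd z) = 0" if "z \<in> D" for z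
    using pair_dual_proj[OF D order_refl that, of v] that v Pc dual_systemD(2)[OF D(1) that]
    by (simp add: v'_def a_minus_def pair_simps pair_minus)
  have zw: "pair (fst z) w = 0" if "z \<in> D" for z
    using S.pair_dual_proj[OF DS _ order_refl, of "prod.swap z" w1] that D(2) w1 Qc[of w1] dual_systemD(1)[OF D(1) that]
    by (simp add: w_def a_minus_def pair_simps pair_minus)
  have vQ: "pair v' (?Q u) = 0" for u
  proof -
    have "pair v' (?Q u) = (\<Sum>z\<in>?D. pair v' (pair (snd z) u \<odot>\<^bsub>W\<^esub> fst z))"
      unfolding dual_proj_def using D S.dual_systemD[OF DS] v'c by (intro S.pair_finsum) auto
    also have "\<dots> = 0" using vz v'c S.dual_systemD[OF DS] by (intro sum.neutral) (auto simp: pair_simps)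
    finally show ?thesis .
  qed
  have vw: "pair v' w = 1" using v'c w1 Qc[of w1] vQ[of w1] by (simp add: w_def a_minus_def pair_simps pair_minus)
  have notD: "(v', w) \<notin> D" using vz vw by force
  let ?D' = "insert (v', w) D"
  have D': "dual_system V W pair ?D'"
    unfolding dual_system_def
  proof (intro conjI ballI)
    show "?D' \<subseteq> carrier V \<times> carrier W" using D(1) v'c wc unfolding dual_system_def by auto
    fix z z' assume "z \<in> ?D'" "z' \<in> ?D'"
    then consider "z = (v', w)" "z' = (v', w)" | "z = (v', w)" "z' \<in> D" | "z' = (v', w)" "z \<in> D" | "z \<in> D" "z' \<in> D"
      by blast
    then show "pair (fst z) (snd z') = (if z = z' then 1 else 0)"
    proof cases
      case 4
      then show ?thesis by (rule dual_systemD(3)[OF D(1)])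
    qed (use vz zw vw notD in auto)
  qed
  \<comment> \<open>The new coefficient in \<open>dual_proj\<close> is computed from v itself. It
    agrees with that of v', because w annihilates the old first components.\<close>
  have pv: "pair v w = 1"
  proof -
    have "pair (?P v) w = (\<Sum>z\<in>D. pair (pair v (snd z) \<odot>\<^bsub>V\<^esub> fst z) w)"
      unfolding dual_proj_def using D dual_systemD[OF D(1)] wc by (intro pair_finsum) auto
    also have "\<dots> = 0" using zw wc dual_systemD[OF D(1)] by (intro sum.neutral) (auto simp: pair_simps)
    finally show ?thesis using vw v Pc wc by (simp add: v'_def a_minus_def pair_simps pair_minus)
  qed
  have "dual_proj V pair ?D' v = v' \<oplus>\<^bsub>V\<^esub> ?P v"
    unfolding dual_proj_def using notD D(2) pv v'c dual_systemD(1)[OF D(1)]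
    by (subst V.finsum_insert) auto
  also have "\<dots> = v"
    unfolding v'_def a_minus_def using v Pc V.a_assoc[of v "\<ominus>\<^bsub>V\<^esub> ?P v" "?P v"] V.l_neg[OF Pc] by simp
  finally have "dual_proj V pair ?D' v = v" .
  with D' D(2) show ?thesis by (intro exI[of _ ?D'] conjI subset_insertI finite.insertI)
qed

lemma dual_system_empty: "dual_system V W pair {}"
  by (simp add: dual_system_def)

lemma lin_closed_dual_proj:
  assumes "finite D" "dual_system V W pair D" 
  shows "lin_closed V {v. v \<in> carrier V \<and> dual_proj V pair D v = v}"
proof -
  have "(\<lambda>v. dual_proj V pair D v) \<in> lhom V V"
    unfolding dual_proj_def using assms
    by (intro lhom_finsum lhomI V.vectorspace_axioms) (auto simp: pair_simps dual_systemD V.sc_add V.sc_sc)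
  from lin_closed_eq[OF V.vectorspace_axioms V.vectorspace_axioms this lhom_id]
  show ?thesis by (auto simp: lin_closed_def)
qed


lemma lin_closed_dual_proj_ex:
  "lin_closed V C \<Longrightarrow> finite D \<Longrightarrow> dual_system V W pair D \<Longrightarrow> (\<And>z. z \<in> D \<Longrightarrow> fst z \<in> C) \<Longrightarrow> dual_proj V pair D v \<in> C"
  unfolding dual_proj_def
  by (rule lin_closed_finsum[OF V.vectorspace_axioms]) (auto intro!: lin_closedD(3)[of V C] dest: dual_systemD(1))

text \<open>Pairing a linear relation with the partner of one vector isolates the coefficient of
  that vector, which gives independence; that the projection is the identity gives spanning.\<close>

lemma dual_system_basis:
  assumes D: "dual_system V W pair D" "finite D" and sp: "\<And>v. v \<in> carrier V \<Longrightarrow> dual_proj V pair D v = v"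
  shows "V.basis (fst ` D)" "V.dim = card D" "V.fin_dim"
proof -
  have sub: "fst ` D \<subseteq> carrier V" using dual_systemD(1)[OF D(1)] by blast
  have inj: "inj_on fst D"
  proof (rule inj_onI)
    fix z z' assume z: "z \<in> D" "z' \<in> D" "fst z = fst z'"
    then have "pair (fst z) (snd z') = 1" using dual_systemD(3)[OF D(1), of z' z'] by simp
    then show "z = z'" using dual_systemD(3)[OF D(1) z(1,2)] by (simp split: if_splits)
  qed
  have "V.span (fst ` D) = carrier V"
  proof
    interpret sm: submodule class_ring "V.span (fst ` D)" V by (rule V.span_is_submodule[OF sub])
    show "V.span (fst ` D) \<subseteq> carrier V" by (rule sm.subset)
    have "lin_closed V (V.span (fst ` D))" 
      unfolding lin_closed_def by (auto intro: sm.m_closed sm.smult_closed sm.zero_closed)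
    then have "dual_proj V pair D v \<in> V.span (fst ` D)" for v
      by (rule lin_closed_dual_proj_ex[OF _ D(2) D(1)]) (use V.in_own_span[OF sub] in blast)
    then show "carrier V \<subseteq> V.span (fst ` D)" using sp by (metis subsetI)
  qed
  moreover have "V.lin_indpt (fst ` D)"
  proof
    assume "V.lin_dep (fst ` D)"
    then obtain A a v where A: "finite A" "A \<subseteq> fst ` D" "V.lincomb a A = \<zero>\<^bsub>V\<^esub>" "v \<in> A" "a v \<noteq> 0"
      unfolding V.lin_dep_def by auto
    obtain z where z: "z \<in> D" "v = fst z" using A by blast
    have Ac: "x \<in> carrier V" if "x \<in> A" for x using A(2) sub that by blast
    have "0 = pair (V.lincomb a A) (snd z)" using A(3) dual_systemD(2)[OF D(1) z(1)] by simp
    also have "\<dots> = (\<Sum>x\<in>A. pair (a x \<odot>\<^bsub>V\<^esub> x) (snd z))"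
      unfolding V.lincomb_def using Ac dual_systemD(2)[OF D(1) z(1)] by (intro pair_finsum A(1)) auto
    also have "\<dots> = (\<Sum>x\<in>A. if x = v then a v else 0)"
    proof (rule sum.cong[OF refl])
      fix x assume x: "x \<in> A"
      then obtain z' where z': "z' \<in> D" "x = fst z'" using A(2) by blast
      have "x = v \<longleftrightarrow> z' = z" using inj z z' by (auto dest: inj_onD)
      then show "pair (a x \<odot>\<^bsub>V\<^esub> x) (snd z) = (if x = v then a v else 0)"
        using dual_systemD(3)[OF D(1) z'(1) z(1)] Ac[OF x] dual_systemD(2)[OF D(1) z(1)] z' z by (simp add: pair_simps)
    qed
    also have "\<dots> = a v" using A by simp
    finally show False using A(5) by simp
  qed
  ultimately show b: "V.basis (fst ` D)" using sub by (simp add: V.basis_def)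
  show "V.fin_dim" unfolding V.fin_dim_def using D(2) b by (intro exI[of _ "fst ` D"]) (simp add: V.basis_def)
  show "V.dim = card D" using V.dim_basis[OF _ b] D(2) card_image[OF inj] by simp
qed

lemma dual_system_finite_span:
  assumes "finite G" "G \<subseteq> carrier V" "dual_system V W pair D0" "finite D0"
  shows "\<exists>D. D0 \<subseteq> D \<and> finite D \<and> dual_system V W pair D \<and> (\<forall>g\<in>G. dual_proj V pair D g = g)"
  using assms(1,2)
proof (induction G rule: finite_induct)
  case empty
  then show ?case using assms(3,4) by auto
next
  case (insert x G)
  then obtain D where D: "D0 \<subseteq> D" "finite D" "dual_system V W pair D" "\<forall>g\<in>G. dual_proj V pair D g = g" by auto
  obtain D' where D': "D \<subseteq> D'" "finite D'" "dual_system V W pair D'" "dual_proj V pair D' x = x"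
    using dual_system_extend[OF D(3,2), of x] insert.prems by auto
  have "\<forall>g\<in>G. dual_proj V pair D' g = g" using dual_proj_mono[OF D'(3,2,1)] D(4) by blast
  then show ?case using D D' by (intro exI[of _ D']) auto
qed

end

section \<open>The group algebra of the symmetric group\<close>

declare plus_fun_apply [simp] func_plus [simp del] func_zero [simp del]

lemma sum_fun_apply: "(sum f I) x = (\<Sum>i\<in>I. f i x)"
  by (induction I rule: infinite_finite_induct) (auto simp: zero_fun_def)

text \<open>Convolution in the group algebra. The cut-off outside the symmetric group puts every
  product into \<open>GA d\<close>, even for factors outside it, so that \<open>GA_mul\<close> is
  unconditional.\<close>

definition gconv :: "nat \<Rightarrow> ((nat \<Rightarrow> nat) \<Rightarrow> 'k::field) \<Rightarrow> ((nat \<Rightarrow> nat) \<Rightarrow> 'k) \<Rightarrow> (nat \<Rightarrow> nat) \<Rightarrow> 'k" where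
  "gconv d a b \<pi> = (if \<pi> permutes {..<d} then \<Sum>\<sigma> | \<sigma> permutes {..<d}. a \<sigma> * b (inv \<sigma> \<circ> \<pi>) else 0)"

definition GA :: "nat \<Rightarrow> ((nat \<Rightarrow> nat) \<Rightarrow> 'k::field) set" where
  "GA d = {a. \<forall>\<sigma>. a \<sigma> \<noteq> 0 \<longrightarrow> \<sigma> permutes {..<d}}"

definition sc :: "'k::field \<Rightarrow> ((nat \<Rightarrow> nat) \<Rightarrow> 'k) \<Rightarrow> (nat \<Rightarrow> nat) \<Rightarrow> 'k" where
  "sc s a = (\<lambda>\<sigma>. s * a \<sigma>)"

lemma sc_apply: "sc s a \<sigma> = s * a \<sigma>"
  by (simp add: sc_def)

lemma sc_simps [simp]: "sc s (sc t a) = sc (s * t) a" "sc 1 a = a" "sc 0 a = 0" "sc s 0 = 0"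
  by (auto simp: sc_def zero_fun_def mult_ac)

lemma sum_sc: "(\<Sum>i\<in>I. sc (f i) a) = sc (sum f I) a"
  by (auto simp: sc_def fun_eq_iff sum_fun_apply sum_distrib_right)

locale sym_alg = fixes d :: nat
begin

abbreviation P where "P \<equiv> {\<sigma>. \<sigma> permutes {..<d}}"
abbreviation mul (infixl "\<star>" 70) where "a \<star> b \<equiv> gconv d a b"

lemma finP [simp]: "finite P"
  by (rule finite_permutations) simp

lemma P_inv: "\<sigma> permutes {..<d} \<Longrightarrow> inv \<sigma> permutes {..<d}"
  by (rule permutes_inv)
lemma P_comp: "\<sigma> permutes {..<d} \<Longrightarrow> \<tau> permutes {..<d} \<Longrightarrow> \<sigma> \<circ> \<tau> permutes {..<d}"
  by (rule permutes_compose)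
lemma P_invs: 
  assumes "\<sigma> permutes {..<d}"
  shows "\<sigma> \<circ> inv \<sigma> = id" "inv \<sigma> \<circ> \<sigma> = id" "inv (inv \<sigma>) = \<sigma>" "\<sigma> \<circ> (inv \<sigma> \<circ> \<tau>) = \<tau>" "inv \<sigma> \<circ> (\<sigma> \<circ> \<tau>) = \<tau>" 
    "\<tau> \<circ> \<sigma> \<circ> inv \<sigma> = \<tau>" "\<tau> \<circ> inv \<sigma> \<circ> \<sigma> = \<tau>"
  using permutes_inv_o[OF assms] permutes_inv_inv[OF assms] by (simp_all add: o_assoc) (simp_all flip: o_assoc)
lemma P_inv_comp: "\<sigma> permutes {..<d} \<Longrightarrow> \<tau> permutes {..<d} \<Longrightarrow> inv (\<sigma> \<circ> \<tau>) = inv \<tau> \<circ> inv \<sigma>"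
  by (rule o_inv_distrib) (simp_all add: permutes_bij)

lemma id_P [simp]: "id permutes {..<d}"
  by (rule permutes_id)

lemma GA_mul [simp]: "a \<star> b \<in> GA d"
  by (auto simp: GA_def gconv_def)
lemma GA_single: "\<sigma> permutes {..<d} \<Longrightarrow> single \<sigma> \<in> GA d"
  by (auto simp: GA_def single_def)
lemma GA_sc: "a \<in> GA d \<Longrightarrow> sc s a \<in> GA d"
  by (auto simp: GA_def sc_def)
lemma GA_add: "a \<in> GA d \<Longrightarrow> b \<in> GA d \<Longrightarrow> a + b \<in> GA d"
  by (auto simp: GA_def) (metis add.right_neutral)
lemma GA_diff: "a \<in> GA d \<Longrightarrow> b \<in> GA d \<Longrightarrow> a - b \<in> GA d"
  by (auto simp: GA_def) (metis diff_zero)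
lemma GA_zero [simp]: "0 \<in> GA d"
  by (simp add: GA_def)
lemma GA_sum: "(\<And>i. i \<in> I \<Longrightarrow> f i \<in> GA d) \<Longrightarrow> sum f I \<in> GA d"
  by (induction I rule: infinite_finite_induct) (auto intro: GA_add)
lemma GA_eqI:
  assumes "a \<in> GA d" "b \<in> GA d" "\<And>\<sigma>. \<sigma> permutes {..<d} \<Longrightarrow> a \<sigma> = b \<sigma>"
  shows "a = b"
proof
  fix \<sigma>
  show "a \<sigma> = b \<sigma>"
  proof (cases "\<sigma> permutes {..<d}")
    case False
    then have "a \<sigma> = 0" "b \<sigma> = 0" using assms(1,2) unfolding GA_def by auto
    then show ?thesis by simp
  qed (rule assms(3))
qed

lemma mul_assoc: "a \<star> b \<star> c = a \<star> (b \<star> c)"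
proof (rule GA_eqI)
  fix \<pi> assume p: "\<pi> permutes {..<d}"
  have "(a \<star> b \<star> c) \<pi> = (\<Sum>\<sigma>\<in>P. \<Sum>\<rho>\<in>P. a \<rho> * b (inv \<rho> \<circ> \<sigma>) * c (inv \<sigma> \<circ> \<pi>))"
    using p by (simp add: gconv_def sum_distrib_right)
  also have "\<dots> = (\<Sum>\<rho>\<in>P. \<Sum>\<sigma>\<in>P. a \<rho> * b (inv \<rho> \<circ> \<sigma>) * c (inv \<sigma> \<circ> \<pi>))"
    by (rule sum.swap)
  also have "\<dots> = (\<Sum>\<rho>\<in>P. \<Sum>\<tau>\<in>P. a \<rho> * b \<tau> * c (inv \<tau> \<circ> (inv \<rho> \<circ> \<pi>)))"
  proof (rule sum.cong[OF refl])
    fix \<rho> assume "\<rho> \<in> P"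
    then have r: "\<rho> permutes {..<d}" by simp
    show "(\<Sum>\<sigma>\<in>P. a \<rho> * b (inv \<rho> \<circ> \<sigma>) * c (inv \<sigma> \<circ> \<pi>)) = (\<Sum>\<tau>\<in>P. a \<rho> * b \<tau> * c (inv \<tau> \<circ> (inv \<rho> \<circ> \<pi>)))"
      by (rule sum.reindex_bij_witness[of _ "\<lambda>\<tau>. \<rho> \<circ> \<tau>" "\<lambda>\<sigma>. inv \<rho> \<circ> \<sigma>"])
        (use r in \<open>simp_all add: P_invs[OF r] P_comp P_inv P_inv_comp comp_assoc\<close>)
  qed
  also have "\<dots> = (a \<star> (b \<star> c)) \<pi>"
    using p by (simp add: gconv_def sum_distrib_left mult.assoc P_comp P_inv)
  finally show "(a \<star> b \<star> c) \<pi> = (a \<star> (b \<star> c)) \<pi>" .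
qed simp_all

lemma mul_add_left: "(a + b) \<star> c = a \<star> c + b \<star> c"
  by (rule ext) (simp add: gconv_def distrib_right sum.distrib)
lemma mul_add_right: "a \<star> (b + c) = a \<star> b + a \<star> c"
  by (rule ext) (simp add: gconv_def distrib_left sum.distrib)
lemma mul_diff_left: "(a - b) \<star> c = a \<star> c - b \<star> c"
  by (rule ext) (simp add: gconv_def left_diff_distrib sum_subtractf)
lemma mul_diff_right: "a \<star> (b - c) = a \<star> b - a \<star> c"
  by (rule ext) (simp add: gconv_def right_diff_distrib sum_subtractf)
lemma mul_sc_left [simp]: "sc s a \<star> c = sc s (a \<star> c)"
  by (rule ext) (simp add: gconv_def sc_def sum_distrib_left mult_ac)
lemma mul_sc_right [simp]: "a \<star> sc s c = sc s (a \<star> c)"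
  by (rule ext) (simp add: gconv_def sc_def sum_distrib_left mult_ac)
lemma mul_zero [simp]: "0 \<star> a = 0" "a \<star> 0 = 0"
  by (auto simp: gconv_def fun_eq_iff)
lemma mul_sum_left: "sum f I \<star> c = (\<Sum>i\<in>I. f i \<star> c)"
  by (induction I rule: infinite_finite_induct) (simp_all only: not_False_eq_True sum.infinite sum.empty sum.insert mul_zero mul_add_left)
lemma mul_sum_right: "c \<star> sum f I = (\<Sum>i\<in>I. c \<star> f i)"
  by (induction I rule: infinite_finite_induct) (simp_all only: not_False_eq_True sum.infinite sum.empty sum.insert mul_zero mul_add_right)

lemma mul_single_left: "\<sigma> permutes {..<d} \<Longrightarrow> \<pi> permutes {..<d} \<Longrightarrow> (single \<sigma> \<star> a) \<pi> = a (inv \<sigma> \<circ> \<pi>)"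
proof -
  assume s: "\<sigma> permutes {..<d}" and p: "\<pi> permutes {..<d}"
  have "(single \<sigma> \<star> a) \<pi> = (\<Sum>\<tau>\<in>P. if \<tau> = \<sigma> then a (inv \<tau> \<circ> \<pi>) else 0)"
    unfolding gconv_def single_def using p by (simp only: if_True) (intro sum.cong refl, simp)
  then show ?thesis using s by (simp add: sum.delta)
qed
lemma mul_single_right:
  assumes s: "\<sigma> permutes {..<d}" and p: "\<pi> permutes {..<d}"
  shows "(a \<star> single \<sigma>) \<pi> = a (\<pi> \<circ> inv \<sigma>)"
proof -
  have "inv \<tau> \<circ> \<pi> = \<sigma> \<longleftrightarrow> \<tau> = \<pi> \<circ> inv \<sigma>" if t: "\<tau> permutes {..<d}" for \<tau>
  proof
    assume "inv \<tau> \<circ> \<pi> = \<sigma>"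
    then have "\<pi> = \<tau> \<circ> \<sigma>" using P_invs(4)[OF t] by metis
    then show "\<tau> = \<pi> \<circ> inv \<sigma>" using P_invs(6)[OF s] by simp
  next
    assume "\<tau> = \<pi> \<circ> inv \<sigma>"
    then have "\<pi> = \<tau> \<circ> \<sigma>" using P_invs(7)[OF s] by simp
    then show "inv \<tau> \<circ> \<pi> = \<sigma>" using P_invs(5)[OF t] by simp
  qed
  then have "(a \<star> single \<sigma>) \<pi> = (\<Sum>\<tau>\<in>P. if \<tau> = \<pi> \<circ> inv \<sigma> then a \<tau> else 0)"
    unfolding gconv_def single_def using p by (simp only: if_True) (intro sum.cong refl, simp)
  also have "\<dots> = a (\<pi> \<circ> inv \<sigma>)" using P_comp[OF p P_inv[OF s]] by (simp add: sum.delta)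
  finally show ?thesis .
qed

lemma single_single: "\<sigma> permutes {..<d} \<Longrightarrow> \<tau> permutes {..<d} \<Longrightarrow> single \<sigma> \<star> single \<tau> = single (\<sigma> \<circ> \<tau>)"
proof (rule GA_eqI)
  fix \<pi> assume *: "\<sigma> permutes {..<d}" "\<tau> permutes {..<d}" "\<pi> permutes {..<d}"
  have "inv \<sigma> \<circ> \<pi> = \<tau> \<longleftrightarrow> \<pi> = \<sigma> \<circ> \<tau>" using P_invs(4,5)[OF *(1)] by metis
  then show "(single \<sigma> \<star> single \<tau>) \<pi> = single (\<sigma> \<circ> \<tau>) \<pi>"
    using * by (simp add: mul_single_left) (auto simp: single_def)
qed (simp_all add: GA_single P_comp)

lemma single_id: "a \<in> GA d \<Longrightarrow> single id \<star> a = a" "a \<in> GA d \<Longrightarrow> a \<star> single id = a"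
  by (rule GA_eqI; simp add: mul_single_left mul_single_right)+

lemma GA_decomp: "a \<in> GA d \<Longrightarrow> a = (\<Sum>\<sigma>\<in>P. sc (a \<sigma>) (single \<sigma>))"
  by (rule ext) (auto simp: sum_fun_apply sc_def single_def GA_def if_distrib sum.delta cong: if_cong)

text \<open>The coefficient of the identity is the trace of the regular representation up to a
  factor d!. Its symmetry is the substitution of inverses in the defining sum.\<close>

lemma trace_comm: "(a \<star> b) id = (b \<star> a) id"
proof -
  have "(\<Sum>\<sigma>\<in>P. a \<sigma> * b (inv \<sigma>)) = (\<Sum>\<sigma>\<in>P. b \<sigma> * a (inv \<sigma>))"
    by (rule sum.reindex_bij_witness[of _ inv inv]) (simp_all add: P_invs(3) P_inv mult.commute)
  then show ?thesis by (simp add: gconv_def)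
qed

text \<open>Multiplication by \<open>single (inv \<sigma>)\<close> moves the coefficient of \<sigma>
  to the identity.\<close>

lemma trace_nondegenerate:
  assumes "a \<in> GA d" "\<And>b. b \<in> GA d \<Longrightarrow> (a \<star> b) id = 0"
  shows "a = 0"
proof (rule GA_eqI)
  fix \<sigma> assume s: "\<sigma> permutes {..<d}"
  have "(a \<star> single (inv \<sigma>)) id = a \<sigma>" using mul_single_right[OF P_inv[OF s] id_P, of a] P_invs(3)[OF s] by simp
  then show "a \<sigma> = 0 \<sigma>" using assms(2)[OF GA_single[OF P_inv[OF s]]] by simp
qed (use assms in auto)

text \<open>The antiautomorphism that inverts group elements. For an invariant element z, the
  coefficient of the identity in z z becomes a sum of squares.\<close>

definition anti where "anti a = (\<lambda>\<sigma>. if \<sigma> permutes {..<d} then a (inv \<sigma>) else 0)"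

lemma anti_mul: "anti (a \<star> b) = anti b \<star> anti a"
proof (rule GA_eqI)
  fix \<pi> assume p: "\<pi> permutes {..<d}"
  have "anti (a \<star> b) \<pi> = (\<Sum>\<sigma>\<in>P. a \<sigma> * b (inv \<sigma> \<circ> inv \<pi>))"
    using p by (simp add: anti_def gconv_def P_inv)
  also have "\<dots> = (\<Sum>\<sigma>\<in>P. b (inv \<sigma>) * a (inv (inv \<sigma> \<circ> \<pi>)))"
    by (rule sum.reindex_bij_witness[of _ "\<lambda>\<sigma>. inv \<pi> \<circ> \<sigma>" "\<lambda>\<sigma>. \<pi> \<circ> \<sigma>"])
      (use p in \<open>simp_all add: P_invs[OF p] P_invs(3) P_inv P_comp P_inv_comp comp_assoc mult.commute\<close>)
  also have "\<dots> = (anti b \<star> anti a) \<pi>"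
    using p by (simp add: anti_def gconv_def P_inv P_comp)
  finally show "anti (a \<star> b) \<pi> = (anti b \<star> anti a) \<pi>" .
qed (simp_all add: GA_def anti_def gconv_def)

section \<open>Young symmetrizers\<close>

definition rsym :: "nat list \<Rightarrow> (nat \<Rightarrow> nat) \<Rightarrow> 'k::field_char_0" where
  "rsym lam = (\<lambda>\<sigma>. if \<sigma> \<in> row_stabilizer lam then 1 else 0)"
definition csym :: "nat list \<Rightarrow> (nat \<Rightarrow> nat) \<Rightarrow> 'k::field_char_0" where
  "csym lam = (\<lambda>\<sigma>. if \<sigma> \<in> col_stabilizer lam then of_int (sign \<sigma>) else 0)"

lemma rsym_apply: "rsym lam \<sigma> = (if \<sigma> \<in> row_stabilizer lam then 1 else 0)"
  and csym_apply: "csym lam \<sigma> = (if \<sigma> \<in> col_stabilizer lam then of_int (sign \<sigma>) else 0)"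
  by (simp_all add: rsym_def csym_def)

lemma stabilizers:
  assumes lam: "lam \<in> partitions d"
  shows "\<sigma> \<in> row_stabilizer lam \<longleftrightarrow> \<sigma> permutes {..<d} \<and> (\<forall>k<d. tab_row lam (\<sigma> k) = tab_row lam k)"
    "\<sigma> \<in> col_stabilizer lam \<longleftrightarrow> \<sigma> permutes {..<d} \<and> (\<forall>k<d. tab_col lam (\<sigma> k) = tab_col lam k)"
  using partitionsD(1)[OF lam] by (simp_all add: row_stabilizer_def col_stabilizer_def)

lemma group_algebra_mult: "a \<otimes>\<^bsub>group_algebra d\<^esub> b = a \<star> b"
proof
  fix \<pi>
  show "(a \<otimes>\<^bsub>group_algebra d\<^esub> b) \<pi> = (a \<star> b) \<pi>"
  proof (cases "\<pi> permutes {..<d}")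
    case True
    have "(\<Sum>(\<sigma>, \<tau>) | \<sigma> permutes {..<d} \<and> \<tau> permutes {..<d} \<and> \<sigma> \<circ> \<tau> = \<pi>. a \<sigma> * b \<tau>) =
        (\<Sum>\<sigma>\<in>P. a \<sigma> * b (inv \<sigma> \<circ> \<pi>))"
      by (rule sum.reindex_bij_witness[of _ "\<lambda>\<sigma>. (\<sigma>, inv \<sigma> \<circ> \<pi>)" fst])
        (use True in \<open>auto simp: P_invs(4,5) P_inv P_comp\<close>)
    then show ?thesis using True by (simp add: group_algebra_def gconv_def)
  next
    case False
    then have *: "{(\<sigma>, \<tau>). \<sigma> permutes {..<d} \<and> \<tau> permutes {..<d} \<and> \<sigma> \<circ> \<tau> = \<pi>} = {}"
      using P_comp by blast
    show ?thesis using False unfolding group_algebra_def gconv_def by (simp add: *)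
  qed
qed

lemma young_eq:
  assumes lam: "lam \<in> partitions d"
  shows "young_symmetrizer lam = rsym lam \<star> csym lam"
  using partitionsD(1)[OF lam] by (simp add: group_algebra_mult young_symmetrizer_def rsym_def csym_def)

lemma GA_syms [simp]: "lam \<in> partitions d \<Longrightarrow> rsym lam \<in> GA d" "lam \<in> partitions d \<Longrightarrow> csym lam \<in> GA d"
  by (auto simp: GA_def rsym_def csym_def stabilizers split: if_splits)

lemma stabilizer_group:
  assumes lam: "lam \<in> partitions d" and f: "f = tab_row lam \<or> f = tab_col lam"
  defines "H \<equiv> {\<sigma>. \<sigma> permutes {..<d} \<and> (\<forall>k<d. f (\<sigma> k) = f k)}"
  shows "id \<in> H" "\<sigma> \<in> H \<Longrightarrow> inv \<sigma> \<in> H" "\<sigma> \<in> H \<Longrightarrow> \<tau> \<in> H \<Longrightarrow> \<sigma> \<circ> \<tau> \<in> H"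
proof -
  show "id \<in> H" by (simp add: H_def)
  show "inv \<sigma> \<in> H" if "\<sigma> \<in> H"
  proof -
    have s: "\<sigma> permutes {..<d}" and *: "\<And>k. k < d \<Longrightarrow> f (\<sigma> k) = f k" using that by (auto simp: H_def)
    have "f (inv \<sigma> k) = f k" if "k < d" for k
      using *[of "inv \<sigma> k"] permutes_in_image[OF P_inv[OF s], of k] that permutes_inverses(1)[OF s, of k] by simp
    then show ?thesis using P_inv[OF s] by (simp add: H_def)
  qed
  show "\<sigma> \<circ> \<tau> \<in> H" if *: "\<sigma> \<in> H" "\<tau> \<in> H"
  proof -
    have t: "\<tau> permutes {..<d}" using * by (simp add: H_def)
    have "\<tau> k < d" if "k < d" for k using permutes_in_image[OF t, of k] that by simp
    then show ?thesis using * by (auto simp: H_def P_comp)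
  qed
qed

lemma rstab:
  assumes lam: "lam \<in> partitions d"
  shows "\<sigma> \<in> row_stabilizer lam \<Longrightarrow> inv \<sigma> \<in> row_stabilizer lam"
    "\<sigma> \<in> row_stabilizer lam \<Longrightarrow> \<tau> \<in> row_stabilizer lam \<Longrightarrow> \<sigma> \<circ> \<tau> \<in> row_stabilizer lam"
    "id \<in> row_stabilizer lam" "\<sigma> \<in> row_stabilizer lam \<Longrightarrow> \<sigma> permutes {..<d}"
  using stabilizer_group[OF lam, of "tab_row lam"] stabilizers(1)[OF lam] by auto

lemma cstab:
  assumes lam: "lam \<in> partitions d"
  shows "\<sigma> \<in> col_stabilizer lam \<Longrightarrow> inv \<sigma> \<in> col_stabilizer lam"
    "\<sigma> \<in> col_stabilizer lam \<Longrightarrow> \<tau> \<in> col_stabilizer lam \<Longrightarrow> \<sigma> \<circ> \<tau> \<in> col_stabilizer lam"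
    "id \<in> col_stabilizer lam" "\<sigma> \<in> col_stabilizer lam \<Longrightarrow> \<sigma> permutes {..<d}"
  using stabilizer_group[OF lam, of "tab_col lam"] stabilizers(2)[OF lam] by auto

lemma rsym_absorb:
  assumes lam: "lam \<in> partitions d" and r: "\<rho> \<in> row_stabilizer lam"
  shows "single \<rho> \<star> rsym lam = rsym lam" "rsym lam \<star> single \<rho> = rsym lam"
proof -
  note rp = rstab(4)[OF lam r]
  have 1: "inv \<rho> \<circ> \<pi> \<in> row_stabilizer lam \<longleftrightarrow> \<pi> \<in> row_stabilizer lam" if "\<pi> permutes {..<d}" for \<pi>
    using rstab(2)[OF lam r, of "inv \<rho> \<circ> \<pi>"] rstab(2)[OF lam rstab(1)[OF lam r], of \<pi>] P_invs(4)[OF rp, of \<pi>] by auto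
  have 2: "\<pi> \<circ> inv \<rho> \<in> row_stabilizer lam \<longleftrightarrow> \<pi> \<in> row_stabilizer lam" if "\<pi> permutes {..<d}" for \<pi>
    using rstab(2)[OF lam _ r, of "\<pi> \<circ> inv \<rho>"] rstab(2)[OF lam _ rstab(1)[OF lam r], of \<pi>] P_invs(7)[OF rp, of \<pi>] by auto
  show "single \<rho> \<star> rsym lam = rsym lam"
    by (rule GA_eqI) (use lam 1 rp in \<open>auto simp: mul_single_left rsym_apply\<close>)
  show "rsym lam \<star> single \<rho> = rsym lam"
    by (rule GA_eqI) (use lam 2 rp in \<open>auto simp: mul_single_right rsym_apply\<close>)
qed

lemma csym_absorb:
  assumes lam: "lam \<in> partitions d" and r: "\<gamma> \<in> col_stabilizer lam"
  shows "single \<gamma> \<star> csym lam = sc (of_int (sign \<gamma>)) (csym lam)" "csym lam \<star> single \<gamma> = sc (of_int (sign \<gamma>)) (csym lam)"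
proof -
  note rp = cstab(4)[OF lam r]
  have pm: "permutation \<pi>" if "\<pi> permutes {..<d}" for \<pi>
    using that permutation_permutes by blast
  have 1: "inv \<gamma> \<circ> \<pi> \<in> col_stabilizer lam \<longleftrightarrow> \<pi> \<in> col_stabilizer lam" if "\<pi> permutes {..<d}" for \<pi>
    using cstab(2)[OF lam r, of "inv \<gamma> \<circ> \<pi>"] cstab(2)[OF lam cstab(1)[OF lam r], of \<pi>] P_invs(4)[OF rp, of \<pi>] by auto
  have 2: "\<pi> \<circ> inv \<gamma> \<in> col_stabilizer lam \<longleftrightarrow> \<pi> \<in> col_stabilizer lam" if "\<pi> permutes {..<d}" for \<pi>
    using cstab(2)[OF lam _ r, of "\<pi> \<circ> inv \<gamma>"] cstab(2)[OF lam _ cstab(1)[OF lam r], of \<pi>] P_invs(7)[OF rp, of \<pi>] by auto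
  have s: "sign (inv \<gamma> \<circ> \<pi>) = sign \<gamma> * sign \<pi>" "sign (\<pi> \<circ> inv \<gamma>) = sign \<gamma> * sign \<pi>" if "\<pi> permutes {..<d}" for \<pi>
    using pm[OF that] pm[OF rp] permutation_inverse[OF pm[OF rp]] by (simp_all add: sign_compose sign_inverse)
  show "single \<gamma> \<star> csym lam = sc (of_int (sign \<gamma>)) (csym lam)"
    by (rule GA_eqI) (use lam 1 rp s in \<open>auto simp: mul_single_left csym_apply sc_apply intro!: GA_sc\<close>)
  show "csym lam \<star> single \<gamma> = sc (of_int (sign \<gamma>)) (csym lam)"
    by (rule GA_eqI) (use lam 2 rp s in \<open>auto simp: mul_single_right csym_apply sc_apply intro!: GA_sc\<close>)
qed

lemma neg_self_zero: "a = sc (- 1) a \<Longrightarrow> (a :: _ \<Rightarrow> 'k::field_char_0) = 0"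
proof
  fix x assume "a = sc (- 1) a"
  then have "a x = - a x" unfolding sc_def by (metis mult_minus1)
  then show "a x = 0 x" by simp
qed

text \<open>The transposition of x and y preserves the rows of lam; conjugated by \<sigma> it swaps
  \<open>inv \<sigma> x\<close> and \<open>inv \<sigma> y\<close>, which share a column of mu. So
  one symmetrizer absorbs it, while the other changes sign.\<close>

lemma transpose_witness:
  assumes "lam \<in> partitions d" "mu \<in> partitions d" "\<sigma> permutes {..<d}"
    and xy: "x < d" "y < d" "x \<noteq> y" "tab_row lam x = tab_row lam y" "tab_col mu (inv \<sigma> x) = tab_col mu (inv \<sigma> y)"
  obtains t where "t \<in> row_stabilizer lam" "inv \<sigma> \<circ> t \<circ> \<sigma> \<in> col_stabilizer mu" "sign (inv \<sigma> \<circ> t \<circ> \<sigma>) = - 1"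
proof -
  define t where "t = Transposition.transpose x y"
  have t: "t permutes {..<d}" unfolding t_def using xy by (intro permutes_swap_id) auto
  have iss: "inv \<sigma> \<circ> t \<circ> \<sigma> permutes {..<d}" using t assms(3) by (intro P_comp P_inv)
  have "tab_row lam (t k) = tab_row lam k" for k
    using xy(4) by (simp add: t_def Transposition.transpose_def)
  then have 1: "t \<in> row_stabilizer lam" using t by (simp add: stabilizers[OF assms(1)])
  have "tab_col mu (inv \<sigma> (t (\<sigma> k))) = tab_col mu k" for k
  proof -
    have k: "inv \<sigma> (\<sigma> k) = k" by (rule permutes_inverses(2)[OF assms(3)])
    show ?thesis
    proof (cases "\<sigma> k = x \<or> \<sigma> k = y")
      case True
      then show ?thesis using xy(5) k by (auto simp: t_def)
    next
      case False
      then show ?thesis using k by (simp add: t_def)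
    qed
  qed
  then have 2: "inv \<sigma> \<circ> t \<circ> \<sigma> \<in> col_stabilizer mu" using iss by (simp add: stabilizers[OF assms(2)])
  have pm: "permutation \<pi>" if "\<pi> permutes {..<d}" for \<pi>
    using that permutation_permutes by blast
  note sp = pm[OF assms(3)] permutation_inverse[OF pm[OF assms(3)]] pm[OF t]
  have "sign (inv \<sigma> \<circ> t \<circ> \<sigma>) = sign \<sigma> * sign t * sign \<sigma>"
    using sp by (simp add: sign_compose permutation_compose sign_inverse)
  also have "\<dots> = -1" using xy(3) by (simp add: t_def sign_swap_id mult.commute sign_idempotent mult.left_commute)
  finally show ?thesis using that 1 2 by blast
qed

text \<open>When dominance fails, the hypothesis of \<open>von_neumann\<close> fails for every
  \<sigma>, which supplies a transposition t. With a and b the row and column sums, a \<sigma> b = a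
  t \<sigma> b = a \<sigma> (\<sigma>^-1 t \<sigma>) b = - a \<sigma> b.\<close>

lemma sym_kill:
  assumes lam: "lam \<in> partitions d" and mu: "mu \<in> partitions d" and s: "\<sigma> permutes {..<d}"
    and nd: "\<not> (\<forall>i. sum_list (take i lam) \<le> sum_list (take i mu))"
  shows "rsym lam \<star> single \<sigma> \<star> csym mu = (0 :: _ \<Rightarrow> 'k::field_char_0)" 
    "csym mu \<star> single \<sigma> \<star> rsym lam = (0 :: _ \<Rightarrow> 'k::field_char_0)"
proof -
  have ex: "\<exists>t. t \<in> row_stabilizer lam \<and> inv \<sigma> \<circ> t \<circ> \<sigma> \<in> col_stabilizer mu \<and> sign (inv \<sigma> \<circ> t \<circ> \<sigma>) = - 1"
    if s: "\<sigma> permutes {..<d}" for \<sigma>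
  proof -
    have "\<exists>x y. x < d \<and> y < d \<and> x \<noteq> y \<and> tab_row lam x = tab_row lam y \<and> tab_col mu (inv \<sigma> x) = tab_col mu (inv \<sigma> y)"
      using von_neumann(1)[OF lam mu s] nd by blast
    then show ?thesis using transpose_witness[OF lam mu s] by metis
  qed
  obtain t where t: "t \<in> row_stabilizer lam" "inv \<sigma> \<circ> t \<circ> \<sigma> \<in> col_stabilizer mu" "sign (inv \<sigma> \<circ> t \<circ> \<sigma>) = - 1"
    using ex[OF s] by blast
  note tp = rstab(4)[OF lam t(1)] and cp = cstab(4)[OF mu t(2)]
  let ?a = "rsym lam :: _ \<Rightarrow> 'k" and ?b = "csym mu :: _ \<Rightarrow> 'k"
  have "?a \<star> single \<sigma> \<star> ?b = (?a \<star> single t) \<star> single \<sigma> \<star> ?b" unfolding rsym_absorb(2)[OF lam t(1)] ..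
  also have "\<dots> = ?a \<star> (single t \<star> single \<sigma>) \<star> ?b" by (simp add: mul_assoc)
  also have "single t \<star> single \<sigma> = single \<sigma> \<star> single (inv \<sigma> \<circ> t \<circ> \<sigma>)"
    using s tp cp by (simp add: single_single P_invs flip: o_assoc)
  also have "?a \<star> (single \<sigma> \<star> single (inv \<sigma> \<circ> t \<circ> \<sigma>)) \<star> ?b = ?a \<star> single \<sigma> \<star> (single (inv \<sigma> \<circ> t \<circ> \<sigma>) \<star> ?b)"
    by (simp add: mul_assoc)
  also have "\<dots> = sc (- 1) (?a \<star> single \<sigma> \<star> ?b)" unfolding csym_absorb(1)[OF mu t(2)] by (simp add: t(3))
  finally show "?a \<star> single \<sigma> \<star> ?b = 0" by (rule neg_self_zero)
  \<comment> \<open>For the opposite order of the factors t has to pass through \<sigma> from right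
    to left, so the witness is taken for the inverse of \<sigma>.\<close>
  obtain t where t: "t \<in> row_stabilizer lam" "\<sigma> \<circ> t \<circ> inv \<sigma> \<in> col_stabilizer mu" "sign (\<sigma> \<circ> t \<circ> inv \<sigma>) = - 1"
    using ex[OF P_inv[OF s]] P_invs(3)[OF s] by auto
  note tp = rstab(4)[OF lam t(1)] and cp = cstab(4)[OF mu t(2)]
  have "?b \<star> single \<sigma> \<star> ?a = ?b \<star> single \<sigma> \<star> (single t \<star> ?a)" unfolding rsym_absorb(1)[OF lam t(1)] ..
  also have "\<dots> = ?b \<star> (single \<sigma> \<star> single t) \<star> ?a" by (simp add: mul_assoc)
  also have "single \<sigma> \<star> single t = single (\<sigma> \<circ> t \<circ> inv \<sigma>) \<star> single \<sigma>"
    using s tp cp by (simp add: single_single P_invs)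
  also have "?b \<star> (single (\<sigma> \<circ> t \<circ> inv \<sigma>) \<star> single \<sigma>) \<star> ?a = (?b \<star> single (\<sigma> \<circ> t \<circ> inv \<sigma>)) \<star> single \<sigma> \<star> ?a"
    by (simp add: mul_assoc)
  also have "\<dots> = sc (- 1) (?b \<star> single \<sigma> \<star> ?a)" unfolding csym_absorb(2)[OF mu t(2)] by (simp add: t(3))
  finally show "?b \<star> single \<sigma> \<star> ?a = 0" by (rule neg_self_zero)
qed

text \<open>Either a transposition makes the product equal to its negative, or
  \<open>von_neumann\<close> factors \<sigma> into a row and a column permutation, which the two
  sums absorb up to a sign.\<close>

lemma sym_scalar:
  assumes lam: "lam \<in> partitions d" and s: "\<sigma> permutes {..<d}"
  shows "\<exists>u. rsym lam \<star> single \<sigma> \<star> csym lam = sc u (rsym lam \<star> csym lam :: _ \<Rightarrow> 'k::field_char_0)"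
proof (cases "\<exists>x y. x < d \<and> y < d \<and> x \<noteq> y \<and> tab_row lam x = tab_row lam y \<and> tab_col lam (inv \<sigma> x) = tab_col lam (inv \<sigma> y)")
  case True
  then obtain t where t: "t \<in> row_stabilizer lam" "inv \<sigma> \<circ> t \<circ> \<sigma> \<in> col_stabilizer lam" "sign (inv \<sigma> \<circ> t \<circ> \<sigma>) = - 1"
    using transpose_witness[OF lam lam s] by metis
  note tp = rstab(4)[OF lam t(1)] and cp = cstab(4)[OF lam t(2)]
  let ?a = "rsym lam :: _ \<Rightarrow> 'k" and ?b = "csym lam :: _ \<Rightarrow> 'k"
  have "?a \<star> single \<sigma> \<star> ?b = (?a \<star> single t) \<star> single \<sigma> \<star> ?b" unfolding rsym_absorb(2)[OF lam t(1)] ..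
  also have "\<dots> = ?a \<star> (single t \<star> single \<sigma>) \<star> ?b" by (simp add: mul_assoc)
  also have "single t \<star> single \<sigma> = single \<sigma> \<star> single (inv \<sigma> \<circ> t \<circ> \<sigma>)"
    using s tp cp by (simp add: single_single P_invs flip: o_assoc)
  also have "?a \<star> (single \<sigma> \<star> single (inv \<sigma> \<circ> t \<circ> \<sigma>)) \<star> ?b = ?a \<star> single \<sigma> \<star> (single (inv \<sigma> \<circ> t \<circ> \<sigma>) \<star> ?b)"
    by (simp add: mul_assoc)
  also have "\<dots> = sc (- 1) (?a \<star> single \<sigma> \<star> ?b)" unfolding csym_absorb(1)[OF lam t(2)] by (simp add: t(3))
  finally have "?a \<star> single \<sigma> \<star> ?b = 0" by (rule neg_self_zero)
  then show ?thesis by (intro exI[of _ 0]) simp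
next
  case False
  then obtain \<rho> \<gamma> where rg: "\<rho> \<in> row_stabilizer lam" "\<gamma> \<in> col_stabilizer lam" "\<sigma> = \<rho> \<circ> \<gamma>"
    using von_neumann(2)[OF lam lam s] by blast
  let ?a = "rsym lam :: _ \<Rightarrow> 'k" and ?b = "csym lam :: _ \<Rightarrow> 'k"
  have "?a \<star> single \<sigma> \<star> ?b = (?a \<star> single \<rho>) \<star> (single \<gamma> \<star> ?b)"
    unfolding rg(3) single_single[OF rstab(4)[OF lam rg(1)] cstab(4)[OF lam rg(2)], symmetric] by (simp add: mul_assoc)
  then show ?thesis unfolding rsym_absorb(2)[OF lam rg(1)] csym_absorb(1)[OF lam rg(2)] by auto
qed

end

text \<open>Gaussian elimination by induction on the number of equations. It will supply a linear
  relation between class functions.\<close>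

lemma exists_nontrivial_solution:
  fixes M :: "'t \<Rightarrow> 's \<Rightarrow> 'k::field"
  assumes "finite S" "finite T" "card S < card T"
  shows "\<exists>g. (\<exists>t\<in>T. g t \<noteq> 0) \<and> (\<forall>s\<in>S. (\<Sum>t\<in>T. g t * M t s) = 0)"
  using assms
proof (induction S arbitrary: T M rule: finite_induct)
  case empty
  then have "T \<noteq> {}" by auto
  then show ?case by (intro exI[of _ "\<lambda>_. 1"]) auto
next
  case (insert s S)
  show ?case
  proof (cases "\<forall>t\<in>T. M t s = 0")
    case True
    obtain g where g: "\<exists>t\<in>T. g t \<noteq> 0" "\<forall>s\<in>S. (\<Sum>t\<in>T. g t * M t s) = 0"
      using insert.IH[of T M] insert.prems insert.hyps by auto
    have "(\<Sum>t\<in>T. g t * M t s) = 0" using True by (intro sum.neutral) simp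
    then show ?thesis using g by (intro exI[of _ g]) simp
  next
    case False
    then obtain t0 where t0: "t0 \<in> T" "M t0 s \<noteq> 0" by blast
    \<comment> \<open>A row operation: multiples of row t0 are subtracted so that column s becomes
      zero in the other rows.\<close>
    define M' where "M' t r = M t r - M t s / M t0 s * M t0 r" for t r
    have "card S < card (T - {t0})" using insert.prems insert.hyps t0 by simp
    then obtain g where g: "\<exists>t\<in>T - {t0}. g t \<noteq> 0" "\<forall>s\<in>S. (\<Sum>t\<in>T - {t0}. g t * M' t s) = 0"
      using insert.IH[of "T - {t0}" M'] insert.prems by auto
    \<comment> \<open>The total multiple of row t0 subtracted by a combination of the rows of
      \<open>M'\<close>; its negative is the coefficient of t0 in the original rows.\<close>
    define c where "c = (\<Sum>t\<in>T - {t0}. g t * (M t s / M t0 s))"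
    have eq: "(\<Sum>t\<in>T. (if t = t0 then - c else g t) * M t r) = (\<Sum>t\<in>T - {t0}. g t * M' t r)" for r
    proof -
      have "(\<Sum>t\<in>T. (if t = t0 then - c else g t) * M t r) = - c * M t0 r + (\<Sum>t\<in>T - {t0}. g t * M t r)"
        using insert.prems t0 by (simp add: sum.remove[of T t0])
      also have "\<dots> = (\<Sum>t\<in>T - {t0}. g t * M' t r)"
        by (simp add: M'_def c_def right_diff_distrib sum_subtractf sum_distrib_right mult.assoc)
      finally show ?thesis .
    qed
    have "(\<Sum>t\<in>T - {t0}. g t * M' t s) = 0" using t0 by (simp add: M'_def)
    then have "\<forall>r\<in>insert s S. (\<Sum>t\<in>T. (if t = t0 then - c else g t) * M t r) = 0" 
      using g(2) unfolding eq by blast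
    moreover obtain t where "t \<in> T - {t0}" "g t \<noteq> 0" using g(1) by blast
    then have "\<exists>t\<in>T. (if t = t0 then - c else g t) \<noteq> 0" by (intro bexI[of _ t]) auto
    ultimately show ?thesis by (intro exI[of _ "\<lambda>t. if t = t0 then - c else g t"] conjI)
  qed
qed

section \<open>Young symmetrizers as quasi-idempotents\<close>

context sym_alg
begin

definition ysym :: "nat list \<Rightarrow> (nat \<Rightarrow> nat) \<Rightarrow> 'k::field_char_0" where "ysym lam = rsym lam \<star> csym lam"
text \<open>The factor n in c c = n c, classically d! divided by the dimension of the Specht module.
  Since c has coefficient 1 at the identity, n is the coefficient of c c there.\<close>

definition ynorm :: "nat list \<Rightarrow> 'k::field_char_0" where "ynorm lam = (ysym lam \<star> ysym lam) id"
definition yidem :: "nat list \<Rightarrow> (nat \<Rightarrow> nat) \<Rightarrow> 'k::field_char_0" where "yidem lam = sc (inverse (ynorm lam)) (ysym lam)"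

lemma GA_ysym [simp]: "ysym lam \<in> GA d" "yidem lam \<in> GA d"
  by (simp_all add: ysym_def yidem_def GA_sc)

lemma sandwich:
  assumes "x \<in> GA d"
  shows "a \<star> x \<star> b = (\<Sum>\<sigma>\<in>P. sc (x \<sigma>) (a \<star> single \<sigma> \<star> b))"
proof -
  have "a \<star> x \<star> b = a \<star> (\<Sum>\<sigma>\<in>P. sc (x \<sigma>) (single \<sigma>)) \<star> b" using GA_decomp[OF assms] by simp
  also have "\<dots> = (\<Sum>\<sigma>\<in>P. sc (x \<sigma>) (a \<star> single \<sigma> \<star> b))"
    unfolding mul_sum_right mul_sum_left by (intro sum.cong refl) simp
  finally show ?thesis .
qed

lemma rsym_csym_scalar:
  assumes lam: "lam \<in> partitions d" and x: "x \<in> GA d"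
  shows "\<exists>u. rsym lam \<star> x \<star> csym lam = sc u (ysym lam :: _ \<Rightarrow> 'k::field_char_0)"
proof -
  have "\<forall>\<sigma>. \<exists>u. \<sigma> permutes {..<d} \<longrightarrow> rsym lam \<star> single \<sigma> \<star> csym lam = sc u (ysym lam :: _ \<Rightarrow> 'k)"
    using sym_scalar[OF lam] unfolding ysym_def by blast
  from choice[OF this] obtain u where
    u: "\<And>\<sigma>. \<sigma> permutes {..<d} \<Longrightarrow> rsym lam \<star> single \<sigma> \<star> csym lam = sc (u \<sigma>) (ysym lam :: _ \<Rightarrow> 'k)"
    by blast
  have "rsym lam \<star> x \<star> csym lam = (\<Sum>\<sigma>\<in>P. sc (x \<sigma> * u \<sigma>) (ysym lam))"
    unfolding sandwich[OF x] by (intro sum.cong refl) (simp add: u)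
  then show ?thesis unfolding sum_sc by blast
qed

lemma sym_kill_all:
  assumes lam: "lam \<in> partitions d" and mu: "mu \<in> partitions d" and x: "x \<in> GA d"
    and nd: "\<not> (\<forall>i. sum_list (take i lam) \<le> sum_list (take i mu))"
  shows "rsym lam \<star> x \<star> csym mu = (0 :: _ \<Rightarrow> 'k::field_char_0)" 
    "csym mu \<star> x \<star> rsym lam = (0 :: _ \<Rightarrow> 'k::field_char_0)"
  unfolding sandwich[OF x] by (simp_all add: sym_kill[OF lam mu _ nd] sum.neutral)

text \<open>In (a b) x (a b) = a (b x a) b the outer factors a and b already force a multiple of a
  b.\<close>

lemma ysym_sandwich:
  assumes lam: "lam \<in> partitions d"
  shows "\<exists>u. ysym lam \<star> x \<star> ysym lam = sc u (ysym lam :: _ \<Rightarrow> 'k::field_char_0)"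
proof -
  have "ysym lam \<star> x \<star> ysym lam = rsym lam \<star> (csym lam \<star> x \<star> rsym lam) \<star> csym lam"
    by (simp add: ysym_def mul_assoc)
  then show ?thesis using rsym_csym_scalar[OF lam GA_mul] by simp
qed

text \<open>Two distinct partitions cannot dominate each other mutually. According to the direction
  that fails, the outer pair of row sum of lam and column sum of mu gives zero, or the inner pair of
  column sum of lam and row sum of mu does.\<close>

lemma ysym_orth:
  assumes lam: "lam \<in> partitions d" and mu: "mu \<in> partitions d" and ne: "lam \<noteq> mu" and x: "x \<in> GA d"
  shows "ysym lam \<star> x \<star> ysym mu = (0 :: _ \<Rightarrow> 'k::field_char_0)"
proof -
  have e: "ysym lam \<star> x \<star> ysym mu = rsym lam \<star> (csym lam \<star> x \<star> rsym mu) \<star> csym mu"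
    by (simp add: ysym_def mul_assoc)
  have "\<not> (\<forall>i. sum_list (take i lam) \<le> sum_list (take i mu)) \<or> \<not> (\<forall>i. sum_list (take i mu) \<le> sum_list (take i lam))"
  proof (rule ccontr)
    assume "\<not> ?thesis"
    then have "sum_list (take i lam) = sum_list (take i mu)" for i by (simp add: order_antisym)
    then have "lam = mu" by (rule partition_eqI) (use partitionsD(3)[OF lam] partitionsD(3)[OF mu] in auto)
    then show False using ne by simp
  qed
  then show ?thesis unfolding e
  proof
    assume "\<not> (\<forall>i. sum_list (take i lam) \<le> sum_list (take i mu))"
    then show "rsym lam \<star> (csym lam \<star> x \<star> rsym mu) \<star> csym mu = (0 :: _ \<Rightarrow> 'k)"
      by (rule sym_kill_all(1)[OF lam mu GA_mul])
  next
    assume "\<not> (\<forall>i. sum_list (take i mu) \<le> sum_list (take i lam))"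
    then have "csym lam \<star> x \<star> rsym mu = (0 :: _ \<Rightarrow> 'k)" by (rule sym_kill_all(2)[OF mu lam x])
    then show "rsym lam \<star> (csym lam \<star> x \<star> rsym mu) \<star> csym mu = (0 :: _ \<Rightarrow> 'k)" by simp
  qed
qed

text \<open>A permutation that preserves both rows and columns is the identity, so the product
  contains the identity exactly once, with sign 1.\<close>

lemma ysym_id:
  assumes lam: "lam \<in> partitions d"
  shows "ysym lam id = (1 :: 'k::field_char_0)"
proof -
  have *: "rsym lam \<sigma> * csym lam (inv \<sigma> \<circ> id) = (if \<sigma> = id then 1 else 0 :: 'k)" if s: "\<sigma> permutes {..<d}" for \<sigma>
  proof (cases "\<sigma> \<in> row_stabilizer lam \<and> inv \<sigma> \<in> col_stabilizer lam")
    case True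
    then have "\<sigma> \<in> col_stabilizer lam" using cstab(1)[OF lam, of "inv \<sigma>"] P_invs(3)[OF s] by simp
    then have "\<sigma> k = k" for k
    proof (cases "k < d")
      case k: True
      then have "\<sigma> k < d" using permutes_in_image[OF s, of k] by simp
      then show ?thesis using True \<open>\<sigma> \<in> col_stabilizer lam\<close> k partitionsD(1)[OF lam] tab_inj[of "\<sigma> k" lam k]
        by (simp add: stabilizers[OF lam])
    qed (use permutes_not_in[OF s, of k] in simp)
    then have "\<sigma> = id" by auto
    then show ?thesis using True by (simp add: rsym_apply csym_apply)
  next
    case False
    moreover have "\<sigma> \<noteq> id" using False rstab(3)[OF lam] cstab(3)[OF lam] by (metis inv_id)
    ultimately show ?thesis by (auto simp: rsym_apply csym_apply)
  qed
  have "ysym lam id = (\<Sum>\<sigma>\<in>P. rsym lam \<sigma> * csym lam (inv \<sigma> \<circ> id) :: 'k)"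
    by (simp add: ysym_def gconv_def)
  also have "\<dots> = (\<Sum>\<sigma>\<in>P. if \<sigma> = id then 1 else 0)" by (intro sum.cong refl) (use * in simp)
  also have "\<dots> = 1" by (simp add: sum.delta)
  finally show ?thesis .
qed

lemma ysym_square: "lam \<in> partitions d \<Longrightarrow> ysym lam \<star> ysym lam = sc (ynorm lam) (ysym lam :: _ \<Rightarrow> 'k::field_char_0)"
proof -
  assume lam: "lam \<in> partitions d"
  obtain u where u: "ysym lam \<star> single id \<star> ysym lam = sc u (ysym lam :: _ \<Rightarrow> 'k)"
    using ysym_sandwich[OF lam] by blast
  then have "ysym lam \<star> ysym lam = sc u (ysym lam :: _ \<Rightarrow> 'k)" by (simp add: single_id)
  moreover from this have "ynorm lam = u" using ysym_id[OF lam, where 'k='k] by (simp add: ynorm_def sc_def)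
  ultimately show ?thesis by simp
qed

lemma rsym_square:
  assumes lam: "lam \<in> partitions d"
  shows "rsym lam \<star> rsym lam = sc (of_nat (card (row_stabilizer lam))) (rsym lam :: _ \<Rightarrow> 'k::field_char_0)"
proof -
  have sub: "row_stabilizer lam \<subseteq> P" using rstab(4)[OF lam] by blast
  have eq: "rsym lam = (\<Sum>\<sigma>\<in>row_stabilizer lam. single \<sigma> :: _ \<Rightarrow> 'k)"
    by (rule ext) (use finite_subset[OF sub finP] in \<open>simp add: rsym_apply sum_fun_apply single_def\<close>)
  have "rsym lam \<star> rsym lam = (\<Sum>\<sigma>\<in>row_stabilizer lam. single \<sigma>) \<star> (rsym lam :: _ \<Rightarrow> 'k)"
    by (subst eq) (rule refl)
  also have "\<dots> = (\<Sum>\<sigma>\<in>row_stabilizer lam. sc 1 (rsym lam))"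
    unfolding mul_sum_left by (intro sum.cong refl) (simp add: rsym_absorb[OF lam])
  finally show ?thesis unfolding sum_sc by simp
qed

lemma anti_syms:
  assumes lam: "lam \<in> partitions d"
  shows "anti (rsym lam) = (rsym lam :: _ \<Rightarrow> 'k::field_char_0)" "anti (csym lam) = (csym lam :: _ \<Rightarrow> 'k)"
proof -
  have pm: "permutation \<pi>" if "\<pi> permutes {..<d}" for \<pi>
    using that permutation_permutes by blast
  have r: "inv \<sigma> \<in> row_stabilizer lam \<longleftrightarrow> \<sigma> \<in> row_stabilizer lam" "inv \<sigma> \<in> col_stabilizer lam \<longleftrightarrow> \<sigma> \<in> col_stabilizer lam" 
    "sign (inv \<sigma>) = sign \<sigma>" if "\<sigma> permutes {..<d}" for \<sigma>
    using rstab(1)[OF lam, of "inv \<sigma>"] rstab(1)[OF lam, of \<sigma>] cstab(1)[OF lam, of "inv \<sigma>"] cstab(1)[OF lam, of \<sigma>]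
      P_invs(3)[OF that] sign_inverse[OF pm[OF that]] by auto
  show "anti (rsym lam) = (rsym lam :: _ \<Rightarrow> 'k)"
    using r rstab(4)[OF lam] by (auto simp: anti_def rsym_apply fun_eq_iff)
  show "anti (csym lam) = (csym lam :: _ \<Rightarrow> 'k)"
    using r cstab(4)[OF lam] by (auto simp: anti_def csym_apply fun_eq_iff)
qed

text \<open>
  With \<open>z = a b a\<close>, where \<open>c = a b\<close> and \<open>c c = n c\<close>, one has \<open>z z = |R| n z\<close>. As \<open>z\<close> is invariant under inversion
  and has integer coefficients, the coefficient of the identity in \<open>z z\<close> is a positive sum of squares.
\<close>

lemma ynorm_nonzero:
  assumes lam: "lam \<in> partitions d"
  shows "ynorm lam \<noteq> (0 :: 'k::field_char_0)"
proof
  assume 0: "ynorm lam = (0 :: 'k)"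
  let ?a = "rsym lam :: _ \<Rightarrow> 'k" and ?b = "csym lam :: _ \<Rightarrow> 'k" and ?r = "of_nat (card (row_stabilizer lam)) :: 'k"
  define z where "z = ?a \<star> ?b \<star> ?a"
  have "z \<star> z = ?a \<star> ?b \<star> (?a \<star> ?a) \<star> ?b \<star> ?a" by (simp add: z_def mul_assoc)
  also have "\<dots> = sc ?r (?a \<star> ?b \<star> (?a \<star> ?b) \<star> ?a)" unfolding rsym_square[OF lam] by (simp add: mul_assoc)
  also have "\<dots> = 0" using ysym_square[OF lam, where 'k='k] unfolding ysym_def[symmetric] 0 by simp
  finally have zz: "(z \<star> z) id = 0" by simp
  have "anti z = z" unfolding z_def anti_mul anti_syms[OF lam] by (simp add: mul_assoc)
  then have az: "anti z \<sigma> = z \<sigma>" for \<sigma> by simp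
  have "z (inv \<sigma>) = z \<sigma>" if "\<sigma> permutes {..<d}" for \<sigma>
    using az[of \<sigma>] that by (simp add: anti_def)
  then have "(z \<star> z) id = (\<Sum>\<sigma>\<in>P. z \<sigma> * z \<sigma>)" by (simp add: gconv_def)
  then have sq: "(\<Sum>\<sigma>\<in>P. z \<sigma> * z \<sigma>) = 0" using zz by simp
  \<comment> \<open>In a field of characteristic zero a sum of nonzero squares may vanish;
    positivity is available only after descending to the integers.\<close>
  have zint: "z \<sigma> \<in> \<int>" for \<sigma>
  proof -
    have *: "(x \<star> y) \<sigma> \<in> \<int>" if "\<And>\<sigma>. x \<sigma> \<in> \<int>" "\<And>\<sigma>. y \<sigma> \<in> \<int>" for x y :: "_ \<Rightarrow> 'k" and \<sigma>
      using that by (auto simp: gconv_def intro!: Ints_sum Ints_mult)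
    have a: "?a \<sigma> \<in> \<int>" and b: "?b \<sigma> \<in> \<int>" for \<sigma> by (auto simp: rsym_apply csym_apply)
    have "(?a \<star> ?b) \<sigma> \<in> \<int>" for \<sigma> by (rule *[OF a b])
    then show ?thesis unfolding z_def by (rule *[OF _ a])
  qed
  have "\<forall>\<sigma>. \<exists>i. z \<sigma> = of_int i"
  proof
    fix \<sigma>
    show "\<exists>i. z \<sigma> = of_int i" using zint[of \<sigma>] by (cases rule: Ints_cases) blast
  qed
  from choice[OF this] obtain m where m: "\<And>\<sigma>. z \<sigma> = of_int (m \<sigma>)" by blast
  have "of_int (\<Sum>\<sigma>\<in>P. m \<sigma> * m \<sigma>) = (0 :: 'k)" using sq by (simp add: m)
  then have "(\<Sum>\<sigma>\<in>P. m \<sigma> * m \<sigma>) = 0" by (simp only: of_int_eq_0_iff)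
  then have "m id * m id = 0" using sum_nonneg_eq_0_iff[of P "\<lambda>\<sigma>. m \<sigma> * m \<sigma>"] id_P by simp
  then have "z id = 0" by (simp add: m)
  \<comment> \<open>By symmetry of the trace this is the coefficient of the identity in a a b = |R|
    a b, and a b has coefficient 1 there.\<close>
  moreover have "z id = ?r"
  proof -
    have "z id = (?a \<star> (?a \<star> ?b)) id" unfolding z_def by (rule trace_comm)
    also have "\<dots> = ((?a \<star> ?a) \<star> ?b) id" by (simp add: mul_assoc)
    also have "\<dots> = ?r" unfolding rsym_square[OF lam] using ysym_id[OF lam, where 'k='k] by (simp add: ysym_def sc_apply)
    finally show ?thesis .
  qed
  moreover have "?r \<noteq> 0"
  proof -
    have "row_stabilizer lam \<subseteq> P" using rstab(4)[OF lam] by blast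
    then have "finite (row_stabilizer lam)" by (rule finite_subset) simp
    then show ?thesis using rstab(3)[OF lam] by auto
  qed
  ultimately show False by simp
qed

lemma yidem_props:
  assumes lam: "lam \<in> partitions d"
  shows "yidem lam \<star> yidem lam = (yidem lam :: _ \<Rightarrow> 'k::field_char_0)"
    "ysym lam = sc (ynorm lam) (yidem lam :: _ \<Rightarrow> 'k)" "yidem lam id = inverse (ynorm lam :: 'k)"
  using ynorm_nonzero[OF lam, where 'k='k] ysym_square[OF lam, where 'k='k] ysym_id[OF lam, where 'k='k]
  by (simp_all add: yidem_def) (simp add: sc_def)

text \<open>The scalar is read off at the identity, where the idempotent has coefficient 1 /
  \<open>ynorm\<close>. The explicit form makes it a linear function of x.\<close>

lemma yidem_sandwich:
  assumes lam: "lam \<in> partitions d"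
  shows "yidem lam \<star> x \<star> yidem lam = sc (ynorm lam * (yidem lam \<star> x \<star> yidem lam) id) (yidem lam :: _ \<Rightarrow> 'k::field_char_0)"
proof -
  let ?e = "yidem lam :: _ \<Rightarrow> 'k"
  obtain u where u: "ysym lam \<star> x \<star> ysym lam = sc u (ysym lam :: _ \<Rightarrow> 'k)"
    using ysym_sandwich[OF lam] by blast
  have "?e \<star> x \<star> ?e = sc (inverse (ynorm lam) * inverse (ynorm lam)) (ysym lam \<star> x \<star> ysym lam)" by (simp add: yidem_def)
  also have "\<dots> = sc (inverse (ynorm lam) * inverse (ynorm lam) * u * ynorm lam) ?e" unfolding u using yidem_props(2)[OF lam, where 'k='k] by (simp add: mult.assoc)
  finally obtain v where v: "?e \<star> x \<star> ?e = sc v ?e" by blast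
  then have "(?e \<star> x \<star> ?e) id = v * inverse (ynorm lam)" using yidem_props(3)[OF lam, where 'k='k] by (simp add: sc_apply)
  then have "ynorm lam * (?e \<star> x \<star> ?e) id = v" using ynorm_nonzero[OF lam, where 'k='k] by simp
  then show ?thesis using v by simp
qed

lemma yidem_orth:
  assumes "lam \<in> partitions d" "mu \<in> partitions d" "lam \<noteq> mu" "x \<in> GA d"
  shows "yidem lam \<star> x \<star> yidem mu = (0 :: _ \<Rightarrow> 'k::field_char_0)"
  using ysym_orth[OF assms] by (simp add: yidem_def)

section \<open>The ideals A e and e A and their pairing\<close>

text \<open>The left ideal A e, written as the fixed set of right multiplication by e, so that
  membership is an equation; likewise e A below.\<close>

definition yleft :: "nat list \<Rightarrow> ((nat \<Rightarrow> nat) \<Rightarrow> 'k::field_char_0) set" where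
  "yleft lam = {x \<in> GA d. x \<star> yidem lam = x}"
definition yright :: "nat list \<Rightarrow> ((nat \<Rightarrow> nat) \<Rightarrow> 'k::field_char_0) set" where
  "yright lam = {x \<in> GA d. yidem lam \<star> x = x}"
text \<open>The factor \<open>ynorm\<close> compensates the coefficient of e at the identity, so
  that y x is exactly \<open>ypair lam x y\<close> times e.\<close>

definition ypair :: "nat list \<Rightarrow> ((nat \<Rightarrow> nat) \<Rightarrow> 'k::field_char_0) \<Rightarrow> ((nat \<Rightarrow> nat) \<Rightarrow> 'k) \<Rightarrow> 'k" where
  "ypair lam x y = ynorm lam * (y \<star> x) id"

lemma ypair_mult:
  assumes lam: "lam \<in> partitions d" and x: "x \<in> yleft lam" and y: "y \<in> yright lam"
  shows "y \<star> x = sc (ypair lam x y) (yidem lam)"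
proof -
  have "y \<star> x = yidem lam \<star> (y \<star> x) \<star> yidem lam"
    using x y by (simp add: yleft_def yright_def mul_assoc) (simp flip: mul_assoc)
  then show ?thesis using yidem_sandwich[OF lam, of "y \<star> x"] by (simp add: ypair_def)
qed

lemma specht_fields:
  assumes lam: "lam \<in> partitions d"
  shows "carrier (specht_module lam :: ('k::field_char_0, _) module) = yleft lam"
    "add (specht_module lam :: ('k, _) module) = (+)" "zero (specht_module lam :: ('k, _) module) = 0"
    "smult (specht_module lam :: ('k, _) module) = sc"
proof -
  have c: "carrier (group_algebra d :: ('k, _) module) = GA d"
    using finite_subset[OF _ finP] by (auto simp: group_algebra_def GA_def free_space_def subset_iff)
  have m: "a \<otimes>\<^bsub>group_algebra d\<^esub> b = a \<star> b" for a b :: "_ \<Rightarrow> 'k"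
    by (rule group_algebra_mult)
  have "{a \<star> ysym lam |a. a \<in> GA d} = (yleft lam :: (_ \<Rightarrow> 'k) set)"
  proof (intro equalityI subsetI)
    fix x :: "_ \<Rightarrow> 'k" assume "x \<in> {a \<star> ysym lam |a. a \<in> GA d}"
    then obtain a where "x = a \<star> ysym lam" by blast
    then show "x \<in> yleft lam" using yidem_props[OF lam, where 'k='k] by (simp add: yleft_def mul_assoc GA_sc)
  next
    fix x :: "_ \<Rightarrow> 'k" assume "x \<in> yleft lam"
    then have "x = sc (inverse (ynorm lam)) x \<star> ysym lam" "x \<in> GA d" by (simp_all add: yleft_def yidem_def)
    then show "x \<in> {a \<star> ysym lam |a. a \<in> GA d}" using GA_sc by blast
  qed
  then show "carrier (specht_module lam :: ('k, _) module) = yleft lam"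
    using partitionsD(1)[OF lam] by (simp add: specht_module_def Let_def c m young_eq[OF lam] ysym_def)
  show "add (specht_module lam :: ('k, _) module) = (+)" "zero (specht_module lam :: ('k, _) module) = 0"
    "smult (specht_module lam :: ('k, _) module) = sc"
    by (auto simp: specht_module_def Let_def group_algebra_def free_space_def fun_eq_iff sc_def)
qed

definition yright_module :: "nat list \<Rightarrow> ('k::field_char_0, (nat \<Rightarrow> nat) \<Rightarrow> 'k) module" where
  "yright_module lam = (group_algebra d)\<lparr>carrier := yright lam\<rparr>"

lemma yright_fields:
  "carrier (yright_module lam) = yright lam" "add (yright_module lam) = (+)" "zero (yright_module lam) = 0" 
  "smult (yright_module lam) = sc"
  by (auto simp: yright_module_def group_algebra_def free_space_def fun_eq_iff sc_def)

lemma ymodules_vs: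
  assumes lam: "lam \<in> partitions d"
  shows "vectorspace class_ring (specht_module lam :: ('k::field_char_0, _) module)"
    "vectorspace class_ring (yright_module lam :: ('k::field_char_0, _) module)"
proof -
  have GAc: "GA d \<subseteq> carrier (free_space P :: ('k, _) module)"
    using finite_subset[OF _ finP] by (auto simp: GA_def free_space_def subset_iff)
  have f: "add (free_space P :: ('k, _) module) = (+)" "zero (free_space P :: ('k, _) module) = 0"
    "smult (free_space P :: ('k, _) module) = sc"
    by (auto simp: free_space_def fun_eq_iff sc_def)
  show "vectorspace class_ring (specht_module lam :: ('k, _) module)"
    by (rule subspace_vs[OF free_space_vs[of P]])
      (use GAc in \<open>auto simp: specht_fields[OF lam] f yleft_def GA_add GA_sc mul_add_left\<close>)
  show "vectorspace class_ring (yright_module lam :: ('k, _) module)"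
    by (rule subspace_vs[OF free_space_vs[of P]])
      (use GAc in \<open>auto simp: yright_fields f yright_def GA_add GA_sc mul_add_right\<close>)
qed

text \<open>Let v = v e be orthogonal to e A. Writing tr for the coefficient of the identity, tr (b
  v) = tr (b v e) = tr (e b v) = 0 for all b, and the trace form is non-degenerate. The other side
  is symmetric.\<close>

lemma ypair_nondegenerate:
  assumes lam: "lam \<in> partitions d"
  shows "nondegenerate_pairing (specht_module lam) (yright_module lam) (ypair lam :: _ \<Rightarrow> _ \<Rightarrow> 'k::field_char_0)"
  unfolding nondegenerate_pairing_def specht_fields[OF lam]
proof (intro conjI ballI allI impI)
  let ?e = "yidem lam :: _ \<Rightarrow> 'k"
  note n0 = ynorm_nonzero[OF lam, where 'k='k]
  show "v = 0" if v: "v \<in> yleft lam" and *: "\<forall>w\<in>carrier (yright_module lam). ypair lam v w = 0" for v :: "_ \<Rightarrow> 'k"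
  proof (rule trace_nondegenerate)
    show "v \<in> GA d" using v by (simp add: yleft_def)
    fix b :: "_ \<Rightarrow> 'k" assume "b \<in> GA d"
    have "?e \<star> b \<in> yright lam" using yidem_props[OF lam, where 'k='k] by (simp add: yright_def flip: mul_assoc)
    then have "(?e \<star> b \<star> v) id = 0" using * n0 by (auto simp: ypair_def yright_fields)
    then have "(b \<star> v \<star> ?e) id = 0" using trace_comm[of ?e "b \<star> v"] by (simp add: mul_assoc)
    then have "(b \<star> v) id = 0" using v by (simp add: yleft_def mul_assoc)
    then show "(v \<star> b) id = 0" using trace_comm[of v b] by simp
  qed
  show "w = \<zero>\<^bsub>yright_module lam\<^esub>" if w: "w \<in> carrier (yright_module lam)" and *: "\<forall>v\<in>yleft lam. ypair lam v w = 0" for w :: "_ \<Rightarrow> 'k"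
  proof -
    have "w = 0"
    proof (rule trace_nondegenerate)
      show "w \<in> GA d" using w by (simp add: yright_def yright_fields)
      fix b :: "_ \<Rightarrow> 'k" assume "b \<in> GA d"
      have "b \<star> ?e \<in> yleft lam" using yidem_props[OF lam, where 'k='k] by (simp add: yleft_def mul_assoc)
      then have "(w \<star> (b \<star> ?e)) id = 0" using * n0 by (auto simp: ypair_def)
      then have "(?e \<star> w \<star> b) id = 0" using trace_comm[of "w \<star> b" ?e] by (simp add: mul_assoc)
      then show "(w \<star> b) id = 0" using w by (simp add: yright_def yright_fields)
    qed
    then show ?thesis by (simp add: yright_fields)
  qed
qed (auto simp: yright_fields ypair_def mul_add_left mul_add_right algebra_simps sc_apply)

end

context sym_alg
begin

text \<open>A e is spanned by the finitely many elements \<sigma> e, so finitely many extensions of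
  the empty dual system yield dual bases. Their size, the dimension of the Specht module, becomes
  the multiplicity.\<close>

lemma specht_dual_system:
  assumes lam: "lam \<in> partitions d"
  shows "\<exists>D. finite D \<and> dual_system (specht_module lam) (yright_module lam) (ypair lam :: _ \<Rightarrow> _ \<Rightarrow> 'k::field_char_0) D \<and>
    (\<forall>x\<in>yleft lam. dual_proj (specht_module lam) (ypair lam) D x = x) \<and>
    card D = vectorspace.dim (class_ring :: 'k ring) (specht_module lam)"
proof -
  let ?S = "specht_module lam :: ('k, _) module" and ?R = "yright_module lam :: ('k, _) module"
  let ?p = "ypair lam :: _ \<Rightarrow> _ \<Rightarrow> 'k"
  interpret paired ?S ?R ?p
    by (intro paired.intro paired_axioms.intro kvsI ymodules_vs[OF lam] ypair_nondegenerate[OF lam])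
  note sf = specht_fields[OF lam, where 'k='k]
  define G where "G = (\<lambda>\<sigma>. single \<sigma> \<star> yidem lam :: _ \<Rightarrow> 'k) ` P"
  have G: "finite G" "G \<subseteq> carrier ?S"
    using yidem_props(1)[OF lam, where 'k='k] by (auto simp: G_def sf yleft_def mul_assoc)
  from dual_system_finite_span[OF this dual_system_empty finite.emptyI]
  obtain D where D: "finite D" "dual_system ?S ?R ?p D" "\<And>g. g \<in> G \<Longrightarrow> dual_proj ?S ?p D g = g" by blast
  note lc = lin_closed_dual_proj[OF D(1,2)]
  have sp: "dual_proj ?S ?p D x = x" if x: "x \<in> carrier ?S" for x
  proof -
    have "x = x \<star> yidem lam" "x \<in> GA d" using x by (simp_all add: sf yleft_def)
    then have "x = (\<Sum>\<sigma>\<in>P. sc (x \<sigma>) (single \<sigma>)) \<star> yidem lam" using GA_decomp[of x] by simp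
    also have "\<dots> = (\<Sum>\<sigma>\<in>P. sc (x \<sigma>) (single \<sigma> \<star> yidem lam))" by (simp add: mul_sum_left)
    finally have x': "x = (\<Sum>\<sigma>\<in>P. sc (x \<sigma>) (single \<sigma> \<star> yidem lam))" .
    have "(\<Sum>\<sigma>\<in>P'. sc (x \<sigma>) (single \<sigma> \<star> yidem lam)) \<in> {v \<in> carrier ?S. dual_proj ?S ?p D v = v}" if "P' \<subseteq> P" for P'
      using finite_subset[OF that finP] that
    proof (induction P' rule: finite_induct)
      case empty
      show ?case using lin_closedD(1)[OF lc] by (simp only: sum.empty sf(3))
    next
      case (insert s P')
      have "single s \<star> yidem lam \<in> G" using insert.prems by (simp add: G_def)
      then have "sc (x s) (single s \<star> yidem lam) \<in> {v \<in> carrier ?S. dual_proj ?S ?p D v = v}"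
        using lin_closedD(3)[OF lc, of "single s \<star> yidem lam" "x s"] D(3) G(2) by (auto simp: sf(4))
      moreover have "(\<Sum>\<sigma>\<in>P'. sc (x \<sigma>) (single \<sigma> \<star> yidem lam)) \<in> {v \<in> carrier ?S. dual_proj ?S ?p D v = v}"
        using insert.IH insert.prems by blast
      ultimately show ?case unfolding sum.insert[OF insert.hyps]
        by (intro lin_closedD(2)[OF lc, unfolded sf(2)]) simp_all
    qed
    then show ?thesis using x' by (metis (mono_tags, lifting) mem_Collect_eq order_refl)
  qed
  show ?thesis using D sp dual_system_basis(2)[OF D(2,1) sp] sf(1) by auto
qed

definition ydual :: "nat list \<Rightarrow> (((nat \<Rightarrow> nat) \<Rightarrow> 'k::field_char_0) \<times> ((nat \<Rightarrow> nat) \<Rightarrow> 'k)) set" where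
  "ydual lam = (SOME D. finite D \<and> dual_system (specht_module lam) (yright_module lam) (ypair lam) D \<and>
    (\<forall>x\<in>yleft lam. dual_proj (specht_module lam) (ypair lam) D x = x) \<and>
    card D = vectorspace.dim (class_ring :: 'k ring) (specht_module lam))"

lemma ydual:
  assumes lam: "lam \<in> partitions d"
  shows "finite (ydual lam :: ((_ \<Rightarrow> 'k::field_char_0) \<times> (_ \<Rightarrow> 'k)) set)"
    "card (ydual lam :: ((_ \<Rightarrow> 'k) \<times> (_ \<Rightarrow> 'k)) set) = vectorspace.dim (class_ring :: 'k ring) (specht_module lam)"
    "z \<in> (ydual lam :: ((_ \<Rightarrow> 'k) \<times> (_ \<Rightarrow> 'k)) set) \<Longrightarrow> fst z \<in> yleft lam"
    "z \<in> (ydual lam :: ((_ \<Rightarrow> 'k) \<times> (_ \<Rightarrow> 'k)) set) \<Longrightarrow> snd z \<in> yright lam"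
    "z \<in> (ydual lam :: ((_ \<Rightarrow> 'k) \<times> (_ \<Rightarrow> 'k)) set) \<Longrightarrow> z' \<in> ydual lam \<Longrightarrow>
       snd z \<star> fst z' = (if z = z' then yidem lam else 0)"
    "x \<in> yleft lam \<Longrightarrow> (\<Sum>z\<in>ydual lam. sc (ypair lam x (snd z)) (fst z)) = (x :: _ \<Rightarrow> 'k)"
proof -
  let ?S = "specht_module lam :: ('k, _) module" and ?R = "yright_module lam :: ('k, _) module"
  let ?p = "ypair lam :: _ \<Rightarrow> _ \<Rightarrow> 'k" and ?D = "ydual lam :: ((_ \<Rightarrow> 'k) \<times> (_ \<Rightarrow> 'k)) set"
  interpret paired ?S ?R ?p
    by (intro paired.intro paired_axioms.intro kvsI ymodules_vs[OF lam] ypair_nondegenerate[OF lam])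
  note sf = specht_fields[OF lam, where 'k='k]
  have D: "finite ?D \<and> dual_system ?S ?R ?p ?D \<and> (\<forall>x\<in>yleft lam. dual_proj ?S ?p ?D x = x) \<and>
      card ?D = vectorspace.dim (class_ring :: 'k ring) ?S"
    unfolding ydual_def by (rule someI_ex[OF specht_dual_system[OF lam]])
  then show fin: "finite ?D" and "card ?D = vectorspace.dim (class_ring :: 'k ring) ?S" by auto
  have dD: "dual_system ?S ?R ?p ?D" using D by blast
  show lr: "fst z \<in> yleft lam" "snd z \<in> yright lam" if "z \<in> ?D" for z
    using dual_systemD(1,2)[OF dD that] by (simp_all add: sf yright_fields)
  show "snd z \<star> fst z' = (if z = z' then yidem lam else 0)" if "z \<in> ?D" "z' \<in> ?D"
    using ypair_mult[OF lam lr(1)[OF that(2)] lr(2)[OF that(1)]] dual_systemD(3)[OF dD that(2,1)]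
    by (auto split: if_splits)
  show "(\<Sum>z\<in>ydual lam. sc (ypair lam x (snd z)) (fst z)) = x" if x: "x \<in> yleft lam"
  proof -
    \<comment> \<open>The sum formed in the Specht module agrees with the pointwise sum of functions
      used in the group algebra.\<close>
    have "finsum ?S g A = sum g A" if "finite A" "g \<in> A \<rightarrow> carrier ?S" for g A
      using that by (induction A rule: finite_induct) (auto simp: sf(2,3))
    note fs = this
    have "dual_proj ?S ?p ?D x = (\<Sum>z\<in>?D. ypair lam x (snd z) \<odot>\<^bsub>?S\<^esub> fst z)"
      unfolding dual_proj_def by (rule fs) (use fin dual_systemD(1)[OF dD] V.scl in auto)
    then have "dual_proj ?S ?p ?D x = (\<Sum>z\<in>?D. sc (ypair lam x (snd z)) (fst z))"
      unfolding sf(4) .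
    then show ?thesis using D x by auto
  qed
qed

section \<open>Central idempotents and their completeness\<close>

definition yproj :: "nat list \<Rightarrow> (nat \<Rightarrow> nat) \<Rightarrow> 'k::field_char_0" where
  "yproj lam = (\<Sum>z\<in>ydual lam. fst z \<star> snd z)"

lemma yleft_mul: "lam \<in> partitions d \<Longrightarrow> x \<in> yleft lam \<Longrightarrow> a \<star> x \<in> yleft lam"
  and yright_mul: "lam \<in> partitions d \<Longrightarrow> y \<in> yright lam \<Longrightarrow> y \<star> a \<in> yright lam"
  by (auto simp: yleft_def yright_def mul_assoc) (simp flip: mul_assoc)

text \<open>Every y_i x is a multiple of e, the multiple being the i-th coordinate of x; so the sum
  of the x_i y_i x is the expansion of x in the basis x_i.\<close>

lemma yproj_left:
  assumes lam: "lam \<in> partitions d" and x: "x \<in> yleft lam"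
  shows "yproj lam \<star> x = (x :: _ \<Rightarrow> 'k::field_char_0)"
proof -
  have "yproj lam \<star> x = (\<Sum>z\<in>ydual lam. sc (ypair lam x (snd z)) (fst z))"
    unfolding yproj_def mul_sum_left
  proof (rule sum.cong[OF refl])
    fix z :: "(_ \<Rightarrow> 'k) \<times> (_ \<Rightarrow> 'k)" assume z: "z \<in> ydual lam"
    have "fst z \<star> snd z \<star> x = fst z \<star> (snd z \<star> x)" by (rule mul_assoc)
    also have "\<dots> = sc (ypair lam x (snd z)) (fst z \<star> yidem lam)"
      using ypair_mult[OF lam x ydual(4)[OF lam z]] by simp
    also have "fst z \<star> yidem lam = fst z" using ydual(3)[OF lam z] by (simp add: yleft_def)
    finally show "fst z \<star> snd z \<star> x = sc (ypair lam x (snd z)) (fst z)" .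
  qed
  then show ?thesis using ydual(6)[OF lam x] by simp
qed

text \<open>Writing u for the central element, y u - y annihilates A e, because u is a left identity
  there; non-degeneracy of the pairing then makes it zero.\<close>

lemma yproj_right:
  assumes lam: "lam \<in> partitions d" and y: "y \<in> yright lam"
  shows "y \<star> yproj lam = (y :: _ \<Rightarrow> 'k::field_char_0)"
proof -
  define w where "w = y \<star> yproj lam - y"
  have w: "w \<in> yright lam"
    using y yright_mul[OF lam y] unfolding w_def yright_def
    by (simp add: mul_diff_right GA_diff)
  have "w \<star> x = 0" if "x \<in> yleft lam" for x
    using yproj_left[OF lam that] by (simp add: w_def mul_diff_left mul_assoc)
  then have "\<forall>x\<in>carrier (specht_module lam). ypair lam x w = 0"
    by (simp add: specht_fields[OF lam] ypair_def)
  then have "w = 0" using ypair_nondegenerate[OF lam, where 'k='k] w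
    unfolding nondegenerate_pairing_def yright_fields by blast
  then show ?thesis by (simp add: w_def)
qed

lemma GA_yproj [simp]: "yproj lam \<in> GA d"
  by (simp add: yproj_def GA_sum)

text \<open>Write u for this element. Each summand of a u begins with an element of A e, on which u
  is a left identity; each summand of u a ends with an element of e A, on which u is a right
  identity. So both products equal u a u.\<close>

lemma yproj_central:
  assumes lam: "lam \<in> partitions d"
  shows "a \<star> yproj lam = yproj lam \<star> (a :: _ \<Rightarrow> 'k::field_char_0)"
proof -
  have l: "a \<star> yproj lam = (\<Sum>z\<in>ydual lam. a \<star> fst z \<star> snd z)"
    unfolding yproj_def by (simp only: mul_sum_right mul_assoc)
  have r: "yproj lam \<star> a = (\<Sum>z\<in>ydual lam. fst z \<star> (snd z \<star> a))"
    unfolding yproj_def by (simp only: mul_sum_left mul_assoc)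
  have "yproj lam \<star> (a \<star> yproj lam) = (\<Sum>z\<in>ydual lam. yproj lam \<star> (a \<star> fst z) \<star> snd z)"
    unfolding l by (simp only: mul_sum_right mul_assoc)
  also have "\<dots> = a \<star> yproj lam"
    unfolding l by (intro sum.cong refl) (simp add: yproj_left[OF lam yleft_mul[OF lam ydual(3)[OF lam]]])
  finally have "a \<star> yproj lam = yproj lam \<star> (a \<star> yproj lam)" ..
  moreover have "yproj lam \<star> a \<star> yproj lam = (\<Sum>z\<in>ydual lam. fst z \<star> (snd z \<star> a \<star> yproj lam))"
    unfolding r by (simp only: mul_sum_left mul_assoc)
  moreover have "\<dots> = yproj lam \<star> a"
    unfolding r by (intro sum.cong refl) (simp add: yproj_right[OF lam yright_mul[OF lam ydual(4)[OF lam]]])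
  ultimately show ?thesis by (simp add: mul_assoc)
qed

lemma yproj_idem:
  assumes lam: "lam \<in> partitions d"
  shows "yproj lam \<star> yproj lam = (yproj lam :: _ \<Rightarrow> 'k::field_char_0)"
proof -
  have "yproj lam \<star> yproj lam = (\<Sum>z\<in>ydual lam. yproj lam \<star> fst z \<star> snd z :: _ \<Rightarrow> 'k)"
    by (subst (2) yproj_def) (simp add: mul_sum_right mul_assoc)
  also have "\<dots> = (\<Sum>z\<in>ydual lam. fst z \<star> snd z)"
    by (intro sum.cong refl) (simp add: yproj_left[OF lam ydual(3)[OF lam]])
  finally show ?thesis by (simp add: yproj_def)
qed

lemma cross_zero:
  assumes lam: "lam \<in> partitions d" and mu: "mu \<in> partitions d" and ne: "lam \<noteq> mu"
    and x: "x \<in> yleft mu" and y: "y \<in> yright lam"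
  shows "y \<star> x = (0 :: _ \<Rightarrow> 'k::field_char_0)"
proof -
  have "y \<star> x = yidem lam \<star> (y \<star> x) \<star> yidem mu"
    using x y by (simp add: yleft_def yright_def mul_assoc) (simp flip: mul_assoc)
  then show ?thesis using yidem_orth[OF lam mu ne GA_mul[of y x]] by simp
qed

lemma yproj_orth:
  assumes lam: "lam \<in> partitions d" and mu: "mu \<in> partitions d" and ne: "lam \<noteq> mu"
  shows "yproj lam \<star> yproj mu = (0 :: _ \<Rightarrow> 'k::field_char_0)"
    "x \<in> yleft mu \<Longrightarrow> yproj lam \<star> x = (0 :: _ \<Rightarrow> 'k::field_char_0)"
proof -
  show 1: "yproj lam \<star> x = 0" if x: "x \<in> yleft mu" for x :: "_ \<Rightarrow> 'k"
    unfolding yproj_def mul_sum_left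
    by (rule sum.neutral) (use cross_zero[OF lam mu ne x ydual(4)[OF lam]] in \<open>simp add: mul_assoc\<close>)
  show "yproj lam \<star> yproj mu = (0 :: _ \<Rightarrow> 'k)"
    unfolding yproj_def[of mu] mul_sum_right
    by (rule sum.neutral) (use 1[OF ydual(3)[OF mu]] in \<open>simp flip: mul_assoc\<close>)
qed

text \<open>It fixes e from the left, and e has a nonzero coefficient at the identity.\<close>

lemma yproj_nonzero:
  assumes lam: "lam \<in> partitions d"
  shows "yproj lam \<noteq> (0 :: _ \<Rightarrow> 'k::field_char_0)"
proof
  assume 0: "yproj lam = (0 :: _ \<Rightarrow> 'k)"
  have "yidem lam \<in> (yleft lam :: (_ \<Rightarrow> 'k) set)" using yidem_props(1)[OF lam, where 'k='k] by (simp add: yleft_def)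
  then have "yidem lam = (0 :: _ \<Rightarrow> 'k)" using yproj_left[OF lam, of "yidem lam :: _ \<Rightarrow> 'k"] 0 by simp
  then show False using yidem_props(3)[OF lam, where 'k='k] ynorm_nonzero[OF lam, where 'k='k] by simp
qed

text \<open>Compare the coefficients of h \<sigma> in h a = a h.\<close>

lemma central_class_function:
  assumes a: "\<And>b. b \<in> GA d \<Longrightarrow> b \<star> a = a \<star> b" and h: "h permutes {..<d}" and s: "\<sigma> permutes {..<d}"
  shows "a (h \<circ> \<sigma> \<circ> inv h) = a \<sigma>"
proof -
  have "(single h \<star> a) (h \<circ> \<sigma>) = (a \<star> single h) (h \<circ> \<sigma>)" using a[OF GA_single[OF h]] by simp
  then show ?thesis using h s by (simp add: mul_single_left mul_single_right P_comp P_invs(5))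
qed

text \<open>
  The elements \<open>yproj lam\<close>, together with \<open>1 - \<Sum>yproj lam\<close> if it is nonzero, are orthogonal central idempotents,
  hence linearly independent class functions; there are at most as many of these as cycle types.
\<close>

lemma yproj_sum: "(\<Sum>lam\<in>partitions d. yproj lam) = (single id :: _ \<Rightarrow> 'k::field_char_0)"
proof (rule ccontr)
  define u where "u = single id - (\<Sum>lam\<in>partitions d. yproj lam :: _ \<Rightarrow> 'k)"
  assume "\<not> ?thesis"
  then have u0: "u \<noteq> 0" by (auto simp: u_def)
  \<comment> \<open>\<open>None\<close> stands for the hypothetical remainder u, so that
    \<open>T\<close> has one element more than there are partitions.\<close>
  define F where "F t = (case t of None \<Rightarrow> u | Some lam \<Rightarrow> yproj lam)" for t
  define T where "T = insert None (Some ` partitions d)"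
  have GAu: "u \<in> GA d"
    unfolding u_def by (intro GA_diff GA_single GA_sum) simp_all
  have uy: "u \<star> yproj lam = 0" if lam: "lam \<in> partitions d" for lam
  proof -
    have "(\<Sum>mu\<in>partitions d. yproj mu) \<star> yproj lam = (\<Sum>mu\<in>partitions d. if mu = lam then yproj lam else 0 :: _ \<Rightarrow> 'k)"
      unfolding mul_sum_left by (intro sum.cong refl) (simp add: yproj_idem yproj_orth lam)
    also have "\<dots> = yproj lam" using lam finite_partitions by simp
    finally show ?thesis by (simp add: u_def mul_diff_left single_id)
  qed
  have cen: "b \<star> F t = F t \<star> b" if "b \<in> GA d" "t \<in> T" for b t
  proof -
    have "b \<star> u = u \<star> b" unfolding u_def mul_diff_left mul_diff_right mul_sum_left mul_sum_right
      using that by (simp add: single_id yproj_central)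
    then show ?thesis using that yproj_central by (auto simp: F_def T_def)
  qed
  have FG: "F t \<in> GA d" if "t \<in> T" for t using that GAu by (auto simp: F_def T_def)
  have uu: "u \<star> u = u"
  proof -
    have "u \<star> (\<Sum>mu\<in>partitions d. yproj mu) = 0" unfolding mul_sum_right by (rule sum.neutral) (simp add: uy)
    then have "u \<star> (single id - (\<Sum>mu\<in>partitions d. yproj mu)) = u" using GAu by (simp add: mul_diff_right single_id)
    then show ?thesis by (simp flip: u_def)
  qed
  have orth: "F t \<star> F t' = (if t = t' then F t else 0)" if "t \<in> T" "t' \<in> T" for t t'
  proof -
    have "yproj lam \<star> u = 0" if "lam \<in> partitions d" for lam
      using uy[OF that] cen[of "yproj lam" None] by (simp add: F_def T_def)
    then show ?thesis using that uu uy yproj_orth(1)[where 'k='k] yproj_idem[where 'k='k] by (auto simp: F_def T_def)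
  qed
  have F0: "F t \<noteq> 0" if "t \<in> T" for t using that u0 yproj_nonzero[where 'k='k] by (auto simp: F_def T_def)
  \<comment> \<open>One representative per cycle type suffices: the relation is only imposed at
    these points, and centrality spreads it over the conjugacy classes.\<close>
  define rep where "rep lam = (SOME \<sigma>. \<sigma> permutes {..<d} \<and> (\<exists>css. cycles_of \<sigma> {..<d} css \<and> map length css = lam))" for lam
  have "card (partitions d) < card T"
    using finite_partitions by (simp add: T_def card_image)
  then obtain g where g: "\<exists>t\<in>T. g t \<noteq> 0" "\<And>lam. lam \<in> partitions d \<Longrightarrow> (\<Sum>t\<in>T. g t * F t (rep lam)) = 0"
    using exists_nontrivial_solution[of "partitions d" T "\<lambda>t lam. F t (rep lam)"] finite_partitions by (auto simp: T_def)
  define Z where "Z = (\<Sum>t\<in>T. sc (g t) (F t))"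
  have Zc: "b \<star> Z = Z \<star> b" if "b \<in> GA d" for b
    unfolding Z_def mul_sum_left mul_sum_right by (intro sum.cong refl) (simp add: cen that)
  have "Z = 0"
  proof (rule GA_eqI)
    show "Z \<in> GA d" unfolding Z_def by (intro GA_sum GA_sc FG)
    fix \<sigma> assume s: "\<sigma> permutes {..<d}"
    obtain css where css: "cycles_of \<sigma> {..<d} css" "map length css \<in> partitions d" using cycles_of_partition[OF s] by blast
    have "rep (map length css) permutes {..<d} \<and> (\<exists>cts. cycles_of (rep (map length css)) {..<d} cts \<and> map length cts = map length css)"
      unfolding rep_def by (rule someI[of _ \<sigma>]) (use s css in blast)
    then obtain cts where r: "rep (map length css) permutes {..<d}" "cycles_of (rep (map length css)) {..<d} cts"
      "map length css = map length cts" by metis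
    obtain h where h: "h permutes {..<d}" "rep (map length css) = h \<circ> \<sigma> \<circ> inv h"
      using conjugate_of_cycles[OF s r(1) css(1) r(2,3)] by blast
    have "Z \<sigma> = Z (rep (map length css))" unfolding h(2) by (rule central_class_function[OF Zc h(1) s, symmetric])
    also have "\<dots> = 0" using g(2)[OF css(2)] by (simp add: Z_def sum_fun_apply sc_apply)
    finally show "Z \<sigma> = 0 \<sigma>" by simp
  qed simp
  obtain t where t: "t \<in> T" "g t \<noteq> 0" using g(1) by blast
  \<comment> \<open>By orthogonality, multiplying the relation by one idempotent isolates its
    coefficient.\<close>
  have "F t \<star> Z = (\<Sum>t'\<in>T. if t' = t then sc (g t) (F t) else 0)"
    unfolding Z_def mul_sum_right by (intro sum.cong refl) (use t orth in auto)
  also have "\<dots> = sc (g t) (F t)" using t finite_partitions by (simp add: T_def)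
  finally have "sc (g t) (F t) = 0" using \<open>Z = 0\<close> by simp
  then have "sc (inverse (g t)) (sc (g t) (F t)) = 0" by simp
  then show False using t F0 by simp
qed

end

section \<open>Spanning sets as induction principles\<close>

text \<open>Spanning is phrased by closure and mentions only carrier, zero, addition and scaling. It
  therefore transfers between a vector space and the Lie module or Lie algebra built on it.\<close>

definition gens :: "('k::field, 'm, 'z) module_scheme \<Rightarrow> 'm set \<Rightarrow> bool" where
  "gens M G \<longleftrightarrow> G \<subseteq> carrier M \<and> (\<forall>C. lin_closed M C \<longrightarrow> G \<subseteq> C \<longrightarrow> carrier M \<subseteq> C)"

lemma gens_induct: "gens M G \<Longrightarrow> lin_closed M C \<Longrightarrow> (\<And>g. g \<in> G \<Longrightarrow> g \<in> C) \<Longrightarrow> x \<in> carrier M \<Longrightarrow> x \<in> C"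
  unfolding gens_def by blast

text \<open>The equaliser of two linear maps is closed. Nearly all identities on tensor spaces below
  are checked on decomposable tensors through this rule.\<close>

lemma gens_hom_eqI:
  assumes "gens M G" and M: "vectorspace class_ring M" "vectorspace class_ring N" and "f \<in> lhom M N" "g \<in> lhom M N"
    and "\<And>x. x \<in> G \<Longrightarrow> f x = g x" and "x \<in> carrier M"
  shows "f x = g x"
  using gens_induct[OF assms(1) lin_closed_eq[OF M assms(4,5)] _ assms(7)] assms(6) by simp

lemma gens_tensor:
  assumes A: "vectorspace class_ring A" and B: "vectorspace class_ring B"
  shows "gens (tensor_prod A B) {tens A B a b | a b. a \<in> carrier A \<and> b \<in> carrier B}"
  unfolding gens_def
proof (intro conjI allI impI subsetI)
  show "x \<in> carrier (tensor_prod A B)" if "x \<in> {tens A B a b | a b. a \<in> carrier A \<and> b \<in> carrier B}" for x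
    using that tens_bilin[OF A B] by (auto simp: bilin_def)
  fix C x assume "lin_closed (tensor_prod A B) C" "{tens A B a b | a b. a \<in> carrier A \<and> b \<in> carrier B} \<subseteq> C"
    "x \<in> carrier (tensor_prod A B)"
  then show "x \<in> C" by (intro tensor_induct[OF A B, of C x]) auto
qed

lemma lhom_cong': "f \<in> lhom M N \<Longrightarrow> (\<And>x. x \<in> carrier M \<Longrightarrow> f x = g x) \<Longrightarrow> kvs M \<Longrightarrow> g \<in> lhom M N"
proof -
  assume f: "f \<in> lhom M N" and e: "\<And>x. x \<in> carrier M \<Longrightarrow> f x = g x" and "kvs M"
  interpret kvs M by fact
  show ?thesis by (rule lhomI) (simp_all add: e[symmetric] lhomD[OF f])
qed

lemma lhom_diff:
  assumes M: "vectorspace class_ring M" and N: "vectorspace class_ring N" and f: "f \<in> lhom M N" and g: "g \<in> lhom M N"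
  shows "(\<lambda>x. f x \<ominus>\<^bsub>N\<^esub> g x) \<in> lhom M N"
proof -
  interpret N: kvs N using N by (rule kvsI)
  have "(\<lambda>x. f x \<oplus>\<^bsub>N\<^esub> (-1) \<odot>\<^bsub>N\<^esub> g x) \<in> lhom M N" by (intro lhom_add lhom_smult assms)
  then show ?thesis by (rule lhom_cong') (auto simp: a_minus_def N.sc_minus lhomD(1)[OF g] kvsI[OF M])
qed

section \<open>Tensor powers\<close>

definition multilin :: "nat \<Rightarrow> ('k::field, 'v, 'y) module_scheme \<Rightarrow> ('k, 'n, 'z) module_scheme \<Rightarrow> ('v list \<Rightarrow> 'n) \<Rightarrow> bool" where
  "multilin d V N F \<longleftrightarrow> (\<forall>vs\<in>tuples d V. F vs \<in> carrier N) \<and>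
     (\<forall>vs\<in>tuples d V. \<forall>i<d. \<forall>x\<in>carrier V. \<forall>y\<in>carrier V.
        F (vs[i := x \<oplus>\<^bsub>V\<^esub> y]) = F (vs[i := x]) \<oplus>\<^bsub>N\<^esub> F (vs[i := y])) \<and>
     (\<forall>vs\<in>tuples d V. \<forall>i<d. \<forall>c. \<forall>x\<in>carrier V. F (vs[i := c \<odot>\<^bsub>V\<^esub> x]) = c \<odot>\<^bsub>N\<^esub> F (vs[i := x]))"

lemma multilinI:
  assumes "\<And>vs. vs \<in> tuples d V \<Longrightarrow> F vs \<in> carrier N"
    "\<And>vs i x y. vs \<in> tuples d V \<Longrightarrow> i < d \<Longrightarrow> x \<in> carrier V \<Longrightarrow> y \<in> carrier V \<Longrightarrow>
        F (vs[i := x \<oplus>\<^bsub>V\<^esub> y]) = F (vs[i := x]) \<oplus>\<^bsub>N\<^esub> F (vs[i := y])"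
    "\<And>vs i c x. vs \<in> tuples d V \<Longrightarrow> i < d \<Longrightarrow> x \<in> carrier V \<Longrightarrow> F (vs[i := c \<odot>\<^bsub>V\<^esub> x]) = c \<odot>\<^bsub>N\<^esub> F (vs[i := x])"
  shows "multilin d V N F"
  using assms unfolding multilin_def by blast

lemma multilinD:
  assumes "multilin d V N F" "vs \<in> tuples d V"
  shows "F vs \<in> carrier N"
    "i < d \<Longrightarrow> x \<in> carrier V \<Longrightarrow> y \<in> carrier V \<Longrightarrow> F (vs[i := x \<oplus>\<^bsub>V\<^esub> y]) = F (vs[i := x]) \<oplus>\<^bsub>N\<^esub> F (vs[i := y])"
    "i < d \<Longrightarrow> x \<in> carrier V \<Longrightarrow> F (vs[i := c \<odot>\<^bsub>V\<^esub> x]) = c \<odot>\<^bsub>N\<^esub> F (vs[i := x])"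
  using assms unfolding multilin_def by blast+

lemma tuples_update: "vs \<in> tuples d V \<Longrightarrow> x \<in> carrier V \<Longrightarrow> vs[i := x] \<in> tuples d V"
  unfolding tuples_def using set_update_subset_insert[of vs i x] by auto

lemma tuples_nth: "vs \<in> tuples d V \<Longrightarrow> i < d \<Longrightarrow> vs ! i \<in> carrier V"
  unfolding tuples_def by auto

lemma tuples_length: "vs \<in> tuples d V \<Longrightarrow> length vs = d"
  unfolding tuples_def by auto

lemma tpow_rels_closed:
  assumes "vectorspace class_ring V"
  shows "tpow_rels d V \<subseteq> carrier (free_space (tuples d V))"
proof -
  interpret V: kvs V using assms by (rule kvsI)
  show ?thesis unfolding tpow_rels_def
    by (intro Un_least subsetI; elim CollectE exE conjE; hypsubst)
       (intro comb_closed tuples_update V.a_closed V.scl; assumption)+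
qed

lemma tensor_pow_vs: "vectorspace class_ring V \<Longrightarrow> vectorspace class_ring (tensor_pow d V)"
  unfolding tensor_pow_def by (intro presented_vs tpow_rels_closed)

lemma tpow_relsI:
  assumes "vs \<in> tuples d V" "i < d" "x \<in> carrier V"
  shows "y \<in> carrier V \<Longrightarrow> 
      (\<lambda>z. single (vs[i := x \<oplus>\<^bsub>V\<^esub> y]) z - single (vs[i := x]) z - single (vs[i := y]) z) \<in> tpow_rels d V"
    "(\<lambda>z. single (vs[i := c \<odot>\<^bsub>V\<^esub> x]) z - c * single (vs[i := x]) z) \<in> tpow_rels d V"
  unfolding tpow_rels_def using assms
   apply -
  subgoal by (rule UnI1, intro CollectI exI conjI; (rule refl)?; assumption)
  subgoal by (rule UnI2, intro CollectI exI conjI; (rule refl)?; assumption)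
  done

lemma tpure_multilin:
  assumes "vectorspace class_ring V"
  shows "multilin d V (tensor_pow d V) (tpure d V)"
proof -
  interpret V: kvs V using assms by (rule kvsI)
  note R = tpow_rels_closed[OF assms]
  show ?thesis unfolding tpure_def tensor_pow_def
    by (rule multilinI) (intro gen_closed gen_comb R tpow_relsI tuples_update V.a_closed V.scl; assumption)+
qed

lemma gens_tpow:
  assumes V: "vectorspace class_ring V"
  shows "gens (tensor_pow d V) (tpure d V ` tuples d V)"
  unfolding gens_def
proof (intro conjI allI impI subsetI)
  show "x \<in> carrier (tensor_pow d V)" if "x \<in> tpure d V ` tuples d V" for x
    using that multilinD(1)[OF tpure_multilin[OF V]] by blast
  fix C x assume *: "lin_closed (tensor_pow d V) C" "tpure d V ` tuples d V \<subseteq> C" "x \<in> carrier (tensor_pow d V)"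
  show "x \<in> C"
    by (rule presented_induct[OF tpow_rels_closed[OF V]]) (use * in \<open>auto simp: tensor_pow_def tpure_def\<close>)
qed

lemma tpow_lift:
  fixes V :: "('k::field, 'v, 'y) module_scheme" and N :: "('k, 'n, 'z) module_scheme"
  assumes V: "vectorspace class_ring V" and N: "vectorspace class_ring N" and F: "multilin d V N F"
  shows "lift N F \<in> lhom (tensor_pow d V) N" "vs \<in> tuples d V \<Longrightarrow> lift N F (tpure d V vs) = F vs"
proof -
  interpret V: kvs V using V by (rule kvsI)
  interpret N: kvs N using N by (rule kvsI)
  have fc: "F \<in> tuples d V \<rightarrow> carrier N" using multilinD(1)[OF F] by blast
  have z: "a \<oplus>\<^bsub>N\<^esub> b \<ominus>\<^bsub>N\<^esub> a \<ominus>\<^bsub>N\<^esub> b = \<zero>\<^bsub>N\<^esub>" "a \<ominus>\<^bsub>N\<^esub> a = \<zero>\<^bsub>N\<^esub>" if "a \<in> carrier N" "b \<in> carrier N" for a b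
    using that N.r_neg1[of a b] by (simp_all add: a_minus_def N.r_neg N.a_ac N.r_neg1 N.r_neg2)
  have rel: "lin_ext N F r = \<zero>\<^bsub>N\<^esub>" if "r \<in> tpow_rels d V" for r
    using that unfolding tpow_rels_def
  proof (elim UnE CollectE exE conjE)
    fix vs i x y assume r: "r = (\<lambda>z. single (vs[i := x \<oplus>\<^bsub>V\<^esub> y]) z - single (vs[i := x]) z - single (vs[i := y]) z)"
      and *: "vs \<in> tuples d V" "i < d" "x \<in> carrier V" "y \<in> carrier V"
    show ?thesis unfolding r using * multilinD[OF F *(1)] multilinD(1)[OF F tuples_update[OF *(1)]]
      by (subst lin_ext_comb[OF N fc]) (simp_all add: tuples_update z)
  next
    fix c vs i x assume r: "r = (\<lambda>z. single (vs[i := c \<odot>\<^bsub>V\<^esub> x]) z - c * single (vs[i := x]) z)"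
      and *: "vs \<in> tuples d V" "i < d" "x \<in> carrier V"
    show ?thesis unfolding r using * multilinD[OF F *(1)] multilinD(1)[OF F tuples_update[OF *(1)]]
      by (subst lin_ext_comb[OF N fc]) (simp_all add: tuples_update z(2))
  qed
  show "lift N F \<in> lhom (tensor_pow d V) N" unfolding tensor_pow_def
    by (intro lift_hom N tpow_rels_closed V fc rel)
  show "lift N F (tpure d V vs) = F vs" if "vs \<in> tuples d V"
    unfolding tpure_def using lift_gen[OF N tpow_rels_closed[OF V] fc rel that] .
qed

lemma tpow_hom_eqI:
  assumes V: "vectorspace class_ring V" and N: "vectorspace class_ring N"
    and "f \<in> lhom (tensor_pow d V) N" "g \<in> lhom (tensor_pow d V) N"
    and "\<And>vs. vs \<in> tuples d V \<Longrightarrow> f (tpure d V vs) = g (tpure d V vs)" and "x \<in> carrier (tensor_pow d V)"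
  shows "f x = g x"
  using gens_hom_eqI[OF gens_tpow[OF V] tensor_pow_vs[OF V] N assms(3,4) _ assms(6)] assms(5) by blast

section \<open>Place permutations\<close>

lemma tuples_permute: "\<sigma> permutes {..<d} \<Longrightarrow> vs \<in> tuples d V \<Longrightarrow> permute_list \<sigma> vs \<in> tuples d V"
  unfolding tuples_def by auto

text \<open>Place j of the permuted list shows place \<sigma> j of the original one, so an update at
  i reappears at the inverse image of i.\<close>

lemma permute_list_update:
  assumes s: "\<sigma> permutes {..<length vs}" and i: "i < length vs"
  shows "permute_list \<sigma> (vs[i := x]) = (permute_list \<sigma> vs)[inv \<sigma> i := x]"
proof (rule nth_equalityI)
  fix j assume "j < length (permute_list \<sigma> (vs[i := x]))"
  then have j: "j < length vs" by simp
  have "\<sigma> j < length vs" using permutes_in_image[OF s, of j] j by simp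
  moreover have "\<sigma> j = i \<longleftrightarrow> j = inv \<sigma> i" using permutes_inverses[OF s] by metis
  ultimately show "permute_list \<sigma> (vs[i := x]) ! j = (permute_list \<sigma> vs)[inv \<sigma> i := x] ! j"
    using j s i by (cases "\<sigma> j = i") (auto simp: permute_list_nth)
qed simp

locale tpow = V: kvs V for V :: "('k::field_char_0, 'v, 'z) module_scheme" +
  fixes d :: nat
begin

abbreviation TP where "TP \<equiv> tensor_pow d V"
abbreviation pure where "pure \<equiv> tpure d V"

sublocale sym_alg d .
sublocale T: kvs TP
  by (rule kvsI, rule tensor_pow_vs) (rule V.vectorspace_axioms)

lemmas pure_cl = multilinD(1)[OF tpure_multilin[OF V.vectorspace_axioms], of _ d]

definition tperm where "tperm \<sigma> = lift TP (\<lambda>vs. pure (permute_list \<sigma> vs))"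

lemma tperm:
  assumes s: "\<sigma> permutes {..<d}"
  shows "tperm \<sigma> \<in> lhom TP TP" "vs \<in> tuples d V \<Longrightarrow> tperm \<sigma> (pure vs) = pure (permute_list \<sigma> vs)"
proof -
  have "inv \<sigma> i < d" if "i < d" for i using permutes_in_image[OF permutes_inv[OF s], of i] that by simp
  then have "multilin d V TP (\<lambda>vs. pure (permute_list \<sigma> vs))"
    using s multilinD[OF tpure_multilin[OF V.vectorspace_axioms] tuples_permute[OF s]]
    by (intro multilinI) (simp_all add: permute_list_update tuples_length)
  from tpow_lift[OF V.vectorspace_axioms T.vectorspace_axioms this]
  show "tperm \<sigma> \<in> lhom TP TP" "vs \<in> tuples d V \<Longrightarrow> tperm \<sigma> (pure vs) = pure (permute_list \<sigma> vs)"
    by (auto simp: tperm_def)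
qed

lemma tperm_cl: "\<sigma> permutes {..<d} \<Longrightarrow> x \<in> carrier TP \<Longrightarrow> tperm \<sigma> x \<in> carrier TP"
  by (rule lhomD(1)[OF tperm(1)])

text \<open>Place permutations act on the right, which reverses the order of composition; the same
  reversal occurs in \<open>act_alg_mul\<close> and decides later which dual basis projects and
  which includes.\<close>

lemma tperm_comp:
  assumes "\<sigma> permutes {..<d}" "\<tau> permutes {..<d}" "x \<in> carrier TP"
  shows "tperm \<tau> (tperm \<sigma> x) = tperm (\<sigma> \<circ> \<tau>) x"
  by (rule tpow_hom_eqI[OF V.vectorspace_axioms T.vectorspace_axioms lhom_comp[OF tperm(1) tperm(1)] tperm(1)])
    (use assms in \<open>simp_all add: tperm(2) P_comp tuples_permute permute_list_compose tuples_length\<close>)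

lemma tperm_id: "x \<in> carrier TP \<Longrightarrow> tperm id x = x"
  by (rule tpow_hom_eqI[OF V.vectorspace_axioms T.vectorspace_axioms tperm(1) lhom_id]) (simp_all add: tperm(2))

abbreviation act_alg where "act_alg a \<equiv> place_perm d V a"

text \<open>\<open>place_perm\<close> is a \<open>lift\<close>, hence prescribed on pure tensors
  only. Both sides are linear, so the formula in terms of \<open>tperm\<close> extends to all
  tensors.\<close>

lemma act_alg:
  shows "act_alg a \<in> lhom TP TP" 
    "x \<in> carrier TP \<Longrightarrow> act_alg a x = (\<Oplus>\<^bsub>TP\<^esub>\<sigma>\<in>P. a \<sigma> \<odot>\<^bsub>TP\<^esub> tperm \<sigma> x)"
proof -
  let ?F = "\<lambda>vs. \<Oplus>\<^bsub>TP\<^esub>\<sigma>\<in>P. a \<sigma> \<odot>\<^bsub>TP\<^esub> pure (permute_list \<sigma> vs)"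
  have h: "(\<lambda>x. \<Oplus>\<^bsub>TP\<^esub>\<sigma>\<in>P. a \<sigma> \<odot>\<^bsub>TP\<^esub> tperm \<sigma> x) \<in> lhom TP TP"
    by (intro lhom_finsum lhom_smult T.vectorspace_axioms finP tperm(1)) simp
  have hv: "(\<Oplus>\<^bsub>TP\<^esub>\<sigma>\<in>P. a \<sigma> \<odot>\<^bsub>TP\<^esub> tperm \<sigma> (pure vs)) = ?F vs" if "vs \<in> tuples d V" for vs
    using that by (intro T.finsum_eq) (auto simp: tperm(2) intro!: T.scl pure_cl tuples_permute)
  have m: "multilin d V TP ?F"
  proof (rule multilinI)
    note pm = multilinD[OF tpure_multilin[OF V.vectorspace_axioms]]
    show "?F vs \<in> carrier TP" if "vs \<in> tuples d V" for vs
      using lhomD(1)[OF h pure_cl[OF that]] hv[OF that] by simp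
    show "?F (vs[i := x \<oplus>\<^bsub>V\<^esub> y]) = ?F (vs[i := x]) \<oplus>\<^bsub>TP\<^esub> ?F (vs[i := y])"
      if "vs \<in> tuples d V" "i < d" "x \<in> carrier V" "y \<in> carrier V" for vs i x y
      using that lhomD(2)[OF h, of "pure (vs[i := x])" "pure (vs[i := y])"] pm(2)[OF that]
      by (simp add: hv[symmetric] tuples_update pure_cl)
    show "?F (vs[i := c \<odot>\<^bsub>V\<^esub> x]) = c \<odot>\<^bsub>TP\<^esub> ?F (vs[i := x])"
      if "vs \<in> tuples d V" "i < d" "x \<in> carrier V" for vs i c x
      using that lhomD(3)[OF h, of "pure (vs[i := x])" c] pm(3)[OF that]
      by (simp add: hv[symmetric] tuples_update pure_cl)
  qed
  from tpow_lift[OF V.vectorspace_axioms T.vectorspace_axioms m]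
  show l: "act_alg a \<in> lhom TP TP" by (simp add: place_perm_def)
  show "act_alg a x = (\<Oplus>\<^bsub>TP\<^esub>\<sigma>\<in>P. a \<sigma> \<odot>\<^bsub>TP\<^esub> tperm \<sigma> x)" if "x \<in> carrier TP"
    by (rule tpow_hom_eqI[OF V.vectorspace_axioms T.vectorspace_axioms l h _ that])
      (use tpow_lift(2)[OF V.vectorspace_axioms T.vectorspace_axioms m] hv in \<open>simp add: place_perm_def\<close>)
qed

lemma act_alg_cl [simp]: "x \<in> carrier TP \<Longrightarrow> act_alg a x \<in> carrier TP"
  by (rule lhomD(1)[OF act_alg(1)])

lemma act_alg_mul:
  assumes x: "x \<in> carrier TP"
  shows "act_alg (a \<star> b) x = act_alg b (act_alg a x)"
proof -
  interpret b: khom TP TP "act_alg b" by (intro khomI T.vectorspace_axioms act_alg)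
  note tc = tperm_cl[OF _ x]
  have "act_alg b (act_alg a x) = (\<Oplus>\<^bsub>TP\<^esub>\<sigma>\<in>P. a \<sigma> \<odot>\<^bsub>TP\<^esub> act_alg b (tperm \<sigma> x))"
    unfolding act_alg(2)[OF x, of a] by (subst b.finsum) (auto intro!: T.finsum_eq simp: tc b.sc)
  also have "\<dots> = (\<Oplus>\<^bsub>TP\<^esub>\<sigma>\<in>P. \<Oplus>\<^bsub>TP\<^esub>\<pi>\<in>P. (a \<sigma> * b (inv \<sigma> \<circ> \<pi>)) \<odot>\<^bsub>TP\<^esub> tperm \<pi> x)"
  proof (rule T.finsum_eq)
    fix \<sigma> assume "\<sigma> \<in> P"
    then have s: "\<sigma> permutes {..<d}" by simp
    have bij: "inj_on (\<lambda>\<pi>. inv \<sigma> \<circ> \<pi>) P" "(\<lambda>\<pi>. inv \<sigma> \<circ> \<pi>) ` P = P"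
    proof -
      show "inj_on (\<lambda>\<pi>. inv \<sigma> \<circ> \<pi>) P" by (rule inj_onI) (metis P_invs(4)[OF s])
      show "(\<lambda>\<pi>. inv \<sigma> \<circ> \<pi>) ` P = P"
      proof
        show "(\<lambda>\<pi>. inv \<sigma> \<circ> \<pi>) ` P \<subseteq> P" using s by (auto intro: P_comp P_inv)
        show "P \<subseteq> (\<lambda>\<pi>. inv \<sigma> \<circ> \<pi>) ` P"
          using s by (auto intro!: image_eqI[of _ _ "\<sigma> \<circ> _"] P_comp simp: P_invs(5)[OF s])
      qed
    qed
    have "act_alg b (tperm \<sigma> x) = (\<Oplus>\<^bsub>TP\<^esub>\<tau>\<in>P. b \<tau> \<odot>\<^bsub>TP\<^esub> tperm (\<sigma> \<circ> \<tau>) x)"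
      unfolding act_alg(2)[OF tc[OF s]] using s x by (intro T.finsum_eq) (auto simp: tperm_comp tc P_comp)
    also have "\<dots> = (\<Oplus>\<^bsub>TP\<^esub>\<pi>\<in>P. b (inv \<sigma> \<circ> \<pi>) \<odot>\<^bsub>TP\<^esub> tperm (\<sigma> \<circ> (inv \<sigma> \<circ> \<pi>)) x)"
      using T.finsum_reindex[of "\<lambda>\<tau>. b \<tau> \<odot>\<^bsub>TP\<^esub> tperm (\<sigma> \<circ> \<tau>) x" "\<lambda>\<pi>. inv \<sigma> \<circ> \<pi>" P] bij s
      by (auto simp: tc P_comp)
    also have "\<dots> = (\<Oplus>\<^bsub>TP\<^esub>\<pi>\<in>P. b (inv \<sigma> \<circ> \<pi>) \<odot>\<^bsub>TP\<^esub> tperm \<pi> x)"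
      using s by (intro T.finsum_eq) (auto simp: P_invs(4) tc)
    finally have "a \<sigma> \<odot>\<^bsub>TP\<^esub> act_alg b (tperm \<sigma> x) = a \<sigma> \<odot>\<^bsub>TP\<^esub> (\<Oplus>\<^bsub>TP\<^esub>\<pi>\<in>P. b (inv \<sigma> \<circ> \<pi>) \<odot>\<^bsub>TP\<^esub> tperm \<pi> x)"
      by simp
    also have "\<dots> = (\<Oplus>\<^bsub>TP\<^esub>\<pi>\<in>P. (a \<sigma> * b (inv \<sigma> \<circ> \<pi>)) \<odot>\<^bsub>TP\<^esub> tperm \<pi> x)"
      by (subst T.sc_finsum) (auto simp: tc T.sc_sc intro!: T.finsum_eq)
    finally show "a \<sigma> \<odot>\<^bsub>TP\<^esub> act_alg b (tperm \<sigma> x) = (\<Oplus>\<^bsub>TP\<^esub>\<pi>\<in>P. (a \<sigma> * b (inv \<sigma> \<circ> \<pi>)) \<odot>\<^bsub>TP\<^esub> tperm \<pi> x)" .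
  qed (auto intro!: T.finsum_cl simp: tc)
  also have "\<dots> = (\<Oplus>\<^bsub>TP\<^esub>\<pi>\<in>P. \<Oplus>\<^bsub>TP\<^esub>\<sigma>\<in>P. (a \<sigma> * b (inv \<sigma> \<circ> \<pi>)) \<odot>\<^bsub>TP\<^esub> tperm \<pi> x)"
    by (rule T.finsum_swap) (auto simp: tc)
  also have "\<dots> = act_alg (a \<star> b) x"
    unfolding act_alg(2)[OF x] by (rule T.finsum_eq) (auto simp: T.finsum_sc gconv_def tc)
  finally show ?thesis ..
qed

lemma act_alg_one: "x \<in> carrier TP \<Longrightarrow> act_alg (single id) x = x"
proof -
  assume x: "x \<in> carrier TP"
  have "(\<Oplus>\<^bsub>TP\<^esub>\<sigma>\<in>P. single id \<sigma> \<odot>\<^bsub>TP\<^esub> tperm \<sigma> x) = single id id \<odot>\<^bsub>TP\<^esub> tperm id x"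
    using T.finsum_delta[of P id "\<lambda>\<sigma>. single id \<sigma> \<odot>\<^bsub>TP\<^esub> tperm \<sigma> x"] by (simp add: tperm_cl x single_def)
  then show ?thesis using x by (simp add: act_alg(2) tperm_id single_def)
qed

lemma act_alg_sc: "x \<in> carrier TP \<Longrightarrow> act_alg (sc s a) x = s \<odot>\<^bsub>TP\<^esub> act_alg a x"
  unfolding act_alg(2) by (subst T.sc_finsum) (auto simp: tperm_cl T.sc_sc sc_apply intro!: T.finsum_eq)

lemma act_alg_sum:
  "finite I \<Longrightarrow> x \<in> carrier TP \<Longrightarrow> act_alg (sum f I) x = (\<Oplus>\<^bsub>TP\<^esub>i\<in>I. act_alg (f i) x)"
proof -
  assume I: "finite I" and x: "x \<in> carrier TP"
  have "act_alg (sum f I) x = (\<Oplus>\<^bsub>TP\<^esub>\<sigma>\<in>P. \<Oplus>\<^bsub>TP\<^esub>i\<in>I. f i \<sigma> \<odot>\<^bsub>TP\<^esub> tperm \<sigma> x)"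
    unfolding act_alg(2)[OF x] using I x by (intro T.finsum_eq) (auto simp: T.finsum_sc tperm_cl sum_fun_apply intro!: T.finsum_cl)
  also have "\<dots> = (\<Oplus>\<^bsub>TP\<^esub>i\<in>I. act_alg (f i) x)"
    unfolding act_alg(2)[OF x] by (rule T.finsum_swap) (use I x in \<open>auto simp: tperm_cl\<close>)
  finally show ?thesis .
qed

lemma act_alg_zero: "x \<in> carrier TP \<Longrightarrow> act_alg 0 x = \<zero>\<^bsub>TP\<^esub>"
  using act_alg_sc[of x 0 "single id"] by simp

text \<open>The symmetrizer is a nonzero multiple of the idempotent e, so its image is the fixed
  space of e. In this form stability under an equivariant action is immediate.\<close>

lemma young_image:
  assumes lam: "lam \<in> partitions d"
  shows "act_alg (young_symmetrizer lam) ` carrier TP = {x \<in> carrier TP. act_alg (yidem lam) x = x}"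
proof (intro equalityI subsetI)
  fix x assume "x \<in> act_alg (young_symmetrizer lam) ` carrier TP"
  then obtain y where y: "y \<in> carrier TP" "x = act_alg (ysym lam) y" by (auto simp: young_eq[OF lam] ysym_def)
  then show "x \<in> {x \<in> carrier TP. act_alg (yidem lam) x = x}"
    using yidem_props[OF lam, where 'k='k] by (simp flip: act_alg_mul)
next
  fix x assume x: "x \<in> {x \<in> carrier TP. act_alg (yidem lam) x = x}"
  then have "x = act_alg (sc (inverse (ynorm lam)) (ysym lam)) x" by (simp add: yidem_def)
  also have "\<dots> = act_alg (sc (inverse (ynorm lam)) (single id) \<star> ysym lam) x" by (simp add: single_id)
  also have "\<dots> = act_alg (ysym lam) (act_alg (sc (inverse (ynorm lam)) (single id)) x)" using x by (simp only: act_alg_mul mem_Collect_eq)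
  finally show "x \<in> act_alg (young_symmetrizer lam) ` carrier TP" using x by (auto simp: young_eq[OF lam] ysym_def)
qed

end

section \<open>Lie modules\<close>

lemma with_act_simps [simp]:
  "carrier (with_act M a) = carrier M" "zero (with_act M a) = zero M" "add (with_act M a) = add M"
  "smult (with_act M a) = smult M" "act (with_act M a) = a"
  by (simp_all add: with_act_def module.defs lie_mod.defs)

text \<open>Negation, subtraction and finite sums depend only on carrier, addition and zero, so for
  a Lie module they may be computed in the underlying vector space.\<close>

lemma additive_cong:
  assumes "carrier M = carrier N" "add M = add N" "zero M = zero N"
  shows "a_inv M = a_inv N" "a_minus M = a_minus N" "finsum M = finsum N"
proof -
  show a: "a_inv M = a_inv N" by (intro ext) (simp add: a_inv_def m_inv_def assms)
  show "a_minus M = a_minus N" by (intro ext) (simp add: a_minus_def a assms)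
  show "finsum M = finsum N" by (intro ext) (simp add: finsum_def finprod_def assms)
qed

lemma lhom_cong_module:
  assumes "carrier M = carrier M'" "add M = add M'" "smult M = smult M'"
    "carrier N = carrier N'" "add N = add N'" "smult N = smult N'"
  shows "lhom M N = lhom M' N'"
  using assms by (simp add: LinearCombinations.module_hom_def)

lemma vs_cong:
  fixes M :: "('k::field, 'm, 'y) module_scheme" and N :: "('k, 'm, 'z) module_scheme"
  assumes "carrier M = carrier N" "add M = add N" "zero M = zero N" "smult M = smult N" "vectorspace class_ring N"
  shows "vectorspace class_ring M"
proof -
  interpret kvs N using assms(5) by (rule kvsI)
  show ?thesis by (rule subspace_vs[OF assms(5)]) (use assms in auto)
qed

lemma with_act_vs: "vectorspace class_ring (M :: ('k::field, 'm) module) \<Longrightarrow> vectorspace class_ring (with_act M a)"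
  by (rule vs_cong[of _ M]) simp_all

lemma lie_module_vs: "lie_module L M \<Longrightarrow> vectorspace class_ring M"
  unfolding lie_module_def by blast

lemma lie_module_alg: "lie_module L M \<Longrightarrow> lie_algebra L"
  unfolding lie_module_def by blast

lemma lie_act_hom: "lie_module L M \<Longrightarrow> x \<in> carrier L \<Longrightarrow> act M x \<in> lhom M M"
proof -
  assume "lie_module L M" and x: "x \<in> carrier L"
  interpret lie_module L M by fact
  show ?thesis by (rule lhomI) (simp_all add: act_closed act_add_right act_smult_right x)
qed

text \<open>Once each element of L acts linearly, the remaining axioms are identities between linear
  maps of m.\<close>

lemma lie_moduleI_gens:
  fixes L :: "('k::field, 'g, 'y) lie_alg_scheme" and M :: "('k, 'm, 'g, 'z) lie_mod_scheme"
  assumes L: "lie_algebra L" and M: "vectorspace class_ring M" and G: "gens M G"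
    and hom: "\<And>x. x \<in> carrier L \<Longrightarrow> act M x \<in> lhom M M"
    and add: "\<And>x y g. x \<in> carrier L \<Longrightarrow> y \<in> carrier L \<Longrightarrow> g \<in> G \<Longrightarrow> act M (x \<oplus>\<^bsub>L\<^esub> y) g = act M x g \<oplus>\<^bsub>M\<^esub> act M y g"
    and sm: "\<And>c x g. x \<in> carrier L \<Longrightarrow> g \<in> G \<Longrightarrow> act M (c \<odot>\<^bsub>L\<^esub> x) g = c \<odot>\<^bsub>M\<^esub> act M x g"
    and br: "\<And>x y g. x \<in> carrier L \<Longrightarrow> y \<in> carrier L \<Longrightarrow> g \<in> G \<Longrightarrow>
      act M (bracket L x y) g = act M x (act M y g) \<ominus>\<^bsub>M\<^esub> act M y (act M x g)"
  shows "lie_module L M"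
proof -
  interpret L: lie_algebra L by fact
  interpret Lk: kvs L by (rule kvsI) (rule L.L.vectorspace_axioms)
  note cl = L.bracket_closed L.L.a_closed Lk.scl
  show ?thesis
  proof (intro lie_module.intro lie_module_axioms.intro L M)
    fix x y m c assume x: "x \<in> carrier L" and m: "m \<in> carrier M"
    show "act M x m \<in> carrier M" by (rule lhomD(1)[OF hom[OF x] m])
    show "act M x (c \<odot>\<^bsub>M\<^esub> m) = c \<odot>\<^bsub>M\<^esub> act M x m" by (rule lhomD(3)[OF hom[OF x] m])
    show "act M (c \<odot>\<^bsub>L\<^esub> x) m = c \<odot>\<^bsub>M\<^esub> act M x m"
      by (rule gens_hom_eqI[OF G M M hom lhom_smult[OF M hom] _ m]) (simp_all add: x cl sm)
    assume y: "y \<in> carrier L"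
    show "act M (x \<oplus>\<^bsub>L\<^esub> y) m = act M x m \<oplus>\<^bsub>M\<^esub> act M y m"
      by (rule gens_hom_eqI[OF G M M hom lhom_add[OF M hom hom] _ m]) (simp_all add: x y cl add)
    show "act M (bracket L x y) m = act M x (act M y m) \<ominus>\<^bsub>M\<^esub> act M y (act M x m)"
      by (rule gens_hom_eqI[OF G M M hom lhom_diff[OF M M lhom_comp[OF hom hom] lhom_comp[OF hom hom]] _ m])
        (simp_all add: x y cl br)
  next
    fix x m n assume "x \<in> carrier L" "m \<in> carrier M" "n \<in> carrier M"
    then show "act M x (m \<oplus>\<^bsub>M\<^esub> n) = act M x m \<oplus>\<^bsub>M\<^esub> act M x n" using lhomD(2)[OF hom] by blast
  qed
qed

text \<open>The counterpart for actions that are given as a \<open>lift\<close> in the Lie algebra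
  variable, such as the two natural modules: the axioms are checked on generators of L, for every
  m.\<close>

lemma lie_moduleI_gens_left:
  fixes L :: "('k::field, 'g, 'y) lie_alg_scheme" and M :: "('k, 'm, 'g, 'z) lie_mod_scheme"
  assumes L: "lie_algebra L" and M: "vectorspace class_ring M" and G: "gens L G"
    and left: "\<And>m. m \<in> carrier M \<Longrightarrow> (\<lambda>x. act M x m) \<in> lhom L M"
    and add: "\<And>g m n. g \<in> G \<Longrightarrow> m \<in> carrier M \<Longrightarrow> n \<in> carrier M \<Longrightarrow> act M g (m \<oplus>\<^bsub>M\<^esub> n) = act M g m \<oplus>\<^bsub>M\<^esub> act M g n"
    and sm: "\<And>g m c. g \<in> G \<Longrightarrow> m \<in> carrier M \<Longrightarrow> act M g (c \<odot>\<^bsub>M\<^esub> m) = c \<odot>\<^bsub>M\<^esub> act M g m"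
    and br: "\<And>g h m. g \<in> G \<Longrightarrow> h \<in> G \<Longrightarrow> m \<in> carrier M \<Longrightarrow>
      act M (bracket L g h) m = act M g (act M h m) \<ominus>\<^bsub>M\<^esub> act M h (act M g m)"
  shows "lie_module L M"
proof -
  interpret L: lie_algebra L by fact
  interpret Mk: kvs M by (rule kvsI) (rule M)
  note Lv = L.L.vectorspace_axioms
  have GL: "g \<in> carrier L" if "g \<in> G" for g using G that by (auto simp: gens_def)
  have add': "act M x (m \<oplus>\<^bsub>M\<^esub> n) = act M x m \<oplus>\<^bsub>M\<^esub> act M x n" 
    if "x \<in> carrier L" "m \<in> carrier M" "n \<in> carrier M" for x m n
    by (rule gens_hom_eqI[OF G Lv M left lhom_add[OF M left left] _ that(1)]) (simp_all add: that add)
  have sm': "act M x (c \<odot>\<^bsub>M\<^esub> m) = c \<odot>\<^bsub>M\<^esub> act M x m" 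
    if "x \<in> carrier L" "m \<in> carrier M" for c x m
    by (rule gens_hom_eqI[OF G Lv M left lhom_smult[OF M left] _ that(1)]) (simp_all add: that sm)
  have hom: "act M x \<in> lhom M M" if "x \<in> carrier L" for x
    by (rule lhomI) (simp_all add: that add' sm' lhomD(1)[OF left])
  have brl: "(\<lambda>x. bracket L x y) \<in> lhom L L" "(\<lambda>x. bracket L y x) \<in> lhom L L" if "y \<in> carrier L" for y
    by (rule lhomI; simp add: that L.bracket_closed L.bracket_add_left L.bracket_smult_left L.bracket_add_right L.bracket_smult_right)+
  \<comment> \<open>The bracket identity is bilinear in the two Lie algebra elements; it is extended
    first in one of them and then in the other.\<close>
  have br1: "act M (bracket L x h) m = act M x (act M h m) \<ominus>\<^bsub>M\<^esub> act M h (act M x m)"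
    if "x \<in> carrier L" "h \<in> G" "m \<in> carrier M" for x h m
    by (rule gens_hom_eqI[OF G Lv M lhom_comp[OF brl(1) left] lhom_diff[OF Lv M left lhom_comp[OF left hom]] _ that(1)])
      (simp_all add: that GL br lhomD(1)[OF hom])
  have br2: "act M (bracket L x y) m = act M x (act M y m) \<ominus>\<^bsub>M\<^esub> act M y (act M x m)"
    if "x \<in> carrier L" "y \<in> carrier L" "m \<in> carrier M" for x y m
    by (rule gens_hom_eqI[OF G Lv M lhom_comp[OF brl(2) left] lhom_diff[OF Lv M lhom_comp[OF left hom] left] _ that(2)])
      (simp_all add: that br1 lhomD(1)[OF hom])
  show ?thesis
    by (intro lie_module.intro lie_module_axioms.intro L M)
      (simp_all add: lhomD[OF hom] lhomD[OF left] br2)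
qed

lemma lie_module_sub:
  fixes N :: "('k::field, 'm, 'g, 'y) lie_mod_scheme" and M :: "('k, 'm, 'g, 'z) lie_mod_scheme"
  assumes M: "lie_module L M" and sub: "carrier N \<subseteq> carrier M"
    and eq: "add N = add M" "zero N = zero M" "smult N = smult M" "act N = act M"
    and cl: "zero M \<in> carrier N" "\<And>x y. x \<in> carrier N \<Longrightarrow> y \<in> carrier N \<Longrightarrow> x \<oplus>\<^bsub>M\<^esub> y \<in> carrier N"
      "\<And>c x. x \<in> carrier N \<Longrightarrow> c \<odot>\<^bsub>M\<^esub> x \<in> carrier N"
      "\<And>x m. x \<in> carrier L \<Longrightarrow> m \<in> carrier N \<Longrightarrow> act M x m \<in> carrier N"
  shows "lie_module L N"
proof -
  interpret M: lie_module L M by fact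
  have N: "vectorspace class_ring N"
    by (rule subspace_vs[OF lie_module_vs[OF M] sub eq(1-3)]) (use cl in auto)
  interpret Nk: kvs N by (rule kvsI) (rule N)
  interpret Mk: kvs M by (rule kvsI) (rule lie_module_vs[OF M])
  have mi: "x \<ominus>\<^bsub>N\<^esub> y = x \<ominus>\<^bsub>M\<^esub> y" if "x \<in> carrier N" "y \<in> carrier N" for x y
    using that sub Nk.minus_sc[of y] Mk.minus_sc[of y] by (auto simp: a_minus_def eq)
  show ?thesis
    by (intro lie_module.intro lie_module_axioms.intro N lie_module_alg[OF M])
      (use sub cl(4) in \<open>auto simp: eq mi subset_iff M.act_add_left M.act_add_right M.act_smult_left M.act_smult_right M.act_bracket\<close>)
qed

section \<open>The Lie algebra and its natural modules\<close>

locale glpair = paired V W pair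
  for V :: "('k::field_char_0, 'v) module" and W :: "('k, 'w) module" and pair
begin

abbreviation T where "T \<equiv> tensor_prod V W"
abbreviation gl where "gl \<equiv> gl_inf V W pair"
abbreviation tn where "tn \<equiv> tens V W"

sublocale T: kvs T
  by (rule kvsI, rule tensor_prod_vs) (rule V.vectorspace_axioms W.vectorspace_axioms)+

lemma tn:
  "u \<in> carrier V \<Longrightarrow> w \<in> carrier W \<Longrightarrow> tn u w \<in> carrier T"
  "u \<in> carrier V \<Longrightarrow> u' \<in> carrier V \<Longrightarrow> w \<in> carrier W \<Longrightarrow> tn (u \<oplus>\<^bsub>V\<^esub> u') w = tn u w \<oplus>\<^bsub>T\<^esub> tn u' w"
  "u \<in> carrier V \<Longrightarrow> w \<in> carrier W \<Longrightarrow> w' \<in> carrier W \<Longrightarrow> tn u (w \<oplus>\<^bsub>W\<^esub> w') = tn u w \<oplus>\<^bsub>T\<^esub> tn u w'"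
  "u \<in> carrier V \<Longrightarrow> w \<in> carrier W \<Longrightarrow> tn (c \<odot>\<^bsub>V\<^esub> u) w = c \<odot>\<^bsub>T\<^esub> tn u w"
  "u \<in> carrier V \<Longrightarrow> w \<in> carrier W \<Longrightarrow> tn u (c \<odot>\<^bsub>W\<^esub> w) = c \<odot>\<^bsub>T\<^esub> tn u w"
  using tens_bilin[OF V.vectorspace_axioms W.vectorspace_axioms] unfolding bilin_def by blast+

lemma gl_fields [simp]:
  "carrier gl = carrier T" "add gl = add T" "zero gl = zero T" "smult gl = smult T"
  by (simp_all add: gl_inf_def Let_def module.defs lie_alg.defs)

lemma gl_vs: "vectorspace class_ring gl"
  by (rule vs_cong[of _ T]) (simp_all add: T.vectorspace_axioms)

lemma gens_T: "gens T {tn a b | a b. a \<in> carrier V \<and> b \<in> carrier W}"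
  by (rule gens_tensor[OF V.vectorspace_axioms W.vectorspace_axioms])

lemma gens_gl: "gens gl {tn a b | a b. a \<in> carrier V \<and> b \<in> carrier W}"
  using gens_T by (simp add: gens_def lin_closed_def)

definition br where "br u u' v v' = pair v u' \<odot>\<^bsub>T\<^esub> tn u v' \<ominus>\<^bsub>T\<^esub> pair u v' \<odot>\<^bsub>T\<^esub> tn v u'"

lemma br_bilin:
  assumes "u \<in> carrier V" "u' \<in> carrier W"
  shows "bilin V W T (br u u')" "bilin V W T (\<lambda>v v'. br v v' u u')"
  unfolding bilin_def br_def using assms
  by (simp_all add: pair_simps tn a_minus_def T.minus_sc T.sc_sum_right T.sc_add T.sc_sc T.a_ac mult.commute mult.left_commute)

definition adg where "adg u u' Y = lift T (\<lambda>(v, v'). br u u' v v') Y"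

lemma adg:
  assumes "u \<in> carrier V" "u' \<in> carrier W"
  shows "adg u u' \<in> lhom T T" "v \<in> carrier V \<Longrightarrow> v' \<in> carrier W \<Longrightarrow> adg u u' (tn v v') = br u u' v v'"
  using tensor_lift_hom[OF V.vectorspace_axioms W.vectorspace_axioms T.vectorspace_axioms br_bilin(1)[OF assms]]
    tensor_lift_tens[OF V.vectorspace_axioms W.vectorspace_axioms T.vectorspace_axioms br_bilin(1)[OF assms]]
  by (auto simp: adg_def[abs_def])

lemma bracket_eq: "bracket gl X Y = lift T (\<lambda>(u, u'). adg u u' Y) X"
  by (simp add: gl_inf_def Let_def module.defs lie_alg.defs adg_def br_def)

lemma adg_bilin:
  assumes Y: "Y \<in> carrier T"
  shows "bilin V W T (\<lambda>u u'. adg u u' Y)"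
proof -
  note vs = T.vectorspace_axioms T.vectorspace_axioms
  note b2 = br_bilin(2)[unfolded bilin_def]
  have s: "adg (u \<oplus>\<^bsub>V\<^esub> v) u' Y = adg u u' Y \<oplus>\<^bsub>T\<^esub> adg v u' Y" if "u \<in> carrier V" "v \<in> carrier V" "u' \<in> carrier W" for u v u'
    by (rule gens_hom_eqI[OF gens_T vs adg(1) lhom_add[OF vs(1) adg(1) adg(1)] _ Y]) (use that b2 in \<open>auto simp: adg(2)\<close>)
  have s': "adg u (u' \<oplus>\<^bsub>W\<^esub> v') Y = adg u u' Y \<oplus>\<^bsub>T\<^esub> adg u v' Y" if "u \<in> carrier V" "v' \<in> carrier W" "u' \<in> carrier W" for u v' u'
    by (rule gens_hom_eqI[OF gens_T vs adg(1) lhom_add[OF vs(1) adg(1) adg(1)] _ Y]) (use that b2 in \<open>auto simp: adg(2)\<close>)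
  have m: "adg (c \<odot>\<^bsub>V\<^esub> u) u' Y = c \<odot>\<^bsub>T\<^esub> adg u u' Y" if "u \<in> carrier V" "u' \<in> carrier W" for c u u'
    by (rule gens_hom_eqI[OF gens_T vs adg(1) lhom_smult[OF vs(1) adg(1)] _ Y]) (use that b2 in \<open>auto simp: adg(2)\<close>)
  have m': "adg u (c \<odot>\<^bsub>W\<^esub> u') Y = c \<odot>\<^bsub>T\<^esub> adg u u' Y" if "u \<in> carrier V" "u' \<in> carrier W" for c u u'
    by (rule gens_hom_eqI[OF gens_T vs adg(1) lhom_smult[OF vs(1) adg(1)] _ Y]) (use that b2 in \<open>auto simp: adg(2)\<close>)
  show ?thesis unfolding bilin_def using Y by (simp add: s s' m m' lhomD(1)[OF adg(1)])
qed

lemma bracket_left_hom: "Y \<in> carrier T \<Longrightarrow> (\<lambda>X. bracket gl X Y) \<in> lhom T T"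
  using tensor_lift_hom[OF V.vectorspace_axioms W.vectorspace_axioms T.vectorspace_axioms adg_bilin]
  by (simp add: bracket_eq)

lemma bracket_tn: "u \<in> carrier V \<Longrightarrow> u' \<in> carrier W \<Longrightarrow> Y \<in> carrier T \<Longrightarrow> bracket gl (tn u u') Y = adg u u' Y"
  unfolding bracket_eq
  by (rule tensor_lift_tens[OF V.vectorspace_axioms W.vectorspace_axioms T.vectorspace_axioms adg_bilin])

lemma bracket_tn_tn: "u \<in> carrier V \<Longrightarrow> u' \<in> carrier W \<Longrightarrow> v \<in> carrier V \<Longrightarrow> v' \<in> carrier W \<Longrightarrow>
    bracket gl (tn u u') (tn v v') = br u u' v v'"
  by (simp add: bracket_tn adg(2) tn(1))

text \<open>The outer \<open>lift\<close> makes the bracket linear in its first argument only.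
  Linearity in the second is an identity between linear maps of the first, checked where the bracket
  reduces to the linear map \<open>adg\<close>.\<close>

lemma bracket_right_hom: "X \<in> carrier T \<Longrightarrow> bracket gl X \<in> lhom T T"
proof (rule lhomI)
  note vs = T.vectorspace_axioms T.vectorspace_axioms
  assume X: "X \<in> carrier T"
  show "bracket gl X Y \<in> carrier T" if "Y \<in> carrier T" for Y by (rule lhomD(1)[OF bracket_left_hom[OF that] X])
  show "bracket gl X (Y \<oplus>\<^bsub>T\<^esub> Z) = bracket gl X Y \<oplus>\<^bsub>T\<^esub> bracket gl X Z" if "Y \<in> carrier T" "Z \<in> carrier T" for Y Z
    by (rule gens_hom_eqI[OF gens_T vs bracket_left_hom lhom_add[OF vs(1) bracket_left_hom bracket_left_hom] _ X])
      (use that in \<open>auto simp: bracket_tn lhomD(2)[OF adg(1)]\<close>)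
  show "bracket gl X (c \<odot>\<^bsub>T\<^esub> Y) = c \<odot>\<^bsub>T\<^esub> bracket gl X Y" if "Y \<in> carrier T" for Y c
    by (rule gens_hom_eqI[OF gens_T vs bracket_left_hom lhom_smult[OF vs(1) bracket_left_hom] _ X])
      (use that in \<open>auto simp: bracket_tn lhomD(3)[OF adg(1)]\<close>)
qed

lemma bracket_cl: "X \<in> carrier T \<Longrightarrow> Y \<in> carrier T \<Longrightarrow> bracket gl X Y \<in> carrier T"
  by (rule lhomD(1)[OF bracket_right_hom])

lemma bracket_anti:
  assumes X: "X \<in> carrier T" and Y: "Y \<in> carrier T"
  shows "bracket gl X Y = (-1) \<odot>\<^bsub>T\<^esub> bracket gl Y X"
proof -
  note vs = T.vectorspace_axioms T.vectorspace_axioms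
  have 1: "bracket gl X (tn v v') = (-1) \<odot>\<^bsub>T\<^esub> bracket gl (tn v v') X" if "v \<in> carrier V" "v' \<in> carrier W" for v v'
    by (rule gens_hom_eqI[OF gens_T vs bracket_left_hom lhom_smult[OF vs(1) bracket_right_hom] _ X])
      (use that in \<open>auto simp: bracket_tn_tn br_def tn a_minus_def T.minus_sc T.sc_sum_right T.sc_sc T.a_ac\<close>)
  show ?thesis
    by (rule gens_hom_eqI[OF gens_T vs bracket_right_hom lhom_smult[OF vs(1) bracket_left_hom] _ Y])
      (use X 1 in auto)
qed

lemma bracket_self: "X \<in> carrier T \<Longrightarrow> bracket gl X X = \<zero>\<^bsub>T\<^esub>"
proof -
  assume X: "X \<in> carrier T"
  let ?B = "bracket gl X X"
  have c: "?B \<in> carrier T" using bracket_cl X by blast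
  have "?B \<oplus>\<^bsub>T\<^esub> ?B = (-1) \<odot>\<^bsub>T\<^esub> ?B \<oplus>\<^bsub>T\<^esub> ?B" using bracket_anti[OF X X] by simp
  also have "\<dots> = \<zero>\<^bsub>T\<^esub>" using c by (simp add: T.sc_minus T.l_neg)
  finally have "?B \<oplus>\<^bsub>T\<^esub> ?B = \<zero>\<^bsub>T\<^esub>" .
  \<comment> \<open>Antisymmetry only gives twice the bracket equal to zero; characteristic zero
    permits halving.\<close>
  then have "(1/2) \<odot>\<^bsub>T\<^esub> (?B \<oplus>\<^bsub>T\<^esub> ?B) = \<zero>\<^bsub>T\<^esub>" by simp
  then have "(1/2 + 1/2) \<odot>\<^bsub>T\<^esub> ?B = \<zero>\<^bsub>T\<^esub>" using c by (simp only: T.sc_sum_right T.sc_add)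
  then show ?thesis using c by simp
qed

text \<open>The four terms are grouped so that the rotation u to v to w to u turns the two positive
  terms into the two negative ones. The cyclic sum therefore telescopes.\<close>

lemma br_jacobi:
  assumes "u \<in> carrier V" "u' \<in> carrier W" "v \<in> carrier V" "v' \<in> carrier W" "w \<in> carrier V" "w' \<in> carrier W"
  shows "bracket gl (tn u u') (bracket gl (tn v v') (tn w w')) =
    ((pair w v' * pair v u') \<odot>\<^bsub>T\<^esub> tn u w' \<oplus>\<^bsub>T\<^esub> (pair v w' * pair u v') \<odot>\<^bsub>T\<^esub> tn w u') \<ominus>\<^bsub>T\<^esub>
    ((pair w v' * pair u w') \<odot>\<^bsub>T\<^esub> tn v u' \<oplus>\<^bsub>T\<^esub> (pair v w' * pair w u') \<odot>\<^bsub>T\<^esub> tn u v')"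
proof -
  interpret h: khom T T "bracket gl (tn u u')"
    by (intro khomI T.vectorspace_axioms bracket_right_hom tn assms)
  show ?thesis using assms
    by (simp add: bracket_tn_tn br_def h.diff h.sc tn)
      (simp add: a_minus_def tn T.minus_sc T.sc_sum_right T.sc_sc T.a_ac)
qed

lemma three_diff:
  assumes "a \<in> carrier T" "b \<in> carrier T" "c \<in> carrier T" "d \<in> carrier T" "e \<in> carrier T" "f \<in> carrier T"
    and "a \<oplus>\<^bsub>T\<^esub> c \<oplus>\<^bsub>T\<^esub> e = b \<oplus>\<^bsub>T\<^esub> d \<oplus>\<^bsub>T\<^esub> f"
  shows "(a \<ominus>\<^bsub>T\<^esub> b) \<oplus>\<^bsub>T\<^esub> (c \<ominus>\<^bsub>T\<^esub> d) \<oplus>\<^bsub>T\<^esub> (e \<ominus>\<^bsub>T\<^esub> f) = \<zero>\<^bsub>T\<^esub>"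
proof -
  have "(a \<ominus>\<^bsub>T\<^esub> b) \<oplus>\<^bsub>T\<^esub> (c \<ominus>\<^bsub>T\<^esub> d) \<oplus>\<^bsub>T\<^esub> (e \<ominus>\<^bsub>T\<^esub> f) = (a \<oplus>\<^bsub>T\<^esub> c \<oplus>\<^bsub>T\<^esub> e) \<ominus>\<^bsub>T\<^esub> (b \<oplus>\<^bsub>T\<^esub> d \<oplus>\<^bsub>T\<^esub> f)"
    using assms(1-6) by (simp add: a_minus_def T.minus_add T.a_ac)
  then show ?thesis using assms by (simp add: T.r_neg a_minus_def)
qed

lemma jacobi_gen:
  assumes "u \<in> carrier V" "u' \<in> carrier W" "v \<in> carrier V" "v' \<in> carrier W" "w \<in> carrier V" "w' \<in> carrier W"
  shows "bracket gl (tn u u') (bracket gl (tn v v') (tn w w')) \<oplus>\<^bsub>T\<^esub> bracket gl (tn v v') (bracket gl (tn w w') (tn u u'))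
     \<oplus>\<^bsub>T\<^esub> bracket gl (tn w w') (bracket gl (tn u u') (tn v v')) = \<zero>\<^bsub>T\<^esub>"
  unfolding br_jacobi[OF assms] br_jacobi[OF assms(3-6,1,2)] br_jacobi[OF assms(5,6,1-4)]
  by (rule three_diff) (use assms in \<open>simp_all add: tn T.a_ac mult.commute\<close>)

lemma gl_lie_algebra: "lie_algebra gl"
proof (intro lie_algebra.intro lie_algebra_axioms.intro gl_vs)
  note vs = T.vectorspace_axioms T.vectorspace_axioms
  note bl = bracket_left_hom and brr = bracket_right_hom
  fix x y z assume "x \<in> carrier gl" "y \<in> carrier gl" "z \<in> carrier gl"
  then have x: "x \<in> carrier T" and y: "y \<in> carrier T" and z: "z \<in> carrier T" by simp_all
  let ?J = "\<lambda>x y z. bracket gl x (bracket gl y z) \<oplus>\<^bsub>T\<^esub> bracket gl y (bracket gl z x) \<oplus>\<^bsub>T\<^esub> bracket gl z (bracket gl x y)"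
  have zero: "(\<lambda>x. \<zero>\<^bsub>T\<^esub>) \<in> lhom T T" by (rule lhomI) simp_all
  have h1: "(\<lambda>x. ?J x y z) \<in> lhom T T" "(\<lambda>x. ?J z x y) \<in> lhom T T" "(\<lambda>x. ?J y z x) \<in> lhom T T"
    if "y \<in> carrier T" "z \<in> carrier T" for y z
    by (intro lhom_add vs(1) lhom_comp[OF bl bl] lhom_comp[OF brr brr] lhom_comp[OF bl brr] lhom_comp[OF brr bl] bl brr bracket_cl that)+
  \<comment> \<open>The Jacobi sum is linear in each argument and is extended from decomposable
    tensors one argument at a time.\<close>
  have j1: "?J x (tn v v') (tn w w') = \<zero>\<^bsub>T\<^esub>" 
    if "x \<in> carrier T" "v \<in> carrier V" "v' \<in> carrier W" "w \<in> carrier V" "w' \<in> carrier W" for x v v' w w'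
    by (rule gens_hom_eqI[OF gens_T vs h1(1) zero _ that(1)]) (use that jacobi_gen in \<open>auto simp: tn(1)\<close>)
  have j2: "?J x y (tn w w') = \<zero>\<^bsub>T\<^esub>" if "x \<in> carrier T" "y \<in> carrier T" "w \<in> carrier V" "w' \<in> carrier W" for x y w w'
    by (rule gens_hom_eqI[OF gens_T vs h1(2) zero _ that(2)]) (use that j1 in \<open>auto simp: tn(1)\<close>)
  have "?J x y z = \<zero>\<^bsub>T\<^esub>"
    by (rule gens_hom_eqI[OF gens_T vs h1(3) zero _ z]) (use x y j2 in auto)
  then show "bracket gl x (bracket gl y z) \<oplus>\<^bsub>gl\<^esub> bracket gl y (bracket gl z x) \<oplus>\<^bsub>gl\<^esub> bracket gl z (bracket gl x y) = \<zero>\<^bsub>gl\<^esub>"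
    by simp
qed (simp_all add: bracket_cl bracket_self lhomD[OF bracket_left_hom] lhomD[OF bracket_right_hom])

abbreviation natV where "natV \<equiv> natural_module V pair"
abbreviation natW where "natW \<equiv> conatural_module W pair"

lemma nat_fields [simp]:
  "carrier natV = carrier V" "add natV = add V" "zero natV = zero V" "smult natV = smult V"
  "carrier natW = carrier W" "add natW = add W" "zero natW = zero W" "smult natW = smult W"
  by (simp_all add: natural_module_def conatural_module_def)

lemma nat_act:
  assumes "u \<in> carrier V" "u' \<in> carrier W"
  shows "v \<in> carrier V \<Longrightarrow> act natV (tn u u') v = pair v u' \<odot>\<^bsub>V\<^esub> u"
    and "w \<in> carrier W \<Longrightarrow> act natW (tn u u') w = (- pair u w) \<odot>\<^bsub>W\<^esub> u'"
  using natural_act(1,2)[OF V.vectorspace_axioms W.vectorspace_axioms nd assms, of v w] assms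
  by (simp_all add: W.sc_minus natural_act(1,2)[OF V.vectorspace_axioms W.vectorspace_axioms nd assms])

lemma natV_lie: "lie_module gl natV"
proof (rule lie_moduleI_gens_left[OF gl_lie_algebra _ gens_gl])
  show vs: "vectorspace class_ring natV" unfolding natural_module_def by (rule with_act_vs) (rule V.vectorspace_axioms)
  have am: "a_minus natV = a_minus V" by (rule additive_cong) simp_all
  have "bilin V W V (\<lambda>u u'. pair v u' \<odot>\<^bsub>V\<^esub> u)" if "v \<in> carrier V" for v
    unfolding bilin_def using that by (simp add: pair_simps V.sc_add V.sc_sum_right V.sc_sc mult.commute)
  from tensor_lift_hom[OF V.vectorspace_axioms W.vectorspace_axioms V.vectorspace_axioms this]
  have left: "(\<lambda>x. act natV x m) \<in> lhom T V" if "m \<in> carrier V" for m using that by (simp add: natural_module_def)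
  moreover have "lhom gl natV = lhom T V" by (rule lhom_cong_module) simp_all
  ultimately show "(\<lambda>x. act natV x m) \<in> lhom gl natV" if "m \<in> carrier natV" for m using that by simp
  fix g m n c h assume "g \<in> {tn a b |a b. a \<in> carrier V \<and> b \<in> carrier W}"
  then obtain a b where g: "g = tn a b" "a \<in> carrier V" "b \<in> carrier W" by blast
  show "act natV g (m \<oplus>\<^bsub>natV\<^esub> n) = act natV g m \<oplus>\<^bsub>natV\<^esub> act natV g n" if "m \<in> carrier natV" "n \<in> carrier natV"
    using that g by (simp add: nat_act pair_simps V.sc_add)
  show "act natV g (c \<odot>\<^bsub>natV\<^esub> m) = c \<odot>\<^bsub>natV\<^esub> act natV g m" if "m \<in> carrier natV"
    using that g by (simp add: nat_act pair_simps V.sc_sc)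
  assume "h \<in> {tn a b |a b. a \<in> carrier V \<and> b \<in> carrier W}"
  then obtain a' b' where h: "h = tn a' b'" "a' \<in> carrier V" "b' \<in> carrier W" by blast
  assume "m \<in> carrier natV"
  then have m: "m \<in> carrier V" by simp
  interpret l: khom T V "\<lambda>x. act natV x m" by (intro khomI T.vectorspace_axioms V.vectorspace_axioms left m)
  show "act natV (bracket gl g h) m = act natV g (act natV h m) \<ominus>\<^bsub>natV\<^esub> act natV h (act natV g m)"
    unfolding am using g h m by (simp add: bracket_tn_tn br_def l.diff l.sc tn nat_act pair_simps V.sc_sc mult.commute)
qed

lemma natW_lie: "lie_module gl natW"
proof (rule lie_moduleI_gens_left[OF gl_lie_algebra _ gens_gl])
  show vs: "vectorspace class_ring natW" unfolding conatural_module_def by (rule with_act_vs) (rule W.vectorspace_axioms)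
  have am: "a_minus natW = a_minus W" by (rule additive_cong) simp_all
  have "bilin V W W (\<lambda>u u'. \<ominus>\<^bsub>W\<^esub> (pair u v \<odot>\<^bsub>W\<^esub> u'))" if "v \<in> carrier W" for v
    unfolding bilin_def using that by (simp add: pair_simps W.minus_sc W.sc_add W.sc_sum_right W.sc_sc mult.commute mult.left_commute)
  from tensor_lift_hom[OF V.vectorspace_axioms W.vectorspace_axioms W.vectorspace_axioms this]
  have left: "(\<lambda>x. act natW x m) \<in> lhom T W" if "m \<in> carrier W" for m using that by (simp add: conatural_module_def)
  moreover have "lhom gl natW = lhom T W" by (rule lhom_cong_module) simp_all
  ultimately show "(\<lambda>x. act natW x m) \<in> lhom gl natW" if "m \<in> carrier natW" for m using that by simp
  fix g m n c h assume "g \<in> {tn a b |a b. a \<in> carrier V \<and> b \<in> carrier W}"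
  then obtain a b where g: "g = tn a b" "a \<in> carrier V" "b \<in> carrier W" by blast
  show "act natW g (m \<oplus>\<^bsub>natW\<^esub> n) = act natW g m \<oplus>\<^bsub>natW\<^esub> act natW g n" if "m \<in> carrier natW" "n \<in> carrier natW"
    using that g W.sc_add[of b "- pair a m" "- pair a n"] by (simp add: nat_act pair_simps)
  show "act natW g (c \<odot>\<^bsub>natW\<^esub> m) = c \<odot>\<^bsub>natW\<^esub> act natW g m" if "m \<in> carrier natW"
    using that g by (simp add: nat_act pair_simps W.sc_sc)
  assume "h \<in> {tn a b |a b. a \<in> carrier V \<and> b \<in> carrier W}"
  then obtain a' b' where h: "h = tn a' b'" "a' \<in> carrier V" "b' \<in> carrier W" by blast
  assume "m \<in> carrier natW"
  then have m: "m \<in> carrier W" by simp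
  interpret l: khom T W "\<lambda>x. act natW x m" by (intro khomI T.vectorspace_axioms W.vectorspace_axioms left m)
  show "act natW (bracket gl g h) m = act natW g (act natW h m) \<ominus>\<^bsub>natW\<^esub> act natW h (act natW g m)"
    unfolding am using g h m 
    by (simp add: bracket_tn_tn br_def l.diff l.sc tn nat_act pair_simps W.sc_sc)
      (simp add: a_minus_def W.minus_sc W.sc_sc W.a_ac mult.commute)
qed

end

section \<open>Equivariant maps\<close>

definition lie_hom :: "('k::field, 'g, 'x) lie_alg_scheme \<Rightarrow> ('k, 'm, 'g, 'y) lie_mod_scheme \<Rightarrow>
   ('k, 'n, 'g, 'z) lie_mod_scheme \<Rightarrow> ('m \<Rightarrow> 'n) \<Rightarrow> bool" where
  "lie_hom L M N f \<longleftrightarrow> f \<in> lhom M N \<and> (\<forall>x\<in>carrier L. \<forall>m\<in>carrier M. f (act M x m) = act N x (f m))"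

lemma lie_homD:
  assumes "lie_hom L M N f"
  shows "f \<in> lhom M N" "x \<in> carrier L \<Longrightarrow> m \<in> carrier M \<Longrightarrow> f (act M x m) = act N x (f m)"
  using assms unfolding lie_hom_def by auto

lemma lie_hom_gensI:
  assumes M: "lie_module L M" and N: "lie_module L N" and G: "gens M G" and f: "f \<in> lhom M N"
    and eq: "\<And>x g. x \<in> carrier L \<Longrightarrow> g \<in> G \<Longrightarrow> f (act M x g) = act N x (f g)"
  shows "lie_hom L M N f"
  unfolding lie_hom_def
proof (intro conjI f ballI)
  fix x m assume x: "x \<in> carrier L" and m: "m \<in> carrier M"
  show "f (act M x m) = act N x (f m)"
    by (rule gens_hom_eqI[OF G lie_module_vs[OF M] lie_module_vs[OF N]
        lhom_comp[OF lie_act_hom[OF M x] f] lhom_comp[OF f lie_act_hom[OF N x]] eq[OF x] m])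
qed

lemma lie_hom_comp: "lie_hom L M N f \<Longrightarrow> lie_hom L N P g \<Longrightarrow> lie_hom L M P (\<lambda>x. g (f x))"
  unfolding lie_hom_def by (auto intro: lhom_comp simp: lhomD(1))

section \<open>Tensor products of Lie modules\<close>

definition tmap where
  "tmap A B A' B' f g = lift (tensor_prod A' B') (\<lambda>(a, b). tens A' B' (f a) (g b))"

lemma tmap:
  fixes A :: "('k::field, 'a, 'y) module_scheme" and B :: "('k, 'b, 'z) module_scheme"
    and A' :: "('k::field, 'c, 'u) module_scheme" and B' :: "('k, 'd, 'v) module_scheme"
  assumes vs: "vectorspace class_ring A" "vectorspace class_ring B" "vectorspace class_ring A'" "vectorspace class_ring B'"
    and f: "f \<in> lhom A A'" and g: "g \<in> lhom B B'"
  shows "tmap A B A' B' f g \<in> lhom (tensor_prod A B) (tensor_prod A' B')"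
    "a \<in> carrier A \<Longrightarrow> b \<in> carrier B \<Longrightarrow> tmap A B A' B' f g (tens A B a b) = tens A' B' (f a) (g b)"
proof -
  have "bilin A B (tensor_prod A' B') (\<lambda>a b. tens A' B' (f a) (g b))"
    using tens_bilin[OF vs(3,4)] lhomD[OF f] lhomD[OF g] unfolding bilin_def by simp
  from tensor_lift_hom[OF vs(1,2) tensor_prod_vs[OF vs(3,4)] this] tensor_lift_tens[OF vs(1,2) tensor_prod_vs[OF vs(3,4)] this]
  show "tmap A B A' B' f g \<in> lhom (tensor_prod A B) (tensor_prod A' B')"
    "a \<in> carrier A \<Longrightarrow> b \<in> carrier B \<Longrightarrow> tmap A B A' B' f g (tens A B a b) = tens A' B' (f a) (g b)"
    by (simp_all add: tmap_def)
qed

lemma lie_tensor_fields [simp]: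
  "carrier (lie_tensor M N) = carrier (tensor_prod M N)" "add (lie_tensor M N) = add (tensor_prod M N)"
  "zero (lie_tensor M N) = zero (tensor_prod M N)" "smult (lie_tensor M N) = smult (tensor_prod M N)"
  by (simp_all add: lie_tensor_def)

lemma lhom_lie_tensor: "lhom (lie_tensor M N) K = lhom (tensor_prod M N) K" "lhom K (lie_tensor M N) = lhom K (tensor_prod M N)"
  by (simp_all add: LinearCombinations.module_hom_def)

lemma (in kvs) finsum_diff:
  assumes "finite I" "\<And>i. i \<in> I \<Longrightarrow> f i \<in> carrier M" "\<And>i. i \<in> I \<Longrightarrow> g i \<in> carrier M"
  shows "(\<Oplus>i\<in>I. f i) \<ominus> (\<Oplus>i\<in>I. g i) = (\<Oplus>i\<in>I. f i \<ominus> g i)"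
proof -
  have "(\<Oplus>i\<in>I. f i \<ominus> g i) = (\<Oplus>i\<in>I. f i \<oplus> (-1) \<odot> g i)"
    using assms by (intro finsum_eq) (auto simp: a_minus_def minus_sc)
  also have "\<dots> = (\<Oplus>i\<in>I. f i) \<oplus> (-1) \<odot> (\<Oplus>i\<in>I. g i)"
    using assms by (simp add: finsum_add sc_finsum)
  finally show ?thesis using assms by (simp add: a_minus_def minus_sc finsum_cl)
qed

text \<open>In the commutator of two Leibniz actions on a tensor, b and c are the mixed terms where
  the two elements act on different factors; they occur on both sides and cancel.\<close>

lemma (in kvs) four_diff:
  assumes "a \<in> carrier M" "b \<in> carrier M" "c \<in> carrier M" "d \<in> carrier M" "a' \<in> carrier M" "d' \<in> carrier M"
  shows "(a \<oplus> b \<oplus> (c \<oplus> d)) \<ominus> (a' \<oplus> c \<oplus> (b \<oplus> d')) = (a \<ominus> a') \<oplus> (d \<ominus> d')"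
proof -
  have "(a \<oplus> b \<oplus> (c \<oplus> d)) \<ominus> (a' \<oplus> c \<oplus> (b \<oplus> d')) = (a \<ominus> a') \<oplus> (d \<ominus> d') \<oplus> (b \<oplus> \<ominus> b) \<oplus> (c \<oplus> \<ominus> c)"
    using assms by (simp add: a_minus_def minus_add a_ac del: r_neg)
  then show ?thesis using assms by (simp add: r_neg)
qed

lemma lie_tensor:
  fixes L :: "('k::field, 'g, 'x) lie_alg_scheme" and M :: "('k, 'm, 'g, 'y) lie_mod_scheme" and N :: "('k, 'n, 'g, 'z) lie_mod_scheme"
  assumes M: "lie_module L M" and N: "lie_module L N"
  shows "x \<in> carrier L \<Longrightarrow> m \<in> carrier M \<Longrightarrow> n \<in> carrier N \<Longrightarrow>
      act (lie_tensor M N) x (tens M N m n) = tens M N (act M x m) n \<oplus>\<^bsub>tensor_prod M N\<^esub> tens M N m (act N x n)" (is "_ \<Longrightarrow> _ \<Longrightarrow> _ \<Longrightarrow> ?A")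
    and "lie_module L (lie_tensor M N)"
proof -
  interpret M: lie_module L M by fact
  interpret N: lie_module L N by fact
  let ?T = "tensor_prod M N"
  note vs = lie_module_vs[OF M] lie_module_vs[OF N]
  interpret T: kvs ?T by (rule kvsI, rule tensor_prod_vs) (rule vs)+
  interpret Mk: kvs M by (rule kvsI, rule vs)
  interpret Nk: kvs N by (rule kvsI, rule vs)
  note tb = tens_bilin[OF vs, unfolded bilin_def]
  have tc: "tens M N a b \<in> carrier ?T" if "a \<in> carrier M" "b \<in> carrier N" for a b using tb that by blast
  have bil: "bilin M N ?T (\<lambda>m n. tens M N (act M x m) n \<oplus>\<^bsub>?T\<^esub> tens M N m (act N x n))" if "x \<in> carrier L" for x
    unfolding bilin_def using that tb
    by (simp add: M.act_closed N.act_closed M.act_add_right N.act_add_right M.act_smult_right N.act_smult_right T.sc_sum_right tc T.a_ac)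
  have hom: "act (lie_tensor M N) x \<in> lhom ?T ?T" if "x \<in> carrier L" for x
    using tensor_lift_hom[OF vs T.vectorspace_axioms bil[OF that]] by (simp add: lie_tensor_def)
  have val: "act (lie_tensor M N) x (tens M N m n) = tens M N (act M x m) n \<oplus>\<^bsub>?T\<^esub> tens M N m (act N x n)"
    if "x \<in> carrier L" "m \<in> carrier M" "n \<in> carrier N" for x m n
    using tensor_lift_tens[OF vs T.vectorspace_axioms bil[OF that(1)] that(2,3)] by (simp add: lie_tensor_def)
  then show "x \<in> carrier L \<Longrightarrow> m \<in> carrier M \<Longrightarrow> n \<in> carrier N \<Longrightarrow> ?A" by blast
  have am: "a_minus (lie_tensor M N) = a_minus ?T" by (rule additive_cong) simp_all
  have neg: "tens M N (a \<ominus>\<^bsub>M\<^esub> b) n = tens M N a n \<ominus>\<^bsub>?T\<^esub> tens M N b n" "tens M N a (n \<ominus>\<^bsub>N\<^esub> n') = tens M N a n \<ominus>\<^bsub>?T\<^esub> tens M N a n'"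
    if "a \<in> carrier M" "b \<in> carrier M" "n \<in> carrier N" "n' \<in> carrier N" for a b n n'
    using that tb by (simp_all add: a_minus_def Mk.minus_sc Nk.minus_sc T.minus_sc tc)
  have gT: "gens (lie_tensor M N) {tens M N a b | a b. a \<in> carrier M \<and> b \<in> carrier N}"
    using gens_tensor[OF vs] by (simp add: gens_def lin_closed_def)
  show "lie_module L (lie_tensor M N)"
  proof (rule lie_moduleI_gens[OF lie_module_alg[OF M] _ gT])
    show "vectorspace class_ring (lie_tensor M N)" unfolding lie_tensor_def by (rule with_act_vs) (rule T.vectorspace_axioms)
    show "act (lie_tensor M N) x \<in> lhom (lie_tensor M N) (lie_tensor M N)" if "x \<in> carrier L" for x
      using hom[OF that] by (simp add: lhom_lie_tensor)
    fix x y c g assume x: "x \<in> carrier L" and "g \<in> {tens M N a b | a b. a \<in> carrier M \<and> b \<in> carrier N}"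
    then obtain a b where g: "g = tens M N a b" "a \<in> carrier M" "b \<in> carrier N" by blast
    have Lc: "c \<odot>\<^bsub>L\<^esub> x \<in> carrier L" using kvs.scl[OF kvsI[OF M.L.L.vectorspace_axioms] x] .
    show "act (lie_tensor M N) (c \<odot>\<^bsub>L\<^esub> x) g = c \<odot>\<^bsub>lie_tensor M N\<^esub> act (lie_tensor M N) x g"
      using x g tb Lc by (simp add: val M.act_smult_left N.act_smult_left M.act_closed N.act_closed T.sc_sum_right tc)
    assume y: "y \<in> carrier L"
    show "act (lie_tensor M N) (x \<oplus>\<^bsub>L\<^esub> y) g = act (lie_tensor M N) x g \<oplus>\<^bsub>lie_tensor M N\<^esub> act (lie_tensor M N) y g"
      using x y g tb by (simp add: val M.act_add_left N.act_add_left M.act_closed N.act_closed tc T.a_ac)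
    show "act (lie_tensor M N) (bracket L x y) g = act (lie_tensor M N) x (act (lie_tensor M N) y g) \<ominus>\<^bsub>lie_tensor M N\<^esub>
        act (lie_tensor M N) y (act (lie_tensor M N) x g)"
      unfolding am using x y g
      by (simp add: val M.L.bracket_closed lhomD(2)[OF hom] M.act_bracket N.act_bracket neg M.act_closed N.act_closed tc T.four_diff)
  qed
qed

lemma tmap_lie_hom:
  fixes L :: "('k::field, 'g, 'x) lie_alg_scheme"
  assumes M: "lie_module L M" "lie_module L N" "lie_module L M'" "lie_module L N'"
    and f: "lie_hom L M M' f" and g: "lie_hom L N N' g"
  shows "lie_hom L (lie_tensor M N) (lie_tensor M' N') (tmap M N M' N' f g)"
proof -
  note vs = M[THEN lie_module_vs]
  note t = tmap[OF vs lie_homD(1)[OF f] lie_homD(1)[OF g]]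
  have gT: "gens (lie_tensor M N) {tens M N a b | a b. a \<in> carrier M \<and> b \<in> carrier N}"
    using gens_tensor[OF vs(1,2)] by (simp add: gens_def lin_closed_def)
  have tc: "tens M N a b \<in> carrier (tensor_prod M N)" if "a \<in> carrier M" "b \<in> carrier N" for a b
    using tens_bilin[OF vs(1,2)] that unfolding bilin_def by blast
  show ?thesis
  proof (rule lie_hom_gensI[OF lie_tensor(2)[OF M(1,2)] lie_tensor(2)[OF M(3,4)] gT])
    show "tmap M N M' N' f g \<in> lhom (lie_tensor M N) (lie_tensor M' N')" using t(1) by (simp add: lhom_lie_tensor)
    fix x z assume x: "x \<in> carrier L" and "z \<in> {tens M N a b | a b. a \<in> carrier M \<and> b \<in> carrier N}"
    then obtain a b where z: "z = tens M N a b" "a \<in> carrier M" "b \<in> carrier N" by blast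
    have ac: "act M x a \<in> carrier M" "act N x b \<in> carrier N" 
      using lhomD(1)[OF lie_act_hom[OF M(1) x] z(2)] lhomD(1)[OF lie_act_hom[OF M(2) x] z(3)] by auto
    show "tmap M N M' N' f g (act (lie_tensor M N) x z) = act (lie_tensor M' N') x (tmap M N M' N' f g z)"
      using z x ac lie_homD(2)[OF f x z(2)] lie_homD(2)[OF g x z(3)] lhomD(1)[OF lie_homD(1)[OF f]] lhomD(1)[OF lie_homD(1)[OF g]]
      by (simp add: lie_tensor(1)[OF M(1,2)] lie_tensor(1)[OF M(3,4)] lhomD(2)[OF t(1)] t(2) tc)
  qed
qed

section \<open>Tensor powers and Schur functors of Lie modules\<close>

locale liepow = LM: lie_module L M for L :: "('k::field_char_0, 'g, 'x) lie_alg_scheme" and M :: "('k, 'v, 'g, 'z) lie_mod_scheme" +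
  fixes d :: nat
begin

sublocale tpow M d
  by (intro tpow.intro kvsI) (rule lie_module_vs[OF LM.lie_module_axioms])

abbreviation LP where "LP \<equiv> lie_pow d M"

lemma lie_pow_fields [simp]:
  "carrier LP = carrier TP" "add LP = add TP" "zero LP = zero TP" "smult LP = smult TP"
  by (simp_all add: lie_pow_def)

lemma lhom_LP: "lhom LP K = lhom TP K" "lhom K LP = lhom K TP"
  by (simp_all add: LinearCombinations.module_hom_def)

lemmas Mvs = lie_module_vs[OF LM.lie_module_axioms]
lemmas pm = multilinD[OF tpure_multilin[OF Mvs], of _ d]

definition upd where "upd x ms i = pure (ms[i := act M x (ms ! i)])"

lemma upd_cl: "x \<in> carrier L \<Longrightarrow> ms \<in> tuples d M \<Longrightarrow> i < d \<Longrightarrow> upd x ms i \<in> carrier TP"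
  unfolding upd_def by (intro pure_cl tuples_update LM.act_closed tuples_nth)

lemma lp_act:
  assumes x: "x \<in> carrier L"
  shows "act LP x \<in> lhom TP TP" "ms \<in> tuples d M \<Longrightarrow> act LP x (pure ms) = (\<Oplus>\<^bsub>TP\<^esub>i\<in>{..<d}. upd x ms i)"
proof -
  have "multilin d M TP (\<lambda>ms. \<Oplus>\<^bsub>TP\<^esub>i\<in>{..<d}. upd x ms i)"
  proof (rule multilinI)
    show "(\<Oplus>\<^bsub>TP\<^esub>i\<in>{..<d}. upd x ms i) \<in> carrier TP" if "ms \<in> tuples d M" for ms
      by (rule T.finsum_cl) (use x that upd_cl in auto)
    fix ms k u v c assume ms: "ms \<in> tuples d M" and k: "k < d" and u: "u \<in> carrier M"
    have len: "length ms = d" using ms by (rule tuples_length)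
    \<comment> \<open>Updates in different slots commute, so for these summands multilinearity in
      slot k is that of the pure tensor.\<close>
    have other: "upd x (ms[k := w]) i = pure (ms[i := act M x (ms ! i), k := w])" if "i \<noteq> k" for w i
      using that by (simp add: upd_def list_update_swap)
    have same: "upd x (ms[k := w]) k = pure (ms[k := act M x w])" for w
      using k len by (simp add: upd_def)
    have mi: "ms[i := act M x (ms ! i)] \<in> tuples d M" if "i < d" for i
      using that x ms by (intro tuples_update LM.act_closed tuples_nth)
    have "upd x (ms[k := c \<odot>\<^bsub>M\<^esub> u]) i = c \<odot>\<^bsub>TP\<^esub> upd x (ms[k := u]) i" if "i < d" for i
      by (cases "i = k") (use x ms k u that mi pm(3) in \<open>auto simp: same other LM.act_smult_right LM.act_closed\<close>)
    then have "(\<Oplus>\<^bsub>TP\<^esub>i\<in>{..<d}. upd x (ms[k := c \<odot>\<^bsub>M\<^esub> u]) i) = (\<Oplus>\<^bsub>TP\<^esub>i\<in>{..<d}. c \<odot>\<^bsub>TP\<^esub> upd x (ms[k := u]) i)"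
      using upd_cl[OF x tuples_update[OF ms u]] by (intro T.finsum_eq) auto
    then show "(\<Oplus>\<^bsub>TP\<^esub>i\<in>{..<d}. upd x (ms[k := c \<odot>\<^bsub>M\<^esub> u]) i) = c \<odot>\<^bsub>TP\<^esub> (\<Oplus>\<^bsub>TP\<^esub>i\<in>{..<d}. upd x (ms[k := u]) i)"
      using upd_cl[OF x tuples_update[OF ms u]] by (subst T.sc_finsum) auto
    assume v: "v \<in> carrier M"
    have "upd x (ms[k := u \<oplus>\<^bsub>M\<^esub> v]) i = upd x (ms[k := u]) i \<oplus>\<^bsub>TP\<^esub> upd x (ms[k := v]) i" if "i < d" for i
      by (cases "i = k") (use x ms k u v that mi pm(2) in \<open>auto simp: same other LM.act_add_right LM.act_closed\<close>)
    then have "(\<Oplus>\<^bsub>TP\<^esub>i\<in>{..<d}. upd x (ms[k := u \<oplus>\<^bsub>M\<^esub> v]) i) = (\<Oplus>\<^bsub>TP\<^esub>i\<in>{..<d}. upd x (ms[k := u]) i \<oplus>\<^bsub>TP\<^esub> upd x (ms[k := v]) i)"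
      using upd_cl[OF x tuples_update[OF ms u]] upd_cl[OF x tuples_update[OF ms v]] by (intro T.finsum_eq) auto
    then show "(\<Oplus>\<^bsub>TP\<^esub>i\<in>{..<d}. upd x (ms[k := u \<oplus>\<^bsub>M\<^esub> v]) i) = (\<Oplus>\<^bsub>TP\<^esub>i\<in>{..<d}. upd x (ms[k := u]) i) \<oplus>\<^bsub>TP\<^esub> (\<Oplus>\<^bsub>TP\<^esub>i\<in>{..<d}. upd x (ms[k := v]) i)"
      using upd_cl[OF x tuples_update[OF ms u]] upd_cl[OF x tuples_update[OF ms v]] by (subst T.finsum_add[symmetric]) auto
  qed
  from tpow_lift[OF Mvs T.vectorspace_axioms this]
  show "act LP x \<in> lhom TP TP" "ms \<in> tuples d M \<Longrightarrow> act LP x (pure ms) = (\<Oplus>\<^bsub>TP\<^esub>i\<in>{..<d}. upd x ms i)"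
    by (simp_all add: lie_pow_def upd_def)
qed

lemma lp_lie: "lie_module L LP"
proof (rule lie_moduleI_gens[OF lie_module_alg[OF LM.lie_module_axioms], of _ "pure ` tuples d M"])
  show "vectorspace class_ring LP" unfolding lie_pow_def by (rule with_act_vs) (rule T.vectorspace_axioms)
  show "gens LP (pure ` tuples d M)" using gens_tpow[OF Mvs, of d] by (simp add: gens_def lin_closed_def)
  show "act LP x \<in> lhom LP LP" if "x \<in> carrier L" for x using lp_act(1)[OF that] by (simp add: lhom_LP)
  have am: "a_minus LP = a_minus TP" by (rule additive_cong) simp_all
  fix x y g c assume x: "x \<in> carrier L" and "g \<in> pure ` tuples d M"
  then obtain ms where g: "g = pure ms" and ms: "ms \<in> tuples d M" by blast
  have len: "length ms = d" using ms by (rule tuples_length)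
  note nth = tuples_nth[OF ms]
  have cx: "c \<odot>\<^bsub>L\<^esub> x \<in> carrier L" using kvs.scl[OF kvsI[OF LM.L.L.vectorspace_axioms] x] .
  have "(\<Oplus>\<^bsub>TP\<^esub>i\<in>{..<d}. upd (c \<odot>\<^bsub>L\<^esub> x) ms i) = (\<Oplus>\<^bsub>TP\<^esub>i\<in>{..<d}. c \<odot>\<^bsub>TP\<^esub> upd x ms i)"
    using upd_cl[OF x ms] nth x by (intro T.finsum_eq) (auto simp: upd_def LM.act_smult_left pm(3)[OF ms] LM.act_closed)
  then show "act LP (c \<odot>\<^bsub>L\<^esub> x) g = c \<odot>\<^bsub>LP\<^esub> act LP x g"
    using T.sc_finsum[of "{..<d}" "upd x ms" c] upd_cl[OF x ms] by (simp add: g lp_act(2) x cx ms)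
  assume y: "y \<in> carrier L"
  have "(\<Oplus>\<^bsub>TP\<^esub>i\<in>{..<d}. upd (x \<oplus>\<^bsub>L\<^esub> y) ms i) = (\<Oplus>\<^bsub>TP\<^esub>i\<in>{..<d}. upd x ms i \<oplus>\<^bsub>TP\<^esub> upd y ms i)"
    using upd_cl[OF x ms] upd_cl[OF y ms] nth x y by (intro T.finsum_eq) (auto simp: upd_def LM.act_add_left pm(2)[OF ms] LM.act_closed)
  then show "act LP (x \<oplus>\<^bsub>L\<^esub> y) g = act LP x g \<oplus>\<^bsub>LP\<^esub> act LP y g"
    using upd_cl[OF x ms] upd_cl[OF y ms] by (simp add: g lp_act(2) x y ms T.finsum_add)
  \<comment> \<open>The term of the double action where y acts in slot j and afterwards x in slot
    i.\<close>
  define t where "t x y j i = upd x (ms[j := act M y (ms ! j)]) i" for x y j i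
  have msj: "ms[j := act M y (ms ! j)] \<in> tuples d M" if "y \<in> carrier L" "j < d" for y j
    using that nth by (intro tuples_update ms LM.act_closed) auto
  have tcl: "t x y j i \<in> carrier TP" if "x \<in> carrier L" "y \<in> carrier L" "j < d" "i < d" for x y j i
    unfolding t_def using that by (intro upd_cl msj)
  have two: "act LP x (act LP y g) = (\<Oplus>\<^bsub>TP\<^esub>j\<in>{..<d}. \<Oplus>\<^bsub>TP\<^esub>i\<in>{..<d}. t x y j i)" if "x \<in> carrier L" "y \<in> carrier L" for x y
  proof -
    interpret h: khom TP TP "act LP x" by (intro khomI T.vectorspace_axioms lp_act(1) that)
    have "act LP x (act LP y g) = (\<Oplus>\<^bsub>TP\<^esub>j\<in>{..<d}. act LP x (upd y ms j))"
      unfolding g lp_act(2)[OF that(2) ms] using upd_cl[OF that(2) ms] by (subst h.finsum) auto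
    also have "\<dots> = (\<Oplus>\<^bsub>TP\<^esub>j\<in>{..<d}. \<Oplus>\<^bsub>TP\<^esub>i\<in>{..<d}. t x y j i)"
      using that tcl[OF that] by (intro T.finsum_eq) (auto simp: upd_def[of y] lp_act(2) msj t_def intro!: T.finsum_cl)
    finally show ?thesis .
  qed
  \<comment> \<open>Actions in different slots commute, so these terms cancel in the
    commutator.\<close>
  have off: "t x y j i = t y x i j" if "i \<noteq> j" for i j
    using that by (simp add: t_def upd_def list_update_swap)
  \<comment> \<open>Only the terms with both actions in the same slot remain; there the module axiom
    of M gives the bracket.\<close>
  have diag: "t x y j j \<ominus>\<^bsub>TP\<^esub> t y x j j = upd (bracket L x y) ms j" if j: "j < d" for j
  proof -
    let ?m = "ms ! j"
    have c: "act M x (act M y ?m) \<in> carrier M" "act M y (act M x ?m) \<in> carrier M"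
      using x y nth[OF j] by (simp_all add: LM.act_closed)
    have "upd (bracket L x y) ms j = pure (ms[j := act M x (act M y ?m) \<oplus>\<^bsub>M\<^esub> (-1) \<odot>\<^bsub>M\<^esub> act M y (act M x ?m)])"
      using c nth[OF j] x y by (simp add: upd_def LM.act_bracket a_minus_def V.minus_sc)
    also have "\<dots> = pure (ms[j := act M x (act M y ?m)]) \<ominus>\<^bsub>TP\<^esub> pure (ms[j := act M y (act M x ?m)])"
      using c j pm(2)[OF ms j c(1), of "(-1) \<odot>\<^bsub>M\<^esub> act M y (act M x ?m)"] pm(3)[OF ms j c(2), of "-1"] 
      by (simp add: a_minus_def T.minus_sc pure_cl tuples_update ms)
    finally show ?thesis using j len by (simp add: t_def upd_def)
  qed
  have "act LP x (act LP y g) \<ominus>\<^bsub>TP\<^esub> act LP y (act LP x g) =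
      (\<Oplus>\<^bsub>TP\<^esub>j\<in>{..<d}. \<Oplus>\<^bsub>TP\<^esub>i\<in>{..<d}. t x y j i) \<ominus>\<^bsub>TP\<^esub> (\<Oplus>\<^bsub>TP\<^esub>j\<in>{..<d}. \<Oplus>\<^bsub>TP\<^esub>i\<in>{..<d}. t y x i j)"
    unfolding two[OF x y] two[OF y x] using tcl[OF y x] by (subst (2) T.finsum_swap) auto
  also have "\<dots> = (\<Oplus>\<^bsub>TP\<^esub>j\<in>{..<d}. \<Oplus>\<^bsub>TP\<^esub>i\<in>{..<d}. t x y j i \<ominus>\<^bsub>TP\<^esub> t y x i j)"
  proof -
    have "(\<Oplus>\<^bsub>TP\<^esub>j\<in>{..<d}. \<Oplus>\<^bsub>TP\<^esub>i\<in>{..<d}. t x y j i) \<ominus>\<^bsub>TP\<^esub> (\<Oplus>\<^bsub>TP\<^esub>j\<in>{..<d}. \<Oplus>\<^bsub>TP\<^esub>i\<in>{..<d}. t y x i j) =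
        (\<Oplus>\<^bsub>TP\<^esub>j\<in>{..<d}. (\<Oplus>\<^bsub>TP\<^esub>i\<in>{..<d}. t x y j i) \<ominus>\<^bsub>TP\<^esub> (\<Oplus>\<^bsub>TP\<^esub>i\<in>{..<d}. t y x i j))"
      by (rule T.finsum_diff) (auto intro!: T.finsum_cl tcl x y)
    also have "\<dots> = (\<Oplus>\<^bsub>TP\<^esub>j\<in>{..<d}. \<Oplus>\<^bsub>TP\<^esub>i\<in>{..<d}. t x y j i \<ominus>\<^bsub>TP\<^esub> t y x i j)"
      by (intro T.finsum_eq T.finsum_diff) (auto intro!: T.finsum_cl T.minus_closed tcl x y)
    finally show ?thesis .
  qed
  also have "\<dots> = (\<Oplus>\<^bsub>TP\<^esub>j\<in>{..<d}. upd (bracket L x y) ms j)"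
  proof (rule T.finsum_eq)
    fix j assume j: "j \<in> {..<d}"
    have "t x y j i \<ominus>\<^bsub>TP\<^esub> t y x i j = \<zero>\<^bsub>TP\<^esub>" if "i < d" "i \<noteq> j" for i
      using off[OF that(2)] tcl[OF y x that(1), of j] j by (simp add: a_minus_def T.r_neg)
    then show "(\<Oplus>\<^bsub>TP\<^esub>i\<in>{..<d}. t x y j i \<ominus>\<^bsub>TP\<^esub> t y x i j) = upd (bracket L x y) ms j"
      using T.finsum_delta[of "{..<d}" j "\<lambda>i. t x y j i \<ominus>\<^bsub>TP\<^esub> t y x i j"] j tcl x y diag by auto
  qed (use upd_cl[OF LM.L.bracket_closed[OF x y] ms] in auto)
  finally show "act LP (bracket L x y) g = act LP x (act LP y g) \<ominus>\<^bsub>LP\<^esub> act LP y (act LP x g)"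
    unfolding am using lp_act(2)[OF LM.L.bracket_closed[OF x y] ms] g by simp
qed

text \<open>An element of L acts in every slot in the same way, so a permutation of the slots merely
  reindexes the Leibniz sum.\<close>

lemma act_alg_equivariant: "lie_hom L LP LP (act_alg a)"
proof -
  have tp: "tperm \<sigma> (act LP x m) = act LP x (tperm \<sigma> m)" if s: "\<sigma> permutes {..<d}" and x: "x \<in> carrier L" and m: "m \<in> carrier TP" for \<sigma> x m
  proof (rule tpow_hom_eqI[OF Mvs T.vectorspace_axioms lhom_comp[OF lp_act(1) tperm(1)] lhom_comp[OF tperm(1) lp_act(1)] _ m])
    fix ms assume ms: "ms \<in> tuples d M"
    have len: "length ms = d" using ms by (rule tuples_length)
    interpret h: khom TP TP "tperm \<sigma>" by (intro khomI T.vectorspace_axioms tperm(1) s)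
    have ps: "permute_list \<sigma> ms \<in> tuples d M" by (rule tuples_permute[OF s ms])
    have im: "inv \<sigma> ` {..<d} = {..<d}" by (rule permutes_image[OF permutes_inv[OF s]])
    have lt: "inv \<sigma> i < d" if "i < d" for i using permutes_in_image[OF permutes_inv[OF s], of i] that by simp
    have "tperm \<sigma> (act LP x (pure ms)) = (\<Oplus>\<^bsub>TP\<^esub>i\<in>{..<d}. tperm \<sigma> (upd x ms i))"
      unfolding lp_act(2)[OF x ms] using upd_cl[OF x ms] by (subst h.finsum) auto
    also have "\<dots> = (\<Oplus>\<^bsub>TP\<^esub>i\<in>{..<d}. upd x (permute_list \<sigma> ms) (inv \<sigma> i))"
    proof (rule T.finsum_eq)
      fix i assume "i \<in> {..<d}"
      then have i: "i < d" by simp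
      have "permute_list \<sigma> ms ! inv \<sigma> i = ms ! i"
        using s len lt[OF i] permutes_inverses(1)[OF s, of i] by (simp add: permute_list_nth)
      then show "tperm \<sigma> (upd x ms i) = upd x (permute_list \<sigma> ms) (inv \<sigma> i)"
        using s len i x ms by (simp add: upd_def tperm(2) tuples_update LM.act_closed tuples_nth permute_list_update)
    qed (use lt upd_cl[OF x ps] in auto)
    also have "\<dots> = (\<Oplus>\<^bsub>TP\<^esub>i\<in>{..<d}. upd x (permute_list \<sigma> ms) i)"
      using T.finsum_reindex[of "upd x (permute_list \<sigma> ms)" "inv \<sigma>" "{..<d}"] im upd_cl[OF x ps] permutes_inj_on[OF permutes_inv[OF s]]
      by auto
    finally show "tperm \<sigma> (act LP x (pure ms)) = act LP x (tperm \<sigma> (pure ms))"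
      using s ms by (simp add: tperm(2) lp_act(2)[OF x ps])
  qed (use s x in auto)
  show ?thesis unfolding lie_hom_def lhom_LP
  proof (intro conjI ballI act_alg(1))
    fix x m assume x: "x \<in> carrier L" and "m \<in> carrier LP"
    then have m: "m \<in> carrier TP" by simp
    interpret h: khom TP TP "act LP x" by (intro khomI T.vectorspace_axioms lp_act(1) x)
    show "act_alg a (act LP x m) = act LP x (act_alg a m)"
      unfolding act_alg(2)[OF h.cl[OF m]] act_alg(2)[OF m]
      by (subst h.finsum) (auto simp: tperm_cl m h.cl h.sc tp x intro!: T.finsum_eq)
  qed
qed

lemma schur_fields:
  assumes lam: "lam \<in> partitions d"
  shows "carrier (schur lam M) = {x \<in> carrier TP. act_alg (yidem lam) x = x}"
    "add (schur lam M) = add TP" "zero (schur lam M) = zero TP" "smult (schur lam M) = smult TP" "act (schur lam M) = act LP"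
  using young_image[OF lam] partitionsD(1)[OF lam] by (simp_all add: schur_def Let_def)

lemma schur_lie:
  assumes lam: "lam \<in> partitions d"
  shows "lie_module L (schur lam M)"
proof -
  interpret h: khom TP TP "act_alg (yidem lam)" by (intro khomI T.vectorspace_axioms act_alg)
  show ?thesis
    by (rule lie_module_sub[OF lp_lie])
      (use lie_homD(2)[OF act_alg_equivariant, of _ _ "yidem lam"] lhomD(1)[OF lp_act(1)] in
        \<open>auto simp: schur_fields[OF lam] h.zero h.add h.sc\<close>)
qed

text \<open>For x in A e the image of x is fixed by e, because the right action turns x followed by
  e into x e = x.\<close>

lemma schur_hom:
  assumes lam: "lam \<in> partitions d"
  shows "x \<in> yleft lam \<Longrightarrow> lie_hom L LP (schur lam M) (act_alg x)" "lie_hom L (schur lam M) LP (act_alg y)"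
proof -
  note e = lie_homD[OF act_alg_equivariant]
  show "lie_hom L (schur lam M) LP (act_alg y)"
    unfolding lie_hom_def using e(2)[of _ _ y] lhomD[OF act_alg(1)[of y]]
    by (auto simp: schur_fields[OF lam] LinearCombinations.module_hom_def)
  assume x: "x \<in> yleft lam"
  have "act_alg x m \<in> carrier (schur lam M)" if "m \<in> carrier TP" for m
    using x that by (simp add: schur_fields[OF lam] yleft_def flip: act_alg_mul)
  then show "lie_hom L LP (schur lam M) (act_alg x)"
    unfolding lie_hom_def using e(2)[of _ _ x] lhomD[OF act_alg(1)[of x]]
    by (auto simp: schur_fields[OF lam] LinearCombinations.module_hom_def)
qed

end

section \<open>Direct sums\<close>

lemma lie_direct_sum_fields:
  fixes N :: "'i \<Rightarrow> ('k::field, 'm, 'g, 'z) lie_mod_scheme"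
  assumes "finite I"
  shows "carrier (lie_direct_sum I N) = (\<Pi>\<^sub>E i\<in>I. carrier (N i))"
    "zero (lie_direct_sum I N) = (\<lambda>i\<in>I. zero (N i))" 
    "add (lie_direct_sum I N) f g = (\<lambda>i\<in>I. f i \<oplus>\<^bsub>N i\<^esub> g i)"
    "smult (lie_direct_sum I N) c f = (\<lambda>i\<in>I. c \<odot>\<^bsub>N i\<^esub> f i)"
    "act (lie_direct_sum I N) x f = (\<lambda>i\<in>I. act (N i) x (f i))"
  using assms by (simp_all add: lie_direct_sum_def)

lemma lie_direct_sum_lie:
  fixes L :: "('k::field, 'g, 'y) lie_alg_scheme" and N :: "'i \<Rightarrow> ('k, 'm, 'g, 'z) lie_mod_scheme"
  assumes L: "lie_algebra L" and I: "finite I" and N: "\<And>i. i \<in> I \<Longrightarrow> lie_module L (N i)"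
  shows "lie_module L (lie_direct_sum I N)"
proof -
  let ?S = "lie_direct_sum I N"
  note S = lie_direct_sum_fields[OF I, of N]
  have K: "kvs (N i)" if "i \<in> I" for i using N[OF that] by (intro kvsI lie_module_vs)
  have eqI: "f = g" if "f \<in> (\<Pi>\<^sub>E i\<in>I. carrier (N i))" "g \<in> (\<Pi>\<^sub>E i\<in>I. carrier (N i))" "\<And>i. i \<in> I \<Longrightarrow> f i = g i" for f g
    using that by (rule PiE_ext)
  note ab = kvs.axioms[THEN vectorspace.axioms(1), THEN Module.module.axioms(2), OF K]
  have acl: "x \<oplus>\<^bsub>N i\<^esub> y \<in> carrier (N i)" if "i \<in> I" "x \<in> carrier (N i)" "y \<in> carrier (N i)" for i x y
    using abelian_groupE(1)[OF ab] that by blast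
  note zcl = abelian_groupE(2)[OF ab] and scl = kvs.scl[OF K]
  have mem: "f i \<in> carrier (N i)" if "f \<in> (\<Pi>\<^sub>E i\<in>I. carrier (N i))" "i \<in> I" for f i using that by auto
  have vs: "vectorspace class_ring ?S"
  proof (rule vectorspaceI)
    fix f g h assume fgh: "f \<in> carrier ?S" "g \<in> carrier ?S" "h \<in> carrier ?S"
    show "f \<oplus>\<^bsub>?S\<^esub> g \<in> carrier ?S" using fgh(1,2) by (simp add: S restrict_PiE_iff acl mem)
    show "f \<oplus>\<^bsub>?S\<^esub> g \<oplus>\<^bsub>?S\<^esub> h = f \<oplus>\<^bsub>?S\<^esub> (g \<oplus>\<^bsub>?S\<^esub> h)"
      using fgh unfolding S by (intro restrict_ext) (simp add: abelian_groupE(3)[OF ab] mem)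
    show "f \<oplus>\<^bsub>?S\<^esub> g = g \<oplus>\<^bsub>?S\<^esub> f"
      using fgh unfolding S by (intro restrict_ext) (simp add: abelian_groupE(4)[OF ab] mem)
  next
    show "\<zero>\<^bsub>?S\<^esub> \<in> carrier ?S" using zcl by (simp add: S restrict_PiE_iff)
  next
    fix f assume f: "f \<in> carrier ?S"
    show "\<zero>\<^bsub>?S\<^esub> \<oplus>\<^bsub>?S\<^esub> f = f"
      using f unfolding S by (intro eqI) (simp_all add: restrict_PiE_iff abelian_groupE(5)[OF ab] mem)
    show "\<exists>g\<in>carrier ?S. g \<oplus>\<^bsub>?S\<^esub> f = \<zero>\<^bsub>?S\<^esub>"
    proof
      show "(\<lambda>i\<in>I. (- 1) \<odot>\<^bsub>N i\<^esub> f i) \<in> carrier ?S" using f by (simp add: S restrict_PiE_iff scl mem)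
      show "(\<lambda>i\<in>I. (- 1) \<odot>\<^bsub>N i\<^esub> f i) \<oplus>\<^bsub>?S\<^esub> f = \<zero>\<^bsub>?S\<^esub>"
        using f unfolding S
      proof (intro restrict_ext)
        fix i assume i: "i \<in> I" and f: "f \<in> (\<Pi>\<^sub>E i\<in>I. carrier (N i))"
        interpret kvs "N i" by (rule K[OF i])
        show "(\<lambda>i\<in>I. (- 1) \<odot>\<^bsub>N i\<^esub> f i) i \<oplus>\<^bsub>N i\<^esub> f i = \<zero>\<^bsub>N i\<^esub>"
          using i mem[OF f i] by (simp add: sc_minus l_neg)
      qed
    qed
    show "1 \<odot>\<^bsub>?S\<^esub> f = f" using f unfolding S by (intro eqI) (simp_all add: restrict_PiE_iff kvs.sc_one[OF K] mem)
    fix c d :: 'k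
    show "c \<odot>\<^bsub>?S\<^esub> f \<in> carrier ?S" using f by (simp add: S restrict_PiE_iff scl mem)
    show "(c + d) \<odot>\<^bsub>?S\<^esub> f = c \<odot>\<^bsub>?S\<^esub> f \<oplus>\<^bsub>?S\<^esub> d \<odot>\<^bsub>?S\<^esub> f"
      using f unfolding S by (intro restrict_ext) (simp add: kvs.sc_add[OF K] mem)
    show "(c * d) \<odot>\<^bsub>?S\<^esub> f = c \<odot>\<^bsub>?S\<^esub> (d \<odot>\<^bsub>?S\<^esub> f)"
      using f unfolding S by (intro restrict_ext) (simp add: kvs.sc_sc[OF K] mem)
    fix g assume g: "g \<in> carrier ?S"
    show "c \<odot>\<^bsub>?S\<^esub> (f \<oplus>\<^bsub>?S\<^esub> g) = c \<odot>\<^bsub>?S\<^esub> f \<oplus>\<^bsub>?S\<^esub> c \<odot>\<^bsub>?S\<^esub> g"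
      using f g unfolding S by (intro restrict_ext) (simp add: kvs.sc_sum_right[OF K] mem)
  qed
  interpret S: kvs ?S by (rule kvsI) (rule vs)
  have ac: "act (N i) x m \<in> carrier (N i)" if "i \<in> I" "x \<in> carrier L" "m \<in> carrier (N i)" for i x m
    using lie_module.act_closed[OF N] that by blast
  have min: "f \<ominus>\<^bsub>?S\<^esub> g = (\<lambda>i\<in>I. f i \<ominus>\<^bsub>N i\<^esub> g i)" if "f \<in> (\<Pi>\<^sub>E i\<in>I. carrier (N i))" "g \<in> (\<Pi>\<^sub>E i\<in>I. carrier (N i))" for f g
  proof -
    have "f \<ominus>\<^bsub>?S\<^esub> g = f \<oplus>\<^bsub>?S\<^esub> (- 1) \<odot>\<^bsub>?S\<^esub> g" using that S.minus_sc[of g] by (simp add: a_minus_def S(1))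
    also have "\<dots> = (\<lambda>i\<in>I. f i \<ominus>\<^bsub>N i\<^esub> g i)"
      unfolding S using that by (intro restrict_ext) (simp add: a_minus_def kvs.minus_sc[OF K] mem)
    finally show ?thesis .
  qed
  show ?thesis
  proof (intro lie_module.intro lie_module_axioms.intro L vs)
    fix x y f g c assume x: "x \<in> carrier L" and f: "f \<in> carrier ?S"
    show acf: "act ?S x f \<in> carrier ?S" using x f by (simp add: S restrict_PiE_iff ac mem)
    show "act ?S (c \<odot>\<^bsub>L\<^esub> x) f = c \<odot>\<^bsub>?S\<^esub> act ?S x f"
      using x f unfolding S by (intro restrict_ext) (simp add: lie_module.act_smult_left[OF N] mem)
    show "act ?S x (c \<odot>\<^bsub>?S\<^esub> f) = c \<odot>\<^bsub>?S\<^esub> act ?S x f"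
      using x f unfolding S by (intro restrict_ext) (simp add: lie_module.act_smult_right[OF N] mem)
    show "act ?S x (f \<oplus>\<^bsub>?S\<^esub> g) = act ?S x f \<oplus>\<^bsub>?S\<^esub> act ?S x g" if "g \<in> carrier ?S"
      using x f that unfolding S by (intro restrict_ext) (simp add: lie_module.act_add_right[OF N] mem)
    assume y: "y \<in> carrier L"
    show "act ?S (x \<oplus>\<^bsub>L\<^esub> y) f = act ?S x f \<oplus>\<^bsub>?S\<^esub> act ?S y f"
      using x y f unfolding S by (intro restrict_ext) (simp add: lie_module.act_add_left[OF N] mem)
    have cl: "(\<lambda>i\<in>I. act (N i) x ((\<lambda>i\<in>I. act (N i) y (f i)) i)) \<in> (\<Pi>\<^sub>E i\<in>I. carrier (N i))" if "x \<in> carrier L" "y \<in> carrier L" for x y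
      using that f by (simp add: S restrict_PiE_iff ac mem)
    show "act ?S (bracket L x y) f = act ?S x (act ?S y f) \<ominus>\<^bsub>?S\<^esub> act ?S y (act ?S x f)"
      using x y f unfolding S min[OF cl[OF x y] cl[OF y x]]
      by (intro restrict_ext) (simp add: lie_module.act_bracket[OF N] mem)
  qed
qed

text \<open>The f i are the projections and the g i the inclusions of a decomposition; the
  isomorphism has the f i as components and inherits their equivariance.\<close>

lemma lie_isomorphic_direct_sum:
  fixes L :: "('k::field, 'g, 'y) lie_alg_scheme" and N :: "'i \<Rightarrow> ('k, 'm, 'g, 'z) lie_mod_scheme" and M :: "('k, 'n, 'g, 'x) lie_mod_scheme"
  assumes M: "lie_module L M" and I: "finite I" and N: "\<And>i. i \<in> I \<Longrightarrow> lie_module L (N i)"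
    and f: "\<And>i. i \<in> I \<Longrightarrow> lie_hom L M (N i) (f i)" and g: "\<And>i. i \<in> I \<Longrightarrow> g i \<in> lhom (N i) M"
    and fg: "\<And>i j n. i \<in> I \<Longrightarrow> j \<in> I \<Longrightarrow> n \<in> carrier (N j) \<Longrightarrow> f i (g j n) = (if i = j then n else \<zero>\<^bsub>N i\<^esub>)"
    and gf: "\<And>m. m \<in> carrier M \<Longrightarrow> (\<Oplus>\<^bsub>M\<^esub>i\<in>I. g i (f i m)) = m"
  shows "lie_isomorphic L M (lie_direct_sum I N)"
  unfolding lie_isomorphic_def
proof (intro conjI M lie_direct_sum_lie[OF lie_module_alg[OF M] I N])
  let ?S = "lie_direct_sum I N" and ?F = "\<lambda>m. \<lambda>i\<in>I. f i m"
  note S = lie_direct_sum_fields[OF I, of N]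
  interpret M: kvs M by (rule kvsI, rule lie_module_vs[OF M])
  note fh = lie_homD(1)[OF f]
  have F: "?F \<in> lhom M ?S"
    by (rule lhomI) (use lhomD[OF fh] in \<open>auto simp: S intro!: restrict_ext\<close>)
  have "bij_betw ?F (carrier M) (carrier ?S)"
  proof (rule bij_betw_byWitness[of _ "\<lambda>h. \<Oplus>\<^bsub>M\<^esub>i\<in>I. g i (h i)"])
    have "(\<Oplus>\<^bsub>M\<^esub>i\<in>I. g i (?F m i)) = m" if "m \<in> carrier M" for m
    proof -
      have "(\<Oplus>\<^bsub>M\<^esub>i\<in>I. g i (?F m i)) = (\<Oplus>\<^bsub>M\<^esub>i\<in>I. g i (f i m))"
        using that lhomD(1)[OF fh] lhomD(1)[OF g] by (intro M.finsum_eq) auto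
      then show ?thesis using gf[OF that] by simp
    qed
    then show "\<forall>m\<in>carrier M. (\<Oplus>\<^bsub>M\<^esub>i\<in>I. g i (?F m i)) = m" by blast
    have gc: "g i (h i) \<in> carrier M" if "h \<in> (\<Pi>\<^sub>E i\<in>I. carrier (N i))" "i \<in> I" for h i
      using lhomD(1)[OF g[OF that(2)]] that by auto
    show "(\<lambda>h. \<Oplus>\<^bsub>M\<^esub>i\<in>I. g i (h i)) ` carrier ?S \<subseteq> carrier M"
      using gc by (auto simp: S intro!: M.finsum_cl)
    show "?F ` carrier M \<subseteq> carrier ?S" using lhomD(1)[OF F] by blast
    show "\<forall>h\<in>carrier ?S. ?F (\<Oplus>\<^bsub>M\<^esub>i\<in>I. g i (h i)) = h"
    proof
      fix h assume "h \<in> carrier ?S"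
      then have h: "h \<in> (\<Pi>\<^sub>E i\<in>I. carrier (N i))" by (simp add: S)
      show "?F (\<Oplus>\<^bsub>M\<^esub>i\<in>I. g i (h i)) = h"
      proof (rule PiE_ext[OF _ h])
        show "?F (\<Oplus>\<^bsub>M\<^esub>i\<in>I. g i (h i)) \<in> (\<Pi>\<^sub>E i\<in>I. carrier (N i))"
          unfolding restrict_PiE_iff by (intro ballI lhomD(1)[OF fh] M.finsum_cl gc[OF h])
        fix i assume i: "i \<in> I"
        interpret fi: khom M "N i" "f i" by (intro khomI lie_module_vs[OF M] lie_module_vs[OF N[OF i]] fh[OF i])
        have hj: "h j \<in> carrier (N j)" if "j \<in> I" for j using h that by auto
        have "f i (\<Oplus>\<^bsub>M\<^esub>j\<in>I. g j (h j)) = (\<Oplus>\<^bsub>N i\<^esub>j\<in>I. f i (g j (h j)))"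
          using gc[OF h] by (intro fi.finsum I) auto
        also have "\<dots> = f i (g i (h i))"
          by (rule fi.N.finsum_delta[OF I i]) (use hj in \<open>auto simp: fi.cl gc[OF h] fg[OF i _ hj]\<close>)
        also have "\<dots> = h i" using fg[OF i i hj[OF i]] by simp
        finally show "?F (\<Oplus>\<^bsub>M\<^esub>i\<in>I. g i (h i)) i = h i" using i by simp
      qed
    qed
  qed
  moreover have "\<forall>x\<in>carrier L. \<forall>m\<in>carrier M. ?F (act M x m) = act ?S x (?F m)"
    using lie_homD(2)[OF f] by (auto simp: S intro!: restrict_ext)
  ultimately show "\<exists>F\<in>lhom M ?S. bij_betw F (carrier M) (carrier ?S) \<and> 
      (\<forall>x\<in>carrier L. \<forall>m\<in>carrier M. F (act M x m) = act ?S x (F m))" using F by blast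
qed

lemma (in kvs) finsum_Times:
  assumes "finite I" "finite J" "\<And>i j. i \<in> I \<Longrightarrow> j \<in> J \<Longrightarrow> f i j \<in> carrier M"
  shows "(\<Oplus>i\<in>I. \<Oplus>j\<in>J. f i j) = (\<Oplus>z\<in>I \<times> J. f (fst z) (snd z))"
  using assms(1,3)
proof (induction I rule: finite_induct)
  case (insert a I)
  have "(\<Oplus>z\<in>(\<lambda>j. (a, j)) ` J. f (fst z) (snd z)) = (\<Oplus>j\<in>J. f a j)"
  proof -
    have "(\<lambda>z. f (fst z) (snd z)) \<in> (\<lambda>j. (a, j)) ` J \<rightarrow> carrier M" using insert.prems by auto
    from finsum_reindex[OF this] show ?thesis by (simp add: inj_on_def)
  qed
  moreover have "insert a I \<times> J = (\<lambda>j. (a, j)) ` J \<union> I \<times> J" by auto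
  moreover have "(\<Oplus>z\<in>(\<lambda>j. (a, j)) ` J \<union> I \<times> J. f (fst z) (snd z)) =
      (\<Oplus>z\<in>(\<lambda>j. (a, j)) ` J. f (fst z) (snd z)) \<oplus> (\<Oplus>z\<in>I \<times> J. f (fst z) (snd z))"
    using insert assms(2) by (intro finsum_Un_disjoint) auto
  ultimately show ?case using insert by (simp add: finsum_cl)
qed simp

section \<open>Decomposition of the mixed tensor power\<close>

locale mixed = glpair V W pair for V :: "('k::field_char_0, 'v) module" and W :: "('k, 'w) module" and pair +
  fixes p q :: nat
begin

sublocale A: liepow gl natV p by (intro liepow.intro natV_lie)
sublocale B: liepow gl natW q by (intro liepow.intro natW_lie)

abbreviation AB where "AB \<equiv> lie_tensor A.LP B.LP"
abbreviation tAB where "tAB \<equiv> tens A.LP B.LP"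

lemma AB_lie: "lie_module gl AB"
  by (rule lie_tensor(2)[OF A.lp_lie B.lp_lie])

sublocale AB: kvs AB
  by (rule kvsI, rule lie_module_vs[OF AB_lie])

lemma gens_AB: "gens AB {tAB a b | a b. a \<in> carrier A.TP \<and> b \<in> carrier B.TP}"
  using gens_tensor[OF lie_module_vs[OF A.lp_lie] lie_module_vs[OF B.lp_lie]] by (simp add: gens_def lin_closed_def)

lemma tAB:
  "a \<in> carrier A.TP \<Longrightarrow> b \<in> carrier B.TP \<Longrightarrow> tAB a b \<in> carrier AB"
  "a \<in> carrier A.TP \<Longrightarrow> b \<in> carrier B.TP \<Longrightarrow> a' \<in> carrier A.TP \<Longrightarrow> tAB (a \<oplus>\<^bsub>A.TP\<^esub> a') b = tAB a b \<oplus>\<^bsub>AB\<^esub> tAB a' b"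
  "a \<in> carrier A.TP \<Longrightarrow> b \<in> carrier B.TP \<Longrightarrow> b' \<in> carrier B.TP \<Longrightarrow> tAB a (b \<oplus>\<^bsub>B.TP\<^esub> b') = tAB a b \<oplus>\<^bsub>AB\<^esub> tAB a b'"
  "a \<in> carrier A.TP \<Longrightarrow> b \<in> carrier B.TP \<Longrightarrow> tAB (c \<odot>\<^bsub>A.TP\<^esub> a) b = c \<odot>\<^bsub>AB\<^esub> tAB a b"
  "a \<in> carrier A.TP \<Longrightarrow> b \<in> carrier B.TP \<Longrightarrow> tAB a (c \<odot>\<^bsub>B.TP\<^esub> b) = c \<odot>\<^bsub>AB\<^esub> tAB a b"
  using tens_bilin[OF lie_module_vs[OF A.lp_lie] lie_module_vs[OF B.lp_lie]] unfolding bilin_def by simp_all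

lemma tAB_hom: "b \<in> carrier B.TP \<Longrightarrow> (\<lambda>a. tAB a b) \<in> lhom A.TP AB" "a \<in> carrier A.TP \<Longrightarrow> tAB a \<in> lhom B.TP AB"
  by (rule lhomI; rule tAB; assumption)+

abbreviation SV where "SV lam \<equiv> schur lam natV"
abbreviation SW where "SW mu \<equiv> schur mu natW"
abbreviation Gam where "Gam lam mu \<equiv> lie_tensor (SV lam) (SW mu)"

lemma Gam_lie: "lam \<in> partitions p \<Longrightarrow> mu \<in> partitions q \<Longrightarrow> lie_module gl (Gam lam mu)"
  by (rule lie_tensor(2)[OF A.schur_lie B.schur_lie])

definition proj where "proj lam mu x y = tmap A.LP B.LP (SV lam) (SW mu) (A.act_alg x) (B.act_alg y)"
definition incl where "incl lam mu x y = tmap (SV lam) (SW mu) A.LP B.LP (A.act_alg x) (B.act_alg y)"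

lemma proj:
  assumes "lam \<in> partitions p" "mu \<in> partitions q" "x \<in> A.yleft lam" "y \<in> B.yleft mu"
  shows "lie_hom gl AB (Gam lam mu) (proj lam mu x y)"
    "a \<in> carrier A.TP \<Longrightarrow> b \<in> carrier B.TP \<Longrightarrow> proj lam mu x y (tAB a b) = tens (SV lam) (SW mu) (A.act_alg x a) (B.act_alg y b)"
  unfolding proj_def
proof -
  show "lie_hom gl AB (Gam lam mu) (tmap A.LP B.LP (SV lam) (SW mu) (A.act_alg x) (B.act_alg y))"
    using assms by (intro tmap_lie_hom A.lp_lie B.lp_lie A.schur_lie B.schur_lie A.schur_hom B.schur_hom)
  show "tmap A.LP B.LP (SV lam) (SW mu) (A.act_alg x) (B.act_alg y) (tAB a b) = tens (SV lam) (SW mu) (A.act_alg x a) (B.act_alg y b)"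
    if "a \<in> carrier A.TP" "b \<in> carrier B.TP"
    by (rule tmap(2)[OF lie_module_vs[OF A.lp_lie] lie_module_vs[OF B.lp_lie] lie_module_vs[OF A.schur_lie[OF assms(1)]]
      lie_module_vs[OF B.schur_lie[OF assms(2)]] lie_homD(1)[OF A.schur_hom(1)[OF assms(1,3)]]
      lie_homD(1)[OF B.schur_hom(1)[OF assms(2,4)]]]) (use that in simp_all)
qed

lemma incl:
  assumes "lam \<in> partitions p" "mu \<in> partitions q"
  shows "lie_hom gl (Gam lam mu) AB (incl lam mu x y)"
    "a \<in> carrier (SV lam) \<Longrightarrow> b \<in> carrier (SW mu) \<Longrightarrow> incl lam mu x y (tens (SV lam) (SW mu) a b) = tAB (A.act_alg x a) (B.act_alg y b)"
  unfolding incl_def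
proof -
  show "lie_hom gl (Gam lam mu) AB (tmap (SV lam) (SW mu) A.LP B.LP (A.act_alg x) (B.act_alg y))"
    using assms by (intro tmap_lie_hom A.lp_lie B.lp_lie A.schur_lie B.schur_lie A.schur_hom B.schur_hom)
  show "tmap (SV lam) (SW mu) A.LP B.LP (A.act_alg x) (B.act_alg y) (tens (SV lam) (SW mu) a b) = tAB (A.act_alg x a) (B.act_alg y b)"
    if "a \<in> carrier (SV lam)" "b \<in> carrier (SW mu)"
    by (rule tmap(2)[OF lie_module_vs[OF A.schur_lie[OF assms(1)]] lie_module_vs[OF B.schur_lie[OF assms(2)]]
      lie_module_vs[OF A.lp_lie] lie_module_vs[OF B.lp_lie] lie_homD(1)[OF A.schur_hom(2)[OF assms(1)]]
      lie_homD(1)[OF B.schur_hom(2)[OF assms(2)]]]) (use that in simp_all)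
qed

text \<open>The copies of the summand for (lam, mu) are indexed by pairs of members (x, y) of the
  dual bases for lam and for mu. Projections use x and inclusions use y: with the right action,
  including and then projecting is y x, while projecting and then including is x y, and the products
  x y sum to 1.\<close>

lemma decomposition:
  "lie_isomorphic gl AB
     (lie_direct_sum
        (SIGMA (lam, mu) : partitions p \<times> partitions q.
           {..<vectorspace.dim (class_ring :: 'k ring) (specht_module lam) *
               vectorspace.dim (class_ring :: 'k ring) (specht_module mu)})
        (\<lambda>((lam, mu), i). Gam lam mu))"
proof -
  define fA :: "nat list \<Rightarrow> nat" where "fA lam = vectorspace.dim (class_ring :: 'k ring) (specht_module lam)" for lam
  let ?I = "SIGMA (lam, mu) : partitions p \<times> partitions q. {..<fA lam * fA mu}"
  define JA where "JA = Sigma (partitions p) (A.ydual :: _ \<Rightarrow> ((_ \<Rightarrow> 'k) \<times> (_ \<Rightarrow> 'k)) set)"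
  define JB where "JB = Sigma (partitions q) (B.ydual :: _ \<Rightarrow> ((_ \<Rightarrow> 'k) \<times> (_ \<Rightarrow> 'k)) set)"
  have "\<exists>h. bij_betw h {..<fA lam} (A.ydual lam :: ((_ \<Rightarrow> 'k) \<times> (_ \<Rightarrow> 'k)) set)" if "lam \<in> partitions p" for lam
    using ex_bij_betw_nat_finite[OF A.ydual(1)[OF that, where 'k='k]] A.ydual(2)[OF that, where 'k='k] by (simp add: atLeast0LessThan fA_def)
  then obtain h where h: "\<And>lam. lam \<in> partitions p \<Longrightarrow> bij_betw (h lam) {..<fA lam} (A.ydual lam :: ((_ \<Rightarrow> 'k) \<times> (_ \<Rightarrow> 'k)) set)"
    by metis
  have "\<exists>h. bij_betw h {..<fA mu} (B.ydual mu :: ((_ \<Rightarrow> 'k) \<times> (_ \<Rightarrow> 'k)) set)" if "mu \<in> partitions q" for mu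
    using ex_bij_betw_nat_finite[OF B.ydual(1)[OF that, where 'k='k]] B.ydual(2)[OF that, where 'k='k] by (simp add: atLeast0LessThan fA_def)
  then obtain k where k: "\<And>mu. mu \<in> partitions q \<Longrightarrow> bij_betw (k mu) {..<fA mu} (B.ydual mu :: ((_ \<Rightarrow> 'k) \<times> (_ \<Rightarrow> 'k)) set)"
    by metis
  \<comment> \<open>A copy number below the product of two dimensions is decoded by quotient and
    remainder into a member of each dual basis; the partition is kept as a label.\<close>
  define a where "a = (\<lambda>((lam :: nat list, mu :: nat list), i :: nat). (lam, h lam (i div fA mu)))"
  define b where "b = (\<lambda>((lam :: nat list, mu :: nat list), i :: nat). (mu, k mu (i mod fA mu)))"
  have rng: "i div fA mu < fA lam" "i mod fA mu < fA mu" if "i < fA lam * fA mu" for i lam mu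
  proof -
    have "0 < fA mu" using that by (cases "fA mu") auto
    then show "i mod fA mu < fA mu" by simp
    show "i div fA mu < fA lam" using that by (rule less_mult_imp_div_less)
  qed
  have bij: "inj_on (\<lambda>z. (a z, b z)) ?I" "(\<lambda>z. (a z, b z)) ` ?I = JA \<times> JB"
  proof -
    show "inj_on (\<lambda>z. (a z, b z)) ?I"
    proof (rule inj_onI)
      fix z z' assume z: "z \<in> ?I" "z' \<in> ?I" and zz: "(a z, b z) = (a z', b z')"
      obtain lam mu i where z1: "z = ((lam, mu), i)" and *: "lam \<in> partitions p" "mu \<in> partitions q" "i \<in> {..<fA lam * fA mu}"
        using z(1) by auto
      obtain lam' mu' i' where z2: "z' = ((lam', mu'), i')" and i2: "i' \<in> {..<fA lam' * fA mu'}"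
        using z(2) by auto
      have e: "a ((lam, mu), i) = a ((lam', mu'), i')" "b ((lam, mu), i) = b ((lam', mu'), i')" using zz z1 z2 by auto
      then have l: "lam' = lam" "mu' = mu" and i': "i' < fA lam * fA mu" using i2 by (auto simp: a_def b_def)
      have "i div fA mu = i' div fA mu"
        using e(1) l rng(1)[of i lam mu] rng(1)[OF i'] * bij_betw_imp_inj_on[OF h[OF *(1)]] by (auto simp: a_def inj_on_eq_iff)
      moreover have "i mod fA mu = i' mod fA mu"
        using e(2) l rng(2)[of i lam mu] rng(2)[OF i'] * bij_betw_imp_inj_on[OF k[OF *(2)]] by (auto simp: b_def inj_on_eq_iff)
      ultimately have "i = i'" by (metis div_mult_mod_eq)
      then show "z = z'" using l z1 z2 by simp
    qed
    show "(\<lambda>z. (a z, b z)) ` ?I = JA \<times> JB"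
    proof (intro equalityI subsetI)
      fix z assume "z \<in> (\<lambda>z. (a z, b z)) ` ?I"
      then obtain lam mu i where *: "lam \<in> partitions p" "mu \<in> partitions q" "i < fA lam * fA mu"
        and z: "z = (a ((lam, mu), i), b ((lam, mu), i))" by auto
      then show "z \<in> JA \<times> JB" using rng[OF *(3)] bij_betwE[OF h[OF *(1)]] bij_betwE[OF k[OF *(2)]]
        by (auto simp: JA_def JB_def a_def b_def)
    next
      fix z assume "z \<in> JA \<times> JB"
      then obtain lam mu x y where z: "z = ((lam, x), (mu, y))" and *: "lam \<in> partitions p" "mu \<in> partitions q"
        and xy: "x \<in> A.ydual lam" "y \<in> B.ydual mu" by (auto simp: JA_def JB_def)
      obtain i where i: "i < fA lam" "h lam i = x" using xy(1) bij_betw_imp_surj_on[OF h[OF *(1)]] by (metis imageE lessThan_iff)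
      obtain j where j: "j < fA mu" "k mu j = y" using xy(2) bij_betw_imp_surj_on[OF k[OF *(2)]] by (metis imageE lessThan_iff)
      have "i * fA mu + j < Suc i * fA mu" using j(1) by simp
      also have "\<dots> \<le> fA lam * fA mu" using i(1) by (intro mult_le_mono1) simp
      finally have "i * fA mu + j < fA lam * fA mu" .
      moreover have "a ((lam, mu), i * fA mu + j) = (lam, x)" "b ((lam, mu), i * fA mu + j) = (mu, y)"
        using i j by (simp_all add: a_def b_def)
      ultimately show "z \<in> (\<lambda>z. (a z, b z)) ` ?I" using * z by (intro image_eqI[of _ _ "((lam, mu), i * fA mu + j)"]) auto
    qed
  qed
  have finI: "finite ?I" using finite_partitions by (intro finite_SigmaI) auto
  have finJ: "finite JA" "finite JB" using finite_partitions A.ydual(1) B.ydual(1) by (auto simp: JA_def JB_def)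
  define N where "N = (\<lambda>((lam, mu), i :: nat). Gam lam mu)"
  define f where "f z = proj (fst (a z)) (fst (b z)) (fst (snd (a z))) (fst (snd (b z)))" for z
  define g where "g z = incl (fst (a z)) (fst (b z)) (snd (snd (a z))) (snd (snd (b z)))" for z
  have az: "fst (a z) \<in> partitions p" "snd (a z) \<in> A.ydual (fst (a z))" and bz: "fst (b z) \<in> partitions q" "snd (b z) \<in> B.ydual (fst (b z))"
    and Nz: "N z = Gam (fst (a z)) (fst (b z))" if "z \<in> ?I" for z
  proof -
    have "(a z, b z) \<in> JA \<times> JB" using that bij(2) by blast
    then show "fst (a z) \<in> partitions p" "snd (a z) \<in> A.ydual (fst (a z))" "fst (b z) \<in> partitions q" "snd (b z) \<in> B.ydual (fst (b z))"
      by (auto simp: JA_def JB_def)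
    show "N z = Gam (fst (a z)) (fst (b z))" by (auto simp: N_def a_def b_def split: prod.split)
  qed
  have Al: "fst (snd (a z)) \<in> A.yleft (fst (a z))" and Bl: "fst (snd (b z)) \<in> B.yleft (fst (b z))" if "z \<in> ?I" for z
    using A.ydual(3) B.ydual(3) az[OF that] bz[OF that] by blast+
  have fh: "lie_hom gl AB (N z) (f z)" and gh: "lie_hom gl (N z) AB (g z)" if "z \<in> ?I" for z
    unfolding Nz[OF that] f_def g_def using az[OF that] bz[OF that] Al[OF that] Bl[OF that] by (auto intro!: proj(1) incl(1))
  have Nl: "lie_module gl (N z)" if "z \<in> ?I" for z unfolding Nz[OF that] using az[OF that] bz[OF that] by (intro Gam_lie)
  \<comment> \<open>The composite is the place permutation by y' x. Inside one block duality makes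
    it the idempotent or zero; across different partitions it is zero by orthogonality.\<close>
  have Aab: "A.act_alg (fst (snd (a z))) (A.act_alg (snd (snd (a z'))) x) = (if a z = a z' then x else \<zero>\<^bsub>A.TP\<^esub>)"
    if z: "z \<in> ?I" "z' \<in> ?I" and x: "x \<in> carrier (SV (fst (a z')))" for z z' x
  proof -
    have x': "x \<in> carrier A.TP" "A.act_alg (A.yidem (fst (a z'))) x = x" using x az[OF z(2)] by (simp_all add: A.schur_fields)
    have "snd (snd (a z')) \<star>\<^sub>A fst (snd (a z)) = (if a z = a z' then A.yidem (fst (a z')) else 0)" 
      if "mulA = gconv p" for mulA (infixl "\<star>\<^sub>A" 70)
    proof (cases "fst (a z) = fst (a z')")
      case True
      then show ?thesis using A.ydual(5)[OF az(1)[OF z(1)], of "snd (a z')" "snd (a z)"] az[OF z(1)] az[OF z(2)] that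
        by (auto simp: prod_eq_iff)
    next
      case False
      then show ?thesis using A.cross_zero[OF az(1)[OF z(2)] az(1)[OF z(1)] _ Al[OF z(1)] A.ydual(4)[OF az[OF z(2)]]] that by auto
    qed
    from this[OF refl] show ?thesis using x' A.act_alg_zero by (simp flip: A.act_alg_mul)
  qed
  have Bab: "B.act_alg (fst (snd (b z))) (B.act_alg (snd (snd (b z'))) x) = (if b z = b z' then x else \<zero>\<^bsub>B.TP\<^esub>)"
    if z: "z \<in> ?I" "z' \<in> ?I" and x: "x \<in> carrier (SW (fst (b z')))" for z z' x
  proof -
    have x': "x \<in> carrier B.TP" "B.act_alg (B.yidem (fst (b z'))) x = x" using x bz[OF z(2)] by (simp_all add: B.schur_fields)
    have "gconv q (snd (snd (b z'))) (fst (snd (b z))) = (if b z = b z' then B.yidem (fst (b z')) else 0)" 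
    proof (cases "fst (b z) = fst (b z')")
      case True
      then show ?thesis using B.ydual(5)[OF bz(1)[OF z(1)], of "snd (b z')" "snd (b z)"] bz[OF z(1)] bz[OF z(2)]
        by (auto simp: prod_eq_iff)
    next
      case False
      then show ?thesis using B.cross_zero[OF bz(1)[OF z(2)] bz(1)[OF z(1)] _ Bl[OF z(1)] B.ydual(4)[OF bz[OF z(2)]]] by auto
    qed
    then show ?thesis using x' B.act_alg_zero by (simp flip: B.act_alg_mul)
  qed
  have fg: "f z (g z' n) = (if z = z' then n else \<zero>\<^bsub>N z\<^esub>)" if z: "z \<in> ?I" "z' \<in> ?I" and n: "n \<in> carrier (N z')" for z z' n
  proof -
    note la = az[OF z(1)] az[OF z(2)] bz[OF z(1)] bz[OF z(2)]
    have gS: "gens (N z') {tens (SV (fst (a z'))) (SW (fst (b z'))) x y | x y. x \<in> carrier (SV (fst (a z'))) \<and> y \<in> carrier (SW (fst (b z')))}"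
      unfolding Nz[OF z(2)] using gens_tensor[OF lie_module_vs[OF A.schur_lie[OF la(3)]] lie_module_vs[OF B.schur_lie[OF la(7)]]]
      by (simp add: gens_def lin_closed_def)
    interpret Nk: kvs "N z" by (rule kvsI, rule lie_module_vs[OF Nl[OF z(1)]])
    have zero: "(\<lambda>n. \<zero>\<^bsub>N z\<^esub>) \<in> lhom (N z') (N z)" by (rule lhomI) simp_all
    have idh: "z = z' \<Longrightarrow> (\<lambda>n. n) \<in> lhom (N z') (N z)" using lhom_id by auto
    have "(\<lambda>n. if z = z' then n else \<zero>\<^bsub>N z\<^esub>) \<in> lhom (N z') (N z)" using zero idh by (cases "z = z'") auto
    then show ?thesis
    proof (rule gens_hom_eqI[OF gS lie_module_vs[OF Nl[OF z(2)]] lie_module_vs[OF Nl[OF z(1)]] lhom_comp[OF lie_homD(1)[OF gh[OF z(2)]] lie_homD(1)[OF fh[OF z(1)]]] _ _ n])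
      fix n assume "n \<in> {tens (SV (fst (a z'))) (SW (fst (b z'))) x y | x y. x \<in> carrier (SV (fst (a z'))) \<and> y \<in> carrier (SW (fst (b z')))}"
      then obtain x y where n: "n = tens (SV (fst (a z'))) (SW (fst (b z'))) x y" and x: "x \<in> carrier (SV (fst (a z')))" and y: "y \<in> carrier (SW (fst (b z')))" by blast
      have xy: "x \<in> carrier A.TP" "y \<in> carrier B.TP" using x y la by (simp_all add: A.schur_fields B.schur_fields)
      have e: "f z (g z' n) = tens (SV (fst (a z))) (SW (fst (b z))) (if a z = a z' then x else \<zero>\<^bsub>A.TP\<^esub>) (if b z = b z' then y else \<zero>\<^bsub>B.TP\<^esub>)"
        unfolding n f_def g_def using la x y xy Aab[OF z x] Bab[OF z y]
        by (simp add: incl(2) proj(2) Al[OF z(1)] Bl[OF z(1)])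
      show "f z (g z' n) = (if z = z' then n else \<zero>\<^bsub>N z\<^esub>)"
      proof (cases "z = z'")
        case True
        have "f z (g z' n) = tens (SV (fst (a z'))) (SW (fst (b z'))) x y" unfolding e using True by simp
        then show ?thesis using True n by simp
      next
        case False
        then have ne: "a z \<noteq> a z' \<or> b z \<noteq> b z'" using inj_onD[OF bij(1), of z z'] z by auto
        note tb = tens_bilin[OF lie_module_vs[OF A.schur_lie[OF la(1)]] lie_module_vs[OF B.schur_lie[OF la(5)]], unfolded bilin_def A.schur_fields[OF la(1)] B.schur_fields[OF la(5)]]
        have z0: "\<zero>\<^bsub>A.TP\<^esub> = 0 \<odot>\<^bsub>A.TP\<^esub> \<zero>\<^bsub>A.TP\<^esub>" "\<zero>\<^bsub>B.TP\<^esub> = 0 \<odot>\<^bsub>B.TP\<^esub> \<zero>\<^bsub>B.TP\<^esub>" by simp_all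
        interpret SA: kvs "SV (fst (a z))" by (rule kvsI, rule lie_module_vs[OF A.schur_lie[OF la(1)]])
        interpret SB: kvs "SW (fst (b z))" by (rule kvsI, rule lie_module_vs[OF B.schur_lie[OF la(5)]])
        define x' where "x' = (if a z = a z' then x else \<zero>\<^bsub>A.TP\<^esub>)"
        define y' where "y' = (if b z = b z' then y else \<zero>\<^bsub>B.TP\<^esub>)"
        have xc: "x' \<in> carrier (SV (fst (a z)))" using x SA.zero_closed A.schur_fields(3)[OF la(1)] by (auto simp: x'_def)
        have yc: "y' \<in> carrier (SW (fst (b z)))" using y SB.zero_closed B.schur_fields(3)[OF la(5)] by (auto simp: y'_def)
        note th = tens_bilin[OF lie_module_vs[OF A.schur_lie[OF la(1)]] lie_module_vs[OF B.schur_lie[OF la(5)]], unfolded bilin_def]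
        \<comment> \<open>One of the two factors is zero, hence 0 times itself, and bilinearity
          moves this scalar out of the tensor.\<close>
        have "tens (SV (fst (a z))) (SW (fst (b z))) x' y' = 0 \<odot>\<^bsub>N z\<^esub> tens (SV (fst (a z))) (SW (fst (b z))) x' y'"
        proof (cases "a z = a z'")
          case True
          then have "y' = 0 \<odot>\<^bsub>SW (fst (b z))\<^esub> y'" using ne yc B.schur_fields(3)[OF la(5)] by (simp add: y'_def)
          then show ?thesis using th xc yc unfolding Nz[OF z(1)] by (metis lie_tensor_fields(4))
        next
          case False
          then have "x' = 0 \<odot>\<^bsub>SV (fst (a z))\<^esub> x'" using xc A.schur_fields(3)[OF la(1)] by (simp add: x'_def)
          then show ?thesis using th xc yc unfolding Nz[OF z(1)] by (metis lie_tensor_fields(4))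
        qed
        also have "\<dots> = \<zero>\<^bsub>N z\<^esub>" using th xc yc by (intro Nk.sc_zero) (simp add: Nz[OF z(1)])
        finally show ?thesis using False unfolding e x'_def y'_def by simp
      qed
    qed
  qed
  \<comment> \<open>Completeness in one factor: the sum of x y over all dual basis members is the
    sum of the central idempotents, which is 1.\<close>
  have sumA: "(\<Oplus>\<^bsub>A.TP\<^esub>j\<in>JA. A.act_alg (snd (snd j)) (A.act_alg (fst (snd j)) x)) = x" if x: "x \<in> carrier A.TP" for x
  proof -
    have "(\<Oplus>\<^bsub>A.TP\<^esub>j\<in>JA. A.act_alg (snd (snd j)) (A.act_alg (fst (snd j)) x)) = A.act_alg (\<Sum>j\<in>JA. gconv p (fst (snd j)) (snd (snd j))) x"
      using x finJ by (simp add: A.act_alg_sum A.act_alg_mul)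
    also have "(\<Sum>j\<in>JA. gconv p (fst (snd j)) (snd (snd j))) = (\<Sum>lam\<in>partitions p. A.yproj lam)"
      unfolding JA_def A.yproj_def using finite_partitions A.ydual(1) by (subst sum.Sigma) (auto intro!: sum.cong)
    finally show ?thesis using x by (simp add: A.yproj_sum A.act_alg_one)
  qed
  have sumB: "(\<Oplus>\<^bsub>B.TP\<^esub>j\<in>JB. B.act_alg (snd (snd j)) (B.act_alg (fst (snd j)) x)) = x" if x: "x \<in> carrier B.TP" for x
  proof -
    have "(\<Oplus>\<^bsub>B.TP\<^esub>j\<in>JB. B.act_alg (snd (snd j)) (B.act_alg (fst (snd j)) x)) = B.act_alg (\<Sum>j\<in>JB. gconv q (fst (snd j)) (snd (snd j))) x"
      using x finJ by (simp add: B.act_alg_sum B.act_alg_mul)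
    also have "(\<Sum>j\<in>JB. gconv q (fst (snd j)) (snd (snd j))) = (\<Sum>mu\<in>partitions q. B.yproj mu)"
      unfolding JB_def B.yproj_def using finite_partitions B.ydual(1) by (subst sum.Sigma) (auto intro!: sum.cong)
    finally show ?thesis using x by (simp add: B.yproj_sum B.act_alg_one)
  qed
  have gf: "(\<Oplus>\<^bsub>AB\<^esub>z\<in>?I. g z (f z m)) = m" if m: "m \<in> carrier AB" for m
  proof (rule gens_hom_eqI[OF gens_AB AB.vectorspace_axioms AB.vectorspace_axioms lhom_finsum[OF AB.vectorspace_axioms finI lhom_comp[OF lie_homD(1)[OF fh] lie_homD(1)[OF gh]]] lhom_id _ m])
    fix m assume "m \<in> {tAB x y | x y. x \<in> carrier A.TP \<and> y \<in> carrier B.TP}"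
    then obtain x y where m: "m = tAB x y" and x: "x \<in> carrier A.TP" and y: "y \<in> carrier B.TP" by blast
    define X where "X j = A.act_alg (snd (snd j)) (A.act_alg (fst (snd j)) x)" for j :: "nat list \<times> (_ \<Rightarrow> 'k) \<times> (_ \<Rightarrow> 'k)"
    define Y where "Y j = B.act_alg (snd (snd j)) (B.act_alg (fst (snd j)) y)" for j :: "nat list \<times> (_ \<Rightarrow> 'k) \<times> (_ \<Rightarrow> 'k)"
    have XY: "X j \<in> carrier A.TP" "Y j \<in> carrier B.TP" for j using x y by (simp_all add: X_def Y_def)
    have "(\<Oplus>\<^bsub>AB\<^esub>z\<in>?I. g z (f z m)) = (\<Oplus>\<^bsub>AB\<^esub>z\<in>?I. tAB (X (a z)) (Y (b z)))"
    proof (rule AB.finsum_eq)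
      fix z assume z: "z \<in> ?I"
      have "A.act_alg (fst (snd (a z))) x \<in> carrier (SV (fst (a z)))" "B.act_alg (fst (snd (b z))) y \<in> carrier (SW (fst (b z)))"
        using lhomD(1)[OF lie_homD(1)[OF A.schur_hom(1)[OF az(1)[OF z] Al[OF z]]], of x] lhomD(1)[OF lie_homD(1)[OF B.schur_hom(1)[OF bz(1)[OF z] Bl[OF z]]], of y] x y
        by simp_all
      then show "g z (f z m) = tAB (X (a z)) (Y (b z))"
        unfolding m f_def g_def X_def Y_def using x y az[OF z] bz[OF z] Al[OF z] Bl[OF z] by (simp add: proj(2) incl(2))
    qed (use XY tAB(1) in auto)
    \<comment> \<open>The decoding is a bijection onto pairs of labels, so the sum over copies
      becomes a double sum and the completeness relations apply to the two factors
      separately.\<close>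
    also have "\<dots> = (\<Oplus>\<^bsub>AB\<^esub>w\<in>JA \<times> JB. tAB (X (fst w)) (Y (snd w)))"
      using AB.finsum_reindex[of "\<lambda>w. tAB (X (fst w)) (Y (snd w))" "\<lambda>z. (a z, b z)" ?I] bij XY tAB(1) by auto
    also have "\<dots> = (\<Oplus>\<^bsub>AB\<^esub>i\<in>JA. \<Oplus>\<^bsub>AB\<^esub>j\<in>JB. tAB (X i) (Y j))"
      using XY tAB(1) finJ by (subst AB.finsum_Times) auto
    also have "\<dots> = (\<Oplus>\<^bsub>AB\<^esub>i\<in>JA. tAB (X i) y)"
    proof (rule AB.finsum_eq)
      fix i
      interpret l: khom B.TP AB "tAB (X i)" by (intro khomI B.T.vectorspace_axioms AB.vectorspace_axioms tAB_hom XY)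
      show "(\<Oplus>\<^bsub>AB\<^esub>j\<in>JB. tAB (X i) (Y j)) = tAB (X i) y"
        using l.finsum[OF finJ(2), of Y] XY sumB[OF y] by (simp add: Y_def)
    qed (use XY y tAB(1) in auto)
    also have "\<dots> = tAB x y"
    proof -
      interpret l: khom A.TP AB "\<lambda>x. tAB x y" by (intro khomI A.T.vectorspace_axioms AB.vectorspace_axioms tAB_hom y)
      show ?thesis using l.finsum[OF finJ(1), of X] XY sumA[OF x] by (simp add: X_def)
    qed
    finally show "(\<Oplus>\<^bsub>AB\<^esub>z\<in>?I. g z (f z m)) = m" unfolding m .
  qed
  show ?thesis
    using lie_isomorphic_direct_sum[OF AB_lie finI Nl fh lie_homD(1)[OF gh] fg gf] by (simp add: N_def fA_def)
qed

end

section \<open>Endomorphisms in coordinates\<close>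

text \<open>
  \<open>K A B I J\<close> stands for the coordinate at \<open>(A, B)\<close> of the image of the basis vector \<open>(I, J)\<close> of the mixed tensor
  power under an endomorphism; \<open>K_eq\<close> expresses that the endomorphism commutes with the matrix unit \<open>E\<^sub>a\<^sub>b\<close>.
\<close>

locale equivariant_kernel =
  fixes p q :: nat and K :: "nat list \<Rightarrow> nat list \<Rightarrow> nat list \<Rightarrow> nat list \<Rightarrow> 'k::field_char_0"
  assumes K_eq: "\<lbrakk>length A = p; length B = q; length I = p; length J = q\<rbrakk> \<Longrightarrow>
      (\<Sum>k<p. if A ! k = a then K (A[k := b]) B I J else 0) - (\<Sum>l<q. if B ! l = b then K A (B[l := a]) I J else 0) =
      (\<Sum>k<p. if I ! k = b then K A B (I[k := a]) J else 0) - (\<Sum>l<q. if J ! l = a then K A B I (J[l := b]) else 0)"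
    and K_fin: "\<lbrakk>length I = p; length J = q\<rbrakk> \<Longrightarrow> \<exists>m. \<forall>A B. length A = p \<longrightarrow> length B = q \<longrightarrow>
      (\<exists>i\<in>set A \<union> set B. m \<le> i) \<longrightarrow> K A B I J = 0"
begin

lemma sum_count: "(\<Sum>k<length xs. if xs ! k = a then c else 0) = of_nat (count (mset xs) a) * (c :: 'k)"
proof (induction xs)
  case (Cons x xs)
  have "(\<Sum>k<length (x # xs). if (x # xs) ! k = a then c else 0) =
      (if x = a then c else 0) + (\<Sum>k<length xs. if xs ! k = a then c else 0)"
    by (simp add: sum.lessThan_Suc_shift del: sum.lessThan_Suc)
  then show ?case using Cons by (simp add: distrib_right)
qed simp

lemma count_list:
  fixes xs :: "nat list"
  shows "i \<notin> set xs \<Longrightarrow> count (mset xs) i = 0" "i \<in> set xs \<Longrightarrow> 1 \<le> count (mset xs) i"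
proof -
  show "count (mset xs) i = 0" if "i \<notin> set xs" using that by (simp add: count_eq_zero_iff)
  show "1 \<le> count (mset xs) i" if "i \<in> set xs"
  proof -
    have "i \<in># mset xs" using that by simp
    then have "0 < count (mset xs) i" by (rule count_greater_zero_iff[THEN iffD2])
    then show ?thesis by simp
  qed
qed

text \<open>Diagonal matrix units multiply a basis vector by a difference of multiplicities of
  indices. For a = b, \<open>K_eq\<close> thus compares two weights, and characteristic zero turns
  their equality in the field into equality of counts.\<close>

lemma weight:
  assumes l: "length A = p" "length B = q" "length I = p" "length J = q" and K: "K A B I J \<noteq> 0"
  shows "mset A + mset J = mset B + mset I"
proof (rule multiset_eqI)
  fix a
  have "(\<Sum>k<length A. if A ! k = a then K A B I J else 0) - (\<Sum>l<length B. if B ! l = a then K A B I J else 0) =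
      (\<Sum>k<length I. if I ! k = a then K A B I J else 0) - (\<Sum>l<length J. if J ! l = a then K A B I J else 0)"
  proof -
    have 1: "(if xs ! k = a then F (xs[k := a]) else 0) = (if xs ! k = a then F xs else (0 :: 'k))" for xs k and F :: "nat list \<Rightarrow> 'k"
      using list_update_id[of xs k] by auto
    show ?thesis using K_eq[OF l, of a a] l
      by (simp add: 1[of _ _ "\<lambda>A. K A B I J"] 1[of _ _ "\<lambda>B. K A B I J"] 1[of _ _ "\<lambda>I. K A B I J"] 1[of _ _ "\<lambda>J. K A B I J"])
  qed
  then have "(of_nat (count (mset A) a) + of_nat (count (mset J) a)) * K A B I J =
      (of_nat (count (mset B) a) + of_nat (count (mset I) a)) * K A B I J"
    unfolding sum_count by (simp add: algebra_simps)
  then have "of_nat (count (mset A) a + count (mset J) a) = (of_nat (count (mset B) a + count (mset I) a) :: 'k)"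
    using K by simp
  then show "count (mset A + mset J) a = count (mset B + mset I) a" by (simp only: of_nat_eq_iff count_union)
qed

definition generic :: "nat list \<Rightarrow> nat list \<Rightarrow> bool" where
  "generic I J \<longleftrightarrow> length I = p \<and> length J = q \<and> distinct I \<and> distinct J \<and> set I \<inter> set J = {}"

text \<open>An index of I is absent from J, so the weight equation forces it into A; as A is no
  longer than I, nothing else fits into A.\<close>

lemma weight_generic:
  assumes g: "generic I J" and l: "length A = p" "length B = q" and w: "mset A + mset J = mset B + mset I"
  shows "mset A = mset I" "mset B = mset J"
proof -
  have "count (mset I) i \<le> count (mset A) i" for i
  proof (cases "i \<in> set I")
    case True
    then have "i \<notin> set J" "distinct I" using g by (auto simp: generic_def)
    then have "count (mset I) i = 1" "count (mset J) i = 0"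
      using True by (simp_all add: distinct_count_atmost_1 count_list)
    moreover have "count (mset A) i + count (mset J) i = count (mset B) i + count (mset I) i"
      using w by (metis count_union)
    ultimately show ?thesis by linarith
  next
    case False
    show ?thesis unfolding count_list(1)[OF False] by (rule le0)
  qed
  then have "mset I \<subseteq># mset A" by (rule mset_subset_eqI)
  moreover have "size (mset I) = size (mset A)" using g l by (simp add: generic_def)
  ultimately show *: "mset A = mset I"
    using mset_subset_size[of "mset I" "mset A"] by (metis less_irrefl subset_mset.less_le)
  show "mset B = mset J" using w unfolding * by (simp add: add.commute)
qed

lemma generic_support:
  assumes "generic I J" "length A = p" "length B = q" "K A B I J \<noteq> 0"
  obtains \<sigma> \<tau> where "\<sigma> permutes {..<p}" "\<tau> permutes {..<q}" "A = permute_list \<sigma> I" "B = permute_list \<tau> J"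
proof -
  have l: "length I = p" "length J = q" using assms(1) by (auto simp: generic_def)
  have m: "mset A = mset I" "mset B = mset J"
    using weight_generic[OF assms(1-3) weight[OF assms(2,3) l assms(4)]] by auto
  obtain \<sigma> where s: "\<sigma> permutes {..<length I}" "permute_list \<sigma> I = A" using mset_eq_permutation[OF m(1)] by blast
  obtain \<tau> where t: "\<tau> permutes {..<length J}" "permute_list \<tau> J = B" using mset_eq_permutation[OF m(2)] by blast
  show ?thesis using that s t l by metis
qed

lemma single_position:
  assumes "k < (n::nat)" "\<And>j. j < n \<Longrightarrow> j \<noteq> k \<Longrightarrow> \<not> Q j" "Q k"
  shows "(\<Sum>j<n. if Q j then h j else 0) = (h k :: 'k)"
proof -
  have "(\<Sum>j<n. if Q j then h j else 0) = (\<Sum>j<n. if j = k then h k else 0)"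
    by (rule sum.cong) (use assms in auto)
  also have "\<dots> = h k" using assms(1) by (subst sum.delta) simp_all
  finally show ?thesis .
qed

lemma no_position: "(\<And>j. j < (n::nat) \<Longrightarrow> \<not> Q j) \<Longrightarrow> (\<Sum>j<n. if Q j then h j else 0) = (0 :: 'k)"
  by (rule sum.neutral) auto

lemma fresh_position: "a \<notin> set xs \<Longrightarrow> j < length xs \<Longrightarrow> xs ! j \<noteq> a"
  by (metis nth_mem)

text \<open>By \<open>weight\<close> a new index a occurs in A as often as in B, as in a term e_a
  tensor f_a of an invariant. Rename one occurrence in A to a remote index c and apply the matrix
  unit \<open>E\<^sub>c\<^sub>a\<close>. The right-hand side is zero, because (I, J) contains
  neither a nor c; on the left every term except K A B I J has c in its row and vanishes by
  finiteness.\<close>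

lemma support:
  assumes l: "length A = p" "length B = q" "length I = p" "length J = q" and K: "K A B I J \<noteq> 0"
  shows "set A \<union> set B \<subseteq> set I \<union> set J"
proof (rule ccontr)
  assume "\<not> ?thesis"
  then obtain a where a: "a \<in> set A \<union> set B" "a \<notin> set I" "a \<notin> set J" by blast
  have "count (mset A) a + count (mset J) a = count (mset B) a + count (mset I) a"
    using weight[OF l K] by (metis count_union)
  then have e: "count (mset A) a = count (mset B) a" using a(2,3) by (simp add: count_list)
  have "a \<in> set A"
  proof (rule ccontr)
    assume n: "a \<notin> set A"
    then have "a \<in> set B" using a(1) by blast
    then show False using e count_list(1)[OF n] count_list(2)[of a B] by simp
  qed
  then obtain k where k: "k < p" "A ! k = a" using l(1) by (metis in_set_conv_nth)
  obtain m where m: "\<And>A B. length A = p \<Longrightarrow> length B = q \<Longrightarrow> \<exists>i\<in>set A \<union> set B. m \<le> i \<Longrightarrow> K A B I J = 0"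
    using K_fin[OF l(3,4)] by blast
  \<comment> \<open>Beyond all indices in sight, and at least the bound m from which on rows
    vanish.\<close>
  define c where "c = m + Suc (Max (insert 0 (set A \<union> set B \<union> set I \<union> set J)))"
  have "x < c" if "x \<in> set A \<union> set B \<union> set I \<union> set J" for x
  proof -
    have "x \<le> Max (insert 0 (set A \<union> set B \<union> set I \<union> set J))" by (rule Max_ge) (use that in simp_all)
    then show ?thesis by (simp add: c_def)
  qed
  then have c: "c \<notin> set A" "c \<notin> set B" "c \<notin> set I" "c \<notin> set J" by blast+
  have mc: "m \<le> c" by (simp add: c_def)
  have lk: "length (A[k := c]) = p" using l by simp
  have "(\<Sum>j<p. if A[k := c] ! j = c then K (A[k := c, j := a]) B I J else 0) = K (A[k := c, k := a]) B I J"
    by (rule single_position[OF k(1)]) (simp_all add: fresh_position[OF c(1)] k l)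
  also have "A[k := c, k := a] = A" using k by (metis list_update_id list_update_overwrite)
  finally have 1: "(\<Sum>j<p. if A[k := c] ! j = c then K (A[k := c, j := a]) B I J else 0) = K A B I J" .
  have 2: "(\<Sum>j<q. if B ! j = a then K (A[k := c]) (B[j := c]) I J else 0) = 0"
  proof (rule sum.neutral, intro ballI)
    fix j assume "j \<in> {..<q}"
    have "c \<in> set (A[k := c])" using k l by (simp add: set_update_memI)
    then have "K (A[k := c]) (B[j := c]) I J = 0" using mc l by (intro m) auto
    then show "(if B ! j = a then K (A[k := c]) (B[j := c]) I J else 0) = 0" by simp
  qed
  have 3: "(\<Sum>j<p. if I ! j = a then K (A[k := c]) B (I[j := c]) J else 0) = 0"
    by (rule no_position) (use a l in auto)
  have 4: "(\<Sum>j<q. if J ! j = c then K (A[k := c]) B I (J[j := a]) else 0) = 0"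
    by (rule no_position) (use c l in auto)
  show False using K_eq[OF lk l(2,3,4), of c a] K unfolding 1 2 3 4 by simp
qed

section \<open>From one generic column to all columns\<close>

definition vanish where "vanish I J \<longleftrightarrow> (\<forall>A B. length A = p \<longrightarrow> length B = q \<longrightarrow> K A B I J = 0)"

text \<open>Apply the matrix unit that changes the k-th index to a. The left-hand side of
  \<open>K_eq\<close> only involves the vanishing column, and on the right a single term survives,
  because indices do not repeat and a is new.\<close>

lemma vanish_move:
  assumes g: "generic I J" and v: "vanish I J" and a: "a \<notin> set I" "a \<notin> set J"
  shows "k < p \<Longrightarrow> vanish (I[k := a]) J" "k < q \<Longrightarrow> vanish I (J[k := a])"
proof -
  have l: "length I = p" "length J = q" and d: "distinct I" "distinct J" using g by (auto simp: generic_def)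
  show "vanish (I[k := a]) J" if k: "k < p"
    unfolding vanish_def
  proof (intro allI impI)
    fix A B :: "nat list" assume AB: "length A = p" "length B = q"
    have v': "K A' B' I J = 0" if "length A' = p" "length B' = q" for A' B' using v that by (simp add: vanish_def)
    have 1: "(\<Sum>j<p. if A ! j = a then K (A[j := I ! k]) B I J else 0) = 0" "(\<Sum>j<q. if B ! j = I ! k then K A (B[j := a]) I J else 0) = 0"
      using AB by (auto intro!: sum.neutral simp: v')
    have 2: "(\<Sum>j<p. if I ! j = I ! k then K A B (I[j := a]) J else 0) = K A B (I[k := a]) J"
      by (rule single_position[OF k]) (use d k l in \<open>auto simp: nth_eq_iff_index_eq\<close>)
    have 3: "(\<Sum>j<q. if J ! j = a then K A B I (J[j := I ! k]) else 0) = 0"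
      by (rule no_position) (use a l in auto)
    show "K A B (I[k := a]) J = 0" using K_eq[OF AB l, of a "I ! k"] unfolding 1 2 3 by simp
  qed
  show "vanish I (J[k := a])" if k: "k < q"
    unfolding vanish_def
  proof (intro allI impI)
    fix A B :: "nat list" assume AB: "length A = p" "length B = q"
    have v': "K A' B' I J = 0" if "length A' = p" "length B' = q" for A' B' using v that by (simp add: vanish_def)
    have 1: "(\<Sum>j<p. if A ! j = J ! k then K (A[j := a]) B I J else 0) = 0" "(\<Sum>j<q. if B ! j = a then K A (B[j := J ! k]) I J else 0) = 0"
      using AB by (auto intro!: sum.neutral simp: v')
    have 2: "(\<Sum>j<q. if J ! j = J ! k then K A B I (J[j := a]) else 0) = K A B I (J[k := a])"
      by (rule single_position[OF k]) (use d k l in \<open>auto simp: nth_eq_iff_index_eq\<close>)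
    have 3: "(\<Sum>j<p. if I ! j = a then K A B (I[j := J ! k]) J else 0) = 0"
      by (rule no_position) (use a l in auto)
    show "K A B I (J[k := a]) = 0" using K_eq[OF AB l, of "J ! k" a] unfolding 1 2 3 by simp
  qed
qed

lemma mix_update: "length N = length I \<Longrightarrow> n < length I \<Longrightarrow> (take n N @ drop n I)[n := N ! n] = take (Suc n) N @ drop (Suc n) I"
  by (simp add: list_update_append take_Suc_conv_app_nth Cons_nth_drop_Suc[symmetric])

text \<open>The indices are replaced one at a time, first in I and then in J. Disjointness from the
  old indices keeps every intermediate pair generic.\<close>

lemma vanish_fresh:
  assumes g: "generic I J" "generic N N'" and v: "vanish I J"
    and dj: "(set N \<union> set N') \<inter> (set I \<union> set J) = {}"
  shows "vanish N N'"
proof -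
  have l: "length I = p" "length J = q" "length N = p" "length N' = q" and d: "distinct I" "distinct J" "distinct N" "distinct N'"
    and s: "set I \<inter> set J = {}" "set N \<inter> set N' = {}" using g by (auto simp: generic_def)
  have nin: "N ! n \<notin> set (take n N)" if "n < p" for n
    using d(3) that l(3) by (metis distinct_take id_take_nth_drop not_distinct_conv_prefix)
  have nin': "N' ! n \<notin> set (take n N')" if "n < q" for n
    using d(4) that l(4) by (metis distinct_take id_take_nth_drop not_distinct_conv_prefix)
  have 1: "vanish (take n N @ drop n I) J" if "n \<le> p" for n using that
  proof (induction n)
    case (Suc n)
    let ?I = "take n N @ drop n I"
    have n: "n < p" using Suc.prems by simp
    have sub: "set (take n N) \<subseteq> set N" "set (drop n I) \<subseteq> set I" by (auto dest: in_set_takeD in_set_dropD)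
    have "generic ?I J" using l d s dj sub n unfolding generic_def by (auto simp: distinct_drop distinct_take)
    moreover have "N ! n \<notin> set ?I" "N ! n \<notin> set J"
    proof -
      have "N ! n \<in> set N" using n l(3) by simp
      then have "N ! n \<notin> set I" "N ! n \<notin> set J" using dj by blast+
      then show "N ! n \<notin> set ?I" "N ! n \<notin> set J" using nin[OF n] sub by auto
    qed
    ultimately have "vanish (?I[n := N ! n]) J" using vanish_move(1) Suc.IH n by simp
    then show ?case using mix_update[of N I n] l n by simp
  qed (use v in simp)
  have 2: "vanish N (take n N' @ drop n J)" if "n \<le> q" for n using that
  proof (induction n)
    case 0
    then show ?case using 1[of p] l by simp
  next
    case (Suc n)
    let ?J = "take n N' @ drop n J"
    have n: "n < q" using Suc.prems by simp
    have sub: "set (take n N') \<subseteq> set N'" "set (drop n J) \<subseteq> set J" by (auto dest: in_set_takeD in_set_dropD)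
    have "generic N ?J" using l d s dj sub n unfolding generic_def by (auto simp: distinct_drop distinct_take)
    moreover have "N' ! n \<notin> set ?J" "N' ! n \<notin> set N"
    proof -
      have "N' ! n \<in> set N'" using n l(4) by simp
      then have "N' ! n \<notin> set J" "N' ! n \<notin> set N" using dj s(2) by blast+
      then show "N' ! n \<notin> set ?J" "N' ! n \<notin> set N" using nin'[OF n] sub by auto
    qed
    ultimately have "vanish N (?J[n := N' ! n])" using vanish_move(2) Suc.IH n by simp
    then show ?case using mix_update[of N' J n] l n by simp
  qed
  show ?thesis using 2[of q] l by simp
qed

text \<open>The two pairs may share indices, so the passage goes through a third pair lying beyond
  both.\<close>

lemma vanish_generic:
  assumes g: "generic I J" "generic I' J'" and v: "vanish I J"
  shows "vanish I' J'"
proof -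
  define m where "m = Suc (Max (insert 0 (set I \<union> set J \<union> set I' \<union> set J')))"
  have "x < m" if "x \<in> set I \<union> set J \<union> set I' \<union> set J'" for x
    using Max_ge[of "insert 0 (set I \<union> set J \<union> set I' \<union> set J')" x] that by (auto simp: m_def less_Suc_eq_le)
  then have m: "\<And>x. x \<in> set I \<Longrightarrow> x < m" "\<And>x. x \<in> set J \<Longrightarrow> x < m" "\<And>x. x \<in> set I' \<Longrightarrow> x < m" "\<And>x. x \<in> set J' \<Longrightarrow> x < m" by blast+
  let ?N = "[m..<m + p]" and ?N' = "[m + p..<m + p + q]"
  have gN: "generic ?N ?N'" by (auto simp: generic_def)
  have "vanish ?N ?N'" by (rule vanish_fresh[OF g(1) gN v]) (use m(1,2) in force)
  then show ?thesis by (rule vanish_fresh[OF gN g(2)]) (use m(3,4) in force)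
qed

text \<open>The number of positions, in both tuples of a row jointly, whose index is repeated: the
  measure of the induction in \<open>all_vanish\<close>.\<close>

definition badness :: "nat multiset \<Rightarrow> nat" where "badness M = size {#x \<in># M. 2 \<le> count M x#}"

text \<open>The fresh index occurs once and is not counted, while b loses at least one counted
  position.\<close>

lemma badness_update:
  assumes b: "2 \<le> count M b" and a: "a \<notin># M"
  shows "badness (M - {#b#} + {#a#}) < badness M"
proof -
  let ?M = "M - {#b#} + {#a#}"
  have ab: "a \<noteq> b" "count M a = 0" using a b by (auto simp: not_in_iff)
  have "{#x \<in># ?M. 2 \<le> count ?M x#} \<subset># {#x \<in># M. 2 \<le> count M x#}"
    unfolding subset_mset.less_le
  proof
    show "{#x \<in># ?M. 2 \<le> count ?M x#} \<subseteq># {#x \<in># M. 2 \<le> count M x#}"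
      by (rule mset_subset_eqI) (use ab in auto)
    have "count {#x \<in># ?M. 2 \<le> count ?M x#} b \<noteq> count {#x \<in># M. 2 \<le> count M x#} b" using ab b by auto
    then show "{#x \<in># ?M. 2 \<le> count ?M x#} \<noteq> {#x \<in># M. 2 \<le> count M x#}" by metis
  qed
  then show ?thesis unfolding badness_def by (rule mset_subset_size)
qed

text \<open>
  If \<open>(A, B)\<close> has no repeated index, then neither has \<open>(I, J)\<close>, by \<open>weight\<close>. Otherwise replace a repeated index
  by a fresh one \<open>c\<close> and apply \<open>K_eq\<close> to the matrix unit moving \<open>c\<close> back. The right-hand side vanishes by induction,
  and on the left all terms but one have \<open>c\<close> in their row, hence lie outside the support of the column \<open>(I, J)\<close>.
\<close>

lemma all_vanish:
  assumes g: "generic I0 J0" and v: "vanish I0 J0"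
    and "length A = p" "length B = q" "length I = p" "length J = q"
  shows "K A B I J = 0"
  using assms(3-)
proof (induction "badness (mset A + mset B)" arbitrary: A B I J rule: less_induct)
  case less
  note l = less.prems
  define c where "c = Suc (Max (insert 0 (set A \<union> set B \<union> set I \<union> set J)))"
  have "x < c" if "x \<in> set A \<union> set B \<union> set I \<union> set J" for x
  proof -
    have "x \<le> Max (insert 0 (set A \<union> set B \<union> set I \<union> set J))" by (rule Max_ge) (use that in simp_all)
    then show ?thesis by (simp add: c_def)
  qed
  then have c: "c \<notin> set A" "c \<notin> set B" "c \<notin> set I" "c \<notin> set J" by blast+
  have supp: "K A' B' I J = 0" if "length A' = p" "length B' = q" "c \<in> set A'" for A' B'
    using support[OF that(1,2) l(3,4)] that(3) c by blast
  consider (bad) b where "2 \<le> count (mset A + mset B) b" | (good) "\<And>b. count (mset A + mset B) b < 2" by (meson not_less)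
  then show ?case
  proof cases
    case good
    have dA: "distinct A" "distinct B" "set A \<inter> set B = {}"
    proof -
      have "count (mset A) x \<le> 1" "count (mset B) x \<le> 1" for x using good[of x] by auto
      moreover have "distinct xs" if "\<And>x. count (mset xs) x \<le> 1" for xs :: "nat list"
        unfolding distinct_count_atmost_1
      proof
        fix x show "count (mset xs) x = (if x \<in> set xs then 1 else 0)"
          using that[of x] count_list[of x xs] by (metis le_antisym)
      qed
      ultimately show "distinct A" "distinct B" by blast+
      show "set A \<inter> set B = {}"
      proof (rule ccontr)
        assume "set A \<inter> set B \<noteq> {}"
        then obtain x where "x \<in># mset A" "x \<in># mset B" by auto
        then have "count (mset A) x \<ge> 1" "count (mset B) x \<ge> 1" by (simp_all only: count_list set_mset_mset)
        then show False using good[of x] unfolding count_union by linarith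
      qed
    qed
    then have gA: "generic A B" using l by (simp add: generic_def)
    show ?thesis
    proof (rule ccontr)
      assume K: "K A B I J \<noteq> 0"
      \<comment> \<open>The weight equation is read in the opposite direction, with (A, B) as the
        generic pair and (I, J) as the unknown one.\<close>
      have "mset I + mset B = mset J + mset A" using weight[OF l K] by (simp add: add.commute)
      from weight_generic[OF gA l(3,4) this] have "mset I = mset A" "mset J = mset B" by auto
      then have "generic I J" using gA l unfolding generic_def
        by (metis mset_eq_imp_distinct_iff mset_eq_setD)
      then have "vanish I J" by (rule vanish_generic[OF g _ v])
      then show False using K l by (simp add: vanish_def)
    qed
  next
    case bad
    note less_bad = badness_update[OF bad, of c]
    have cM: "c \<notin># mset A + mset B" using c by simp
    show ?thesis
    proof (cases "b \<in> set A")
      case True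
      then obtain k where k: "k < p" "A ! k = b" using l(1) by (metis in_set_conv_nth)
      let ?A = "A[k := c]"
      have lA: "length ?A = p" using l by simp
      have "mset ?A + mset B = mset A + mset B - {#b#} + {#c#}"
        using k l True by (simp add: mset_update)
      \<comment> \<open>The induction hypothesis is needed for all columns, since the right-hand
        side of \<open>K_eq\<close> alters I and J.\<close>
      then have IH: "K ?A B I' J' = 0" if "length I' = p" "length J' = q" for I' J'
        using less.hyps[OF _ lA l(2) that] less_bad[OF cM] by simp
      have "(\<Sum>j<p. if ?A ! j = c then K (?A[j := b]) B I J else 0) = K (?A[k := b]) B I J"
        by (rule single_position[OF k(1)]) (simp_all add: fresh_position[OF c(1)] k l)
      also have "?A[k := b] = A" using k by (metis list_update_id list_update_overwrite)
      finally have 1: "(\<Sum>j<p. if ?A ! j = c then K (?A[j := b]) B I J else 0) = K A B I J" .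
      have 2: "(\<Sum>j<q. if B ! j = b then K ?A (B[j := c]) I J else 0) = 0"
        using k l by (intro sum.neutral) (auto intro!: supp simp: set_update_memI)
      have 3: "(\<Sum>j<p. if I ! j = b then K ?A B (I[j := c]) J else 0) = 0"
        using l by (intro sum.neutral) (auto simp: IH)
      have 4: "(\<Sum>j<q. if J ! j = c then K ?A B I (J[j := b]) else 0) = 0"
        by (rule no_position) (use c l in auto)
      show ?thesis using K_eq[OF lA l(2,3,4), of c b] unfolding 1 2 3 4 by simp
    next
      case False
      \<comment> \<open>Without an occurrence in A, the repetition of b takes place inside B, and
        the argument is mirrored.\<close>
      then have "count (mset B) b \<ge> 2" using bad by (simp add: count_list)
      then have bB: "b \<in> set B" using count_list(1)[of b B] by (cases "b \<in> set B") simp_all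
      then obtain k where k: "k < q" "B ! k = b" using l(2) by (metis in_set_conv_nth)
      let ?B = "B[k := c]"
      have lB: "length ?B = q" using l by simp
      have "mset A + mset ?B = mset A + mset B - {#b#} + {#c#}"
        using k l bB by (simp add: mset_update)
      then have IH: "K A ?B I' J' = 0" if "length I' = p" "length J' = q" for I' J'
        using less.hyps[OF _ l(1) lB that] less_bad[OF cM] by simp
      have "(\<Sum>j<q. if ?B ! j = c then K A (?B[j := b]) I J else 0) = K A (?B[k := b]) I J"
        by (rule single_position[OF k(1)]) (simp_all add: fresh_position[OF c(2)] k l)
      also have "?B[k := b] = B" using k by (metis list_update_id list_update_overwrite)
      finally have 1: "(\<Sum>j<q. if ?B ! j = c then K A (?B[j := b]) I J else 0) = K A B I J" .
      have 2: "(\<Sum>j<p. if A ! j = b then K (A[j := c]) ?B I J else 0) = 0"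
        using l by (intro sum.neutral) (auto intro!: supp simp: set_update_memI)
      have 3: "(\<Sum>j<q. if J ! j = b then K A ?B I (J[j := c]) else 0) = 0"
        using l by (intro sum.neutral) (auto simp: IH)
      have 4: "(\<Sum>j<p. if I ! j = c then K A ?B (I[j := b]) J else 0) = 0"
        by (rule no_position) (use c l in auto)
      show ?thesis using K_eq[OF l(1) lB l(3,4), of b c] unfolding 1 2 3 4 by simp
    qed
  qed
qed

end

section \<open>Dual bases\<close>

lemma (in kvs) basis_gens: "basis B \<Longrightarrow> gens M B"
proof -
  assume B: "basis B"
  then have Bc: "B \<subseteq> carrier M" and sp: "span B = carrier M" unfolding basis_def by auto
  show ?thesis
    unfolding gens_def
  proof (intro conjI Bc allI impI subsetI)
    fix C x assume C: "lin_closed M C" "B \<subseteq> C" and "x \<in> carrier M"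
    then have "x \<in> span B" using sp by simp
    then obtain a A where A: "finite A" "A \<subseteq> B" "x = lincomb a A" unfolding span_def by blast
    have sub: "v \<in> carrier M \<and> v \<in> C" if "v \<in> A" for v using that A(2) Bc C(2) by blast
    show "x \<in> C" unfolding A(3) lincomb_def
      by (rule lin_closed_finsum[OF vectorspace_axioms C(1) A(1)]) (use sub in \<open>auto intro: lin_closedD(3)[OF C(1)]\<close>)
  qed
qed

lemma countably_infinite_dim_gens:
  fixes V :: "('k::field, 'v, 'z) module_scheme"
  assumes "countably_infinite_dim V"
  obtains b :: "nat \<Rightarrow> 'v" where "\<And>n. b n \<in> carrier V" "gens V (range b)" "\<not> vectorspace.fin_dim class_ring V"
proof -
  interpret kvs V using assms by (intro kvsI) (simp add: countably_infinite_dim_def)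
  obtain B where B: "basis B" "countable B" "infinite B" using assms by (auto simp: countably_infinite_dim_def)
  have r: "range (from_nat_into B) = B" by (rule range_from_nat_into) (use B in auto)
  have "\<not> fin_dim"
  proof
    assume fd: "fin_dim"
    have "lin_indpt B" "B \<subseteq> carrier V" using B(1) by (auto simp: basis_def)
    then show False using fin_dim_li_fin[OF fd] B(3) by blast
  qed
  moreover have "from_nat_into B n \<in> carrier V" for n using B(1) r unfolding basis_def by blast
  ultimately show ?thesis using that[of "from_nat_into B"] basis_gens[OF B(1)] r by simp
qed

definition dual_bases :: "('k::field, 'v, 'y) module_scheme \<Rightarrow> ('k, 'w, 'z) module_scheme \<Rightarrow> ('v \<Rightarrow> 'w \<Rightarrow> 'k) \<Rightarrow>
    (nat \<Rightarrow> 'v) \<Rightarrow> (nat \<Rightarrow> 'w) \<Rightarrow> bool" where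
  "dual_bases V W pair e f \<longleftrightarrow> gens V (range e) \<and> gens W (range f) \<and> (\<forall>i j. pair (e i) (f j) = (if i = j then 1 else 0))"

text \<open>
  Mackey's back-and-forth argument: alternately enlarge a finite dual system so that its span contains
  the next vector of a spanning sequence of \<open>V\<close> and the next one of a spanning sequence of \<open>W\<close>.
\<close>

lemma (in paired) dual_bases_exist:
  assumes cV: "countably_infinite_dim V" and cW: "countably_infinite_dim W"
  obtains e f where "dual_bases V W pair e f"
proof -
  interpret S: paired W V "\<lambda>w v. pair v w" by unfold_locales (rule nondegenerate_pairing_swap[OF nd])
  obtain b :: "nat \<Rightarrow> 'v" where b: "\<And>n. b n \<in> carrier V" "gens V (range b)" "\<not> V.fin_dim" by (rule countably_infinite_dim_gens[OF cV]) blast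
  obtain c :: "nat \<Rightarrow> 'w" where c: "\<And>n. c n \<in> carrier W" "gens W (range c)" by (rule countably_infinite_dim_gens[OF cW]) blast
  let ?P = "\<lambda>D. finite D \<and> dual_system V W pair D"
  let ?Q = "\<lambda>n D D'. D \<subseteq> D' \<and> dual_proj V pair D' (b n) = b n \<and>
      dual_proj W (\<lambda>w v. pair v w) (prod.swap ` D') (c n) = c n"
  have "\<exists>D. \<forall>n. ?P (D n) \<and> ?Q n (D n) (D (Suc n))"
  proof (rule dependent_nat_choice)
    show "\<exists>D. ?P D" using dual_system_empty by blast
    fix D n assume "?P D"
    then obtain D1 where D1: "D \<subseteq> D1" "finite D1" "dual_system V W pair D1" "dual_proj V pair D1 (b n) = b n"
      using dual_system_extend[of D "b n"] b(1) by blast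
    \<comment> \<open>The extension with the roles of V and W exchanged. It contains the previous
      system, so \<open>b n\<close> stays fixed by the larger projection.\<close>
    obtain D2 where D2: "prod.swap ` D1 \<subseteq> D2" "finite D2" "dual_system W V (\<lambda>w v. pair v w) D2"
        "dual_proj W (\<lambda>w v. pair v w) D2 (c n) = c n"
      using S.dual_system_extend[OF dual_system_swap[OF D1(3)] _ c(1)] D1(2) by blast
    let ?D = "prod.swap ` D2"
    have sw: "prod.swap ` ?D = D2" by (simp add: image_comp)
    have D1s: "D1 \<subseteq> ?D" using D2(1) by force
    have ds: "dual_system V W pair ?D" using dual_system_swap[OF D2(3)] by simp
    have "dual_proj V pair ?D (b n) = b n" by (rule dual_proj_mono[OF ds _ D1s D1(4)]) (simp add: D2(2))
    then have "?P ?D \<and> ?Q n D ?D" using D1(1) D1s D2(2,4) ds sw by auto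
    then show "\<exists>D'. ?P D' \<and> ?Q n D D'" by blast
  qed
  then obtain D where D: "\<And>n. ?P (D n)" "\<And>n. ?Q n (D n) (D (Suc n))" by blast
  have mono: "D m \<subseteq> D n" if "m \<le> n" for m n by (rule lift_Suc_mono_le[OF _ that]) (use D(2) in blast)
  define U where "U = (\<Union>n. D n)"
  have U: "pair (fst z) (snd z') = (if z = z' then 1 else 0)" if "z \<in> U" "z' \<in> U" for z z'
  proof -
    from that obtain m n where "z \<in> D m" "z' \<in> D n" unfolding U_def by blast
    then have "z \<in> D (max m n)" "z' \<in> D (max m n)" using mono[of m "max m n"] mono[of n "max m n"] by auto
    then show ?thesis using dual_systemD(3) D(1) by blast
  qed
  have Uc: "fst z \<in> carrier V" "snd z \<in> carrier W" if "z \<in> U" for z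
    using that dual_systemD(1,2) D(1) unfolding U_def by blast+
  have gV: "gens V (fst ` U)"
    unfolding gens_def
  proof (intro conjI allI impI subsetI)
    fix C x assume C: "lin_closed V C" "fst ` U \<subseteq> C" and x: "x \<in> carrier V"
    have "b n \<in> C" for n
    proof -
      have "dual_proj V pair (D (Suc n)) (b n) \<in> C"
      proof (rule lin_closed_dual_proj_ex[OF C(1)])
        fix z assume "z \<in> D (Suc n)"
        then show "fst z \<in> C" using C(2) by (auto simp: U_def)
      qed (simp_all add: D(1))
      then show ?thesis using D(2)[of n] by simp
    qed
    then show "x \<in> C" using gens_induct[OF b(2) C(1) _ x] by blast
  qed (use Uc in blast)
  have gW: "gens W (snd ` U)"
    unfolding gens_def
  proof (intro conjI allI impI subsetI)
    fix C x assume C: "lin_closed W C" "snd ` U \<subseteq> C" and x: "x \<in> carrier W"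
    have "c n \<in> C" for n
    proof -
      have "dual_proj W (\<lambda>w v. pair v w) (prod.swap ` D (Suc n)) (c n) \<in> C"
      proof (rule S.lin_closed_dual_proj_ex[OF C(1) _ dual_system_swap])
        fix z assume "z \<in> prod.swap ` D (Suc n)"
        then obtain y where "y \<in> D (Suc n)" "z = prod.swap y" by blast
        then have "y \<in> U" "fst z = snd y" unfolding U_def by auto
        then show "fst z \<in> C" using C(2) by auto
      qed (simp_all add: D(1))
      then show ?thesis using D(2)[of n] by simp
    qed
    then show "x \<in> C" using gens_induct[OF c(2) C(1) _ x] by blast
  qed (use Uc in blast)
  \<comment> \<open>A finite U would have the identity as its projection and make V
    finite-dimensional. Infinity is what allows U to be enumerated by the natural numbers without
    repetition.\<close>
  have infU: "infinite U"
  proof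
    assume fin: "finite U"
    have ds: "dual_system V W pair U" using U Uc unfolding dual_system_def by (auto simp: mem_Times_iff)
    let ?C = "{v. v \<in> carrier V \<and> dual_proj V pair U v = v}"
    have "b n \<in> ?C" for n
      using dual_proj_mono[OF ds fin, of "D (Suc n)" "b n"] D(2)[of n] b(1) by (auto simp: U_def)
    then have "v \<in> ?C" if "v \<in> carrier V" for v
      using gens_induct[OF b(2) lin_closed_dual_proj[OF fin ds] _ that] by blast
    then have "dual_proj V pair U v = v" if "v \<in> carrier V" for v using that by blast
    from dual_system_basis(3)[OF ds fin this] b(3) show False by blast
  qed
  have "countable U" unfolding U_def using D(1) by (intro countable_UN) (auto intro: countable_finite)
  from bij_betw_from_nat_into[OF this infU] have h: "bij_betw (from_nat_into U) UNIV U" .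
  let ?h = "from_nat_into U"
  have hU: "?h i \<in> U" for i using h by (auto simp: bij_betw_def)
  have rU: "range ?h = U" using h by (simp add: bij_betw_def)
  have img: "range (\<lambda>i. fst (?h i)) = fst ` U" "range (\<lambda>i. snd (?h i)) = snd ` U"
    using arg_cong[OF rU, of "image fst"] arg_cong[OF rU, of "image snd"] by (simp_all only: image_image)
  have inj: "?h i = ?h j \<longleftrightarrow> i = j" for i j using bij_betw_imp_inj_on[OF h] by (rule inj_eq)
  have "dual_bases V W pair (\<lambda>i. fst (?h i)) (\<lambda>i. snd (?h i))"
    unfolding dual_bases_def img using gV gW U[OF hU hU] by (simp add: inj)
  then show ?thesis by (rule that)
qed

section \<open>Coordinates on the mixed tensor power\<close>

text \<open>The ground field as a vector space record, so that coordinates are elements of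
  \<open>lhom\<close> and identities between functionals can be checked on generators.\<close>

definition scalars :: "('k::field, 'k) module" where
  "scalars = \<lparr>carrier = UNIV, monoid.mult = undefined, one = undefined, zero = 0, add = (+), smult = (*)\<rparr>"

lemma scalars_simps [simp]:
  "carrier scalars = UNIV" "x \<oplus>\<^bsub>scalars\<^esub> y = x + y" "c \<odot>\<^bsub>scalars\<^esub> x = c * x" "\<zero>\<^bsub>scalars\<^esub> = 0"
  by (simp_all add: scalars_def)

lemma scalars_vs: "vectorspace class_ring scalars"
  by (rule vectorspaceI) (auto simp: algebra_simps intro: exI[of _ "- _"])

lemma finsum_scalars:
  fixes g :: "'i \<Rightarrow> 'k::field"
  assumes "finite I"
  shows "(\<Oplus>\<^bsub>scalars\<^esub>i\<in>I. g i) = (\<Sum>i\<in>I. g i)"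
proof -
  interpret kvs "scalars :: ('k, 'k) module" by (rule kvsI, rule scalars_vs)
  show ?thesis using assms by (induction I rule: finite_induct) simp_all
qed

lemma functional_finsum:
  assumes "vectorspace class_ring M" "f \<in> lhom M scalars" "finite I" "\<And>i. i \<in> I \<Longrightarrow> g i \<in> carrier M"
  shows "f (\<Oplus>\<^bsub>M\<^esub>i\<in>I. g i) = (\<Sum>i\<in>I. f (g i))"
  using khom.finsum[OF khomI[OF assms(1) scalars_vs assms(2)] assms(3), of g] assms(4) unfolding finsum_scalars[OF assms(3)] by simp

lemma functional_sum:
  fixes M :: "('k::field, 'm, 'z) module_scheme"
  assumes "finite I" "\<And>i. i \<in> I \<Longrightarrow> f i \<in> lhom M (scalars :: ('k, 'k) module)"
  shows "(\<lambda>x. \<Sum>i\<in>I. f i x) \<in> lhom M scalars"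
  using lhom_finsum[OF scalars_vs assms] by (simp add: finsum_scalars[OF assms(1)])

lemma lin_closed_vimage:
  assumes "vectorspace class_ring M" "vectorspace class_ring N" and f: "f \<in> lhom M N" and C: "lin_closed N C"
  shows "lin_closed M {x. f x \<in> C}"
proof -
  interpret f: khom M N f by (rule khomI) (use assms in auto)
  show ?thesis using lin_closedD[OF C] unfolding lin_closed_def by (simp add: f.zero f.add f.sc f.cl)
qed

lemma gens_tensor_subset:
  assumes A: "vectorspace class_ring A" and B: "vectorspace class_ring B" and G: "gens A G" and H: "gens B H"
  shows "gens (tensor_prod A B) {tens A B a b | a b. a \<in> G \<and> b \<in> H}"
  unfolding gens_def
proof (intro conjI allI impI subsetI)
  note tb = tens_bilin[OF A B, unfolded bilin_def] and T = tensor_prod_vs[OF A B]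
  have sub: "G \<subseteq> carrier A" "H \<subseteq> carrier B" using G H by (auto simp: gens_def)
  show "x \<in> carrier (tensor_prod A B)" if "x \<in> {tens A B a b | a b. a \<in> G \<and> b \<in> H}" for x
  proof -
    from that obtain a b where "x = tens A B a b" "a \<in> carrier A" "b \<in> carrier B" using sub by blast
    then show ?thesis using tb by simp
  qed
  fix C x assume C: "lin_closed (tensor_prod A B) C" and GC: "{tens A B a b | a b. a \<in> G \<and> b \<in> H} \<subseteq> C"
    and x: "x \<in> carrier (tensor_prod A B)"
  have 1: "tens A B a b \<in> C" if a: "a \<in> G" and b: "b \<in> carrier B" for a b
  proof -
    have "tens A B a \<in> lhom B (tensor_prod A B)" using tb a sub(1) by (intro lhomI) auto
    from lin_closed_vimage[OF B T this C] have "b \<in> {b. tens A B a b \<in> C}"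
      by (rule gens_induct[OF H _ _ b]) (use GC a in blast)
    then show ?thesis by simp
  qed
  have 2: "tens A B a b \<in> C" if a: "a \<in> carrier A" and b: "b \<in> carrier B" for a b
  proof -
    have "(\<lambda>a. tens A B a b) \<in> lhom A (tensor_prod A B)" using tb b by (intro lhomI) auto
    from lin_closed_vimage[OF A T this C] have "a \<in> {a. tens A B a b \<in> C}"
      by (rule gens_induct[OF G _ _ a]) (use 1 b in blast)
    then show ?thesis by simp
  qed
  show "x \<in> C" by (rule tensor_induct[OF A B C 2 x])
qed

context tpow begin

text \<open>Induction on the number n of leading slots that may hold arbitrary vectors: linearity in
  the last of them replaces its vector by generators.\<close>

lemma gens_tpow_subset:
  assumes G: "gens V G"
  shows "gens TP (pure ` {vs. length vs = d \<and> set vs \<subseteq> G})"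
  unfolding gens_def
proof (intro conjI allI impI subsetI)
  have sub: "G \<subseteq> carrier V" using G by (auto simp: gens_def)
  show "x \<in> carrier TP" if "x \<in> pure ` {vs. length vs = d \<and> set vs \<subseteq> G}" for x
    using that sub by (auto simp: tuples_def intro!: pure_cl)
  fix C x assume C: "lin_closed TP C" and GC: "pure ` {vs. length vs = d \<and> set vs \<subseteq> G} \<subseteq> C" and x: "x \<in> carrier TP"
  have "pure vs \<in> C" if "n \<le> d" "vs \<in> tuples d V" "\<And>i. n \<le> i \<Longrightarrow> i < d \<Longrightarrow> vs ! i \<in> G" for n vs
    using that
  proof (induction n arbitrary: vs)
    case 0
    then have "set vs \<subseteq> G" "length vs = d" by (auto simp: in_set_conv_nth tuples_length)
    then show ?case using GC by blast
  next
    case (Suc n)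
    have n: "n < d" using Suc.prems by simp
    note pm = multilinD(2,3)[OF tpure_multilin[OF V.vectorspace_axioms] Suc.prems(2) n]
    have "(\<lambda>x. pure (vs[n := x])) \<in> lhom V TP"
      using Suc.prems(2) by (intro lhomI pm pure_cl tuples_update)
    from lin_closed_vimage[OF V.vectorspace_axioms T.vectorspace_axioms this C]
    have "vs ! n \<in> {x. pure (vs[n := x]) \<in> C}"
    proof (rule gens_induct[OF G _ _ tuples_nth[OF Suc.prems(2) n]])
      fix g assume g: "g \<in> G"
      have "pure (vs[n := g]) \<in> C"
      proof (rule Suc.IH)
        show "vs[n := g] \<in> tuples d V" using g sub Suc.prems(2) by (intro tuples_update) auto
        show "vs[n := g] ! i \<in> G" if "n \<le> i" "i < d" for i
          using that g Suc.prems(3)[of i] tuples_length[OF Suc.prems(2)] by (cases "i = n") auto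
      qed (use n in simp)
      then show "g \<in> {x. pure (vs[n := x]) \<in> C}" by simp
    qed
    then show ?case by simp
  qed
  from this[of d] have "pure vs \<in> C" if "vs \<in> tuples d V" for vs using that by simp
  then show "x \<in> C" using gens_induct[OF gens_tpow[OF V.vectorspace_axioms] C _ x] by blast
qed

definition tcoord :: "(nat \<Rightarrow> 'v \<Rightarrow> 'k) \<Rightarrow> nat list \<Rightarrow> ('v list \<Rightarrow> 'k) set \<Rightarrow> 'k" where
  "tcoord \<phi> I = lift scalars (\<lambda>vs. \<Prod>k<d. \<phi> (I ! k) (vs ! k))"

lemma prod_update:
  fixes g :: "nat \<Rightarrow> 'k"
  assumes "i < d" "length vs = d"
  shows "(\<Prod>k<d. \<phi> (I ! k) (vs[i := x] ! k)) = \<phi> (I ! i) x * (\<Prod>k\<in>{..<d} - {i}. \<phi> (I ! k) (vs ! k) :: 'k)"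
proof -
  have "(\<Prod>k<d. \<phi> (I ! k) (vs[i := x] ! k)) = \<phi> (I ! i) (vs[i := x] ! i) * (\<Prod>k\<in>{..<d} - {i}. \<phi> (I ! k) (vs[i := x] ! k))"
    using assms(1) by (intro prod.remove) auto
  also have "(\<Prod>k\<in>{..<d} - {i}. \<phi> (I ! k) (vs[i := x] ! k)) = (\<Prod>k\<in>{..<d} - {i}. \<phi> (I ! k) (vs ! k))"
    by (rule prod.cong) auto
  finally show ?thesis using assms by simp
qed

lemma tcoord:
  assumes \<phi>: "\<And>i. \<phi> i \<in> lhom V scalars"
  shows "tcoord \<phi> I \<in> lhom TP scalars" "vs \<in> tuples d V \<Longrightarrow> tcoord \<phi> I (pure vs) = (\<Prod>k<d. \<phi> (I ! k) (vs ! k))"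
proof -
  have "multilin d V scalars (\<lambda>vs. \<Prod>k<d. \<phi> (I ! k) (vs ! k))"
    by (rule multilinI) (simp_all add: prod_update tuples_length lhomD(2,3)[OF \<phi>] algebra_simps)
  from tpow_lift[OF V.vectorspace_axioms scalars_vs this]
  show "tcoord \<phi> I \<in> lhom TP scalars" "vs \<in> tuples d V \<Longrightarrow> tcoord \<phi> I (pure vs) = (\<Prod>k<d. \<phi> (I ! k) (vs ! k))"
    unfolding tcoord_def by blast+
qed

lemma tcoord_basis:
  assumes \<phi>: "\<And>i. \<phi> i \<in> lhom V scalars" and dual: "\<And>i j. \<phi> i (\<epsilon> j) = (if i = j then 1 else 0)"
    and \<epsilon>: "\<And>i. \<epsilon> i \<in> carrier V" and l: "length I = d" "length J = d"
  shows "tcoord \<phi> I (pure (map \<epsilon> J)) = (if I = J then 1 else 0)"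
proof -
  have "map \<epsilon> J \<in> tuples d V" using l \<epsilon> by (auto simp: tuples_def)
  then have 1: "tcoord \<phi> I (pure (map \<epsilon> J)) = (\<Prod>k<d. if I ! k = J ! k then 1 else 0)"
    using l by (simp add: tcoord(2)[OF \<phi>] dual)
  show ?thesis
  proof (cases "I = J")
    case False
    then obtain k where "k < d" "I ! k \<noteq> J ! k" using l by (metis nth_equalityI)
    then have "(\<Prod>k<d. if I ! k = J ! k then 1 else 0 :: 'k) = 0" by (intro prod_zero) auto
    then show ?thesis using 1 False by simp
  qed (use 1 in simp)
qed

end

context liepow begin

text \<open>The scalar and the labels are left open so that one computation serves both factors: the
  scalar is 1 on V, and -1 on W with the labels exchanged.\<close>

lemma tcoord_act:
  assumes \<phi>: "\<And>i. \<phi> i \<in> lhom M scalars" and x: "x \<in> carrier L"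
    and act: "\<And>i v. v \<in> carrier M \<Longrightarrow> \<phi> i (act M x v) = (if i = a then s * \<phi> b v else 0)"
    and I: "length I = d" and t: "t \<in> carrier TP"
  shows "tcoord \<phi> I (act LP x t) = (\<Sum>k<d. if I ! k = a then s * tcoord \<phi> (I[k := b]) t else 0)"
proof (rule tpow_hom_eqI[OF Mvs scalars_vs _ _ _ t])
  note tc = tcoord[OF \<phi>]
  show "(\<lambda>t. tcoord \<phi> I (act LP x t)) \<in> lhom TP scalars" by (rule lhom_comp[OF lp_act(1)[OF x] tc(1)])
  show "(\<lambda>t. \<Sum>k<d. if I ! k = a then s * tcoord \<phi> (I[k := b]) t else 0) \<in> lhom TP scalars"
    by (intro functional_sum lhomI) (simp_all add: lhomD(2,3)[OF tc(1)] algebra_simps)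
  fix vs assume vs: "vs \<in> tuples d M"
  have am: "act M x (vs ! k) \<in> carrier M" if "k < d" for k by (intro LM.act_closed x tuples_nth[OF vs that])
  have "tcoord \<phi> I (act LP x (pure vs)) = (\<Sum>k<d. tcoord \<phi> I (upd x vs k))"
    unfolding lp_act(2)[OF x vs] by (rule functional_finsum[OF T.vectorspace_axioms tc(1)]) (use upd_cl[OF x vs] in auto)
  also have "\<dots> = (\<Sum>k<d. if I ! k = a then s * tcoord \<phi> (I[k := b]) (pure vs) else 0)"
  proof (rule sum.cong[OF refl])
    fix k assume "k \<in> {..<d}"
    then have k: "k < d" by simp
    have "tcoord \<phi> I (upd x vs k) = \<phi> (I ! k) (act M x (vs ! k)) * (\<Prod>j\<in>{..<d} - {k}. \<phi> (I ! j) (vs ! j))"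
      unfolding upd_def by (simp add: tc(2) tuples_update[OF vs am[OF k]] prod_update[OF k] tuples_length[OF vs])
    also have "\<dots> = (if I ! k = a then s * tcoord \<phi> (I[k := b]) (pure vs) else 0)"
    proof (cases "I ! k = a")
      case True
      have "tcoord \<phi> (I[k := b]) (pure vs) = \<phi> b (vs ! k) * (\<Prod>j\<in>{..<d} - {k}. \<phi> (I[k := b] ! j) (vs ! j))"
        unfolding tc(2)[OF vs] using k I by (subst prod.remove[of _ k]) auto
      also have "(\<Prod>j\<in>{..<d} - {k}. \<phi> (I[k := b] ! j) (vs ! j)) = (\<Prod>j\<in>{..<d} - {k}. \<phi> (I ! j) (vs ! j))"
        by (rule prod.cong) auto
      finally show ?thesis using True by (simp add: act tuples_nth[OF vs k])
    qed (simp add: act tuples_nth[OF vs k])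
    finally show "tcoord \<phi> I (upd x vs k) = (if I ! k = a then s * tcoord \<phi> (I[k := b]) (pure vs) else 0)" .
  qed
  finally show "tcoord \<phi> I (act LP x (pure vs)) = (\<Sum>k<d. if I ! k = a then s * tcoord \<phi> (I[k := b]) (pure vs) else 0)" .
qed

lemma act_basis:
  assumes x: "x \<in> carrier L" and \<epsilon>: "\<And>i. \<epsilon> i \<in> carrier M"
    and act: "\<And>i. act M x (\<epsilon> i) = (if i = b then s else 0) \<odot>\<^bsub>M\<^esub> \<epsilon> a" and I: "length I = d"
  shows "act LP x (pure (map \<epsilon> I)) = (\<Oplus>\<^bsub>TP\<^esub>k\<in>{..<d}. (if I ! k = b then s else 0) \<odot>\<^bsub>TP\<^esub> pure (map \<epsilon> (I[k := a])))"
proof -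
  have m: "map \<epsilon> J \<in> tuples d M" if "length J = d" for J using that \<epsilon> by (auto simp: tuples_def)
  show ?thesis unfolding lp_act(2)[OF x m[OF I]]
  proof (rule T.finsum_eq)
    fix k assume "k \<in> {..<d}"
    then have k: "k < d" by simp
    show "upd x (map \<epsilon> I) k = (if I ! k = b then s else 0) \<odot>\<^bsub>TP\<^esub> pure (map \<epsilon> (I[k := a]))"
      unfolding upd_def using k I by (simp only: nth_map act multilinD(3)[OF tpure_multilin[OF Mvs] m[OF I] k \<epsilon>] map_update)
    show "(if I ! k = b then s else 0) \<odot>\<^bsub>TP\<^esub> pure (map \<epsilon> (I[k := a])) \<in> carrier TP"
      using I by (intro T.scl pure_cl m) simp
  qed
qed

end

lemma (in tpow) act_alg_single:
  assumes s: "\<sigma> permutes {..<d}" and vs: "vs \<in> tuples d V"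
  shows "act_alg (single \<sigma>) (pure vs) = pure (permute_list \<sigma> vs)"
proof -
  have "(\<Oplus>\<^bsub>TP\<^esub>\<tau>\<in>P. single \<sigma> \<tau> \<odot>\<^bsub>TP\<^esub> tperm \<tau> (pure vs)) = single \<sigma> \<sigma> \<odot>\<^bsub>TP\<^esub> tperm \<sigma> (pure vs)"
    using s vs by (intro T.finsum_delta) (auto simp: tperm_cl pure_cl single_def)
  then show ?thesis using s vs by (simp add: act_alg(2) pure_cl tperm(2) tuples_permute) (simp add: single_def pure_cl tuples_permute)
qed

text \<open>As the indices are distinct, only the identity fixes I, so this coordinate picks out one
  coefficient of x. It will show that the summands are nonzero.\<close>

lemma (in tpow) tcoord_alg:
  assumes \<phi>: "\<And>i. \<phi> i \<in> lhom V scalars" and dual: "\<And>i j. \<phi> i (\<epsilon> j) = (if i = j then 1 else 0)"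
    and \<epsilon>: "\<And>i. \<epsilon> i \<in> carrier V" and I: "length I = d" "distinct I"
  shows "tcoord \<phi> I (act_alg x (pure (map \<epsilon> I))) = x id"
proof -
  have m: "map \<epsilon> I \<in> tuples d V" using I \<epsilon> by (auto simp: tuples_def)
  have fix_id: "I = permute_list \<sigma> I \<longleftrightarrow> \<sigma> = id" if s: "\<sigma> permutes {..<d}" for \<sigma>
  proof
    assume e: "I = permute_list \<sigma> I"
    have "\<sigma> k = k" for k
    proof (cases "k < d")
      case True
      have "\<sigma> k < d" using permutes_in_image[OF s, of k] True by simp
      moreover have "I ! k = I ! \<sigma> k" using arg_cong[OF e, of "\<lambda>I. I ! k"] True I s by (simp add: permute_list_nth)
      ultimately show ?thesis using I True by (simp add: nth_eq_iff_index_eq)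
    qed (use s in \<open>simp add: permutes_not_in\<close>)
    then show "\<sigma> = id" by (simp add: fun_eq_iff)
  qed simp
  have "tcoord \<phi> I (act_alg x (pure (map \<epsilon> I))) = (\<Sum>\<sigma>\<in>P. tcoord \<phi> I (x \<sigma> \<odot>\<^bsub>TP\<^esub> tperm \<sigma> (pure (map \<epsilon> I))))"
    unfolding act_alg(2)[OF pure_cl[OF m]]
    by (rule functional_finsum[OF T.vectorspace_axioms tcoord(1)[OF \<phi>]]) (use m in \<open>auto simp: tperm_cl pure_cl\<close>)
  also have "\<dots> = (\<Sum>\<sigma>\<in>P. if \<sigma> = id then x id else 0)"
  proof (rule sum.cong[OF refl])
    fix \<sigma> assume "\<sigma> \<in> P"
    then have s: "\<sigma> permutes {..<d}" by simp
    have "tperm \<sigma> (pure (map \<epsilon> I)) = pure (map \<epsilon> (permute_list \<sigma> I))"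
      using s m I by (simp add: tperm(2) permute_list_map)
    moreover have "tcoord \<phi> I (pure (map \<epsilon> (permute_list \<sigma> I))) = (if I = permute_list \<sigma> I then 1 else 0)"
      by (rule tcoord_basis[OF \<phi> dual \<epsilon> I(1)]) (use I in simp)
    ultimately show "tcoord \<phi> I (x \<sigma> \<odot>\<^bsub>TP\<^esub> tperm \<sigma> (pure (map \<epsilon> I))) = (if \<sigma> = id then x id else 0)"
      using lhomD(3)[OF tcoord(1)[OF \<phi>] tperm_cl[OF s pure_cl[OF m]]] by (simp add: fix_id[OF s])
  qed
  also have "\<dots> = x id" by (subst sum.delta) auto
  finally show ?thesis .
qed

locale mixed_basis = mixed V W pair p q
  for V :: "('k::field_char_0, 'v) module" and W :: "('k, 'w) module" and pair p q +
  fixes e :: "nat \<Rightarrow> 'v" and f :: "nat \<Rightarrow> 'w"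
  assumes db: "dual_bases V W pair e f"
begin

lemma ef: "e i \<in> carrier V" "f i \<in> carrier W" "pair (e i) (f j) = (if i = j then 1 else 0)"
  using db by (auto simp: dual_bases_def gens_def)

definition "phi i v = pair v (f i)"
definition "psi j w = pair (e j) w"

lemma phi: "phi i \<in> lhom natV scalars" "phi i (e j) = (if i = j then 1 else 0)"
  and psi: "psi j \<in> lhom natW scalars" "psi i (f j) = (if i = j then 1 else 0)"
  by (auto simp: phi_def psi_def ef pair_simps intro!: lhomI)

abbreviation cA where "cA \<equiv> A.tcoord phi"
abbreviation cB where "cB \<equiv> B.tcoord psi"
lemmas cA = A.tcoord[of phi, OF phi(1)]
lemmas cB = B.tcoord[of psi, OF psi(1)]

abbreviation pA where "pA I \<equiv> A.pure (map e I)"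
abbreviation pB where "pB J \<equiv> B.pure (map f J)"

lemma tuples_ef: "length I = p \<Longrightarrow> map e I \<in> tuples p natV" "length J = q \<Longrightarrow> map f J \<in> tuples q natW"
  using ef by (auto simp: tuples_def)

lemma pAB: "length I = p \<Longrightarrow> pA I \<in> carrier A.TP" "length J = q \<Longrightarrow> pB J \<in> carrier B.TP"
  by (intro A.pure_cl B.pure_cl tuples_ef; assumption)+

definition bas where "bas I J = tAB (pA I) (pB J)"
definition coord where "coord I J = lift scalars (\<lambda>(a, b). cA I a * cB J b)"

lemma bas_cl: "length I = p \<Longrightarrow> length J = q \<Longrightarrow> bas I J \<in> carrier AB"
  unfolding bas_def by (intro tAB(1) pAB)

lemma coord:
  "coord I J \<in> lhom AB scalars"
  "a \<in> carrier A.TP \<Longrightarrow> b \<in> carrier B.TP \<Longrightarrow> coord I J (tAB a b) = cA I a * cB J b"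
proof -
  have b: "bilin A.LP B.LP scalars (\<lambda>a b. cA I a * cB J b)"
    unfolding bilin_def by (simp add: lhomD(2,3)[OF cA(1)] lhomD(2,3)[OF cB(1)] algebra_simps)
  note vs = lie_module_vs[OF A.lp_lie] lie_module_vs[OF B.lp_lie] scalars_vs
  show "coord I J \<in> lhom AB scalars" unfolding coord_def lhom_lie_tensor by (rule tensor_lift_hom[OF vs b])
  show "coord I J (tAB a b) = cA I a * cB J b" if "a \<in> carrier A.TP" "b \<in> carrier B.TP"
    unfolding coord_def by (rule tensor_lift_tens[OF vs b]) (use that in simp_all)
qed

lemma coord_bas:
  "length I = p \<Longrightarrow> length J = q \<Longrightarrow> length I' = p \<Longrightarrow> length J' = q \<Longrightarrow> 
     coord I J (bas I' J') = (if I = I' \<and> J = J' then 1 else 0)"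
  unfolding bas_def by (simp add: coord(2) pAB A.tcoord_basis[OF phi(1,2)] B.tcoord_basis[OF psi(1,2)] ef)

lemma gens_bas: "gens AB {bas I J | I J. length I = p \<and> length J = q}"
proof -
  have "gens A.TP (A.pure ` {vs. length vs = p \<and> set vs \<subseteq> range e})"
    by (rule A.gens_tpow_subset) (use db in \<open>simp add: dual_bases_def gens_def lin_closed_def\<close>)
  then have A: "gens A.LP (A.pure ` {vs. length vs = p \<and> set vs \<subseteq> range e})" by (simp add: gens_def lin_closed_def)
  have "gens B.TP (B.pure ` {vs. length vs = q \<and> set vs \<subseteq> range f})"
    by (rule B.gens_tpow_subset) (use db in \<open>simp add: dual_bases_def gens_def lin_closed_def\<close>)
  then have B: "gens B.LP (B.pure ` {vs. length vs = q \<and> set vs \<subseteq> range f})" by (simp add: gens_def lin_closed_def)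
  have ex: "\<exists>I. vs = map g I" if "set vs \<subseteq> range g" for vs and g :: "nat \<Rightarrow> 'x"
    using that by (metis ex_map_conv rangeE subsetD)
  have "{tAB a b | a b. a \<in> A.pure ` {vs. length vs = p \<and> set vs \<subseteq> range e} \<and> b \<in> B.pure ` {vs. length vs = q \<and> set vs \<subseteq> range f}}
      \<subseteq> {bas I J | I J. length I = p \<and> length J = q}" (is "?G \<subseteq> ?H")
  proof
    fix x assume "x \<in> ?G"
    then obtain vs ws where x: "x = tAB (A.pure vs) (B.pure ws)" and l: "length vs = p" "length ws = q"
      and "set vs \<subseteq> range e" "set ws \<subseteq> range f" by blast
    then obtain I J where "vs = map e I" "ws = map f J" using ex[of vs e] ex[of ws f] by blast
    then show "x \<in> ?H" using x l unfolding bas_def by (intro CollectI exI[of _ I] exI[of _ J]) simp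
  qed
  moreover have "gens AB ?G" using gens_tensor_subset[OF lie_module_vs[OF A.lp_lie] lie_module_vs[OF B.lp_lie] A B]
    by (simp add: gens_def lin_closed_def)
  moreover have "?H \<subseteq> carrier AB" using bas_cl by blast
  ultimately show ?thesis unfolding gens_def by (meson order_trans)
qed

lemma expansion:
  assumes x: "x \<in> carrier AB"
  obtains F where "finite F" "\<And>z. z \<in> F \<Longrightarrow> length (fst z) = p \<and> length (snd z) = q"
    "(\<Oplus>\<^bsub>AB\<^esub>z\<in>F. coord (fst z) (snd z) x \<odot>\<^bsub>AB\<^esub> bas (fst z) (snd z)) = x"
proof -
  let ?X = "{z. length (fst z) = p \<and> length (snd z) = q}"
  let ?P = "\<lambda>G x. \<Oplus>\<^bsub>AB\<^esub>z\<in>G. coord (fst z) (snd z) x \<odot>\<^bsub>AB\<^esub> bas (fst z) (snd z)"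
  have h: "?P G \<in> lhom AB AB" if "finite G" "G \<subseteq> ?X" for G
  proof (rule lhom_finsum[OF AB.vectorspace_axioms that(1)])
    fix z assume "z \<in> G"
    then have "length (fst z) = p" "length (snd z) = q" using that(2) by auto
    then have "bas (fst z) (snd z) \<in> carrier AB" by (rule bas_cl)
    then show "(\<lambda>x. coord (fst z) (snd z) x \<odot>\<^bsub>AB\<^esub> bas (fst z) (snd z)) \<in> lhom AB AB"
      by (intro lhomI AB.scl) (simp_all add: lhomD(2,3)[OF coord(1)] AB.sc_add AB.sc_sc del: lie_tensor_fields)
  qed
  \<comment> \<open>Asking that every finite set beyond F reproduces x makes the property additive:
    for a sum the two sets are united.\<close>
  let ?C = "{x. \<exists>F. finite F \<and> F \<subseteq> ?X \<and> (\<forall>G. finite G \<longrightarrow> F \<subseteq> G \<longrightarrow> G \<subseteq> ?X \<longrightarrow> ?P G x = x)}"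
  have "lin_closed AB ?C"
    unfolding lin_closed_def
  proof (intro conjI ballI allI)
    show "\<zero>\<^bsub>AB\<^esub> \<in> ?C"
      using khom.zero[OF khomI[OF AB.vectorspace_axioms AB.vectorspace_axioms h]] by (intro CollectI exI[of _ "{}"]) blast
    fix x c assume x: "x \<in> ?C \<inter> carrier AB"
    then obtain F where F: "finite F" "F \<subseteq> ?X" "\<And>G. finite G \<Longrightarrow> F \<subseteq> G \<Longrightarrow> G \<subseteq> ?X \<Longrightarrow> ?P G x = x" by blast
    have "?P G (c \<odot>\<^bsub>AB\<^esub> x) = c \<odot>\<^bsub>AB\<^esub> x" if "finite G" "F \<subseteq> G" "G \<subseteq> ?X" for G
      using lhomD(3)[OF h[OF that(1,3)], of x c] F(3)[OF that] x by simp
    then show "c \<odot>\<^bsub>AB\<^esub> x \<in> ?C" using F(1,2) by blast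
    fix y assume y: "y \<in> ?C \<inter> carrier AB"
    then obtain F' where F': "finite F'" "F' \<subseteq> ?X" "\<And>G. finite G \<Longrightarrow> F' \<subseteq> G \<Longrightarrow> G \<subseteq> ?X \<Longrightarrow> ?P G y = y" by blast
    have "?P G (x \<oplus>\<^bsub>AB\<^esub> y) = x \<oplus>\<^bsub>AB\<^esub> y" if "finite G" "F \<union> F' \<subseteq> G" "G \<subseteq> ?X" for G
    proof -
      have "F \<subseteq> G" "F' \<subseteq> G" using that(2) by auto
      then show ?thesis using lhomD(2)[OF h[OF that(1,3)], of x y] F(3)[OF that(1) _ that(3)] F'(3)[OF that(1) _ that(3)] x y by simp
    qed
    then show "x \<oplus>\<^bsub>AB\<^esub> y \<in> ?C" using F(1,2) F'(1,2) by (intro CollectI exI[of _ "F \<union> F'"]) blast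
  qed
  then have "x \<in> ?C"
  proof (rule gens_induct[OF gens_bas _ _ x])
    fix g assume "g \<in> {bas I J | I J. length I = p \<and> length J = q}"
    then obtain I J where g: "g = bas I J" and l: "length I = p" "length J = q" by blast
    have "?P G g = g" if G: "finite G" "{(I, J)} \<subseteq> G" "G \<subseteq> ?X" for G
    proof -
      have "?P G g = coord I J g \<odot>\<^bsub>AB\<^esub> bas I J"
      proof -
        have 1: "coord (fst z) (snd z) g \<odot>\<^bsub>AB\<^esub> bas (fst z) (snd z) = (if z = (I, J) then bas I J else \<zero>\<^bsub>AB\<^esub>)" if "z \<in> G" for z
        proof -
          have z: "length (fst z) = p" "length (snd z) = q" using that G(3) by auto
          show ?thesis unfolding g coord_bas[OF z l] using bas_cl[OF z] bas_cl[OF l]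
            by (auto simp: prod_eq_iff simp del: lie_tensor_fields)
        qed
        have "?P G g = (\<Oplus>\<^bsub>AB\<^esub>z\<in>G. if z = (I, J) then bas I J else \<zero>\<^bsub>AB\<^esub>)"
          by (rule AB.finsum_eq) (use 1 bas_cl[OF l] AB.zero_closed in auto)
        also have "\<dots> = bas I J"
          using AB.finsum_delta[OF G(1), of "(I, J)" "\<lambda>z. if z = (I, J) then bas I J else \<zero>\<^bsub>AB\<^esub>"] G(2) bas_cl[OF l] AB.zero_closed by simp
        finally show ?thesis using bas_cl[OF l] by (simp add: g coord_bas l del: lie_tensor_fields)
      qed
      then show ?thesis using bas_cl[OF l] by (simp add: g coord_bas l del: lie_tensor_fields)
    qed
    then show "g \<in> ?C" using l by (intro CollectI exI[of _ "{(I, J)}"]) simp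
  qed
  then obtain F where F: "finite F" "F \<subseteq> ?X" "\<And>G. finite G \<Longrightarrow> F \<subseteq> G \<Longrightarrow> G \<subseteq> ?X \<Longrightarrow> ?P G x = x" by blast
  show ?thesis by (rule that[OF F(1) _ F(3)]) (use F(1,2) in blast)+
qed

lemma coord_zero_eq:
  assumes x: "x \<in> carrier AB" and c: "\<And>I J. length I = p \<Longrightarrow> length J = q \<Longrightarrow> coord I J x = 0"
  shows "x = \<zero>\<^bsub>AB\<^esub>"
proof -
  obtain F where F: "finite F" "\<And>z. z \<in> F \<Longrightarrow> length (fst z) = p \<and> length (snd z) = q"
    "(\<Oplus>\<^bsub>AB\<^esub>z\<in>F. coord (fst z) (snd z) x \<odot>\<^bsub>AB\<^esub> bas (fst z) (snd z)) = x" using expansion[OF x] by blast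
  have "(\<Oplus>\<^bsub>AB\<^esub>z\<in>F. coord (fst z) (snd z) x \<odot>\<^bsub>AB\<^esub> bas (fst z) (snd z)) = (\<Oplus>\<^bsub>AB\<^esub>z\<in>F. \<zero>\<^bsub>AB\<^esub>)"
    by (rule AB.finsum_eq) (use F(2) c bas_cl in \<open>auto simp del: lie_tensor_fields\<close>)
  then show ?thesis using F(3) by (simp add: AB.finsum_zero del: lie_tensor_fields)
qed

text \<open>A tensor is a finite combination of basis vectors, so its coordinates vanish at large
  indices. This supplies \<open>K_fin\<close>.\<close>

lemma coord_bounded:
  assumes x: "x \<in> carrier AB"
  shows "\<exists>m. \<forall>I J. length I = p \<longrightarrow> length J = q \<longrightarrow> (\<exists>i\<in>set I \<union> set J. m \<le> i) \<longrightarrow> coord I J x = 0"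
proof -
  obtain F where F: "finite F" "\<And>z. z \<in> F \<Longrightarrow> length (fst z) = p \<and> length (snd z) = q"
    "(\<Oplus>\<^bsub>AB\<^esub>z\<in>F. coord (fst z) (snd z) x \<odot>\<^bsub>AB\<^esub> bas (fst z) (snd z)) = x" using expansion[OF x] by blast
  define S where "S = insert 0 (\<Union>z\<in>F. set (fst z) \<union> set (snd z))"
  have finS: "finite S" using F(1) by (simp add: S_def)
  have "coord I J x = 0" if l: "length I = p" "length J = q" and i: "i \<in> set I \<union> set J" "Suc (Max S) \<le> i" for I J i
  proof -
    have "i \<notin> S" using Max_ge[OF finS, of i] i(2) by auto
    then have nF: "(I, J) \<notin> F" using i(1) by (auto simp: S_def)
    have "coord I J x = coord I J (\<Oplus>\<^bsub>AB\<^esub>z\<in>F. coord (fst z) (snd z) x \<odot>\<^bsub>AB\<^esub> bas (fst z) (snd z))" by (simp only: F(3))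
    also have "\<dots> = (\<Sum>z\<in>F. coord I J (coord (fst z) (snd z) x \<odot>\<^bsub>AB\<^esub> bas (fst z) (snd z)))"
      by (rule functional_finsum[OF AB.vectorspace_axioms coord(1) F(1)]) (use F(2) bas_cl AB.scl in blast)
    also have "\<dots> = 0"
    proof (rule sum.neutral, intro ballI)
      fix z assume z: "z \<in> F"
      then have "\<not> (I = fst z \<and> J = snd z)" using nF by auto
      then show "coord I J (coord (fst z) (snd z) x \<odot>\<^bsub>AB\<^esub> bas (fst z) (snd z)) = 0"
        using F(2)[OF z] lhomD(3)[OF coord(1) bas_cl[of "fst z" "snd z"]] by (auto simp: coord_bas l simp del: lie_tensor_fields)
    qed
    finally show ?thesis .
  qed
  then show ?thesis by blast
qed

abbreviation E where "E a b \<equiv> tn (e a) (f b)"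

lemma E_cl: "E a b \<in> carrier gl"
  by (simp add: tn ef)

lemma act_phi: "v \<in> carrier V \<Longrightarrow> phi i (act natV (E a b) v) = (if i = a then 1 * phi b v else 0)"
  and act_psi: "w \<in> carrier W \<Longrightarrow> psi j (act natW (E a b) w) = (if j = b then (- 1) * psi a w else 0)"
  by (auto simp: nat_act ef phi_def psi_def pair_simps)

lemma act_e: "act natV (E a b) (e i) = (if i = b then 1 else 0) \<odot>\<^bsub>natV\<^esub> e a"
  and act_f: "act natW (E a b) (f j) = (if j = a then - 1 else 0) \<odot>\<^bsub>natW\<^esub> f b"
  by (auto simp: nat_act ef)

text \<open>On coordinates a matrix unit acts by its transpose: it replaces an index of the
  coordinate functional. This yields the left-hand side of \<open>K_eq\<close>.\<close>

lemma coord_act: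
  assumes x: "x \<in> carrier AB" and l: "length I = p" "length J = q"
  shows "coord I J (act AB (E a b) x) =
    (\<Sum>k<p. if I ! k = a then coord (I[k := b]) J x else 0) - (\<Sum>k<q. if J ! k = b then coord I (J[k := a]) x else 0)"
proof (rule gens_hom_eqI[OF gens_AB AB.vectorspace_axioms scalars_vs _ _ _ x])
  show "(\<lambda>x. coord I J (act AB (E a b) x)) \<in> lhom AB scalars"
    by (rule lhom_comp[OF lie_act_hom[OF AB_lie E_cl] coord(1)])
  have "(\<lambda>x. \<Sum>k<p. if I ! k = a then coord (I[k := b]) J x else 0) \<in> lhom AB scalars"
    "(\<lambda>x. \<Sum>k<q. if J ! k = b then coord I (J[k := a]) x else 0) \<in> lhom AB scalars"
    by (intro functional_sum finite_lessThan lhomI; simp add: lhomD(2,3)[OF coord(1)] del: lie_tensor_fields)+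
  from lhomD(2,3)[OF this(1)] lhomD(2,3)[OF this(2)]
  show "(\<lambda>x. (\<Sum>k<p. if I ! k = a then coord (I[k := b]) J x else 0) - (\<Sum>k<q. if J ! k = b then coord I (J[k := a]) x else 0))
      \<in> lhom AB scalars" by (intro lhomI) (simp_all add: algebra_simps del: lie_tensor_fields)
  fix x assume "x \<in> {tAB a b | a b. a \<in> carrier A.TP \<and> b \<in> carrier B.TP}"
  then obtain u v where x: "x = tAB u v" and u: "u \<in> carrier A.TP" and v: "v \<in> carrier B.TP" by blast
  have ac: "act A.LP (E a b) u \<in> carrier A.TP" "act B.LP (E a b) v \<in> carrier B.TP"
    using lhomD(1)[OF A.lp_act(1)[OF E_cl] u] lhomD(1)[OF B.lp_act(1)[OF E_cl] v] .
  have "act AB (E a b) x = tAB (act A.LP (E a b) u) v \<oplus>\<^bsub>AB\<^esub> tAB u (act B.LP (E a b) v)"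
    unfolding x using lie_tensor(1)[OF A.lp_lie B.lp_lie E_cl] u v by simp
  then have "coord I J (act AB (E a b) x) = cA I (act A.LP (E a b) u) * cB J v + cA I u * cB J (act B.LP (E a b) v)"
    using lhomD(2)[OF coord(1) tAB(1)[OF ac(1) v] tAB(1)[OF u ac(2)]] by (simp add: coord(2) u v ac)
  also have "cA I (act A.LP (E a b) u) = (\<Sum>k<p. if I ! k = a then 1 * cA (I[k := b]) u else 0)"
    by (rule A.tcoord_act[OF phi(1) E_cl _ l(1) u]) (rule act_phi, simp)
  also have "cB J (act B.LP (E a b) v) = (\<Sum>k<q. if J ! k = b then (- 1) * cB (J[k := a]) v else 0)"
    by (rule B.tcoord_act[OF psi(1) E_cl _ l(2) v]) (rule act_psi, simp)
  also have "(\<Sum>k<p. if I ! k = a then 1 * cA (I[k := b]) u else 0) * cB J v + cA I u * (\<Sum>k<q. if J ! k = b then (- 1) * cB (J[k := a]) v else 0)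
      = (\<Sum>k<p. if I ! k = a then coord (I[k := b]) J x else 0) - (\<Sum>k<q. if J ! k = b then coord I (J[k := a]) x else 0)"
  proof -
    have "(\<Sum>k<p. if I ! k = a then coord (I[k := b]) J x else 0) = (\<Sum>k<p. if I ! k = a then 1 * cA (I[k := b]) u else 0) * cB J v"
      unfolding x sum_distrib_right by (rule sum.cong) (simp_all add: coord(2) u v)
    moreover have "(\<Sum>k<q. if J ! k = b then coord I (J[k := a]) x else 0) = - (cA I u * (\<Sum>k<q. if J ! k = b then (- 1) * cB (J[k := a]) v else 0))"
      unfolding x sum_distrib_left sum_negf[symmetric] by (rule sum.cong) (simp_all add: coord(2) u v)
    ultimately show ?thesis by simp
  qed
  finally show "coord I J (act AB (E a b) x) =
    (\<Sum>k<p. if I ! k = a then coord (I[k := b]) J x else 0) - (\<Sum>k<q. if J ! k = b then coord I (J[k := a]) x else 0)" .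
qed

text \<open>The functional h is arbitrary, because it will be a coordinate composed with an
  endomorphism; this yields the right-hand side of \<open>K_eq\<close>.\<close>

lemma bas_act:
  assumes h: "h \<in> lhom AB scalars" and l: "length I = p" "length J = q"
  shows "h (act AB (E a b) (bas I J)) =
    (\<Sum>k<p. if I ! k = b then h (bas (I[k := a]) J) else 0) - (\<Sum>k<q. if J ! k = a then h (bas I (J[k := b])) else 0)"
proof -
  note u = pAB(1)[OF l(1)] and v = pAB(2)[OF l(2)]
  have ac: "act A.LP (E a b) (pA I) \<in> carrier A.TP" "act B.LP (E a b) (pB J) \<in> carrier B.TP"
    using lhomD(1)[OF A.lp_act(1)[OF E_cl] u] lhomD(1)[OF B.lp_act(1)[OF E_cl] v] .
  have "act AB (E a b) (bas I J) = tAB (act A.LP (E a b) (pA I)) (pB J) \<oplus>\<^bsub>AB\<^esub> tAB (pA I) (act B.LP (E a b) (pB J))"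
    unfolding bas_def using lie_tensor(1)[OF A.lp_lie B.lp_lie E_cl] u v by simp
  then have 1: "h (act AB (E a b) (bas I J)) = h (tAB (act A.LP (E a b) (pA I)) (pB J)) + h (tAB (pA I) (act B.LP (E a b) (pB J)))"
    using lhomD(2)[OF h tAB(1)[OF ac(1) v] tAB(1)[OF u ac(2)]] by simp
  have hA: "(\<lambda>x. h (tAB x (pB J))) \<in> lhom A.TP scalars" by (rule lhom_comp[OF tAB_hom(1)[OF v] h])
  have hB: "(\<lambda>x. h (tAB (pA I) x)) \<in> lhom B.TP scalars" by (rule lhom_comp[OF tAB_hom(2)[OF u] h])
  have lu: "length (I[k := a]) = p" "length (J[k := b]) = q" for k using l by simp_all
  have "h (tAB (act A.LP (E a b) (pA I)) (pB J)) = (\<Sum>k<p. h (tAB ((if I ! k = b then 1 else 0) \<odot>\<^bsub>A.TP\<^esub> pA (I[k := a])) (pB J)))"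
    unfolding A.act_basis[OF E_cl _ act_e l(1), simplified nat_fields, OF ef(1)]
    by (rule functional_finsum[OF A.T.vectorspace_axioms hA finite_lessThan A.T.scl[OF pAB(1)[OF lu(1)]]])
  also have "\<dots> = (\<Sum>k<p. if I ! k = b then h (bas (I[k := a]) J) else 0)"
    by (rule sum.cong[OF refl]) (simp add: lhomD(3)[OF hA pAB(1)[OF lu(1)]] bas_def)
  finally have 2: "h (tAB (act A.LP (E a b) (pA I)) (pB J)) = (\<Sum>k<p. if I ! k = b then h (bas (I[k := a]) J) else 0)" .
  have "h (tAB (pA I) (act B.LP (E a b) (pB J))) = (\<Sum>k<q. h (tAB (pA I) ((if J ! k = a then - 1 else 0) \<odot>\<^bsub>B.TP\<^esub> pB (J[k := b]))))"
    unfolding B.act_basis[OF E_cl _ act_f l(2), simplified nat_fields, OF ef(2)]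
    by (rule functional_finsum[OF B.T.vectorspace_axioms hB finite_lessThan B.T.scl[OF pAB(2)[OF lu(2)]]])
  also have "\<dots> = - (\<Sum>k<q. if J ! k = a then h (bas I (J[k := b])) else 0)"
    unfolding sum_negf[symmetric] by (rule sum.cong[OF refl]) (simp add: lhomD(3)[OF hB pAB(2)[OF lu(2)]] bas_def)
  finally show ?thesis unfolding 1 2 by simp
qed

end

section \<open>Indecomposability\<close>

lemma lie_hom_linear_combination:
  assumes L: "lie_module L M" "lie_module L N" and F: "finite F" and g: "\<And>z. z \<in> F \<Longrightarrow> lie_hom L M N (g z)"
  shows "lie_hom L M N (\<lambda>x. \<Oplus>\<^bsub>N\<^esub>z\<in>F. c z \<odot>\<^bsub>N\<^esub> g z x)"
  unfolding lie_hom_def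
proof (intro conjI ballI)
  note M = lie_module_vs[OF L(1)] and N = lie_module_vs[OF L(2)]
  interpret N: kvs N using N by (rule kvsI)
  show "(\<lambda>x. \<Oplus>\<^bsub>N\<^esub>z\<in>F. c z \<odot>\<^bsub>N\<^esub> g z x) \<in> lhom M N" by (intro lhom_finsum lhom_smult N F lie_homD(1)[OF g])
  fix x m assume x: "x \<in> carrier L" and m: "m \<in> carrier M"
  interpret a: khom N N "act N x" by (rule khomI[OF N N lie_act_hom[OF L(2) x]])
  have gm: "g z m \<in> carrier N" if "z \<in> F" for z by (rule lhomD(1)[OF lie_homD(1)[OF g[OF that]] m])
  have "act N x (\<Oplus>\<^bsub>N\<^esub>z\<in>F. c z \<odot>\<^bsub>N\<^esub> g z m) = (\<Oplus>\<^bsub>N\<^esub>z\<in>F. act N x (c z \<odot>\<^bsub>N\<^esub> g z m))"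
    by (rule a.finsum[OF F]) (simp add: gm)
  also have "\<dots> = (\<Oplus>\<^bsub>N\<^esub>z\<in>F. c z \<odot>\<^bsub>N\<^esub> g z (act M x m))"
    by (rule N.finsum_eq) (simp_all add: a.sc gm lie_homD(2)[OF g x m] a.cl)
  finally show "(\<Oplus>\<^bsub>N\<^esub>z\<in>F. c z \<odot>\<^bsub>N\<^esub> g z (act M x m)) = act N x (\<Oplus>\<^bsub>N\<^esub>z\<in>F. c z \<odot>\<^bsub>N\<^esub> g z m)" ..
qed

lemma lie_hom_diff:
  assumes L: "lie_module L M" "lie_module L N" and g: "lie_hom L M N g" "lie_hom L M N h"
  shows "lie_hom L M N (\<lambda>x. g x \<ominus>\<^bsub>N\<^esub> h x)"
  unfolding lie_hom_def
proof (intro conjI ballI)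
  note M = lie_module_vs[OF L(1)] and N = lie_module_vs[OF L(2)]
  show "(\<lambda>x. g x \<ominus>\<^bsub>N\<^esub> h x) \<in> lhom M N" by (intro lhom_diff M N lie_homD(1)[OF g(1)] lie_homD(1)[OF g(2)])
  fix x m assume x: "x \<in> carrier L" and m: "m \<in> carrier M"
  interpret a: khom N N "act N x" by (rule khomI[OF N N lie_act_hom[OF L(2) x]])
  show "g (act M x m) \<ominus>\<^bsub>N\<^esub> h (act M x m) = act N x (g m \<ominus>\<^bsub>N\<^esub> h m)"
    unfolding a.diff[OF lhomD(1)[OF lie_homD(1)[OF g(1)] m] lhomD(1)[OF lie_homD(1)[OF g(2)] m]]
    by (simp add: lie_homD(2)[OF g(1) x m] lie_homD(2)[OF g(2) x m])
qed

text \<open>The component in A is unique because the intersection is zero, and it is equivariant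
  because both summands are stable.\<close>

lemma direct_sum_projection:
  fixes L :: "('k::field, 'g, 'y) lie_alg_scheme" and M :: "('k, 'm, 'g, 'z) lie_mod_scheme"
  assumes M: "lie_module L M" and A: "lie_submodule L A M" and B: "lie_submodule L B M"
    and int: "A \<inter> B = {\<zero>\<^bsub>M\<^esub>}" and sum: "A <+>\<^bsub>M\<^esub> B = carrier M"
  obtains f where "lie_hom L M M f" "\<And>a. a \<in> A \<Longrightarrow> f a = a" "\<And>b. b \<in> B \<Longrightarrow> f b = \<zero>\<^bsub>M\<^esub>"
proof -
  interpret M: kvs M by (rule kvsI, rule lie_module_vs[OF M])
  interpret LM: lie_module L M by (rule M)
  have sA: "submodule class_ring A M" and sB: "submodule class_ring B M"
    using A B by (auto simp: lie_submodule_def subspace_def)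
  have Ac: "a \<in> carrier M" if "a \<in> A" for a using submodule.subset[OF sA] that by blast
  have Bc: "b \<in> carrier M" if "b \<in> B" for b using submodule.subset[OF sB] that by blast
  have A0: "\<zero>\<^bsub>M\<^esub> \<in> A" "\<zero>\<^bsub>M\<^esub> \<in> B" using int by auto
  have Aadd: "a \<oplus>\<^bsub>M\<^esub> a' \<in> A" if "a \<in> A" "a' \<in> A" for a a' using submodule.m_closed[OF sA] that by blast
  have Badd: "a \<oplus>\<^bsub>M\<^esub> a' \<in> B" if "a \<in> B" "a' \<in> B" for a a' using submodule.m_closed[OF sB] that by blast
  have Asc: "c \<odot>\<^bsub>M\<^esub> a \<in> A" if "a \<in> A" for c a using submodule.smult_closed[OF sA _ that, of c] by simp
  have Bsc: "c \<odot>\<^bsub>M\<^esub> a \<in> B" if "a \<in> B" for c a using submodule.smult_closed[OF sB _ that, of c] by simp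
  have Aact: "act M x a \<in> A" if "a \<in> A" "x \<in> carrier L" for x a using A that by (simp add: lie_submodule_def)
  have Bact: "act M x a \<in> B" if "a \<in> B" "x \<in> carrier L" for x a using B that by (simp add: lie_submodule_def)
  have uniq: "a = a'" if h: "a \<in> A" "a' \<in> A" "b \<in> B" "b' \<in> B" "a \<oplus>\<^bsub>M\<^esub> b = a' \<oplus>\<^bsub>M\<^esub> b'" for a a' b b'
  proof -
    have "a \<ominus>\<^bsub>M\<^esub> a' = b' \<ominus>\<^bsub>M\<^esub> b"
    proof -
      have "a \<ominus>\<^bsub>M\<^esub> a' = (a \<oplus>\<^bsub>M\<^esub> b) \<ominus>\<^bsub>M\<^esub> b \<ominus>\<^bsub>M\<^esub> a'"
        using h(1-4) Ac Bc by (simp add: a_minus_def M.a_assoc M.r_neg)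
      also have "\<dots> = (a' \<oplus>\<^bsub>M\<^esub> b') \<ominus>\<^bsub>M\<^esub> b \<ominus>\<^bsub>M\<^esub> a'" by (simp only: h(5))
      also have "\<dots> = b' \<ominus>\<^bsub>M\<^esub> b"
      proof -
        have cl: "a' \<in> carrier M" "b' \<in> carrier M" "\<ominus>\<^bsub>M\<^esub> b \<in> carrier M" "\<ominus>\<^bsub>M\<^esub> a' \<in> carrier M" using h Ac Bc by simp_all
        have "(a' \<oplus>\<^bsub>M\<^esub> b') \<ominus>\<^bsub>M\<^esub> b \<ominus>\<^bsub>M\<^esub> a' = (a' \<oplus>\<^bsub>M\<^esub> \<ominus>\<^bsub>M\<^esub> a') \<oplus>\<^bsub>M\<^esub> (b' \<oplus>\<^bsub>M\<^esub> \<ominus>\<^bsub>M\<^esub> b)"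
          unfolding a_minus_def
          using cl by (simp only: M.a_ac M.a_closed)
        then show ?thesis using cl by (simp add: M.r_neg a_minus_def)
      qed
      finally show ?thesis .
    qed
    moreover have "a \<ominus>\<^bsub>M\<^esub> a' \<in> A" unfolding a_minus_def M.minus_sc[OF Ac[OF h(2)]] by (intro Aadd Asc h)
    moreover have "b' \<ominus>\<^bsub>M\<^esub> b \<in> B" unfolding a_minus_def M.minus_sc[OF Bc[OF h(3)]] by (intro Badd Bsc h)
    ultimately have "a \<ominus>\<^bsub>M\<^esub> a' \<in> A \<inter> B" by simp
    then have "a \<ominus>\<^bsub>M\<^esub> a' = \<zero>\<^bsub>M\<^esub>" unfolding int by simp
    then show ?thesis by (rule M.sub_zero_eq[OF Ac[OF h(1)] Ac[OF h(2)]])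
  qed
  have "\<exists>a b. a \<in> A \<and> b \<in> B \<and> x = a \<oplus>\<^bsub>M\<^esub> b" if "x \<in> carrier M" for x
  proof -
    have "x \<in> A <+>\<^bsub>M\<^esub> B" using that sum by simp
    then show ?thesis unfolding set_add_def set_mult_def by auto
  qed
  then obtain f g where fg: "\<And>x. x \<in> carrier M \<Longrightarrow> f x \<in> A \<and> g x \<in> B \<and> x = f x \<oplus>\<^bsub>M\<^esub> g x" by metis
  have f: "f (a \<oplus>\<^bsub>M\<^esub> b) = a" if "a \<in> A" "b \<in> B" for a b
    using uniq[of "f (a \<oplus>\<^bsub>M\<^esub> b)" a "g (a \<oplus>\<^bsub>M\<^esub> b)" b] fg[of "a \<oplus>\<^bsub>M\<^esub> b"] that Ac Bc by simp
  have fc: "f x \<in> carrier M" "g x \<in> carrier M" if "x \<in> carrier M" for x using fg[OF that] Ac Bc by auto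
  have "lie_hom L M M f"
    unfolding lie_hom_def
  proof (intro conjI ballI lhomI)
    fix x assume x: "x \<in> carrier M"
    note fx = fg[OF x] and xc = fc[OF x]
    show "f x \<in> carrier M" by (rule xc)
    show "f (c \<odot>\<^bsub>M\<^esub> x) = c \<odot>\<^bsub>M\<^esub> f x" for c
    proof -
      have "c \<odot>\<^bsub>M\<^esub> x = c \<odot>\<^bsub>M\<^esub> f x \<oplus>\<^bsub>M\<^esub> c \<odot>\<^bsub>M\<^esub> g x" using fx M.sc_sum_right[OF xc] by metis
      then show ?thesis using f[OF Asc Bsc, of "f x" "g x" c c] fx by simp
    qed
    show "f (x \<oplus>\<^bsub>M\<^esub> y) = f x \<oplus>\<^bsub>M\<^esub> f y" if y: "y \<in> carrier M" for y
    proof -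
      have "x \<oplus>\<^bsub>M\<^esub> y = (f x \<oplus>\<^bsub>M\<^esub> g x) \<oplus>\<^bsub>M\<^esub> (f y \<oplus>\<^bsub>M\<^esub> g y)" using fx fg[OF y] by metis
      also have "\<dots> = (f x \<oplus>\<^bsub>M\<^esub> f y) \<oplus>\<^bsub>M\<^esub> (g x \<oplus>\<^bsub>M\<^esub> g y)" using xc fc[OF y] by (simp only: M.a_ac M.a_closed)
      finally show ?thesis using f[OF Aadd Badd, of "f x" "f y" "g x" "g y"] fx fg[OF y] by simp
    qed
    show "f (act M l x) = act M l (f x)" if l: "l \<in> carrier L" for l
    proof -
      have "act M l x = act M l (f x) \<oplus>\<^bsub>M\<^esub> act M l (g x)" using fx LM.act_add_right[OF l xc] by metis
      then show ?thesis using f[OF Aact[OF _ l] Bact[OF _ l], of "f x" "g x"] fx by simp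
    qed
  qed
  moreover have "f a = a" if "a \<in> A" for a using f[OF that A0(2)] Ac[OF that] by simp
  moreover have "f b = \<zero>\<^bsub>M\<^esub>" if "b \<in> B" for b using f[OF A0(1) that] Bc[OF that] by simp
  ultimately show ?thesis by (rule that)
qed

text \<open>The projection onto A along B is a scalar s. If s = 0 then A is zero, and otherwise B,
  on which the projection vanishes, is zero.\<close>

lemma indecomposableI:
  assumes M: "lie_module L M" and ne: "carrier M \<noteq> {\<zero>\<^bsub>M\<^esub>}"
    and scalar: "\<And>f. lie_hom L M M f \<Longrightarrow> \<exists>s. \<forall>x\<in>carrier M. f x = s \<odot>\<^bsub>M\<^esub> x"
  shows "indecomposable L M"
  unfolding indecomposable_def
proof (intro conjI M ne allI impI)
  fix A B assume A: "lie_submodule L A M" and B: "lie_submodule L B M"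
    and int: "A \<inter> B = {\<zero>\<^bsub>M\<^esub>}" and sum: "A <+>\<^bsub>M\<^esub> B = carrier M"
  interpret M: kvs M by (rule kvsI, rule lie_module_vs[OF M])
  obtain f where f: "lie_hom L M M f" "\<And>a. a \<in> A \<Longrightarrow> f a = a" "\<And>b. b \<in> B \<Longrightarrow> f b = \<zero>\<^bsub>M\<^esub>"
    using direct_sum_projection[OF M A B int sum] by blast
  obtain s where s: "\<And>x. x \<in> carrier M \<Longrightarrow> f x = s \<odot>\<^bsub>M\<^esub> x" using scalar[OF f(1)] by blast
  have sub: "A \<subseteq> carrier M" "B \<subseteq> carrier M"
    using A B by (auto simp: lie_submodule_def subspace_def dest: submodule.subset)
  show "A = {\<zero>\<^bsub>M\<^esub>} \<or> B = {\<zero>\<^bsub>M\<^esub>}"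
  proof (cases "s = 0")
    case True
    have "a = \<zero>\<^bsub>M\<^esub>" if "a \<in> A" for a
    proof -
      have a: "a \<in> carrier M" using sub(1) that by blast
      show ?thesis using f(2)[OF that] s[OF a] a True by simp
    qed
    then show ?thesis using int by blast
  next
    case False
    have "b = \<zero>\<^bsub>M\<^esub>" if "b \<in> B" for b
    proof -
      have b: "b \<in> carrier M" using sub(2) that by blast
      have "b = inverse s \<odot>\<^bsub>M\<^esub> (s \<odot>\<^bsub>M\<^esub> b)" using b False by (simp add: M.sc_sc)
      also have "\<dots> = \<zero>\<^bsub>M\<^esub>" using f(3)[OF that] s[OF b] by simp
      finally show ?thesis .
    qed
    then show ?thesis using int by blast
  qed
qed

section \<open>Endomorphisms of the mixed tensor power and of its summands\<close>

context mixed_basis begin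

lemma endo_kernel:
  assumes h: "lie_hom gl AB AB \<theta>"
  shows "equivariant_kernel p q (\<lambda>A B I J. coord A B (\<theta> (bas I J)))"
proof
  note th = lie_homD[OF h]
  fix I J :: "nat list" assume l: "length I = p" "length J = q"
  note bc = bas_cl[OF l]
  show "\<exists>m. \<forall>A B. length A = p \<longrightarrow> length B = q \<longrightarrow> (\<exists>i\<in>set A \<union> set B. m \<le> i) \<longrightarrow> coord A B (\<theta> (bas I J)) = 0"
    by (rule coord_bounded[OF lhomD(1)[OF th(1) bc]])
  fix A B :: "nat list" and a b assume AB: "length A = p" "length B = q"
  have "coord A B (act AB (E a b) (\<theta> (bas I J))) = coord A B (\<theta> (act AB (E a b) (bas I J)))"
    by (simp only: th(2)[OF E_cl bc])
  then show "(\<Sum>k<p. if A ! k = a then coord (A[k := b]) B (\<theta> (bas I J)) else 0) -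
      (\<Sum>l<q. if B ! l = b then coord A (B[l := a]) (\<theta> (bas I J)) else 0) =
      (\<Sum>k<p. if I ! k = b then coord A B (\<theta> (bas (I[k := a]) J)) else 0) -
      (\<Sum>l<q. if J ! l = a then coord A B (\<theta> (bas I (J[l := b]))) else 0)"
    unfolding coord_act[OF lhomD(1)[OF th(1) bc] AB] bas_act[OF lhom_comp[OF th(1) coord(1)] l] .
qed

abbreviation I0 where "I0 \<equiv> [0..<p]"
abbreviation J0 where "J0 \<equiv> [p..<p + q]"

lemma l0: "length I0 = p" "length J0 = q"
  by simp_all

text \<open>The difference of the two endomorphisms has a vanishing generic column, and
  \<open>all_vanish\<close> spreads this to all columns.\<close>

lemma endo_eq:
  assumes g: "lie_hom gl AB AB g" and h: "lie_hom gl AB AB h" and eq: "g (bas I0 J0) = h (bas I0 J0)"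
    and x: "x \<in> carrier AB"
  shows "g x = h x"
proof (rule gens_hom_eqI[OF gens_bas AB.vectorspace_axioms AB.vectorspace_axioms lie_homD(1)[OF g] lie_homD(1)[OF h] _ x])
  let ?\<theta> = "\<lambda>x. g x \<ominus>\<^bsub>AB\<^esub> h x"
  have th: "lie_hom gl AB AB ?\<theta>" by (rule lie_hom_diff[OF AB_lie AB_lie g h])
  note thc = lhomD(1)[OF lie_homD(1)[OF th]] and gc = lhomD(1)[OF lie_homD(1)[OF g]] and hc = lhomD(1)[OF lie_homD(1)[OF h]]
  interpret K: equivariant_kernel p q "\<lambda>A B I J. coord A B (?\<theta> (bas I J))" by (rule endo_kernel[OF th])
  have "?\<theta> (bas I0 J0) = \<zero>\<^bsub>AB\<^esub>" unfolding eq a_minus_def by (rule AB.r_neg[OF hc[OF bas_cl[OF l0]]])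
  moreover have "coord A B \<zero>\<^bsub>AB\<^esub> = 0" for A B
    using khom.zero[OF khomI[OF AB.vectorspace_axioms scalars_vs coord(1)]] by simp
  ultimately have v: "K.vanish I0 J0" unfolding K.vanish_def by simp
  have gen: "K.generic I0 J0" unfolding K.generic_def by auto
  fix y assume "y \<in> {bas I J | I J. length I = p \<and> length J = q}"
  then obtain I J where y: "y = bas I J" and l: "length I = p" "length J = q" by blast
  have "?\<theta> (bas I J) = \<zero>\<^bsub>AB\<^esub>"
    by (rule coord_zero_eq[OF thc[OF bas_cl[OF l]]]) (rule K.all_vanish[OF gen v _ _ l])
  then show "g y = h y" unfolding y by (rule AB.sub_zero_eq[OF gc[OF bas_cl[OF l]] hc[OF bas_cl[OF l]]])
qed

definition "R \<sigma> \<tau> = tmap A.LP B.LP A.LP B.LP (A.act_alg (single \<sigma>)) (B.act_alg (single \<tau>))"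

lemma R:
  "lie_hom gl AB AB (R \<sigma> \<tau>)"
  "a \<in> carrier A.TP \<Longrightarrow> b \<in> carrier B.TP \<Longrightarrow> R \<sigma> \<tau> (tAB a b) = tAB (A.act_alg (single \<sigma>) a) (B.act_alg (single \<tau>) b)"
proof -
  show "lie_hom gl AB AB (R \<sigma> \<tau>)" unfolding R_def
    by (rule tmap_lie_hom[OF A.lp_lie B.lp_lie A.lp_lie B.lp_lie A.act_alg_equivariant B.act_alg_equivariant])
  show "R \<sigma> \<tau> (tAB a b) = tAB (A.act_alg (single \<sigma>) a) (B.act_alg (single \<tau>) b)" if "a \<in> carrier A.TP" "b \<in> carrier B.TP"
    unfolding R_def by (rule tmap(2)[OF lie_module_vs[OF A.lp_lie] lie_module_vs[OF B.lp_lie] lie_module_vs[OF A.lp_lie]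
      lie_module_vs[OF B.lp_lie] lie_homD(1)[OF A.act_alg_equivariant] lie_homD(1)[OF B.act_alg_equivariant]]) (use that in simp_all)
qed

text \<open>Schur--Weyl duality: the place permutations span the endomorphism algebra.\<close>

lemma endo_place_permutations:
  assumes g: "lie_hom gl AB AB g"
  obtains F :: "(nat list \<times> nat list) set" and c s r where "finite F"
    "\<And>x. x \<in> carrier AB \<Longrightarrow> g x = (\<Oplus>\<^bsub>AB\<^esub>z\<in>F. c z \<odot>\<^bsub>AB\<^esub> R (s z) (r z) x)"
proof -
  let ?t = "bas I0 J0"
  interpret K: equivariant_kernel p q "\<lambda>A B I J. coord A B (g (bas I J))" by (rule endo_kernel[OF g])
  have gen: "K.generic I0 J0" unfolding K.generic_def by auto
  note gt = lhomD(1)[OF lie_homD(1)[OF g] bas_cl[OF l0]]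
  define c where "c z = coord (fst z) (snd z) (g ?t)" for z
  obtain F where F: "finite F" "\<And>z. z \<in> F \<Longrightarrow> length (fst z) = p \<and> length (snd z) = q"
    "(\<Oplus>\<^bsub>AB\<^esub>z\<in>F. c z \<odot>\<^bsub>AB\<^esub> bas (fst z) (snd z)) = g ?t"
    using expansion[OF gt] unfolding c_def by blast
  have Rc: "R \<sigma> \<tau> x \<in> carrier AB" if "x \<in> carrier AB" for \<sigma> \<tau> x by (rule lhomD(1)[OF lie_homD(1)[OF R(1)] that])
  \<comment> \<open>The scaled equation covers all z at once: a nonzero coefficient forces the basis
    vector to be a place permutation of the generic one, and for a zero coefficient any permutations
    serve.\<close>
  have "\<exists>\<sigma> \<tau>. c z \<odot>\<^bsub>AB\<^esub> R \<sigma> \<tau> ?t = c z \<odot>\<^bsub>AB\<^esub> bas (fst z) (snd z)" if z: "z \<in> F" for z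
  proof (cases "c z = 0")
    case True
    have l: "length (fst z) = p" "length (snd z) = q" using F(2)[OF z] by auto
    show ?thesis unfolding True using AB.sc_zero[OF Rc[OF bas_cl[OF l0]]] AB.sc_zero[OF bas_cl[OF l]] by simp
  next
    case False
    have l: "length (fst z) = p" "length (snd z) = q" using F(2)[OF z] by auto
    obtain \<sigma> \<tau> where st: "\<sigma> permutes {..<p}" "\<tau> permutes {..<q}" "fst z = permute_list \<sigma> I0" "snd z = permute_list \<tau> J0"
      by (rule K.generic_support[OF gen l False[unfolded c_def]])
    have "R \<sigma> \<tau> ?t = tAB (A.pure (permute_list \<sigma> (map e I0))) (B.pure (permute_list \<tau> (map f J0)))"
      unfolding bas_def R(2)[OF pAB(1)[OF l0(1)] pAB(2)[OF l0(2)]]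
        A.act_alg_single[OF st(1) tuples_ef(1)[OF l0(1)]] B.act_alg_single[OF st(2) tuples_ef(2)[OF l0(2)]] ..
    also have "\<dots> = bas (fst z) (snd z)" unfolding bas_def st(3,4) using st(1,2) by (simp only: permute_list_map l0)
    finally show ?thesis by metis
  qed
  then obtain s r where sr: "\<And>z. z \<in> F \<Longrightarrow> c z \<odot>\<^bsub>AB\<^esub> R (s z) (r z) ?t = c z \<odot>\<^bsub>AB\<^esub> bas (fst z) (snd z)" by metis
  have "g x = (\<Oplus>\<^bsub>AB\<^esub>z\<in>F. c z \<odot>\<^bsub>AB\<^esub> R (s z) (r z) x)" if "x \<in> carrier AB" for x
  proof (rule endo_eq[OF g lie_hom_linear_combination[OF AB_lie AB_lie F(1) R(1)] _ that])
    show "g ?t = (\<Oplus>\<^bsub>AB\<^esub>z\<in>F. c z \<odot>\<^bsub>AB\<^esub> R (s z) (r z) ?t)"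
      unfolding F(3)[symmetric]
    proof (rule AB.finsum_eq)
      fix z assume z: "z \<in> F"
      show "c z \<odot>\<^bsub>AB\<^esub> bas (fst z) (snd z) = c z \<odot>\<^bsub>AB\<^esub> R (s z) (r z) ?t" by (rule sr[OF z, symmetric])
      show "c z \<odot>\<^bsub>AB\<^esub> R (s z) (r z) ?t \<in> carrier AB" by (rule AB.scl[OF Rc[OF bas_cl[OF l0]]])
    qed
  qed
  then show ?thesis by (rule that[OF F(1)])
qed

text \<open>The summand is a retract of the tensor power, so its endomorphism h extends to an
  endomorphism there, a combination of place permutations. Compressing each of these back to the
  summand gives a scalar, by e A e = k e in both factors.\<close>

lemma Gam_scalar:
  assumes lam: "lam \<in> partitions p" and mu: "mu \<in> partitions q" and h: "lie_hom gl (Gam lam mu) (Gam lam mu) h"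
  shows "\<exists>s. \<forall>x\<in>carrier (Gam lam mu). h x = s \<odot>\<^bsub>Gam lam mu\<^esub> x"
proof -
  let ?G = "Gam lam mu" and ?i = "incl lam mu (A.yidem lam) (B.yidem mu)" and ?r = "proj lam mu (A.yidem lam) (B.yidem mu)"
  let ?tG = "tens (SV lam) (SW mu)"
  have ye: "(A.yidem lam :: _ \<Rightarrow> 'k) \<in> A.yleft lam" "(B.yidem mu :: _ \<Rightarrow> 'k) \<in> B.yleft mu"
    using A.yidem_props(1)[OF lam, where 'k='k] B.yidem_props(1)[OF mu, where 'k='k] by (simp_all add: A.yleft_def B.yleft_def)
  note i = incl[OF lam mu, where x = "A.yidem lam" and y = "B.yidem mu"] and r = proj[OF lam mu ye]
  interpret G: kvs ?G by (rule kvsI, rule lie_module_vs[OF Gam_lie[OF lam mu]])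
  note vS = lie_module_vs[OF A.schur_lie[OF lam]] lie_module_vs[OF B.schur_lie[OF mu]]
  note tb = tens_bilin[OF vS, unfolded bilin_def]
  have gS: "gens ?G {?tG x y | x y. x \<in> carrier (SV lam) \<and> y \<in> carrier (SW mu)}"
    using gens_tensor[OF vS] by (simp add: gens_def lin_closed_def)
  have sub: "a \<in> carrier A.TP" "A.act_alg (A.yidem lam) a = a" if "a \<in> carrier (SV lam)" for a
    using that by (simp_all add: A.schur_fields[OF lam])
  have sub': "b \<in> carrier B.TP" "B.act_alg (B.yidem mu) b = b" if "b \<in> carrier (SW mu)" for b
    using that by (simp_all add: B.schur_fields[OF mu])
  have ri: "?r (?i x) = x" if x: "x \<in> carrier ?G" for x
  proof (rule gens_hom_eqI[OF gS G.vectorspace_axioms G.vectorspace_axioms lhom_comp[OF lie_homD(1)[OF i(1)] lie_homD(1)[OF r(1)]] lhom_id _ x])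
    fix x assume "x \<in> {?tG x y | x y. x \<in> carrier (SV lam) \<and> y \<in> carrier (SW mu)}"
    then obtain a b where x: "x = ?tG a b" and ab: "a \<in> carrier (SV lam)" "b \<in> carrier (SW mu)" by blast
    show "?r (?i x) = x" unfolding x i(2)[OF ab] sub(2)[OF ab(1)] sub'(2)[OF ab(2)] r(2)[OF sub(1)[OF ab(1)] sub'(1)[OF ab(2)]] ..
  qed
  \<comment> \<open>Including, permuting and projecting is multiplication by e \<sigma> e = u e in
    the first factor and by the analogous scalar v in the second.\<close>
  have rRi: "\<exists>w. \<forall>x\<in>carrier ?G. ?r (R \<sigma> \<tau> (?i x)) = w \<odot>\<^bsub>?G\<^esub> x" for \<sigma> \<tau>
  proof -
    obtain u where u: "gconv p (gconv p (A.yidem lam) (single \<sigma>)) (A.yidem lam) = sc u (A.yidem lam :: _ \<Rightarrow> 'k)"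
      using A.yidem_sandwich[OF lam] by blast
    obtain v where v: "gconv q (gconv q (B.yidem mu) (single \<tau>)) (B.yidem mu) = sc v (B.yidem mu :: _ \<Rightarrow> 'k)"
      using B.yidem_sandwich[OF mu] by blast
    have eA: "A.act_alg (A.yidem lam) (A.act_alg (single \<sigma>) a) = u \<odot>\<^bsub>SV lam\<^esub> a" if a: "a \<in> carrier (SV lam)" for a
    proof -
      have "A.act_alg (A.yidem lam) (A.act_alg (single \<sigma>) (A.act_alg (A.yidem lam) a)) = A.act_alg (sc u (A.yidem lam)) a"
        using sub(1)[OF a] by (simp flip: u add: A.act_alg_mul)
      then show ?thesis using sub[OF a] by (simp add: A.act_alg_sc A.schur_fields[OF lam])
    qed
    have eB: "B.act_alg (B.yidem mu) (B.act_alg (single \<tau>) b) = v \<odot>\<^bsub>SW mu\<^esub> b" if b: "b \<in> carrier (SW mu)" for b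
    proof -
      have "B.act_alg (B.yidem mu) (B.act_alg (single \<tau>) (B.act_alg (B.yidem mu) b)) = B.act_alg (sc v (B.yidem mu)) b"
        using sub'(1)[OF b] by (simp flip: v add: B.act_alg_mul)
      then show ?thesis using sub'[OF b] by (simp add: B.act_alg_sc B.schur_fields[OF mu])
    qed
    have "?r (R \<sigma> \<tau> (?i x)) = (u * v) \<odot>\<^bsub>?G\<^esub> x" if x: "x \<in> carrier ?G" for x
    proof (rule gens_hom_eqI[OF gS G.vectorspace_axioms G.vectorspace_axioms
          lhom_comp[OF lhom_comp[OF lie_homD(1)[OF i(1)] lie_homD(1)[OF R(1)]] lie_homD(1)[OF r(1)]]
          lhom_smult[OF G.vectorspace_axioms lhom_id] _ x])
      fix x assume "x \<in> {?tG x y | x y. x \<in> carrier (SV lam) \<and> y \<in> carrier (SW mu)}"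
      then obtain a b where x: "x = ?tG a b" and ab: "a \<in> carrier (SV lam)" "b \<in> carrier (SW mu)" by blast
      note ab' = sub(1)[OF ab(1)] sub'(1)[OF ab(2)]
      have "?r (R \<sigma> \<tau> (?i x)) = ?tG (u \<odot>\<^bsub>SV lam\<^esub> a) (v \<odot>\<^bsub>SW mu\<^esub> b)"
        unfolding x i(2)[OF ab] sub(2)[OF ab(1)] sub'(2)[OF ab(2)] R(2)[OF ab'] r(2)[OF A.act_alg_cl[OF ab'(1)] B.act_alg_cl[OF ab'(2)]]
          eA[OF ab(1)] eB[OF ab(2)] ..
      also have "\<dots> = (u * v) \<odot>\<^bsub>?G\<^esub> x"
      proof -
        have "v \<odot>\<^bsub>SW mu\<^esub> b \<in> carrier (SW mu)" by (rule kvs.scl[OF kvsI[OF vS(2)] ab(2)])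
        then show ?thesis using tb ab G.sc_sc[of x u v] x by simp
      qed
      finally show "?r (R \<sigma> \<tau> (?i x)) = (u * v) \<odot>\<^bsub>?G\<^esub> x" .
    qed
    then show ?thesis by blast
  qed
  then obtain w where w: "\<And>\<sigma> \<tau> x. x \<in> carrier ?G \<Longrightarrow> ?r (R \<sigma> \<tau> (?i x)) = w \<sigma> \<tau> \<odot>\<^bsub>?G\<^esub> x" by metis
  have "lie_hom gl AB AB (\<lambda>x. ?i (h (?r x)))" by (rule lie_hom_comp[OF lie_hom_comp[OF r(1) h] i(1)])
  then obtain F :: "(nat list \<times> nat list) set" and c s t where F: "finite F"
    "\<And>x. x \<in> carrier AB \<Longrightarrow> ?i (h (?r x)) = (\<Oplus>\<^bsub>AB\<^esub>z\<in>F. c z \<odot>\<^bsub>AB\<^esub> R (s z) (t z) x)"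
    by (rule endo_place_permutations) blast
  have "h x = (\<Sum>z\<in>F. c z * w (s z) (t z)) \<odot>\<^bsub>?G\<^esub> x" if x: "x \<in> carrier ?G" for x
  proof -
    note ix = lhomD(1)[OF lie_homD(1)[OF i(1)] x]
    have Rc: "R (s z) (t z) (?i x) \<in> carrier AB" for z by (rule lhomD(1)[OF lie_homD(1)[OF R(1)] ix])
    interpret r: khom AB ?G ?r by (rule khomI[OF AB.vectorspace_axioms G.vectorspace_axioms lie_homD(1)[OF r(1)]])
    have "h x = ?r (?i (h (?r (?i x))))" unfolding ri[OF x] by (rule ri[OF lhomD(1)[OF lie_homD(1)[OF h] x], symmetric])
    also have "\<dots> = ?r (\<Oplus>\<^bsub>AB\<^esub>z\<in>F. c z \<odot>\<^bsub>AB\<^esub> R (s z) (t z) (?i x))" by (simp only: F(2)[OF ix])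
    also have "\<dots> = (\<Oplus>\<^bsub>?G\<^esub>z\<in>F. ?r (c z \<odot>\<^bsub>AB\<^esub> R (s z) (t z) (?i x)))"
      by (rule r.finsum[OF F(1)]) (rule AB.scl[OF Rc])
    also have "\<dots> = (\<Oplus>\<^bsub>?G\<^esub>z\<in>F. (c z * w (s z) (t z)) \<odot>\<^bsub>?G\<^esub> x)"
      by (rule G.finsum_eq) (simp_all only: r.sc[OF Rc] w[OF x] G.sc_sc[OF x] G.scl[OF x])
    also have "\<dots> = (\<Sum>z\<in>F. c z * w (s z) (t z)) \<odot>\<^bsub>?G\<^esub> x" by (rule G.finsum_sc[OF F(1) x])
    finally show ?thesis .
  qed
  then show ?thesis by blast
qed

text \<open>Project the generic basis vector by the two idempotents: its coordinate at itself is the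
  product of their coefficients at the identity, the inverses of the two nonzero norms.\<close>

lemma Gam_nonzero:
  assumes lam: "lam \<in> partitions p" and mu: "mu \<in> partitions q"
  shows "carrier (Gam lam mu) \<noteq> {\<zero>\<^bsub>Gam lam mu\<^esub>}"
proof
  let ?G = "Gam lam mu"
  assume z: "carrier ?G = {\<zero>\<^bsub>?G\<^esub>}"
  let ?a = "A.act_alg (A.yidem lam) (pA I0)" and ?b = "B.act_alg (B.yidem mu) (pB J0)"
  note i = incl[OF lam mu, where x = "single id" and y = "single id"]
  note ac = pAB(1)[OF l0(1)] and bc = pAB(2)[OF l0(2)]
  have a: "?a \<in> carrier (SV lam)" and b: "?b \<in> carrier (SW mu)"
    using ac bc A.yidem_props(1)[OF lam, where 'k='k] B.yidem_props(1)[OF mu, where 'k='k]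
    by (simp_all add: A.schur_fields[OF lam] B.schur_fields[OF mu] flip: A.act_alg_mul B.act_alg_mul)
  have "tens (SV lam) (SW mu) ?a ?b \<in> carrier ?G"
    using tens_bilin[OF lie_module_vs[OF A.schur_lie[OF lam]] lie_module_vs[OF B.schur_lie[OF mu]]] a b by (simp add: bilin_def)
  then have "incl lam mu (single id) (single id) (tens (SV lam) (SW mu) ?a ?b) = \<zero>\<^bsub>AB\<^esub>"
    unfolding z using khom.zero[OF khomI[OF lie_module_vs[OF Gam_lie[OF lam mu]] AB.vectorspace_axioms lie_homD(1)[OF i(1)]]]
    by simp
  then have "tAB ?a ?b = \<zero>\<^bsub>AB\<^esub>" unfolding i(2)[OF a b] using ac bc by (simp add: A.act_alg_one B.act_alg_one)
  then have "coord I0 J0 (tAB ?a ?b) = 0"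
    using khom.zero[OF khomI[OF AB.vectorspace_axioms scalars_vs coord(1)]] by simp
  moreover have "cA I0 ?a = A.yidem lam id" by (rule A.tcoord_alg[OF phi]) (simp_all add: ef)
  moreover have "cB J0 ?b = B.yidem mu id" by (rule B.tcoord_alg[OF psi]) (simp_all add: ef)
  ultimately have "inverse (A.ynorm lam) * inverse (B.ynorm mu) = (0 :: 'k)"
    using ac bc by (simp add: coord(2) A.yidem_props(3)[OF lam] B.yidem_props(3)[OF mu])
  then show False using A.ynorm_nonzero[OF lam, where 'k='k] B.ynorm_nonzero[OF mu, where 'k='k] by simp
qed

lemma Gam_indecomposable:
  "lam \<in> partitions p \<Longrightarrow> mu \<in> partitions q \<Longrightarrow> indecomposable gl (Gam lam mu)"
  by (rule indecomposableI[OF Gam_lie Gam_nonzero Gam_scalar])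

end

theorem corollary2p4:
  fixes V :: "('k::field_char_0, 'v) module"
    and Vs :: "('k, 'w) module"
    and pair :: "'v \<Rightarrow> 'w \<Rightarrow> 'k"
    and p q :: nat
  assumes "countably_infinite_dim V"
    and "countably_infinite_dim Vs"
    and "nondegenerate_pairing V Vs pair"
  shows
    "lie_isomorphic (gl_inf V Vs pair)
       (mixed_tensor V Vs pair p q)
       (lie_direct_sum
          (SIGMA (lam, mu) : partitions p \<times> partitions q.
             {..<vectorspace.dim (class_ring :: 'k ring) (specht_module lam) *
                 vectorspace.dim (class_ring :: 'k ring) (specht_module mu)})
          (\<lambda>((lam, mu), i).
             lie_tensor (schur lam (natural_module V pair)) (schur mu (conatural_module Vs pair)))) \<and>
     (\<forall>lam \<in> partitions p. \<forall>mu \<in> partitions q.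
        indecomposable (gl_inf V Vs pair)
          (lie_tensor (schur lam (natural_module V pair)) (schur mu (conatural_module Vs pair))))"
proof -
  have V: "kvs V" and W: "kvs Vs" using assms(1,2) by (simp_all add: countably_infinite_dim_def kvs_def)
  interpret mixed V Vs pair p q
    by (intro mixed.intro glpair.intro paired.intro paired_axioms.intro V W assms(3))
  obtain e f where "dual_bases V Vs pair e f" by (rule dual_bases_exist[OF assms(1,2)])
  then interpret mixed_basis V Vs pair p q e f by unfold_locales
  show ?thesis unfolding mixed_tensor_def using decomposition Gam_indecomposable by blast
qed

end
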